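(* Let $\mathbb{G}$ be a Carnot group, let $\mathbb{H}$ be a homogeneous group, and let $\mu$ be a Radon measure on $\mathbb{G}$. If every Lipschitz function $f:\mathbb{G}\to\mathbb{H}$ is Pansu differentiable at $\mu$-almost every point of $\mathbb{G}$, then $\mu$ is absolutely continuous with respect to the Haar measure of $\mathbb{G}$.
   Context: A Carnot group of step $\mathfrak{s}$ is a connected, simply connected Lie group $\mathbb G$ whose Lie algebra has a stratification $\mathfrak g=V_1\oplus\dots\oplus V_{\mathfrak s}$, i.e. $[V_1,V_i]=V_{i+1}$ for $1\le i<\mathfrak s$ and $[V_1,V_{\mathfrak s}]=\{0\}$. A homogeneous group is a connected, simply connected Lie group whose Lie algebra has a gradation $\mathfrak h=W_1\oplus\dots\oplus W_{s}$, i.e. $[W_i,W_j]\subseteq W_{i+j}$ for all $i,j$ (with $W_\ell=\{0\}$ for $\ell>s$), endowed with the dilations and a distance as described below; every Carnot group is a homogeneous group. Via the exponential map, each such group is identified with its Lie algebra, with the group law $*$ given by the Baker–Campbell–Hausdorff formula (identity $0$, $x^{-1}=-x$). In particular $\mathbb G\cong\mathbb R^n$ and its Haar measure is, up to a constant, the Lebesgue measure $\mathscr L^n$. The dilations are $\delta_\lambda(v_1,\dots,v_s)=(\lambda v_1,\lambda^2v_2,\dots,\lambda^{s}v_{s})$ for $\lambda>0$, where $v_i$ is the component in the $i$-th layer. A distance $d$ is homogeneous and left-invariant if $d(\delta_\lambda x,\delta_\lambda y)=\lambda d(x,y)$ for $\lambda>0$ and $d(z*x,z*y)=d(x,y)$.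 $\mathbb G$ carries the Carnot–Carathéodory distance (all homogeneous left-invariant distances on $\mathbb G$ are bi-Lipschitz equivalent), and $\|x\|_{\mathbb G}$ is the distance of $x$ from $0$; $\mathbb H$ carries a homogeneous left-invariant distance $d_{\mathbb H}$. Lipschitz is meant with respect to these distances. A map $f:\mathbb G\to\mathbb H$ is Pansu differentiable at $x\in\mathbb G$ if there is a homogeneous homomorphism $L:\mathbb G\to\mathbb H$ (a group homomorphism commuting with the dilations $\delta_\lambda$, $\lambda>0$) such that $d_{\mathbb H}\big(f(x)^{-1}*f(x*h),L(h)\big)=o(\|h\|_{\mathbb G})$ as $h\to0$, $h\in\mathbb G$.
   Formalization: The first layer W_1 of the homogeneous group H is assumed nonzero; if W_1={0} (e.g. H=R=W_2 with distance |x-y|^{1/2}) all Lipschitz maps from a nontrivial G to H are constant, hence Pansu differentiable everywhere, and the claim fails for a Dirac mass. *)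

theory Defs
  imports "HOL-Analysis.Analysis" "HOL-Library.Landau_Symbols"
begin

section \<open>Graded Lie algebras\<close>

definition lie_bracket :: "('a::euclidean_space \<Rightarrow> 'a \<Rightarrow> 'a) \<Rightarrow> bool" where
  "lie_bracket b \<longleftrightarrow>
     bilinear b \<and> (\<forall>x. b x x = 0) \<and>
     (\<forall>x y z. b x (b y z) + b y (b z x) + b z (b x y) = 0)"

text \<open>
  A finite-dimensional real Lie algebra together with a family of layers. The layers proper are
  those with index 1, ..., \<open>step\<close>; the predicates below require all other layers to be
  zero. The connected, simply connected nilpotent Lie group of such an algebra is identified with
  the algebra itself through the exponential map, so the points of the group are the elements of
  the underlying vector space, 0 is the identity and \<open>- x\<close> is the inverse of
  \<open>x\<close>.
\<close>

record 'a graded_algebra =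
  lbr :: "'a \<Rightarrow> 'a \<Rightarrow> 'a"
  layer :: "nat \<Rightarrow> 'a set"
  step :: nat

definition direct_sum_of_layers :: "'a::euclidean_space graded_algebra \<Rightarrow> bool" where
  "direct_sum_of_layers G \<longleftrightarrow>
     (\<forall>i. subspace (layer G i)) \<and>
     (\<forall>i. i \<notin> {1..step G} \<longrightarrow> layer G i = {0}) \<and>
     (\<forall>x. \<exists>!c. (\<forall>i. c i \<in> layer G i) \<and> x = (\<Sum>i = 1..step G. c i))"

definition homogeneous_group :: "'a::euclidean_space graded_algebra \<Rightarrow> bool" where
  "homogeneous_group G \<longleftrightarrow>
     lie_bracket (lbr G) \<and> direct_sum_of_layers G \<and>
     (\<forall>i j. \<forall>x\<in>layer G i. \<forall>y\<in>layer G j. lbr G x y \<in> layer G (i + j))"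

definition carnot_group :: "'a::euclidean_space graded_algebra \<Rightarrow> bool" where
  "carnot_group G \<longleftrightarrow>
     lie_bracket (lbr G) \<and> direct_sum_of_layers G \<and>
     (\<forall>i\<in>{1..<step G}.
        span {lbr G x y |x y. x \<in> layer G 1 \<and> y \<in> layer G i} = layer G (Suc i)) \<and>
     (\<forall>x\<in>layer G 1. \<forall>y\<in>layer G (step G). lbr G x y = 0)"

section \<open>Group law and dilations\<close>

fun nested_bracket :: "('a::real_vector \<Rightarrow> 'a \<Rightarrow> 'a) \<Rightarrow> 'a list \<Rightarrow> 'a" where
  "nested_bracket b [] = 0"
| "nested_bracket b [x] = x"
| "nested_bracket b (x # y # w) = b x (nested_bracket b (y # w))"

text \<open>
  Dynkin's form of the Baker--Campbell--Hausdorff series: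
  the sum over \<open>k\<close> and \<open>(r\<^sub>1, q\<^sub>1), \<dots>, (r\<^sub>k, q\<^sub>k)\<close> with all
  \<open>r\<^sub>i + q\<^sub>i > 0\<close> of
  \<open>(-1)^(k - 1) / (k * (\<Sum>i. r\<^sub>i + q\<^sub>i) * (\<Prod>i. r\<^sub>i! * q\<^sub>i!))\<close> times the
  right-nested bracket of the word
  \<open>x^r\<^sub>1 y^q\<^sub>1 \<dots> x^r\<^sub>k y^q\<^sub>k\<close>. In a graded algebra the nested brackets of words
  longer than \<open>step\<close> vanish, so the series is the finite sum over the exponent lists of
  total degree at most \<open>step\<close>.
\<close>

definition degree_of :: "(nat \<times> nat) list \<Rightarrow> nat" where
  "degree_of ps = (\<Sum>(r, q)\<leftarrow>ps. r + q)"

definition bch_exponents :: "nat \<Rightarrow> (nat \<times> nat) list set" where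
  "bch_exponents n =
     {ps. ps \<noteq> [] \<and> (\<forall>(r, q)\<in>set ps. 0 < r + q) \<and> degree_of ps \<le> n}"

definition bch_coeff :: "(nat \<times> nat) list \<Rightarrow> real" where
  "bch_coeff ps =
     (-1) ^ (length ps - 1) /
     (real (length ps) * real (degree_of ps) * (\<Prod>(r, q)\<leftarrow>ps. fact r * fact q))"

definition bch_word :: "'a \<Rightarrow> 'a \<Rightarrow> (nat \<times> nat) list \<Rightarrow> 'a list" where
  "bch_word x y ps = concat (map (\<lambda>(r, q). replicate r x @ replicate q y) ps)"

definition gmult :: "'a::euclidean_space graded_algebra \<Rightarrow> 'a \<Rightarrow> 'a \<Rightarrow> 'a" where
  "gmult G x y =
     (\<Sum>ps\<in>bch_exponents (step G).
        bch_coeff ps *\<^sub>R nested_bracket (lbr G) (bch_word x y ps))"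

lemma finite_bch_exponents: "finite (bch_exponents n)"
proof -
  have len: "length ps \<le> degree_of ps" if "\<forall>(r, q)\<in>set ps. 0 < r + q" for ps
    using that by (induction ps) (auto simp: degree_of_def)
  have mem: "r + q \<le> degree_of ps" if "(r, q) \<in> set ps" for r q ps
    using that by (induction ps) (auto simp: degree_of_def)
  have "bch_exponents n \<subseteq> {ps. set ps \<subseteq> {..n} \<times> {..n} \<and> length ps \<le> n}"
  proof (rule subsetI)
    fix ps assume ps: "ps \<in> bch_exponents n"
    have "r \<le> n \<and> q \<le> n" if "(r, q) \<in> set ps" for r q
      using mem[OF that] ps by (simp add: bch_exponents_def)
    then show "ps \<in> {ps. set ps \<subseteq> {..n} \<times> {..n} \<and> length ps \<le> n}"
      using len[of ps] ps by (auto simp: bch_exponents_def)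
  qed
  then show ?thesis
    by (rule finite_subset) (intro finite_lists_length_le finite_cartesian_product finite_atMost)
qed

definition layer_component :: "'a::euclidean_space graded_algebra \<Rightarrow> 'a \<Rightarrow> nat \<Rightarrow> 'a" where
  "layer_component G x =
     (THE c. (\<forall>i. c i \<in> layer G i) \<and> x = (\<Sum>i = 1..step G. c i))"

definition dilation :: "'a::euclidean_space graded_algebra \<Rightarrow> real \<Rightarrow> 'a \<Rightarrow> 'a" where
  "dilation G r x = (\<Sum>i = 1..step G. r ^ i *\<^sub>R layer_component G x i)"

section \<open>Distances\<close>

definition homogeneous_distance ::
    "'a::euclidean_space graded_algebra \<Rightarrow> ('a \<Rightarrow> 'a \<Rightarrow> real) \<Rightarrow> bool" where
  "homogeneous_distance G d \<longleftrightarrow>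
     Metric_space UNIV d \<and>
     (\<forall>r>0. \<forall>x y. d (dilation G r x) (dilation G r y) = r * d x y) \<and>
     (\<forall>x y z. d (gmult G z x) (gmult G z y) = d x y)"

text \<open>The value at \<open>p\<close> of the left-invariant vector field with value \<open>u\<close> at 0.\<close>

definition left_invariant_field :: "'a::euclidean_space graded_algebra \<Rightarrow> 'a \<Rightarrow> 'a \<Rightarrow> 'a" where
  "left_invariant_field G u p = vector_derivative (\<lambda>t. gmult G p (t *\<^sub>R u)) (at 0)"

text \<open>
  Absolutely continuous horizontal curves on \<open>[0,1]\<close>, written in integral form: \<open>u t\<close>
  is the derivative of the curve, translated back to 0.
\<close>

definition horizontal_curve ::
    "'a::euclidean_space graded_algebra \<Rightarrow> (real \<Rightarrow> 'a) \<Rightarrow> (real \<Rightarrow> 'a) \<Rightarrow> bool" where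
  "horizontal_curve G \<gamma> u \<longleftrightarrow>
     continuous_on {0..1} \<gamma> \<and> u absolutely_integrable_on {0..1} \<and>
     (\<forall>t\<in>{0..1}. u t \<in> layer G 1) \<and>
     (\<forall>t\<in>{0..1}.
        ((\<lambda>s. left_invariant_field G (u s) (\<gamma> s)) has_integral (\<gamma> t - \<gamma> 0)) {0..t})"

text \<open>
  The scalar product on the first layer is the restriction of the one of the ambient Euclidean
  space. As the Lie algebra structure on that space is arbitrary, every scalar product on the
  first layer of a stratified Lie algebra arises in this way, up to a linear isomorphism.
\<close>

definition cc_distance :: "'a::euclidean_space graded_algebra \<Rightarrow> 'a \<Rightarrow> 'a \<Rightarrow> real" where
  "cc_distance G x y =
     Inf {integral {0..1} (\<lambda>t. norm (u t)) |\<gamma> u.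
            horizontal_curve G \<gamma> u \<and> \<gamma> 0 = x \<and> \<gamma> 1 = y}"

definition lipschitz_wrt ::
    "('a \<Rightarrow> 'a \<Rightarrow> real) \<Rightarrow> ('b \<Rightarrow> 'b \<Rightarrow> real) \<Rightarrow> ('a \<Rightarrow> 'b) \<Rightarrow> bool" where
  "lipschitz_wrt d d' f \<longleftrightarrow> (\<exists>C. \<forall>x y. d' (f x) (f y) \<le> C * d x y)"

section \<open>Pansu differentiability\<close>

definition homogeneous_hom ::
    "'a::euclidean_space graded_algebra \<Rightarrow> 'b::euclidean_space graded_algebra \<Rightarrow>
     ('a \<Rightarrow> 'b) \<Rightarrow> bool" where
  "homogeneous_hom G H L \<longleftrightarrow>
     (\<forall>x y. L (gmult G x y) = gmult H (L x) (L y)) \<and>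
     (\<forall>r>0. \<forall>x. L (dilation G r x) = dilation H r (L x))"

definition pansu_differentiable_at ::
    "'a::euclidean_space graded_algebra \<Rightarrow> 'b::euclidean_space graded_algebra \<Rightarrow>
     ('b \<Rightarrow> 'b \<Rightarrow> real) \<Rightarrow> ('a \<Rightarrow> 'b) \<Rightarrow> 'a \<Rightarrow> bool" where
  "pansu_differentiable_at G H dH f x \<longleftrightarrow>
     (\<exists>L. homogeneous_hom G H L \<and>
        (\<lambda>h. dH (gmult H (- f x) (f (gmult G x h))) (L h)) \<in> o[at 0](\<lambda>h. cc_distance G h 0))"

section \<open>Measures\<close>

text \<open>
  On a Euclidean space every Borel measure that is finite on compact sets is inner and outer
  regular, so regularity need not be required.
\<close>

definition radon_measure :: "'a::euclidean_space measure \<Rightarrow> bool" where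
  "radon_measure \<mu> \<longleftrightarrow> sets \<mu> = sets borel \<and> (\<forall>K. compact K \<longrightarrow> emeasure \<mu> K < \<infinity>)"

definition haar_measure :: "'a::euclidean_space graded_algebra \<Rightarrow> 'a measure \<Rightarrow> bool" where
  "haar_measure G \<nu> \<longleftrightarrow>
     radon_measure \<nu> \<and> emeasure \<nu> UNIV \<noteq> 0 \<and>
     (\<forall>z. \<forall>A\<in>sets borel. emeasure \<nu> (gmult G z ` A) = emeasure \<nu> A)"

end

theory Submission
  imports Defs
begin

text \<open>
 If \<open>\<mu>\<close> is not absolutely continuous, it charges a compact set \<open>N\<close> of Haar measure zero. The line
 spanned by an element \<open>v\<close> of the first layer of \<open>H\<close> carries a multiple of the Euclidean distance, so it
 suffices to find a real function \<open>f\<close>, Lipschitz for the Carnot--Caratheodory distance, whose difference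
 quotients in one horizontal direction diverge on a subset of \<open>N\<close> of positive measure.

 Such an \<open>f\<close> is a sum of functions with tiny values whose horizontal derivative is bounded, and bounded
 below on that subset. They are the components of horizontal vector fields with divergence at least
 \<open>c > 0\<close> on \<open>N\<close>: convolve a density \<open>0 \<le> \<phi> \<le> 1\<close> that vanishes near \<open>N\<close> with the dilates of a mean
 zero bump written in divergence form, up to a very small scale. The derivatives of the resulting field are
 truncated singular integrals of \<open>\<phi>\<close>. The weak type (1,1) estimate for the adjoint operators and a duality
 argument provide a \<open>\<phi>\<close> for which all of them are bounded, independently of \<open>N\<close>.
\<close>

text \<open>If infinitely many functions whose derivatives in one direction are at least
  \<open>c\<close> on a set are added with equal signs, the derivatives of the partial sums are
  unbounded there. The signs therefore alternate, and this requires consecutive functions to have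
  nearly equal derivatives on the set, with errors whose sum stays bounded. What is bounded below at
  the outset is a divergence, so one component is selected by the pigeonhole principle; convexity of
  the family of admissible fields supplies the near equality. All constants must be independent of
  the null set and of the smallness of the values. This is why the density may be made to vanish on
  an arbitrary set filling at most a quarter of a window, and why the singular integrals need bounds
  uniform in the truncation. One density must serve all pairs of basis directions at once, hence a
  duality argument with sums over these pairs. The group law is given by Dynkin's polynomial and the
  Haar measure by its invariance; associativity, uniqueness and unimodularity are derived from these
  descriptions.\<close>

notation scaleR (infixr "*R" 75)

abbreviation cont :: "('a::topological_space => 'b::topological_space) => bool" where
 "cont == continuous_on UNIV"

abbreviation Borel :: "('a::topological_space => 'b::topological_space) set" where
 "Borel == borel_measurable borel"

section \<open>Linear operators and truncated power series\<close>

text \<open>As elements of a type of class \<open>real_algebra_1\<close>, endomorphisms have powers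
  and obey the commutator identities proved below for arbitrary algebras. The class demands
  \<open>0 ~= 1\<close>, which holds because a Euclidean space is nontrivial.\<close>

typedef (overloaded) 'a endo = "{f :: 'a::real_vector => 'a. linear f}"
 morphisms app Endo
 by (rule exI[of _ id]) (simp add: linear_id)

setup_lifting type_definition_endo

instantiation endo :: (euclidean_space) real_algebra_1
begin

lift_definition zero_endo :: "'a endo" is "%x. 0" by (rule linear_zero)
lift_definition one_endo :: "'a endo" is "%x. x" by (rule linear_ident)
lift_definition plus_endo :: "'a endo => 'a endo => 'a endo" is "%f g x. f x + g x"
 by (rule linear_compose_add)
lift_definition minus_endo :: "'a endo => 'a endo => 'a endo" is "%f g x. f x - g x"
 by (rule linear_compose_sub)
lift_definition uminus_endo :: "'a endo => 'a endo" is "%f x. - f x"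
 by (rule linear_compose_neg)
lift_definition times_endo :: "'a endo => 'a endo => 'a endo" is "%f g x. f (g x)"
 by (metis linear_compose comp_def ext)
lift_definition scaleR_endo :: "real => 'a endo => 'a endo" is "%r f x. r *R f x"
 by (rule linear_compose_scale_right)

instance
proof
 have "\<exists>x::'a. x ~= 0" using nonempty_Basis nonzero_Basis by blast
 thus "(0::'a endo) ~= 1" by transfer metis
qed (transfer; fastforce simp: algebra_simps linear_add linear_scale)+

end

lemma app_simps [simp]:
 "app 0 x = 0" "app 1 x = x" "app (S + T) x = app S x + app T x"
 "app (S - T) x = app S x - app T x" "app (- S) x = - app S x"
 "app (S * T) x = app S (app T x)" "app (r *R S) x = r *R app S x"
 by (transfer; simp)+

lemma linear_app: "linear (app S)"
 by transfer

lemma app_sum: "app (\<Sum>i\<in>I. S i) x = (\<Sum>i\<in>I. app (S i) x)"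
 by (induction I rule: infinite_finite_induct) auto

lemma app_eqI: "(!!x. app S x = app T x) ==> S = T"
 by (simp add: app_inject[symmetric] ext)

lemma app_Endo: "linear f ==> app (Endo f) = f"
 by (simp add: Endo_inverse)

text \<open>Evaluation of a power series at a nilpotent element. If \<open>a ^ Suc N = 0\<close>,
  the truncation loses nothing and evaluation is multiplicative, so identities between formal power
  series pass to operators.\<close>

definition pev :: "nat => real fps => 'r::real_algebra_1 => 'r" where
 "pev N F a = (\<Sum>n\<le>N. fps_nth F n *R a ^ n)"

lemma pev_cong: "(!!n. n <= N ==> fps_nth F n = fps_nth F' n) ==> pev N F a = pev N F' a"
 by (simp add: pev_def)

lemma pev_mult:
 assumes a: "a ^ Suc N = 0"
 shows "pev N (F * F') a = pev N F a * pev N F' a"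
proof -
 have z: "a ^ k = 0" if "k > N" for k
 proof -
  have "k = Suc N + (k - Suc N)" using that by simp
  thus ?thesis using a by (metis mult_zero_left power_add)
 qed
 let ?g = "%i j. (fps_nth F i * fps_nth F' j) *R a ^ (i + j)"
 have "pev N F a * pev N F' a = (\<Sum>i\<le>N. \<Sum>j\<le>N. ?g i j)"
  by (simp add: pev_def sum_product power_add mult.commute)
 also have "... = (\<Sum>(i,j)\<in>{..N} \<times> {..N}. ?g i j)"
  by (simp add: sum.cartesian_product)
 also have "... = (\<Sum>(i,j)\<in>{(i,j). i + j <= N}. ?g i j)"
  by (rule sum.mono_neutral_right) (auto, meson not_le z)
 also have "... = (\<Sum>k\<le>N. \<Sum>i\<le>k. ?g i (k - i))"
  by (rule sum.triangle_reindex_eq)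
 also have "... = pev N (F * F') a"
  by (simp add: pev_def fps_mult_nth scaleR_sum_left atLeast0AtMost)
 finally show ?thesis by simp
qed

lemma pev_one: "pev N 1 a = 1"
proof -
 have "pev N 1 a = (\<Sum>n\<in>{0}. fps_nth 1 n *R a ^ n)"
  unfolding pev_def by (rule sum.mono_neutral_right) auto
 thus ?thesis by simp
qed

lemma pev_add: "pev N (F + F') a = pev N F a + pev N F' a"
 by (simp add: pev_def scaleR_add_left sum.distrib)

lemma pev_diff: "pev N (F - F') a = pev N F a - pev N F' a"
 by (simp add: pev_def scaleR_diff_left sum_subtractf)

lemma pev_const_mult: "pev N (fps_const c * F) a = c *R pev N F a"
 by (simp add: pev_def scaleR_sum_right)

lemma pev_sum: "pev N (\<Sum>i\<in>I. F i) a = (\<Sum>i\<in>I. pev N (F i) a)"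
proof -
 have "pev N 0 a = 0" by (simp add: pev_def)
 thus ?thesis by (induction I rule: infinite_finite_induct) (auto simp: pev_add)
qed

lemma pev_power:
 assumes "a ^ Suc N = 0"
 shows "pev N (F ^ k) a = pev N F a ^ k"
 by (induction k) (use assms in \<open>simp_all add: pev_one pev_mult\<close>)

text \<open>The series \<open>(e^X - 1) / X\<close>.\<close>

definition exp_quot :: "real fps" where
 "exp_quot = Abs_fps (%n. 1 / fact (Suc n))"

text \<open>The truncated series of \<open>log M / (M - 1)\<close>, not of \<open>log M\<close>:
  after differentiation of Dynkin's series the last block becomes a vector, and the blocks before it
  give the powers of \<open>M - 1\<close> with these coefficients.\<close>

definition log_trunc :: "nat => 'r::real_algebra_1 => 'r" where
 "log_trunc N M = (\<Sum>k<N. ((-1) ^ k / real (Suc k)) *R (M - 1) ^ k)"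

lemma exp_quot_X: "fps_X * exp_quot = fps_exp 1 - 1"
proof (rule fps_ext)
 fix n show "fps_nth (fps_X * exp_quot) n = fps_nth (fps_exp 1 - 1) n"
  by (cases n) (auto simp: exp_quot_def algebra_simps)
qed

text \<open>\<open>\<Sum>k. (-1)^k / (k+1) * (e^X - 1)^k = X / (e^X - 1)\<close> up to order \<open>N\<close>.\<close>
lemma log_series_exp_quot:
 assumes "n < N"
 shows "fps_nth ((\<Sum>k<N. fps_const ((-1) ^ k / real (Suc k)) * (fps_exp 1 - 1) ^ k) * exp_quot) n
  = (if n = 0 then 1 else 0)"
proof -
 let ?L = "\<Sum>k<N. fps_const ((-1) ^ k / real (Suc k)) * (fps_exp 1 - 1 :: real fps) ^ k"
 let ?b = "fps_exp 1 - 1 :: real fps"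
 \<comment> \<open>Multiplied by \<open>X\<close>, the product becomes the logarithm series composed
   with \<open>e^X - 1\<close>, that is, \<open>X\<close>; the terms with \<open>k > n\<close> start
   beyond the order considered.\<close>
 have "fps_nth (?L * exp_quot) n = fps_nth (fps_X * (?L * exp_quot)) (Suc n)"
  by simp
 also have "fps_X * (?L * exp_quot) = ?L * ?b"
  by (simp add: exp_quot_X[symmetric] ac_simps)
 also have "?L * ?b = (\<Sum>k<N. fps_const ((-1) ^ k / real (Suc k)) * ?b ^ Suc k)"
  by (simp add: sum_distrib_right mult.assoc mult.commute[of ?b])
 also have "fps_nth ... (Suc n) = (\<Sum>k<N. (-1) ^ k / real (Suc k) * fps_nth (?b ^ Suc k) (Suc n))"
  by (simp add: fps_sum_nth)
 also have "... = (\<Sum>k\<le>n. (-1) ^ k / real (Suc k) * fps_nth (?b ^ Suc k) (Suc n))"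
 proof (rule sum.mono_neutral_right)
  show "\<forall>k\<in>{..<N} - {..n}. (-1) ^ k / real (Suc k) * fps_nth (?b ^ Suc k) (Suc n) = 0"
  proof
   fix k assume "k \<in> {..<N} - {..n}"
   hence "Suc n < Suc k" by auto
   hence "fps_nth (?b ^ Suc k) (Suc n) = 0"
    by (intro startsby_zero_power_prefix[rule_format]) auto
   thus "(-1) ^ k / real (Suc k) * fps_nth (?b ^ Suc k) (Suc n) = 0" by simp
  qed
 qed (use assms in auto)
 also have "... = (\<Sum>i\<le>Suc n. fps_nth (fps_ln 1) i * fps_nth (?b ^ i) (Suc n))"
  by (subst sum.atMost_Suc_shift) (simp add: fps_ln_nth)
 also have "... = fps_nth (fps_ln 1 oo ?b) (Suc n)"
  by (simp add: fps_compose_nth atLeast0AtMost)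
 also have "fps_ln 1 oo ?b = fps_X"
  by (subst fps_ln_fps_exp_inv) (auto intro!: fps_inv)
 finally show ?thesis by (simp add: fps_X_def)
qed

section \<open>Commutator identities\<close>

definition ad_pow :: "'r::ring_1 => nat => 'r => 'r" where
 "ad_pow Z k Y = ((%T. Z * T - T * Z) ^^ k) Y"

lemma ad_pow_0 [simp]: "ad_pow Z 0 Y = Y"
 and ad_pow_Suc: "Z * ad_pow Z k Y = ad_pow Z (Suc k) Y + ad_pow Z k Y * Z"
 by (simp_all add: ad_pow_def)

text \<open>Left multiplication by \<open>Z\<close> is the commutator with \<open>Z\<close> plus
  right multiplication by \<open>Z\<close>. These two maps commute, and this is their binomial
  theorem.\<close>

lemma power_mult_ad_pow:
 fixes Z Y :: "'r::real_algebra_1"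
 shows "Z ^ n * Y = (\<Sum>k\<le>n. real (n choose k) *R (ad_pow Z k Y * Z ^ (n - k)))"
proof (induction n)
 case (Suc n)
 let ?f = "%k. ad_pow Z k Y * Z ^ (Suc n - k)"
 have "Z ^ Suc n * Y = (\<Sum>k\<le>n. real (n choose k) *R (Z * ad_pow Z k Y * Z ^ (n - k)))"
  by (simp add: Suc mult.assoc sum_distrib_left)
 also have "... = (\<Sum>k\<le>n. real (n choose k) *R ?f (Suc k)) + (\<Sum>k\<le>n. real (n choose k) *R ?f k)"
  by (simp add: ad_pow_Suc distrib_right scaleR_add_right sum.distrib Suc_diff_le mult.assoc
    power_commutes flip: power_Suc2 power_Suc)
 also have "(\<Sum>k\<le>n. real (n choose k) *R ?f k) = ?f 0 + (\<Sum>k\<le>n. real (n choose Suc k) *R ?f (Suc k))"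
 proof -
  have "(\<Sum>k\<le>n. real (n choose k) *R ?f k) = (\<Sum>k\<le>Suc n. real (n choose k) *R ?f k)"
   by (simp add: binomial_eq_0)
  also have "... = ?f 0 + (\<Sum>k\<le>n. real (n choose Suc k) *R ?f (Suc k))"
   by (subst sum.atMost_Suc_shift) simp
  finally show ?thesis .
 qed
 also have "(\<Sum>k\<le>n. real (n choose k) *R ?f (Suc k)) + (?f 0 + (\<Sum>k\<le>n. real (n choose Suc k) *R ?f (Suc k)))
   = ?f 0 + (\<Sum>k\<le>n. real (Suc n choose Suc k) *R ?f (Suc k))"
  by (simp add: scaleR_add_left sum.distrib algebra_simps)
 also have "... = (\<Sum>k\<le>Suc n. real (Suc n choose k) *R ?f k)"
  by (subst sum.atMost_Suc_shift) simp
 finally show ?case .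
qed simp

text \<open>The left-hand side is the derivative of \<open>Z ^ n\<close> in the direction
  \<open>Y\<close>. With the powers of \<open>Z\<close> collected on the right, the derivative of
  the exponential series will factor.\<close>

lemma sum_power_ad_pow:
 fixes Z Y :: "'r::real_algebra_1"
 shows "(\<Sum>i<n. Z ^ i * Y * Z ^ (n - Suc i)) =
  (\<Sum>k<n. real (n choose Suc k) *R (ad_pow Z k Y * Z ^ (n - Suc k)))"
proof (induction n)
 case (Suc n)
 let ?f = "%k. ad_pow Z k Y * Z ^ (n - k)"
 have "(\<Sum>i<Suc n. Z ^ i * Y * Z ^ (Suc n - Suc i)) = (\<Sum>i<n. Z ^ i * Y * Z ^ (n - i)) + Z ^ n * Y"
  by simp
 also have "(\<Sum>i<n. Z ^ i * Y * Z ^ (n - i)) = (\<Sum>i<n. Z ^ i * Y * Z ^ (n - Suc i)) * Z"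
  unfolding sum_distrib_right
  by (intro sum.cong refl) (simp add: mult.assoc Suc_diff_Suc flip: power_Suc2)
 also have "... = (\<Sum>k<n. real (n choose Suc k) *R ?f k)"
  unfolding Suc sum_distrib_right
  by (intro sum.cong refl) (simp add: mult.assoc Suc_diff_Suc flip: power_Suc2)
 also have "... = (\<Sum>k<Suc n. real (n choose Suc k) *R ?f k)"
  by simp
 also have "Z ^ n * Y = (\<Sum>k<Suc n. real (n choose k) *R ?f k)"
  by (subst power_mult_ad_pow) (simp add: lessThan_Suc_atMost)
 finally show ?case by (simp only: sum.distrib[symmetric] scaleR_add_left[symmetric]) (simp add: add.commute)
qed simp

text \<open>The noncommutative expansion of a power of a sum. The lists will be Dynkin's exponent
  lists without their last pair.\<close>

lemma sum_lists_prod: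
 fixes f :: "'p => 'r::ring_1"
 assumes "finite P"
 shows "(\<Sum>qs\<in>{qs. set qs \<subseteq> P \<and> length qs = k}. prod_list (map f qs)) = (\<Sum>p\<in>P. f p) ^ k"
proof (induction k)
 case 0
 have "{qs. set qs \<subseteq> P \<and> length qs = 0} = {[]}" by auto
 thus ?case by simp
next
 case (Suc k)
 let ?L = "{qs. set qs \<subseteq> P \<and> length qs = k}"
 have fin: "finite ?L" using assms by (rule finite_lists_length_eq)
 have "(\<Sum>qs\<in>{qs. set qs \<subseteq> P \<and> length qs = Suc k}. prod_list (map f qs))
   = (\<Sum>(qs, p)\<in>?L \<times> P. f p * prod_list (map f qs))"
  unfolding lists_length_Suc_eq
  by (subst sum.reindex) (auto intro!: inj_onI sum.cong)
 also have "... = (\<Sum>p\<in>P. f p) * (\<Sum>qs\<in>?L. prod_list (map f qs))"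
  unfolding sum_product sum.cartesian_product[symmetric] by (subst sum.swap) simp
 finally show ?case by (simp add: Suc)
qed

section \<open>The group law of a graded Lie algebra\<close>

locale graded_group =
 fixes G :: "'a::euclidean_space graded_algebra"
 assumes homogeneous: "homogeneous_group G"
begin

abbreviation br :: "'a => 'a => 'a" where "br == lbr G"
abbreviation V :: "nat => 'a set" where "V == layer G"
abbreviation comp :: "nat => 'a => 'a" where "comp i x == layer_component G x i"
abbreviation mul :: "'a => 'a => 'a" (infixl "\<odot>" 70) where "x \<odot> y == gmult G x y"
abbreviation dil :: "real => 'a => 'a" where "dil == dilation G"

lemma bilinear_br: "bilinear br"
 and br_self [simp]: "br x x = 0"
 and jacobi: "br x (br y z) + br y (br z x) + br z (br x y) = 0"
 using homogeneous by (auto simp: homogeneous_group_def lie_bracket_def)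

lemma subspace_V: "subspace (V i)"
 and V_trivial: "i \<notin> {1..step G} ==> V i = {0}"
 and decomp: "\<exists>!c. (\<forall>i. c i \<in> V i) \<and> x = (\<Sum>i = 1..step G. c i)"
 and br_V: "x \<in> V i ==> y \<in> V j ==> br x y \<in> V (i + j)"
 using homogeneous unfolding homogeneous_group_def direct_sum_of_layers_def by blast+

lemma comp_in_V: "comp i x \<in> V i"
 and sum_comp: "(\<Sum>i = 1..step G. comp i x) = x"
proof -
 have "(\<forall>i. layer_component G x i \<in> V i) \<and> x = (\<Sum>i = 1..step G. layer_component G x i)"
  unfolding layer_component_def by (rule theI'[OF decomp])
 thus "comp i x \<in> V i" "(\<Sum>i = 1..step G. comp i x) = x" by auto
qed

lemmas sum_comps = sum_comp sum_comp[unfolded One_nat_def]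

lemma comp_unique:
 assumes "!!i. c i \<in> V i" "x = (\<Sum>i = 1..step G. c i)"
 shows "comp i x = c i"
proof -
 have "layer_component G x = c"
  unfolding layer_component_def
  by (rule the1_equality[OF decomp]) (use assms in auto)
 thus ?thesis by simp
qed

lemma linear_comp: "linear (comp i)"
proof (rule linearI)
 show "comp i (x + y) = comp i x + comp i y" for x y
  by (rule comp_unique[where c = "%i. comp i x + comp i y"])
   (auto simp: sum.distrib sum_comps comp_in_V subspace_V subspace_add)
 show "comp i (r *R x) = r *R comp i x" for r x
  by (rule comp_unique[where c = "%i. r *R comp i x"])
   (auto simp: sum_comps comp_in_V subspace_V subspace_scale scaleR_sum_right[symmetric])
qed

lemmas comp_simps [simp] = linear_0[OF linear_comp] linear_add[OF linear_comp]
 linear_diff[OF linear_comp] linear_scale[OF linear_comp] linear_neg[OF linear_comp]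
 linear_sum[OF linear_comp]

lemma comp_0 [simp]: "comp 0 x = 0"
 using comp_in_V[of x 0] V_trivial[of 0] by simp

lemma comp_V: "v \<in> V j ==> comp i v = (if i = j then v else 0)"
proof (rule comp_unique)
 fix i assume v: "v \<in> V j"
 show "(if i = j then v else 0) \<in> V i" using v subspace_V[of i] by (auto simp: subspace_0)
next
 assume v: "v \<in> V j"
 show "v = (\<Sum>i = 1..step G. if i = j then v else 0)"
  using v V_trivial[of j] by (cases "j \<in> {1..step G}") auto
qed

lemma step_pos: "step G >= 1"
proof (rule ccontr)
 assume "\<not> step G >= 1"
 hence "x = 0" for x :: 'a using sum_comp[of x] by simp
 thus False using nonempty_Basis nonzero_Basis by blast
qed

lemmas br_simps = bilinear_ladd[OF bilinear_br] bilinear_radd[OF bilinear_br]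
 bilinear_lmul[OF bilinear_br] bilinear_rmul[OF bilinear_br]
 bilinear_lzero[OF bilinear_br] bilinear_rzero[OF bilinear_br]
 bilinear_lneg[OF bilinear_br] bilinear_rneg[OF bilinear_br]
 bilinear_lsub[OF bilinear_br] bilinear_rsub[OF bilinear_br]

lemma br_sum: "br (\<Sum>i\<in>I. f i) y = (\<Sum>i\<in>I. br (f i) y)" "br x (\<Sum>i\<in>I. f i) = (\<Sum>i\<in>I. br x (f i))"
 using bilinear_br linear_sum[of "%x. br x y"] linear_sum[of "br x"] unfolding bilinear_def by auto

lemma br_antisym: "br x y = - br y x"
 using br_self[of "x + y"] by (simp add: br_simps add_eq_0_iff2 del: br_self) (simp add: add_eq_0_iff)

text \<open>The descending filtration by layers of index at least \<open>k\<close>. It is everything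
  for \<open>k <= 1\<close> and zero beyond \<open>step G\<close>; congruences modulo
  \<open>Fil k\<close> replace exact computations in the layers.\<close>

definition Fil :: "nat => 'a set" where
 "Fil k = {x. \<forall>i<k. comp i x = 0}"

lemma subspace_Fil: "subspace (Fil k)"
 by (auto simp: Fil_def subspace_def)

lemma Fil_antimono: "j <= k ==> x \<in> Fil k ==> x \<in> Fil j"
 by (auto simp: Fil_def)

lemma Fil_trivial: "x \<in> Fil (Suc (step G)) ==> x = 0"
 using sum_comp[of x] by (simp add: Fil_def)

lemma Fil_0 [simp]: "x \<in> Fil 0" and Fil_1 [simp]: "x \<in> Fil (Suc 0)"
 by (auto simp: Fil_def)

lemma V_Fil: "v \<in> V k ==> v \<in> Fil k"
 by (auto simp: Fil_def comp_V)

lemma zero_Fil [simp]: "0 \<in> Fil k"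
 by (simp add: Fil_def)

lemma Fil_add: "x \<in> Fil k ==> y \<in> Fil k ==> x + y \<in> Fil k"
 and Fil_diff: "x \<in> Fil k ==> y \<in> Fil k ==> x - y \<in> Fil k"
 and Fil_scale: "x \<in> Fil k ==> r *R x \<in> Fil k"
 and Fil_sum: "(!!i. i \<in> I ==> f i \<in> Fil k) ==> (\<Sum>i\<in>I. f i) \<in> Fil k"
 by (auto simp: subspace_Fil subspace_add subspace_diff subspace_scale subspace_sum)

lemma br_Fil:
 assumes "x \<in> Fil i" "y \<in> Fil j"
 shows "br x y \<in> Fil (i + j)"
proof -
 have "br x y = br (\<Sum>k=1..step G. comp k x) (\<Sum>l=1..step G. comp l y)"
  by (simp add: sum_comps)
 also have "... = (\<Sum>k=1..step G. \<Sum>l=1..step G. br (comp k x) (comp l y))"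
  by (simp add: br_sum, rule sum.swap)
 also have "... \<in> Fil (i + j)"
 proof (intro Fil_sum)
  fix k l
  show "br (comp k x) (comp l y) \<in> Fil (i + j)"
  proof (cases "k < i \<or> l < j")
   case True
   thus ?thesis using assms by (auto simp: Fil_def br_simps)
  next
   case False
   have "br (comp k x) (comp l y) \<in> V (k + l)" by (intro br_V comp_in_V)
   hence "br (comp k x) (comp l y) \<in> Fil (k + l)" by (rule V_Fil)
   thus ?thesis by (rule Fil_antimono[rotated]) (use False in auto)
  qed
 qed
 finally show ?thesis .
qed

definition deg_op :: "'a => 'a" where
 "deg_op x = (\<Sum>i = 1..step G. real i *R comp i x)"

lemma linear_deg_op: "linear deg_op"
 unfolding deg_op_def
 by (intro linear_compose_sum ballI linear_compose_scale_right linear_comp)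

lemma comp_deg_op: "comp i (deg_op x) = real i *R comp i x"
 by (rule comp_unique)
  (auto simp: deg_op_def subspace_V subspace_scale comp_in_V)

lemma deg_op_V: "x \<in> V i ==> deg_op x = real i *R x"
 using V_trivial[of i]
 by (cases "i \<in> {1..step G}") (auto simp: deg_op_def comp_V if_distrib cong: if_cong)

lemma deg_op_derivation: "deg_op (br x y) = br (deg_op x) y + br x (deg_op y)"
proof -
 interpret D: linear deg_op by (rule linear_deg_op)
 have "deg_op (br (comp k x) (comp l y)) =
   br (deg_op (comp k x)) (comp l y) + br (comp k x) (deg_op (comp l y))" for k l
  by (simp add: deg_op_V[OF comp_in_V] deg_op_V[OF br_V[OF comp_in_V comp_in_V]] br_simps
    scaleR_add_left)
 hence "deg_op (br (\<Sum>k=1..step G. comp k x) (\<Sum>l=1..step G. comp l y)) =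
  br (deg_op (\<Sum>k=1..step G. comp k x)) (\<Sum>l=1..step G. comp l y) +
  br (\<Sum>k=1..step G. comp k x) (deg_op (\<Sum>l=1..step G. comp l y))"
  by (simp add: br_sum D.sum sum.distrib)
 thus ?thesis by (simp add: sum_comps)
qed

text \<open>
 The adjoint representation on the semidirect product with the line spanned by the grading
 derivation is faithful, unlike the adjoint representation on the algebra itself.
\<close>

definition R :: "'a => ('a \<times> real) endo" where
 "R x = Endo (%(y, c). (br x y - c *R deg_op x, 0))"

lemma app_R [simp]: "app (R x) (y, c) = (br x y - c *R deg_op x, 0)"
proof -
 have "linear (%(y, c). (br x y - c *R deg_op x, 0::real))"
  by (rule linearI) (auto simp: br_simps algebra_simps)
 thus ?thesis by (simp add: R_def app_Endo)
qed

lemma R_simps: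
 "R (x + y) = R x + R y" "R (r *R x) = r *R R x" "R 0 = 0" "R (x - y) = R x - R y"
proof -
 show a: "R (x + y) = R x + R y" for x y
  by (rule app_eqI; force simp: br_simps linear_add[OF linear_deg_op] algebra_simps)
 show b: "R (r *R x) = r *R R x" for r x
  by (rule app_eqI; force simp: br_simps linear_scale[OF linear_deg_op] algebra_simps)
 show "R 0 = 0" using b[of 0 0] by simp
 show "R (x - y) = R x - R y" using a[of "x - y" y] by simp
qed

lemma R_sum: "R (\<Sum>i\<in>I. f i) = (\<Sum>i\<in>I. R (f i))"
 by (induction I rule: infinite_finite_induct) (auto simp: R_simps)

text \<open>On \<open>(z, c)\<close> the Jacobi identity settles the part that depends on
  \<open>z\<close>, and the derivation property of \<open>deg_op\<close> the part that depends on
  \<open>c\<close>.\<close>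

lemma R_br: "R (br x y) = R x * R y - R y * R x"
proof (rule app_eqI)
 fix w :: "'a \<times> real"
 obtain z c where w: "w = (z, c)" by force
 have "br (br x y) z = br x (br y z) - br y (br x z)"
  using jacobi[of x y z] br_antisym[of z "br x y"] br_antisym[of z x]
  by (simp add: br_simps algebra_simps)
 moreover have "br (deg_op x) y = - br y (deg_op x)" by (rule br_antisym)
 ultimately show "app (R (br x y)) w = app (R x * R y - R y * R x) w"
  by (simp add: w br_simps deg_op_derivation algebra_simps)
qed

text \<open>The operator sends \<open>(0, 1)\<close> to \<open>(- deg_op x, 0)\<close>, and
  \<open>deg_op\<close> acts on the layer \<open>i\<close> as the nonzero scalar
  \<open>i\<close>.\<close>

lemma R_inj: "R x = R y ==> x = y"
proof -
 assume "R x = R y"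
 hence "app (R x) (0, 1) = app (R y) (0, 1)" by simp
 hence D: "deg_op x = deg_op y" by (simp add: br_simps)
 have "comp i x = comp i y" if "i \<in> {1..step G}" for i
  using that arg_cong[OF D, of "comp i"] by (simp add: comp_deg_op)
 thus "x = y" using sum_comp[of x] sum_comp[of y] by (metis (no_types, lifting) sum.cong)
qed

definition Wf :: "nat => ('a \<times> real) set" where
 "Wf i = {(y, c). y \<in> Fil i \<and> (0 < i --> c = 0)}"

lemma subspace_Wf: "subspace (Wf i)"
 by (auto simp: Wf_def subspace_def Fil_add Fil_scale zero_prod_def)

lemma Wf_antimono: "i <= j ==> w \<in> Wf j ==> w \<in> Wf i"
 by (auto simp: Wf_def intro: Fil_antimono)

text \<open>Operators that shift the filtration by at least \<open>j\<close>. A shift beyond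
  \<open>step G\<close> is zero, so nilpotency and the vanishing of all error terms reduce to
  counting shifts.\<close>

definition raises :: "nat => ('a \<times> real) endo => bool" where
 "raises j T \<longleftrightarrow> (\<forall>i. \<forall>w\<in>Wf i. app T w \<in> Wf (i + j))"

lemma raises_0: "raises j 0"
 using subspace_0[OF subspace_Wf] by (simp add: raises_def)

lemma raises_1: "raises 0 1"
 by (simp add: raises_def)

lemma raises_add: "raises j S ==> raises j T ==> raises j (S + T)"
 and raises_diff: "raises j S ==> raises j T ==> raises j (S - T)"
 and raises_scale: "raises j S ==> raises j (r *R S)"
 using subspace_Wf by (auto simp: raises_def subspace_add subspace_diff subspace_scale)

lemma raises_sum: "(!!i. i \<in> I ==> raises j (S i)) ==> raises j (\<Sum>i\<in>I. S i)"
 by (induction I rule: infinite_finite_induct) (auto simp: raises_0 raises_add)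

lemma raises_mult: "raises j S ==> raises k T ==> raises (j + k) (S * T)"
 unfolding raises_def app_simps by (metis add.assoc add.commute)

lemma raises_mono: "raises k S ==> j <= k ==> raises j S"
 unfolding raises_def by (meson Wf_antimono add_left_mono)

lemma raises_power: "raises j S ==> raises (j * n) (S ^ n)"
 by (induction n) (auto simp: raises_1 intro: raises_mult)

lemma raises_R: "x \<in> Fil k ==> k >= 1 ==> raises k (R x)"
proof -
 assume x: "x \<in> Fil k" "k >= 1"
 hence D: "deg_op x \<in> Fil k" by (simp add: Fil_def comp_deg_op)
 show ?thesis
  unfolding raises_def
 proof (intro allI ballI)
  fix i w assume "w \<in> Wf i"
  then obtain y c where w: "w = (y, c)" "y \<in> Fil i" "0 < i --> c = 0" by (auto simp: Wf_def)
  have "br x y \<in> Fil (i + k)" using br_Fil[OF x(1) w(2)] by (simp add: add.commute)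
  thus "app (R x) w \<in> Wf (i + k)" using w x D
   by (cases "i = 0") (auto simp: Wf_def intro: Fil_diff Fil_scale)
 qed
qed

lemma raises_R1: "raises 1 (R x)"
 by (rule raises_R) auto

lemma raises_trivial: "raises j T ==> j > step G ==> T = 0"
proof (rule app_eqI)
 fix w assume "raises j T" "j > step G"
 hence "raises (Suc (step G)) T" by (auto intro: raises_mono)
 moreover have "w \<in> Wf 0" by (auto simp: Wf_def)
 ultimately have "app T w \<in> Wf (Suc (step G))" by (fastforce simp: raises_def)
 thus "app T w = app 0 w" by (auto simp: Wf_def zero_prod_def dest: Fil_trivial)
qed

lemma R_nilpotent: "R x ^ Suc (step G) = 0"
 by (rule raises_trivial[OF raises_power[OF raises_R1]]) simp

section \<open>The exponential of the representation and its inverse\<close>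

definition ex :: "'a => ('a \<times> real) endo" where
 "ex x = pev (step G) (fps_exp 1) (R x)"

lemma ex_sum: "ex x = (\<Sum>n\<le>step G. (1 / fact n) *R R x ^ n)"
 by (simp add: ex_def pev_def)

lemma ex_scale: "ex (t *R x) = pev (step G) (fps_exp t) (R x)"
proof -
 have "(t *R R x) ^ n = t ^ n *R R x ^ n" for n
  by (induction n) (simp_all add: mult.commute)
 thus ?thesis by (simp add: ex_sum pev_def R_simps)
qed

lemma ex_add: "ex ((s + t) *R x) = ex (s *R x) * ex (t *R x)"
 by (simp only: ex_scale fps_exp_add_mult pev_mult[OF R_nilpotent])

lemma ex_0: "ex 0 = 1"
 using ex_scale[of 0 0] by (simp add: pev_one)

lemma ex_minus: "ex x * ex (- x) = 1"
 using ex_add[of 1 "-1" x] by (simp add: ex_0)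

lemma raises_ex: "raises 0 (ex x)"
 unfolding ex_sum by (intro raises_sum raises_scale raises_mono[OF raises_power[OF raises_R1]]) auto

text \<open>At \<open>e^Z\<close> the two factors are \<open>Z / (e^Z - 1)\<close> and
  \<open>(e^Z - 1) / Z\<close>. There are \<open>Suc (step G)\<close> terms because the series
  identity holds strictly below the number of terms, while powers of \<open>R x\<close> up to
  \<open>step G\<close> may survive.\<close>

lemma log_trunc_ex: "log_trunc (Suc (step G)) (ex x) * pev (step G) exp_quot (R x) = 1"
proof -
 let ?s = "step G"
 have "log_trunc (Suc ?s) (ex x) = pev ?s (\<Sum>k<Suc ?s. fps_const ((-1) ^ k / real (Suc k)) * (fps_exp 1 - 1) ^ k) (R x)"
  by (simp only: log_trunc_def ex_def pev_sum pev_const_mult pev_power[OF R_nilpotent] pev_diff pev_one)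
 hence "log_trunc (Suc ?s) (ex x) * pev ?s exp_quot (R x) = pev ?s 1 (R x)"
  by (simp only: pev_mult[OF R_nilpotent, symmetric])
   (rule pev_cong, simp only: log_series_exp_quot[OF le_imp_less_Suc] fps_one_nth)
 thus ?thesis by (simp add: pev_one)
qed

lemma pev_log_trunc_ex: "pev (step G) exp_quot (R x) * log_trunc (Suc (step G)) (ex x) = 1"
proof -
 let ?s = "step G"
 have "log_trunc (Suc ?s) (ex x) = pev ?s (\<Sum>k<Suc ?s. fps_const ((-1) ^ k / real (Suc k)) * (fps_exp 1 - 1) ^ k) (R x)"
  by (simp only: log_trunc_def ex_def pev_sum pev_const_mult pev_power[OF R_nilpotent] pev_diff pev_one)
 thus ?thesis using log_trunc_ex[of x]
  by (simp only: pev_mult[OF R_nilpotent, symmetric] mult.commute)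
qed

text \<open>Multiplying \<open>ex z - 1\<close> by \<open>log_trunc\<close> of \<open>ex z\<close>
  recovers \<open>R z\<close>, and \<open>R\<close> is injective.\<close>

lemma ex_inj:
 assumes "ex x = ex y"
 shows "x = y"
proof (rule R_inj)
 have "R z = (ex z - 1) * log_trunc (Suc (step G)) (ex z)" for z
 proof -
  let ?s = "step G" let ?L = "log_trunc (Suc ?s) (ex z)"
  have X: "pev ?s fps_X (R z) = R z"
  proof -
   have "pev ?s fps_X (R z) = (\<Sum>n\<in>{1}. fps_nth fps_X n *R R z ^ n)"
    unfolding pev_def by (rule sum.mono_neutral_right) (use step_pos in auto)
   thus ?thesis by simp
  qed
  have "ex z - 1 = R z * pev ?s exp_quot (R z)"
  proof -
   have "pev ?s (fps_X * exp_quot) (R z) = pev ?s (fps_exp 1 - 1) (R z)"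
    by (simp only: exp_quot_X)
   thus ?thesis by (simp add: pev_mult R_nilpotent X pev_diff pev_one ex_def del: power_Suc)
  qed
  thus ?thesis by (simp add: mult.assoc pev_log_trunc_ex)
 qed
 thus "R x = R y" using assms by metis
qed

end

section \<open>The Baker--Campbell--Hausdorff formula\<close>

context graded_group
begin

abbreviation emb :: "'a => 'a \<times> real" where "emb x == (x, 0)"

lemma emb_in_Wf: "x \<in> Fil k ==> emb x \<in> Wf k"
 by (simp add: Wf_def)

lemma app_R_power_emb: "app (R x ^ n) (emb y) = emb ((br x ^^ n) y)"
 by (induction n) auto

lemma br_power_Fil: "y \<in> Fil k ==> (br x ^^ n) y \<in> Fil (n + k)"
proof (induction n)
 case (Suc n)
 hence "br x ((br x ^^ n) y) \<in> Fil (1 + (n + k))" by (intro br_Fil) auto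
 thus ?case by simp
qed simp

text \<open>The operator \<open>(e^(ad z) - 1) / ad z\<close>, which governs the derivative of the
  exponential along a curve.\<close>

definition exp_quot_ad :: "'a => 'a => 'a" where
 "exp_quot_ad z y = (\<Sum>k\<le>step G. (1 / fact (Suc k)) *R (br z ^^ k) y)"

definition exp_ad :: "'a => 'a => 'a" where
 "exp_ad z y = (\<Sum>k\<le>step G. (1 / fact k) *R (br z ^^ k) y)"

lemma linear_emb: "linear (%x. emb x)"
 by (rule linearI) auto

lemma emb_sum: "emb (\<Sum>i\<in>I. f i) = (\<Sum>i\<in>I. emb (f i))"
 by (rule linear_sum[OF linear_emb])

lemma emb_exp_quot_ad: "emb (exp_quot_ad z y) = app (pev (step G) exp_quot (R z)) (emb y)"
proof -
 have "emb (exp_quot_ad z y) = (\<Sum>k\<le>step G. (1 / fact (Suc k)) *R emb ((br z ^^ k) y))"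
  by (simp add: exp_quot_ad_def emb_sum)
 also have "... = app (pev (step G) exp_quot (R z)) (emb y)"
  by (simp add: pev_def exp_quot_def app_sum app_R_power_emb)
 finally show ?thesis .
qed

lemma R_ad_pow: "R ((br z ^^ k) y) = ad_pow (R z) k (R y)"
 by (induction k) (auto simp: ad_pow_def R_br)

lemma ad_pow_R_zero: "k + m >= step G ==> ad_pow (R z) k (R y) * R z ^ m = 0"
proof -
 assume km: "k + m >= step G"
 have "raises (k + 1) (ad_pow (R z) k (R y))"
  unfolding R_ad_pow[symmetric] by (intro raises_R br_power_Fil) auto
 hence "raises (k + 1 + 1 * m) (ad_pow (R z) k (R y) * R z ^ m)"
  by (intro raises_mult raises_power raises_R1)
 thus ?thesis by (rule raises_trivial) (use km in auto)
qed

lemma triangle_square: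
 fixes f :: "nat => nat => 'c::comm_monoid_add"
 assumes "!!k m. k + m >= N ==> f k m = 0"
 shows "(\<Sum>n<N. \<Sum>k\<le>n. f k (n - k)) = (\<Sum>k\<le>N. \<Sum>m\<le>N. f k m)"
proof -
 have "(\<Sum>n<N. \<Sum>k\<le>n. f k (n - k)) = (\<Sum>(k, m)\<in>{(k, m). k + m < N}. f k m)"
  by (rule sum.triangle_reindex[symmetric])
 also have "... = (\<Sum>(k, m)\<in>{..N} \<times> {..N}. f k m)"
  by (rule sum.mono_neutral_left) (auto, meson not_le assms)
 finally show ?thesis by (simp add: sum.cartesian_product)
qed

text \<open>Conjugation by an exponential is the exponential of the commutator. Under the
  exponential series the binomials of \<open>power_mult_ad_pow\<close> become
  \<open>1 / (k! m!)\<close>, and since the terms with \<open>k + m >= step G\<close> vanish, the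
  triangle may be completed to a square and the double sum factors.\<close>

lemma ex_mult_R: "ex x * R y = R (exp_ad x y) * ex x"
proof -
 let ?s = "step G"
 define f where "f k m = (1 / (fact k * fact m)) *R (ad_pow (R x) k (R y) * R x ^ m)" for k m
 have f0: "f k m = 0" if "k + m >= ?s" for k m
  using ad_pow_R_zero[OF that] by (simp add: f_def)
 have "ex x * R y = (\<Sum>n\<le>?s. (1 / fact n) *R (\<Sum>k\<le>n. real (n choose k) *R (ad_pow (R x) k (R y) * R x ^ (n - k))))"
  by (simp add: ex_sum sum_distrib_right power_mult_ad_pow)
 also have "... = (\<Sum>n\<le>?s. \<Sum>k\<le>n. f k (n - k))"
  unfolding scaleR_sum_right
  by (intro sum.cong refl) (simp add: f_def binomial_fact field_simps)
 also have "... = (\<Sum>n<?s. \<Sum>k\<le>n. f k (n - k)) + (\<Sum>k\<le>?s. f k (?s - k))"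
  by (simp flip: lessThan_Suc_atMost)
 also have "(\<Sum>k\<le>?s. f k (?s - k)) = 0"
  by (intro sum.neutral) (auto intro: f0)
 also have "(\<Sum>n<?s. \<Sum>k\<le>n. f k (n - k)) = (\<Sum>k\<le>?s. \<Sum>m\<le>?s. f k m)"
  by (rule triangle_square) (rule f0)
 also have "... = (\<Sum>k\<le>?s. (1 / fact k) *R R ((br x ^^ k) y)) * ex x"
  by (simp add: sum_product ex_sum f_def R_ad_pow mult.commute)
 also have "... = R (exp_ad x y) * ex x"
  by (simp add: exp_ad_def R_sum R_simps)
 finally show ?thesis by simp
qed

lemma bounded_bilinear_R: "bounded_bilinear (%x w. app (R x) w)"
proof (rule bilinear_conv_bounded_bilinear[THEN iffD1])
 show "bilinear (%x w. app (R x) w)"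
  unfolding bilinear_def
  by (auto intro!: linear_app linearI simp del: app_R simp: R_simps)
qed

text \<open>Derivatives are taken after application to a vector, since \<open>endo\<close> is an
  algebra without a norm.\<close>

lemma has_vector_derivative_R_power:
 assumes z: "(z has_vector_derivative z') (at t)" and w: "(w has_vector_derivative w') (at t)"
 shows "((%t. app (R (z t) ^ n) (w t)) has_vector_derivative
  (app (\<Sum>i<n. R (z t) ^ i * R z' * R (z t) ^ (n - Suc i)) (w t) + app (R (z t) ^ n) w')) (at t)"
proof (induction n)
 case (Suc n)
 have "((%t. app (R (z t)) (app (R (z t) ^ n) (w t))) has_vector_derivative
  (app (R (z t)) (app (\<Sum>i<n. R (z t) ^ i * R z' * R (z t) ^ (n - Suc i)) (w t) + app (R (z t) ^ n) w')
   + app (R z') (app (R (z t) ^ n) (w t)))) (at t)"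
  by (rule bounded_bilinear.has_vector_derivative[OF bounded_bilinear_R z Suc])
 moreover have "(\<Sum>i<Suc n. R (z t) ^ i * R z' * R (z t) ^ (Suc n - Suc i)) =
  R z' * R (z t) ^ n + R (z t) * (\<Sum>i<n. R (z t) ^ i * R z' * R (z t) ^ (n - Suc i))"
  by (simp add: sum.lessThan_Suc_shift sum_distrib_left mult.assoc del: sum.lessThan_Suc)
 ultimately show ?case
  by (simp add: linear_add[OF linear_app] algebra_simps)
qed (use w in simp)

text \<open>The left-hand side is the exponential series differentiated term by term. Rearranged by
  \<open>sum_power_ad_pow\<close>, it becomes the classical derivative of the exponential
  map.\<close>

lemma sum_power_ex:
 "(\<Sum>n\<le>step G. (1 / fact n) *R (\<Sum>i<n. R z ^ i * R y * R z ^ (n - Suc i))) = R (exp_quot_ad z y) * ex z"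
proof -
 let ?s = "step G"
 define f where "f k m = (1 / (fact (Suc k) * fact m)) *R (ad_pow (R z) k (R y) * R z ^ m)" for k m
 have f0: "f k m = 0" if "k + m >= ?s" for k m
  using ad_pow_R_zero[OF that] by (simp add: f_def)
 have "(\<Sum>n\<le>?s. (1 / fact n) *R (\<Sum>i<n. R z ^ i * R y * R z ^ (n - Suc i)))
   = (\<Sum>n\<le>?s. \<Sum>k<n. f k (n - Suc k))"
  unfolding sum_power_ad_pow scaleR_sum_right
  by (intro sum.cong refl) (simp add: f_def binomial_fact Suc_leI del: fact_Suc)
 also have "... = (\<Sum>n<?s. \<Sum>k\<le>n. f k (n - k))"
  unfolding lessThan_Suc_atMost[symmetric] by (subst sum.lessThan_Suc_shift) simp
 also have "... = (\<Sum>k\<le>?s. \<Sum>m\<le>?s. f k m)"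
  by (rule triangle_square) (rule f0)
 also have "... = (\<Sum>k\<le>?s. (1 / fact (Suc k)) *R R ((br z ^^ k) y)) * ex z"
  by (simp add: sum_product ex_sum f_def R_ad_pow mult.commute del: fact_Suc)
 also have "... = R (exp_quot_ad z y) * ex z"
  by (simp add: exp_quot_ad_def R_sum R_simps)
 finally show ?thesis by simp
qed

lemma has_vector_derivative_ex:
 assumes z: "(z has_vector_derivative z') (at t)" and w: "(w has_vector_derivative w') (at t)"
 shows "((%t. app (ex (z t)) (w t)) has_vector_derivative
  (app (R (exp_quot_ad (z t) z') * ex (z t)) (w t) + app (ex (z t)) w')) (at t)"
proof -
 have "((%t. \<Sum>n\<le>step G. (1 / fact n) *R app (R (z t) ^ n) (w t)) has_vector_derivative
  (\<Sum>n\<le>step G. (1 / fact n) *R (app (\<Sum>i<n. R (z t) ^ i * R z' * R (z t) ^ (n - Suc i)) (w t) + app (R (z t) ^ n) w'))) (at t)"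
  by (intro has_vector_derivative_sum bounded_linear.has_vector_derivative[OF bounded_linear_scaleR_right]
    has_vector_derivative_R_power z w)
 moreover have "(\<Sum>n\<le>step G. (1 / fact n) *R (app (\<Sum>i<n. R (z t) ^ i * R z' * R (z t) ^ (n - Suc i)) (w t) + app (R (z t) ^ n) w'))
  = app (\<Sum>n\<le>step G. (1 / fact n) *R (\<Sum>i<n. R (z t) ^ i * R z' * R (z t) ^ (n - Suc i))) (w t) + app (ex (z t)) w'"
  by (simp add: app_sum ex_sum scaleR_add_right sum.distrib)
 ultimately show ?thesis
  unfolding sum_power_ex by (simp add: ex_sum app_sum)
qed

lemma exp_quot_ad_self: "exp_quot_ad (t *R x) x = x"
proof -
 have "(br (t *R x) ^^ k) x = (if k = 0 then x else 0)" for k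
  by (induction k) (auto simp: br_simps)
 hence "exp_quot_ad (t *R x) x = (\<Sum>k\<le>step G. if k = 0 then x else 0)"
  unfolding exp_quot_ad_def by (intro sum.cong) auto
 thus ?thesis by simp
qed

text \<open>Differentiating the second factor leaves \<open>R y\<close> between the exponentials;
  \<open>ex_mult_R\<close> moves it to the left, where it becomes
  \<open>exp_ad (t *R x) y\<close>.\<close>

lemma has_vector_derivative_ex_ex:
 "((%t. app (ex (t *R x) * ex (t *R y)) w) has_vector_derivative
  app (R (x + exp_ad (t *R x) y) * (ex (t *R x) * ex (t *R y))) w) (at t)"
proof -
 have d: "((%t. t *R u) has_vector_derivative u) (at t)" for u :: 'a
  by (auto intro!: derivative_eq_intros)
 have 1: "((%t. app (ex (t *R y)) w) has_vector_derivative app (R y * ex (t *R y)) w) (at t)"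
  using has_vector_derivative_ex[OF d has_vector_derivative_const, of y w]
  by (simp add: exp_quot_ad_self linear_0[OF linear_app])
 have 2: "app (ex (t *R x)) (app (R y * ex (t *R y)) w) =
  app (R (exp_ad (t *R x) y) * (ex (t *R x) * ex (t *R y))) w"
  using arg_cong[OF ex_mult_R[of "t *R x" y], of "%S. app S (app (ex (t *R y)) w)"]
  by simp
 show ?thesis
  using has_vector_derivative_ex[OF d 1, of x] 2
  by (simp add: exp_quot_ad_self R_simps)
qed

end

lemma nested_bracket_append:
 "w ~= [] ==> nested_bracket b (u @ w) = foldr b u (nested_bracket b w)"
proof (induction u)
 case (Cons x u)
 then obtain y v where "u @ w = y # v" by (cases "u @ w") auto
 thus ?case using Cons by simp
qed simp

lemma degree_of_simps [simp]:
 "degree_of [] = 0" "degree_of (p # ps) = fst p + snd p + degree_of ps"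
 "degree_of (ps @ qs) = degree_of ps + degree_of qs"
 by (auto simp: degree_of_def split: prod.splits)

lemma bch_word_simps [simp]:
 "bch_word x y [] = []"
 "bch_word x y (p # ps) = replicate (fst p) x @ replicate (snd p) y @ bch_word x y ps"
 "bch_word x y (ps @ qs) = bch_word x y ps @ bch_word x y qs"
 by (auto simp: bch_word_def split: prod.splits)

lemma length_bch_word [simp]: "length (bch_word x y ps) = degree_of ps"
 by (induction ps) auto

lemma map_bch_word: "map f (bch_word x y ps) = bch_word (f x) (f y) ps"
 by (induction ps) auto

lemma length_le_degree_of: "\<forall>(r, q)\<in>set ps. 0 < r + q ==> length ps <= degree_of ps"
 by (induction ps) auto

lemma member_le_degree_of: "(r, q) \<in> set ps ==> r + q <= degree_of ps"
 by (induction ps) auto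

definition exponent_pairs :: "nat => (nat \<times> nat) set" where
 "exponent_pairs s = {..s} \<times> {..s} - {(0, 0)}"

text \<open>The last pair is split off because it contains the innermost letter of the nested
  bracket, while all earlier pairs act as operators. Bounding the pairs one by one admits lists of
  degree above \<open>s\<close>, on which the summand vanishes.\<close>

lemma sum_bch_exponents:
 fixes g :: "(nat \<times> nat) list => 'c::comm_monoid_add"
 assumes g: "!!ps. degree_of ps > s ==> g ps = 0"
 shows "(\<Sum>ps\<in>bch_exponents s. g ps) =
  (\<Sum>k<s. \<Sum>qs\<in>{qs. set qs \<subseteq> exponent_pairs s \<and> length qs = k}. \<Sum>p\<in>exponent_pairs s. g (qs @ [p]))"
proof -
 let ?P = "exponent_pairs s"
 let ?L = "%k. {qs. set qs \<subseteq> ?P \<and> length qs = k}"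
 let ?A = "%k. (%(qs, p). qs @ [p]) ` (?L k \<times> ?P)"
 have finP: "finite ?P" by (simp add: exponent_pairs_def)
 have finL: "finite (?L k)" for k using finP by (rule finite_lists_length_eq)
 have sub: "bch_exponents s \<subseteq> (\<Union>k<s. ?A k)"
 proof
  fix ps assume ps: "ps \<in> bch_exponents s"
  hence ne: "ps ~= []" and pos: "\<forall>(r, q)\<in>set ps. 0 < r + q" and deg: "degree_of ps <= s"
   by (auto simp: bch_exponents_def)
  have "set ps \<subseteq> ?P"
  proof
   fix p assume p: "p \<in> set ps"
   obtain r q where rq: "p = (r, q)" by force
   have "r + q <= degree_of ps" using p rq by (intro member_le_degree_of) simp
   moreover have "0 < r + q" using pos p rq by blast
   ultimately show "p \<in> ?P" using deg by (auto simp: exponent_pairs_def rq)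
  qed
  moreover have "length ps <= s" using length_le_degree_of[OF pos] deg by simp
  moreover have "length ps >= 1" using ne by (cases ps) auto
  ultimately have "butlast ps \<in> ?L (length ps - 1)" "last ps \<in> ?P" "length ps - 1 < s"
   using ne last_in_set[OF ne] by (auto dest: in_set_butlastD)
  thus "ps \<in> (\<Union>k<s. ?A k)"
   by (intro UN_I[of "length ps - 1"] image_eqI[of _ _ "(butlast ps, last ps)"]) (use ne in auto)
 qed
 have "(\<Sum>ps\<in>bch_exponents s. g ps) = (\<Sum>ps\<in>(\<Union>k<s. ?A k). g ps)"
 proof (rule sum.mono_neutral_left)
  show "finite (\<Union>k<s. ?A k)" using finP finL by blast
  show "\<forall>ps\<in>(\<Union>k<s. ?A k) - bch_exponents s. g ps = 0"
  proof
   fix ps assume ps: "ps \<in> (\<Union>k<s. ?A k) - bch_exponents s"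
   hence "\<forall>p\<in>set ps. p \<in> ?P" "ps ~= []"
    by auto
   hence "\<forall>(r, q)\<in>set ps. 0 < r + q" "ps ~= []"
    by (fastforce simp: exponent_pairs_def)+
   hence "degree_of ps > s" using ps by (auto simp: bch_exponents_def not_le)
   thus "g ps = 0" by (rule g)
  qed
 qed (rule sub)
 also have "... = (\<Sum>k<s. \<Sum>ps\<in>?A k. g ps)"
  by (rule sum.UNION_disjoint) (use finP finL in auto)
 also have "... = (\<Sum>k<s. \<Sum>(qs, p)\<in>?L k \<times> ?P. g (qs @ [p]))"
  by (intro sum.cong refl, subst sum.reindex) (auto simp: inj_on_def intro!: sum.cong)
 finally show ?thesis by (simp add: sum.cartesian_product)
qed

context graded_group
begin

section \<open>Dynkin's series along the curve of the products (t x)(t y)\<close>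

lemma nested_bracket_scale:
 "nested_bracket br (map ((*R) t) w) = t ^ length w *R nested_bracket br w"
 by (induction br w rule: nested_bracket.induct) (auto simp: br_simps)

lemma nested_bracket_Fil: "nested_bracket br w \<in> Fil (length w)"
proof (induction br w rule: nested_bracket.induct)
 case (3 x y w)
 hence "br x (nested_bracket br (y # w)) \<in> Fil (1 + length (y # w))"
  by (intro br_Fil) auto
 thus ?case by simp
qed auto

lemma nested_bracket_zero: "length w > step G ==> nested_bracket br w = 0"
 by (rule Fil_trivial, rule Fil_antimono[OF _ nested_bracket_Fil]) auto

lemma foldr_replicate: "foldr br (replicate n x) y = (br x ^^ n) y"
 by (induction n) auto

definition blk :: "real => 'a => 'a => nat \<times> nat => ('a \<times> real) endo" where
 "blk t x y = (%(r, q). (t ^ (r + q) / (fact r * fact q)) *R (R x ^ r * R y ^ q))"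

text \<open>The innermost block is a vector rather than an operator. Its exponent of
  \<open>t\<close> is lower by one because differentiating the curve removes one factor
  \<open>t\<close>.\<close>

definition last_blk :: "real => 'a => 'a => nat \<times> nat => 'a" where
 "last_blk t x y = (%(r, q). (t ^ (r + q - 1) / (fact r * fact q)) *R
  nested_bracket br (replicate r x @ replicate q y))"

lemma app_prod_blk:
 "app (prod_list (map (blk t x y) qs)) (emb u) =
  emb ((t ^ degree_of qs / (\<Prod>(r, q)\<leftarrow>qs. fact r * fact q)) *R foldr br (bch_word x y qs) u)"
proof (induction qs)
 case (Cons p qs)
 obtain r q where p: "p = (r, q)" by force
 have lin: "(br x ^^ n) (c *R v) = c *R (br x ^^ n) v" for x n c v
  by (induction n) (auto simp: br_simps)
 show ?case
  using Cons by (simp add: p blk_def app_R_power_emb lin foldr_replicate power_add field_simps)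
qed simp

lemma scaleR_power_endo: "(c *R T) ^ n = c ^ n *R T ^ n" for T :: "('a \<times> real) endo"
 by (induction n) (simp_all add: mult.commute)

lemma sum_blk: "(\<Sum>p\<in>exponent_pairs (step G). blk t x y p) = ex (t *R x) * ex (t *R y) - 1"
proof -
 let ?s = "step G"
 have "ex (t *R x) * ex (t *R y) = (\<Sum>p\<in>{..?s} \<times> {..?s}. blk t x y p)"
  by (simp add: ex_sum sum_product R_simps blk_def power_add sum.cartesian_product case_prod_unfold
    scaleR_power_endo mult.commute)
 also have "... = blk t x y (0, 0) + (\<Sum>p\<in>exponent_pairs ?s. blk t x y p)"
  unfolding exponent_pairs_def by (rule sum.remove) auto
 finally show ?thesis by (simp add: blk_def)
qed

text \<open>A nested bracket that ends in two equal letters vanishes. Only the pair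
  \<open>(1, 0)\<close>, giving \<open>x\<close>, and the pairs \<open>(r, 1)\<close>, giving the
  series of \<open>exp_ad\<close>, survive.\<close>

lemma sum_last_blk: "(\<Sum>p\<in>exponent_pairs (step G). last_blk t x y p) = x + exp_ad (t *R x) y"
proof -
 let ?s = "step G"
 have rep: "nested_bracket br (replicate n z) = (if n = 1 then z else 0)" for n z
 proof (induction n)
  case (Suc n)
  thus ?case by (cases n) (auto simp: br_simps split: if_splits)
 qed simp
 have pow0: "(br z ^^ n) 0 = 0" for n z
  by (induction n) (auto simp: br_simps)
 have q2: "last_blk t x y (r, q) = 0" if "q >= 2" for r q
  using that by (simp add: last_blk_def nested_bracket_append rep foldr_replicate pow0)
 have q0: "last_blk t x y (r, 0) = (if r = 1 then x else 0)" for r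
  by (simp add: last_blk_def rep)
 have q1: "last_blk t x y (r, 1) = (1 / fact r) *R (br (t *R x) ^^ r) y" for r
 proof -
  have "(br (t *R x) ^^ r) y = t ^ r *R (br x ^^ r) y"
   by (induction r) (auto simp: br_simps)
  thus ?thesis
   by (simp add: last_blk_def nested_bracket_append foldr_replicate)
 qed
 have "(\<Sum>p\<in>exponent_pairs ?s. last_blk t x y p) = (\<Sum>p\<in>insert (1, 0) ({..?s} \<times> {1}). last_blk t x y p)"
 proof (rule sum.mono_neutral_right)
  show "insert (1, 0) ({..?s} \<times> {1}) \<subseteq> exponent_pairs ?s"
   using step_pos by (auto simp: exponent_pairs_def)
  show "\<forall>p\<in>exponent_pairs ?s - insert (1, 0) ({..?s} \<times> {1}). last_blk t x y p = 0"
  proof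
   fix p assume p: "p \<in> exponent_pairs ?s - insert (1, 0) ({..?s} \<times> {1})"
   obtain r q where rq: "p = (r, q)" by force
   then consider "q >= 2" | "q = 0" "r ~= 1"
    using p by (cases "q = 0"; cases "q = 1") (auto simp: exponent_pairs_def)
   thus "last_blk t x y p = 0" using rq q2 q0 by cases auto
  qed
 qed (simp add: exponent_pairs_def)
 also have "... = x + (\<Sum>r\<le>?s. last_blk t x y (r, 1))"
 proof -
  have "(\<Sum>p\<in>{..?s} \<times> {1}. last_blk t x y p) = (\<Sum>r\<le>?s. \<Sum>q\<in>{1}. last_blk t x y (r, q))"
   by (simp only: sum.cartesian_product case_prod_eta)
  thus ?thesis by (subst sum.insert) (auto simp: q0)
 qed
 finally show ?thesis by (simp only: q1 exp_ad_def)
qed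

definition bch_curve :: "'a => 'a => real => 'a" where
 "bch_curve x y t = (t *R x) \<odot> (t *R y)"

text \<open>The factor \<open>degree_of ps\<close> produced by the derivative cancels the one in the
  denominator of \<open>bch_coeff\<close>; this is what makes the series summable in closed
  form.\<close>

definition bch_deriv :: "'a => 'a => real => 'a" where
 "bch_deriv x y t = (\<Sum>ps\<in>bch_exponents (step G).
  (bch_coeff ps * real (degree_of ps) * t ^ (degree_of ps - 1)) *R nested_bracket br (bch_word x y ps))"

lemma bch_curve_sum:
 "bch_curve x y t = (\<Sum>ps\<in>bch_exponents (step G).
  (bch_coeff ps * t ^ degree_of ps) *R nested_bracket br (bch_word x y ps))"
 unfolding bch_curve_def gmult_def
 by (simp add: map_bch_word[symmetric] nested_bracket_scale)

lemma bch_curve_0: "bch_curve x y 0 = 0"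
 unfolding bch_curve_sum
proof (intro sum.neutral ballI)
 fix ps assume "ps \<in> bch_exponents (step G)"
 hence "degree_of ps > 0"
  by (cases ps) (auto simp: bch_exponents_def)
 thus "(bch_coeff ps * 0 ^ degree_of ps) *R nested_bracket br (bch_word x y ps) = 0" by simp
qed

lemma has_vector_derivative_bch_curve:
 "(bch_curve x y has_vector_derivative bch_deriv x y t) (at t)"
proof -
 have "((%t. (bch_coeff ps * t ^ degree_of ps) *R u) has_vector_derivative
  (bch_coeff ps * real (degree_of ps) * t ^ (degree_of ps - 1)) *R u) (at t)" for ps and u :: 'a
  by (auto intro!: derivative_eq_intros simp: has_vector_derivative_def algebra_simps)
 thus ?thesis
  unfolding bch_curve_sum[abs_def] bch_deriv_def
  by (intro has_vector_derivative_sum)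
qed

text \<open>All admissible blocks together sum to \<open>ex (t *R x) * ex (t *R y) - 1\<close>.
  Lists of \<open>k\<close> blocks followed by a last one give its \<open>k\<close>-th power with
  the coefficient \<open>(-1)^k / (k + 1)\<close>, which is \<open>log_trunc\<close>.\<close>

lemma emb_bch_deriv:
 "emb (bch_deriv x y t) =
  app (log_trunc (step G) (ex (t *R x) * ex (t *R y))) (emb (x + exp_ad (t *R x) y))"
proof -
 let ?s = "step G" let ?P = "exponent_pairs ?s"
 let ?L = "%k. {qs. set qs \<subseteq> ?P \<and> length qs = k}"
 let ?M = "ex (t *R x) * ex (t *R y)"
 define g where "g ps = (bch_coeff ps * real (degree_of ps) * t ^ (degree_of ps - 1)) *R
  nested_bracket br (bch_word x y ps)" for ps
 have finP: "finite ?P" by (simp add: exponent_pairs_def)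
 have g: "emb (g (qs @ [p])) = ((-1) ^ length qs / real (Suc (length qs))) *R
   app (prod_list (map (blk t x y) qs)) (emb (last_blk t x y p))" if p: "p \<in> ?P" for qs p
 proof -
  obtain r q where rq: "p = (r, q)" by force
  hence pos: "r + q > 0" using p by (auto simp: exponent_pairs_def)
  have ne: "replicate r x @ replicate q y ~= []" using pos by auto
  have lin: "foldr br w (c *R v) = c *R foldr br w v" for w c v
   by (induction w) (auto simp: br_simps)
  have deg: "t ^ (degree_of qs + (r + q) - 1) = t ^ degree_of qs * t ^ (r + q - 1)"
   using pos by (subst power_add[symmetric], intro arg_cong[where f = "power t"]) arith
  have coef: "bch_coeff (qs @ [(r, q)]) * real (degree_of (qs @ [(r, q)])) =
   (-1) ^ length qs / real (Suc (length qs)) *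
   (1 / (\<Prod>(r, q)\<leftarrow>qs. fact r * fact q) * (1 / (fact r * fact q)))"
  proof -
   have "real (degree_of qs) + (real r + real q) ~= 0"
    using pos by (simp flip: of_nat_add)
   thus ?thesis by (simp add: bch_coeff_def)
  qed
  show ?thesis
   unfolding g_def rq coef app_prod_blk last_blk_def
   by (simp add: nested_bracket_append[OF ne] lin deg[simplified])
 qed
 have "bch_deriv x y t = (\<Sum>ps\<in>bch_exponents ?s. g ps)"
  by (simp add: bch_deriv_def g_def)
 also have "... = (\<Sum>k<?s. \<Sum>qs\<in>?L k. \<Sum>p\<in>?P. g (qs @ [p]))"
  by (rule sum_bch_exponents) (simp add: g_def nested_bracket_zero)
 finally have "emb (bch_deriv x y t) = (\<Sum>k<?s. \<Sum>qs\<in>?L k. \<Sum>p\<in>?P. emb (g (qs @ [p])))"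
  by (simp add: emb_sum)
 also have "... = (\<Sum>k<?s. \<Sum>qs\<in>?L k. \<Sum>p\<in>?P. ((-1) ^ k / real (Suc k)) *R
   app (prod_list (map (blk t x y) qs)) (emb (last_blk t x y p)))"
  by (intro sum.cong refl) (auto simp: g)
 also have "... = (\<Sum>k<?s. ((-1) ^ k / real (Suc k)) *R
   app (\<Sum>qs\<in>?L k. prod_list (map (blk t x y) qs)) (emb (\<Sum>p\<in>?P. last_blk t x y p)))"
  by (simp add: app_sum emb_sum linear_sum[OF linear_app] scaleR_sum_right)
   (intro sum.cong refl sum.swap)
 also have "... = app (log_trunc ?s ?M) (emb (x + exp_ad (t *R x) y))"
  unfolding sum_lists_prod[OF finP] sum_last_blk sum_blk by (simp add: log_trunc_def app_sum)
 finally show ?thesis .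
qed

lemma raises_ex_minus_1: "raises 1 (ex x - 1)"
proof -
 have "ex x = 1 + (\<Sum>n<step G. (1 / fact (Suc n)) *R R x ^ Suc n)"
  unfolding ex_sum by (subst sum.atMost_shift) simp
 moreover have "raises 1 (\<Sum>n<step G. (1 / fact (Suc n)) *R R x ^ Suc n)"
  by (intro raises_sum raises_scale raises_mono[OF raises_power[OF raises_R1]]) auto
 ultimately show ?thesis by simp
qed

lemma raises_power_diff:
 assumes "raises j (A - B)" "raises 0 A" "raises 0 B"
 shows "raises j (A ^ n - B ^ n)"
proof (induction n)
 case (Suc n)
 have "A ^ Suc n - B ^ Suc n = A * (A ^ n - B ^ n) + (A - B) * B ^ n"
  by (simp add: algebra_simps)
 moreover have "raises (0 + j) (A * (A ^ n - B ^ n))" by (intro raises_mult Suc assms)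
 moreover have "raises (j + 0 * n) ((A - B) * B ^ n)" by (intro raises_mult raises_power assms)
 ultimately show ?case by (simp add: raises_add)
qed (simp add: raises_0)

lemma raises_log_trunc_diff:
 assumes "raises j (A - B)" "raises 0 A" "raises 0 B"
 shows "raises j (log_trunc N A - log_trunc N B)"
proof -
 have "log_trunc N A - log_trunc N B =
  (\<Sum>k<N. ((-1) ^ k / real (Suc k)) *R ((A - 1) ^ k - (B - 1) ^ k))"
  by (simp add: log_trunc_def sum_subtractf scaleR_diff_right)
 also have "raises j ..."
 proof (intro raises_sum raises_scale raises_power_diff)
  show "raises j (A - 1 - (B - 1))" "raises 0 (A - 1)" "raises 0 (B - 1)"
   using assms by (simp_all add: raises_diff raises_1)
 qed
 finally show ?thesis .
qed

lemma Wf_of_derivative: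
 assumes d: "!!t. (y has_vector_derivative y' t) (at t)" and y': "!!t. y' t \<in> Wf k" and y0: "y 0 \<in> Wf k"
 shows "y t \<in> Wf k"
proof -
 have zero: "f (y t) = 0" if lin: "linear f" and f: "!!w. w \<in> Wf k ==> f w = 0" for f :: "'a \<times> real => 'a"
 proof -
  have "((%t. f (y t)) has_vector_derivative 0) (at s)" for s
   using bounded_linear.has_vector_derivative[OF _ d] lin f[OF y'] linear_conv_bounded_linear
   by metis
  then obtain c where "!!s. f (y s) = c"
   using has_vector_derivative_zero_constant[of UNIV "%t. f (y t)"] by auto
  thus ?thesis using f[OF y0] by metis
 qed
 have "comp i (fst (y t)) = 0" if "i < k" for i
 proof (rule zero)
  show "linear (%w. comp i (fst w))" by (rule linearI) auto
 qed (use that in \<open>auto simp: Wf_def Fil_def\<close>)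
 moreover have "snd (y t) = 0" if "k > 0"
 proof -
  obtain b :: 'a where b: "b \<in> Basis" by (meson ex_in_conv nonempty_Basis)
  have "snd (y t) *R b = 0"
   by (rule zero[of "%w. snd w *R b"])
    (use that in \<open>auto simp: Wf_def intro!: linearI simp: algebra_simps\<close>)
  thus ?thesis using b by (auto simp: nonzero_Basis)
 qed
 ultimately show ?thesis by (cases "y t") (auto simp: Wf_def Fil_def)
qed

text \<open>
 Both sides of the Baker--Campbell--Hausdorff formula agree at \<open>t = 0\<close>, and the better they agree
 along the filtration, the better their derivatives agree.
\<close>
lemma raises_bch: "raises j (ex (bch_curve x y t) - ex (t *R x) * ex (t *R y))"
proof (induction j arbitrary: t)
 case 0
 show ?case by (intro raises_diff raises_ex raises_mult[of 0 _ 0, simplified])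
next
 case (Suc j)
 let ?s = "step G"
 let ?z = "bch_curve x y" and ?z' = "bch_deriv x y"
 let ?M = "%t. ex (t *R x) * ex (t *R y)" and ?v = "%t. x + exp_ad (t *R x) y"
 have M1: "raises 1 (?M t - 1)" for t
 proof -
  have "?M t - 1 = (ex (t *R x) - 1) * ex (t *R y) + (ex (t *R y) - 1)"
   by (simp add: left_diff_distrib)
  thus ?thesis
   by (metis raises_add raises_mult raises_ex_minus_1 raises_ex add.right_neutral)
 qed
 have M0: "raises 0 (?M t)" for t
  using raises_mult[OF raises_ex raises_ex] by simp
 \<comment> \<open>With \<open>ex (?z t)\<close> in place of \<open>?M t\<close> the factor
   \<open>?Psi\<close> would cancel \<open>log_trunc\<close> exactly. The induction hypothesis
   measures the replacement, and one more degree comes from applying the operators to a vector of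
   \<open>Wf 1\<close>.\<close>
 have key: "exp_quot_ad (?z t) (?z' t) - ?v t \<in> Fil (Suc j)" for t
 proof -
  let ?E = "ex (?z t)" and ?Psi = "pev ?s exp_quot (R (?z t))"
  have Psi0: "raises 0 ?Psi"
   unfolding pev_def by (intro raises_sum raises_scale raises_mono[OF raises_power[OF raises_R1]]) auto
  \<comment> \<open>The cancellation uses \<open>Suc (step G)\<close> terms while
    \<open>emb_bch_deriv\<close> has \<open>step G\<close> of them; the additional term vanishes on
    \<open>?v t\<close>.\<close>
  have "app ((?M t - 1) ^ ?s) (emb (?v t)) \<in> Wf (1 + 1 * ?s)"
   using raises_power[OF M1] emb_in_Wf[of "?v t" 1] by (fastforce simp: raises_def)
  hence "app ((?M t - 1) ^ ?s) (emb (?v t)) = 0"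
   by (cases "app ((?M t - 1) ^ ?s) (emb (?v t))") (auto simp: Wf_def zero_prod_def dest: Fil_trivial)
  hence "emb (?z' t) = app (log_trunc (Suc ?s) (?M t)) (emb (?v t))"
   by (simp add: emb_bch_deriv log_trunc_def)
  hence "emb (exp_quot_ad (?z t) (?z' t)) - emb (?v t) =
   app (?Psi * log_trunc (Suc ?s) (?M t)) (emb (?v t)) - app (?Psi * log_trunc (Suc ?s) ?E) (emb (?v t))"
   by (simp add: emb_exp_quot_ad pev_log_trunc_ex)
  also have "... = app (?Psi * (log_trunc (Suc ?s) (?M t) - log_trunc (Suc ?s) ?E)) (emb (?v t))"
   by (simp add: linear_diff[OF linear_app])
  also have "... \<in> Wf (1 + j)"
  proof -
   have "raises j (?M t - ?E)"
    using raises_scale[OF Suc, of "-1" t] by simp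
   hence "raises (0 + j) (?Psi * (log_trunc (Suc ?s) (?M t) - log_trunc (Suc ?s) ?E))"
    by (intro raises_mult Psi0 raises_log_trunc_diff M0 raises_ex)
   hence "app (?Psi * (log_trunc (Suc ?s) (?M t) - log_trunc (Suc ?s) ?E)) (emb (?v t)) \<in> Wf (1 + (0 + j))"
    using emb_in_Wf[of "?v t" 1] unfolding raises_def by (metis Fil_1 One_nat_def)
   thus ?thesis by simp
  qed
  finally show ?thesis by (simp add: Wf_def)
 qed
 \<comment> \<open>The derivative of the difference splits in two: one term carries the error
   bounded by \<open>key\<close>, and in the other \<open>R (?v t)\<close> adds one degree to the
   induction hypothesis.\<close>
 have "app (ex (?z t) - ?M t) w \<in> Wf (i + Suc j)" if w: "w \<in> Wf i" for i w
 proof (rule Wf_of_derivative[where y = "%t. app (ex (?z t) - ?M t) w" and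
    y' = "%t. app (R (exp_quot_ad (?z t) (?z' t) - ?v t) * ex (?z t)
     + R (?v t) * (ex (?z t) - ?M t)) w"])
  fix t
  have "((%t. app (ex (?z t)) w - app (?M t) w) has_vector_derivative
   app (R (exp_quot_ad (?z t) (?z' t)) * ex (?z t)) w - app (R (?v t) * ?M t) w) (at t)"
   using has_vector_derivative_ex[OF has_vector_derivative_bch_curve[of x y t] has_vector_derivative_const[of w]]
   by (intro has_vector_derivative_diff has_vector_derivative_ex_ex) (simp add: linear_0[OF linear_app])
  thus "((%t. app (ex (?z t) - ?M t) w) has_vector_derivative
    app (R (exp_quot_ad (?z t) (?z' t) - ?v t) * ex (?z t) + R (?v t) * (ex (?z t) - ?M t)) w) (at t)"
   by (simp only: app_simps R_simps linear_diff[OF linear_app]) (simp add: algebra_simps)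
  have "raises (Suc j) (R (exp_quot_ad (?z t) (?z' t) - ?v t) * ex (?z t))"
   using raises_mult[OF raises_R[OF key] raises_ex] by simp
  moreover have "raises (Suc j) (R (?v t) * (ex (?z t) - ?M t))"
   using raises_mult[OF raises_R1 Suc] by simp
  ultimately show "app (R (exp_quot_ad (?z t) (?z' t) - ?v t) * ex (?z t)
    + R (?v t) * (ex (?z t) - ?M t)) w \<in> Wf (i + Suc j)"
   using w raises_add unfolding raises_def by blast
  show "app (ex (?z 0) - ?M 0) w \<in> Wf (i + Suc j)"
   by (simp add: bch_curve_0 ex_0 subspace_0[OF subspace_Wf])
 qed
 thus ?case by (simp add: raises_def)
qed

text \<open>A shift by \<open>Suc (step G)\<close> is zero, so the two sides agree at
  \<open>t = 1\<close>. Together with \<open>ex_inj\<close> this transfers the group axioms from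
  operators to the Dynkin product.\<close>

theorem ex_mul: "ex (x \<odot> y) = ex x * ex y"
 using raises_trivial[OF raises_bch[of "Suc (step G)" x y 1]] by (simp add: bch_curve_def)

lemma mul_assoc: "(x \<odot> y) \<odot> z = x \<odot> (y \<odot> z)"
 by (rule ex_inj) (simp add: ex_mul mult.assoc)

lemma mul_0 [simp]: "x \<odot> 0 = x" "0 \<odot> x = x"
 by (rule ex_inj, simp add: ex_mul ex_0)+

lemma mul_minus [simp]: "x \<odot> (- x) = 0" "(- x) \<odot> x = 0"
 using ex_minus[of x] ex_minus[of "- x"] by (auto intro!: ex_inj simp: ex_mul ex_0)

lemma mul_parallel: "(s *R x) \<odot> (t *R x) = (s + t) *R x"
 by (rule ex_inj) (simp add: ex_mul ex_add)

lemma mul_cancel [simp]: "(- x) \<odot> (x \<odot> y) = y" "x \<odot> ((- x) \<odot> y) = y"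
 by (simp_all flip: mul_assoc)

lemma mul_cancel_right [simp]: "(y \<odot> x) \<odot> (- x) = y" "(y \<odot> (- x)) \<odot> x = y"
 by (simp_all add: mul_assoc)

lemma minus_mul: "- (x \<odot> y) = (- y) \<odot> (- x)"
proof -
 have "(x \<odot> y) \<odot> ((- y) \<odot> (- x)) = 0" by (simp add: mul_assoc)
 hence "(- (x \<odot> y)) \<odot> ((x \<odot> y) \<odot> ((- y) \<odot> (- x))) = - (x \<odot> y)" by simp
 thus ?thesis by (simp only: mul_cancel)
qed

end

section \<open>Dilations and the lower order terms of the group law\<close>

context graded_group
begin

lemma comp_dil: "comp i (dil r x) = r ^ i *R comp i x"
 by (rule comp_unique) (auto simp: dilation_def subspace_V subspace_scale comp_in_V)

lemma comp_eqI: "(!!i. comp i x = comp i y) ==> x = y"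
 using sum_comp[of x] sum_comp[of y] by simp

lemma linear_dil: "linear (dil r)"
 unfolding dilation_def
 by (intro linear_compose_sum ballI linear_compose_scale_right linear_comp)

lemmas dil_simps [simp] = linear_0[OF linear_dil] linear_neg[OF linear_dil]

lemma dil_dil [simp]: "dil r (dil s x) = dil (r * s) x"
 and dil_1 [simp]: "dil 1 x = x"
 by (rule comp_eqI, simp add: comp_dil power_mult_distrib)+

lemma dil_inverse [simp]: "r ~= 0 ==> dil r (dil (1 / r) x) = x" "r ~= 0 ==> dil (1 / r) (dil r x) = x"
 by simp_all

lemma dil_V: "v \<in> V j ==> dil r v = r ^ j *R v"
 by (rule comp_eqI) (auto simp: comp_dil comp_V)

lemma dil_br: "dil r (br x y) = br (dil r x) (dil r y)"
proof -
 have "dil r (br (comp k x) (comp l y)) = br (dil r (comp k x)) (dil r (comp l y))" for k l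
  by (simp add: dil_V[OF comp_in_V] dil_V[OF br_V[OF comp_in_V comp_in_V]] br_simps power_add)
 hence "dil r (br (\<Sum>k=1..step G. comp k x) (\<Sum>l=1..step G. comp l y)) =
  br (dil r (\<Sum>k=1..step G. comp k x)) (dil r (\<Sum>l=1..step G. comp l y))"
  by (simp add: br_sum linear_sum[OF linear_dil])
 thus ?thesis by (simp add: sum_comps)
qed

lemma dil_nested: "dil r (nested_bracket br w) = nested_bracket br (map (dil r) w)"
 by (induction br w rule: nested_bracket.induct) (auto simp: dil_br)

lemma dil_mul: "dil r (x \<odot> y) = dil r x \<odot> dil r y"
 by (simp add: gmult_def linear_sum[OF linear_dil] linear_scale[OF linear_dil] dil_nested map_bch_word)

definition fst_sum :: "(nat \<times> nat) list => nat" where "fst_sum ps = (\<Sum>p\<leftarrow>ps. fst p)"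
definition snd_sum :: "(nat \<times> nat) list => nat" where "snd_sum ps = (\<Sum>p\<leftarrow>ps. snd p)"

lemma degree_of_fst_snd: "degree_of ps = fst_sum ps + snd_sum ps"
 by (induction ps) (auto simp: fst_sum_def snd_sum_def)

lemma nested_bracket_Fil_list:
 "list_all2 (%x d. x \<in> Fil d) w ds ==> w ~= [] ==> nested_bracket br w \<in> Fil (sum_list ds)"
proof (induction br w arbitrary: ds rule: nested_bracket.induct)
 case (3 x y w)
 then obtain d e where "ds = d # e" "x \<in> Fil d" "list_all2 (%x d. x \<in> Fil d) (y # w) e"
  by (auto simp: list_all2_Cons1)
 thus ?case using 3 by (auto intro: br_Fil)
qed (auto simp: list_all2_Cons1)

lemma nested_bch_word_Fil:
 assumes "x \<in> Fil i" "y \<in> Fil j" "degree_of ps > 0"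
 shows "nested_bracket br (bch_word x y ps) \<in> Fil (fst_sum ps * i + snd_sum ps * j)"
proof -
 have "list_all2 (%x d. x \<in> Fil d) (bch_word x y ps) (bch_word i j ps)"
 proof (induction ps)
  case (Cons p ps)
  have "list_all2 (%x d. x \<in> Fil d) (replicate n z) (replicate n d)" if "z \<in> Fil d" for n z d
   using that by (induction n) auto
  thus ?case using Cons assms by (auto intro!: list_all2_appendI)
 qed simp
 moreover have "sum_list (bch_word i j ps) = fst_sum ps * i + snd_sum ps * j"
  by (induction ps) (auto simp: fst_sum_def snd_sum_def sum_list_replicate algebra_simps)
 moreover have "bch_word x y ps ~= []" using assms(3) length_bch_word[of x y ps] by (metis list.size(3) less_irrefl)
 ultimately show ?thesis using nested_bracket_Fil_list by metis
qed

lemma nested_replicate: "nested_bracket br (replicate n z) = (if n = 1 then z else 0)"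
proof (induction n)
 case (Suc n)
 thus ?case by (cases n) (auto simp: br_simps split: if_splits)
qed simp

lemma nested_bch_word_one_letter:
 assumes "fst_sum ps = 0 \<or> snd_sum ps = 0" "degree_of ps >= 2"
 shows "nested_bracket br (bch_word x y ps) = 0"
proof -
 have "fst_sum ps = 0 ==> bch_word x y ps = replicate (snd_sum ps) y"
  by (induction ps) (auto simp: fst_sum_def snd_sum_def replicate_add)
 moreover have "snd_sum ps = 0 ==> bch_word x y ps = replicate (fst_sum ps) x"
  by (induction ps) (auto simp: fst_sum_def snd_sum_def replicate_add)
 ultimately show ?thesis using assms by (auto simp: nested_replicate degree_of_fst_snd)
qed

lemma bch_exponents_degree_1:
 "{ps \<in> bch_exponents n. degree_of ps = 1} = (if n >= 1 then {[(1, 0)], [(0, 1)]} else {})"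
proof -
 have *: "ps \<in> {[(1, 0)], [(0, 1)]}" if "ps ~= []" "\<forall>(r, q)\<in>set ps. 0 < r + q" "degree_of ps = 1" for ps
 proof -
  obtain p ps' where "ps = p # ps'" using \<open>ps ~= []\<close> by (cases ps) auto
  obtain r q where p: "p = (r, q)" by force
  have "r + q > 0" "r + q + degree_of ps' = 1" "length ps' <= degree_of ps'"
   using that length_le_degree_of[of ps'] \<open>ps = p # ps'\<close> p by simp_all
  hence "r + q = 1" "length ps' = 0" by linarith+
  thus ?thesis using p \<open>ps = p # ps'\<close> by (auto simp: add_is_1)
 qed
 show ?thesis
 proof (cases "n >= 1")
  case True
  have "{ps \<in> bch_exponents n. degree_of ps = 1} \<subseteq> {[(1, 0)], [(0, 1)]}"
  proof
   fix ps assume "ps \<in> {ps \<in> bch_exponents n. degree_of ps = 1}"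
   thus "ps \<in> {[(1, 0)], [(0, 1)]}" by (intro *) (simp_all add: bch_exponents_def)
  qed
  moreover have "{[(1, 0)], [(0, 1)]} \<subseteq> {ps \<in> bch_exponents n. degree_of ps = 1}"
   using True by (simp add: bch_exponents_def)
  ultimately show ?thesis using True by (simp only: if_True subset_antisym)
 next
  case False
  thus ?thesis by (auto simp: bch_exponents_def)
 qed
qed

lemma bch_exponents_degree_2:
 "{ps \<in> bch_exponents n. degree_of ps = 2} = (if n >= 2 then
  {[(1, 1)], [(1, 0), (0, 1)], [(0, 1), (1, 0)], [(2, 0)], [(0, 2)], [(1, 0), (1, 0)], [(0, 1), (0, 1)]} else {})"
proof -
 have *: "ps \<in> {[(1, 1)], [(1, 0), (0, 1)], [(0, 1), (1, 0)], [(2, 0)], [(0, 2)], [(1, 0), (1, 0)], [(0, 1), (0, 1)]}"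
  if "ps ~= []" "\<forall>(r, q)\<in>set ps. 0 < r + q" "degree_of ps = 2" for ps
 proof -
  obtain p ps' where ps: "ps = p # ps'" using \<open>ps ~= []\<close> by (cases ps) auto
  obtain r q where p: "p = (r, q)" by force
  show ?thesis
  proof (cases ps')
   case Nil
   hence "r + q = 2" using that ps p by simp
   hence "(r, q) \<in> {(1, 1), (2, 0), (0, 2)}" by (cases r; cases "r = 1") auto
   thus ?thesis using ps p Nil by auto
  next
   case (Cons p' ps'')
   obtain r' q' where p': "p' = (r', q')" by force
   have "r + q > 0" "r' + q' > 0" "r + q + (r' + q') + degree_of ps'' = 2" "length ps'' <= degree_of ps''"
    using that ps p p' Cons length_le_degree_of[of ps''] by simp_all
   hence "r + q = 1" "r' + q' = 1" "length ps'' = 0" by linarith+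
   thus ?thesis using ps p p' Cons by (auto simp: add_is_1)
  qed
 qed
 show ?thesis
 proof (cases "n >= 2")
  case True
  have "{ps \<in> bch_exponents n. degree_of ps = 2} \<subseteq> {[(1, 1)], [(1, 0), (0, 1)], [(0, 1), (1, 0)], [(2, 0)], [(0, 2)], [(1, 0), (1, 0)], [(0, 1), (0, 1)]}"
  proof
   fix ps assume "ps \<in> {ps \<in> bch_exponents n. degree_of ps = 2}"
   thus "ps \<in> {[(1, 1)], [(1, 0), (0, 1)], [(0, 1), (1, 0)], [(2, 0)], [(0, 2)], [(1, 0), (1, 0)], [(0, 1), (0, 1)]}" by (intro *) (simp_all add: bch_exponents_def)
  qed
  moreover have "{[(1, 1)], [(1, 0), (0, 1)], [(0, 1), (1, 0)], [(2, 0)], [(0, 2)], [(1, 0), (1, 0)], [(0, 1), (0, 1)]} \<subseteq> {ps \<in> bch_exponents n. degree_of ps = 2}"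
   using True by (simp add: bch_exponents_def)
  ultimately show ?thesis using True by (simp only: if_True subset_antisym)
 next
  case False
  thus ?thesis by (auto simp: bch_exponents_def)
 qed
qed

text \<open>The terms of degree 1 and 2 give the sum and half the bracket. A word of degree at least
  3 in which both letters occur has weight at least \<open>i + j + 1\<close>, and a word of such
  degree in one letter has bracket zero.\<close>

lemma mul_expand:
 assumes "x \<in> Fil i" "y \<in> Fil j" "i >= 1" "j >= 1"
 shows "x \<odot> y - (x + y + (1/2) *R br x y) \<in> Fil (i + j + 1)"
proof -
 let ?E = "bch_exponents (step G)"
 define g where "g ps = bch_coeff ps *R nested_bracket br (bch_word x y ps)" for ps
 have "x \<odot> y = (\<Sum>ps\<in>?E. g ps)" by (simp add: gmult_def g_def)
 also have "?E = {ps\<in>?E. degree_of ps = 1} \<union> ({ps\<in>?E. degree_of ps = 2} \<union> {ps\<in>?E. degree_of ps >= 3})"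
 proof -
  have "degree_of ps >= 1" if "ps \<in> ?E" for ps
   using that by (cases ps) (auto simp: bch_exponents_def)
  thus ?thesis by fastforce
 qed
 also have "(\<Sum>ps\<in>.... g ps) = (\<Sum>ps\<in>{ps\<in>?E. degree_of ps = 1}. g ps) +
  ((\<Sum>ps\<in>{ps\<in>?E. degree_of ps = 2}. g ps) + (\<Sum>ps\<in>{ps\<in>?E. degree_of ps >= 3}. g ps))"
  by (subst sum.union_disjoint, simp_all add: finite_bch_exponents disjoint_iff)
   (subst sum.union_disjoint, simp_all add: finite_bch_exponents disjoint_iff)
 also have "(\<Sum>ps\<in>{ps\<in>?E. degree_of ps = 1}. g ps) = x + y"
  using step_pos unfolding bch_exponents_degree_1 by (simp add: g_def bch_coeff_def)
 also have "(\<Sum>ps\<in>{ps\<in>?E. degree_of ps = 2}. g ps) = (1/2) *R br x y"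
 proof (cases "step G >= 2")
  case True
  thus ?thesis unfolding bch_exponents_degree_2
   by (simp add: g_def bch_coeff_def br_simps numeral_2_eq_2 br_antisym[of y x] flip: scaleR_add_left)
 next
  case False
  moreover have "br x y \<in> Fil (Suc (step G))"
   by (rule Fil_antimono[OF _ br_Fil[OF assms(1,2)]]) (use assms False in auto)
  ultimately show ?thesis using Fil_trivial unfolding bch_exponents_degree_2 by simp
 qed
 finally have "x \<odot> y - (x + y + (1/2) *R br x y) = (\<Sum>ps\<in>{ps\<in>?E. degree_of ps >= 3}. g ps)"
  by simp
 also have "... \<in> Fil (i + j + 1)"
 proof (rule Fil_sum)
  fix ps assume ps: "ps \<in> {ps\<in>?E. degree_of ps >= 3}"
  show "g ps \<in> Fil (i + j + 1)"
  proof (cases "fst_sum ps = 0 \<or> snd_sum ps = 0")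
   case True
   thus ?thesis using nested_bch_word_one_letter[OF True] ps by (simp add: g_def)
  next
   case False
   let ?r = "fst_sum ps" and ?q = "snd_sum ps"
   have rq: "?r >= 1" "?q >= 1" "?r + ?q >= 3" using False ps by (auto simp: degree_of_fst_snd)
   have "i + j + 1 <= ?r * i + ?q * j"
   proof (cases "?r >= 2")
    case True
    have "2 * i <= ?r * i" "1 * j <= ?q * j" using True rq by (intro mult_right_mono; simp)+
    thus ?thesis using assms by linarith
   next
    case False
    hence "?q >= 2" using rq by auto
    hence "1 * i <= ?r * i" "2 * j <= ?q * j" using rq by (intro mult_right_mono; simp)+
    thus ?thesis using assms by linarith
   qed
   thus ?thesis
    unfolding g_def using ps
    by (intro Fil_scale Fil_antimono[OF _ nested_bch_word_Fil[OF assms(1,2)]]) auto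
  qed
 qed
 finally show ?thesis .
qed

lemma mul_mod:
 assumes "x \<in> Fil i" "y \<in> Fil j" "i >= 1" "j >= 1"
 shows "x \<odot> y - (x + y) \<in> Fil (i + j)"
proof -
 have "x \<odot> y - (x + y) = (x \<odot> y - (x + y + (1/2) *R br x y)) + (1/2) *R br x y"
  by simp
 thus ?thesis
  using Fil_antimono[OF _ mul_expand[OF assms]] br_Fil[OF assms(1,2)]
  by (metis Fil_add Fil_scale le_add1)
qed

lemma mul_Fil: "x \<in> Fil k ==> y \<in> Fil k ==> k >= 1 ==> x \<odot> y \<in> Fil k"
 using Fil_add[OF Fil_antimono[OF _ mul_mod[of x k y k]] Fil_add[of x k y]] by simp

lemma minus_Fil: "x \<in> Fil k ==> - x \<in> Fil k"
 using Fil_scale[of x k "-1"] by simp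

text \<open>Translates a perturbation of \<open>b\<close> in the vector space into one in the group.
  If the quotient lies in \<open>Fil i\<close>, multiplying it by \<open>b\<close> is addition up to
  \<open>Fil (i + 1)\<close>, so it agrees with \<open>q\<close> up to \<open>Fil (i + 1)\<close>;
  this raises its degree step by step up to \<open>k\<close>.\<close>

lemma mul_minus_mod:
 assumes q: "q \<in> Fil k" and k: "k >= 1"
 shows "(b + q) \<odot> (- b) - q \<in> Fil (Suc k)"
proof -
 let ?r = "(b + q) \<odot> (- b)"
 have r: "?r \<odot> b = b + q" by simp
 have step: "?r - q \<in> Fil (i + 1)" if "?r \<in> Fil i" "i >= 1" for i
  using mul_mod[of ?r i b 1] that minus_Fil[of "?r \<odot> b - (?r + b)" "i + 1"] unfolding r
  by (simp add: algebra_simps)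
 have "?r \<in> Fil i" if "i >= 1" "i <= k" for i
  using that
 proof (induction i rule: dec_induct)
  case (step i)
  hence "?r - q \<in> Fil (i + 1)" using \<open>!!i. ?r \<in> Fil i ==> i >= 1 ==> _\<close> by auto
  moreover have "q \<in> Fil (i + 1)" using q step by (auto intro: Fil_antimono)
  ultimately show ?case using Fil_add[of "?r - q" "i + 1" q] by simp
 qed simp
 thus ?thesis using step[of k] k by simp
qed

text \<open>The group commutator equals the bracket to leading order: the second order terms of the
  two products are opposite halves of the bracket, and \<open>mul_minus_mod\<close> turns the
  difference of the products into their quotient.\<close>

lemma commutator_mod:
 assumes p: "p \<in> Fil j" and j: "j >= 1"
 shows "(x \<odot> p) \<odot> (- (p \<odot> x)) - br x p \<in> Fil (j + 2)"
proof -
 let ?q = "x \<odot> p - p \<odot> x"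
 have "x \<odot> p - (x + p + (1/2) *R br x p) \<in> Fil (1 + j + 1)"
  using p j by (intro mul_expand) auto
 hence 1: "x \<odot> p - (x + p + (1/2) *R br x p) \<in> Fil (j + 2)"
  by (rule Fil_antimono[rotated]) simp
 have "p \<odot> x - (p + x + (1/2) *R br p x) \<in> Fil (j + 1 + 1)"
  using p j by (intro mul_expand) auto
 hence 2: "p \<odot> x - (p + x + (1/2) *R br p x) \<in> Fil (j + 2)"
  by (rule Fil_antimono[rotated]) simp
 have half: "(1/2) *R br x p - (1/2) *R br p x = br x p"
  by (simp add: br_antisym[of p x] flip: scaleR_left_distrib)
 have "?q - br x p = ?q - ((1/2) *R br x p - (1/2) *R br p x)"
  by (simp only: half)
 also have "... = (x \<odot> p - (x + p + (1/2) *R br x p)) - (p \<odot> x - (p + x + (1/2) *R br p x))"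
  by simp
 finally have "?q - br x p = (x \<odot> p - (x + p + (1/2) *R br x p)) - (p \<odot> x - (p + x + (1/2) *R br p x))" .
 hence q: "?q - br x p \<in> Fil (j + 2)"
  using Fil_diff[OF 1 2] by metis
 moreover have "br x p \<in> Fil (j + 1)" using br_Fil[of x 1 p j] p by simp
 ultimately have "?q \<in> Fil (j + 1)"
  using Fil_add[of "?q - br x p" "j + 1" "br x p"] Fil_antimono[of "j + 1" "j + 2"] by simp
 hence "(p \<odot> x + ?q) \<odot> (- (p \<odot> x)) - ?q \<in> Fil (Suc (j + 1))"
  by (rule mul_minus_mod) simp
 thus ?thesis
  using q Fil_add[of "(p \<odot> x + ?q) \<odot> (- (p \<odot> x)) - ?q" "j + 2" "?q - br x p"] by simp
qed

lemma bounded_bilinear_br: "bounded_bilinear br"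
 using bilinear_br by (simp add: bilinear_conv_bounded_bilinear)

lemma mul_as_sum_of_functions:
 "f x \<odot> g x = (\<Sum>ps\<in>bch_exponents (step G). bch_coeff ps *R nested_bracket br (map (%h. h x) (bch_word f g ps)))"
 by (simp add: gmult_def map_bch_word)

lemma set_bch_word: "set (bch_word x y ps) \<subseteq> {x, y}"
 by (induction ps) auto

lemma continuous_on_mul [continuous_intros]:
 assumes "continuous_on A f" "continuous_on A g"
 shows "continuous_on A (%x. f x \<odot> g x)"
proof -
 have nested: "continuous_on A (%x. nested_bracket br (map (%h. h x) hs))"
  if "\<forall>h\<in>set hs. continuous_on A h" for hs
  using that
 proof (induction hs rule: induct_list012)
  case (3 h h' hs)
  thus ?case by (auto intro!: bounded_bilinear.continuous_on[OF bounded_bilinear_br])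
 qed auto
 show ?thesis
  unfolding mul_as_sum_of_functions using assms set_bch_word[of f g]
  by (intro continuous_intros nested) blast
qed

end

section \<open>Stratified algebras and factorization into horizontal elements\<close>

locale stratified_group =
 fixes G :: "'a::euclidean_space graded_algebra"
 assumes carnot: "carnot_group G"
begin

text \<open>The stratification controls brackets with the first layer. Higher layers are spanned by
  such brackets, and the Jacobi identity in the form
  \<open>[[u, v], y] = [u, [v, y]] - [v, [u, y]]\<close> allows induction on the first
  index.\<close>

lemma carnot_graded: "homogeneous_group G"
proof -
 let ?B = "lbr G" let ?V = "layer G" let ?s = "step G"
 have lie: "bilinear ?B" and self: "!!x. ?B x x = 0"
  and jac: "!!x y z. ?B x (?B y z) + ?B y (?B z x) + ?B z (?B x y) = 0"
  and sub: "!!i. subspace (?V i)" and triv: "!!i. i \<notin> {1..?s} ==> ?V i = {0}"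
  and gen: "!!i. i \<in> {1..<?s} ==> span {?B x y |x y. x \<in> ?V 1 \<and> y \<in> ?V i} = ?V (Suc i)"
  and top: "!!x y. x \<in> ?V 1 ==> y \<in> ?V ?s ==> ?B x y = 0"
  using carnot unfolding carnot_group_def lie_bracket_def direct_sum_of_layers_def by blast+
 note bl = bilinear_ladd[OF lie] bilinear_radd[OF lie] bilinear_lzero[OF lie] bilinear_rzero[OF lie]
  bilinear_lmul[OF lie] bilinear_rmul[OF lie]
 have anti: "?B x y = - ?B y x" for x y
  using self[of "x + y"] unfolding bl by (simp add: self eq_neg_iff_add_eq_0 add.commute)
 have base: "?B x y \<in> ?V (Suc j)" if "x \<in> ?V 1" "y \<in> ?V j" for x y j
 proof (cases "j \<in> {1..<?s}")
  case True
  have "?B x y \<in> {?B x y |x y. x \<in> ?V 1 \<and> y \<in> ?V j}" using that by blast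
  hence "?B x y \<in> span {?B x y |x y. x \<in> ?V 1 \<and> y \<in> ?V j}" by (rule span_base)
  thus ?thesis by (simp only: gen[OF True])
 next
  case False
  hence "j = ?s \<or> j \<notin> {1..?s}" by auto
  hence "?B x y = 0" using top that triv[of j] by (auto simp: bl)
  thus ?thesis using sub subspace_0 by metis
 qed
 have "\<forall>x\<in>?V i. \<forall>y\<in>?V j. ?B x y \<in> ?V (i + j)" for i j
 proof (induction i arbitrary: j)
  case 0
  thus ?case using triv[of 0] by (auto simp: bl subspace_0[OF sub])
 next
  case (Suc i)
  show ?case
  proof (cases "i \<in> {1..<?s}")
   case True
   show ?thesis
   proof (intro ballI)
    fix x y assume x: "x \<in> ?V (Suc i)" and y: "y \<in> ?V j"
    have "subspace {x. ?B x y \<in> ?V (Suc i + j)}"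
     using sub[of "Suc i + j"] by (auto simp: subspace_def bl)
    moreover have "{?B u v |u v. u \<in> ?V 1 \<and> v \<in> ?V i} \<subseteq> {x. ?B x y \<in> ?V (Suc i + j)}"
    proof clarify
     fix u v assume u: "u \<in> ?V 1" and v: "v \<in> ?V i"
     have "?B u (?B v y) \<in> ?V (Suc (i + j))" using base u v y Suc by blast
     moreover have "?B v (?B u y) \<in> ?V (i + Suc j)" using base u v y Suc by blast
     moreover have "?B (?B u v) y = ?B u (?B v y) - ?B v (?B u y)"
      using jac[of u v y] anti[of y "?B u v"] anti[of y u]
      by (simp add: bilinear_rneg[OF lie] algebra_simps)
     ultimately show "?B (?B u v) y \<in> ?V (Suc i + j)" by (simp add: sub subspace_diff)
    qed
    ultimately have "span {?B u v |u v. u \<in> ?V 1 \<and> v \<in> ?V i} \<subseteq> {x. ?B x y \<in> ?V (Suc i + j)}"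
     by (rule span_minimal[rotated])
    thus "?B x y \<in> ?V (Suc i + j)" using gen[OF True] x by blast
   qed
  next
   case False
   then consider "i = 0" | "i >= ?s" by fastforce
   thus ?thesis
   proof cases
    case 1
    thus ?thesis using base by auto
   next
    case 2
    hence "?V (Suc i) = {0}" using triv by auto
    thus ?thesis by (auto simp: bl subspace_0[OF sub])
   qed
  qed
 qed
 thus ?thesis using carnot by (simp add: carnot_group_def homogeneous_group_def)
qed

sublocale graded_group G
 by unfold_locales (rule carnot_graded)

lemma span_br: "i \<in> {1..<step G} ==> span {br x y |x y. x \<in> V 1 \<and> y \<in> V i} = V (Suc i)"
 using carnot by (simp add: carnot_group_def)

definition gprod :: "'a list => 'a" where "gprod xs = foldr (\<odot>) xs 0"

lemma gprod_simps [simp]: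
 "gprod [] = 0" "gprod (x # xs) = x \<odot> gprod xs" "gprod (xs @ ys) = gprod xs \<odot> gprod ys"
proof -
 show 1: "gprod (x # xs) = x \<odot> gprod xs" for x xs by (simp add: gprod_def)
 show "gprod [] = 0" by (simp add: gprod_def)
 thus "gprod (xs @ ys) = gprod xs \<odot> gprod ys"
  by (induction xs) (auto simp: 1 mul_assoc)
qed

lemma gprod_rev: "gprod (rev (map uminus xs)) = - gprod xs"
 by (induction xs) (auto simp: minus_mul)

text \<open>The number of factors is fixed and each factor depends continuously on \<open>y\<close>,
  so that derivatives along the factors can later be integrated over \<open>y\<close>.\<close>

definition hfactor :: "('a => 'a) => bool" where
 "hfactor th \<longleftrightarrow> (\<exists>ws. (\<forall>w\<in>set ws. cont w \<and> range w \<subseteq> V 1) \<and>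
  (\<forall>y. th y = gprod (map (%w. w y) ws)))"

lemma hfactor_continuous: "hfactor th ==> cont th"
proof -
 assume "hfactor th"
 then obtain ws where ws: "\<forall>w\<in>set ws. cont w" "!!y. th y = gprod (map (%w. w y) ws)"
  by (auto simp: hfactor_def)
 have "cont (%y. gprod (map (%w. w y) ws))"
  using ws(1) by (induction ws) (auto intro!: continuous_intros)
 thus ?thesis using ws(2) by (metis (no_types, lifting) continuous_on_cong)
qed

lemma hfactor_0: "hfactor (%y. 0)"
 unfolding hfactor_def by (rule exI[of _ "[]"]) simp

lemma hfactor_V1: "cont w ==> range w \<subseteq> V 1 ==> hfactor w"
 unfolding hfactor_def by (rule exI[of _ "[w]"]) simp

lemma hfactor_mul: "hfactor th ==> hfactor th' ==> hfactor (%y. th y \<odot> th' y)"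
 unfolding hfactor_def
proof (elim exE conjE)
 fix ws ws'
 assume "\<forall>w\<in>set ws. cont w \<and> range w \<subseteq> V 1" "\<forall>y. th y = gprod (map (%w. w y) ws)"
  "\<forall>w\<in>set ws'. cont w \<and> range w \<subseteq> V 1" "\<forall>y. th' y = gprod (map (%w. w y) ws')"
 thus "\<exists>ws. (\<forall>w\<in>set ws. cont w \<and> range w \<subseteq> V 1) \<and>
  (\<forall>y. th y \<odot> th' y = gprod (map (%w. w y) ws))"
  by (intro exI[of _ "ws @ ws'"]) (auto simp: image_subset_iff)
qed

lemma hfactor_minus: "hfactor th ==> hfactor (%y. - th y)"
 unfolding hfactor_def
proof (elim exE conjE)
 fix ws
 assume ws: "\<forall>w\<in>set ws. cont w \<and> range w \<subseteq> V 1" "\<forall>y. th y = gprod (map (%w. w y) ws)"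
 show "\<exists>ws. (\<forall>w\<in>set ws. cont w \<and> range w \<subseteq> V 1) \<and> (\<forall>y. - th y = gprod (map (%w. w y) ws))"
 proof (intro exI conjI ballI allI)
  let ?ws = "rev (map (%w y. - w y) ws)"
  show "- th y = gprod (map (%w. w y) ?ws)" for y
   using ws(2) gprod_rev[of "map (%w. w y) ws"] by (simp add: rev_map comp_def)
  fix w assume "w \<in> set ?ws"
  then obtain v where v: "v \<in> set ws" "w = (%y. - v y)" by auto
  thus "cont w" "range w \<subseteq> V 1"
   using ws(1) subspace_neg[OF subspace_V[of 1]] by (auto intro!: continuous_intros)
 qed
qed

lemma hfactor_compose: "hfactor th ==> cont g ==> hfactor (%y. th (g y))"
 unfolding hfactor_def
proof (elim exE conjE)
 fix ws
 assume g: "cont g"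
  and ws: "\<forall>w\<in>set ws. cont w \<and> range w \<subseteq> V 1" "\<forall>y. th y = gprod (map (%w. w y) ws)"
 show "\<exists>ws. (\<forall>w\<in>set ws. cont w \<and> range w \<subseteq> V 1) \<and> (\<forall>y. th (g y) = gprod (map (%w. w y) ws))"
  by (rule exI[of _ "map (%w y. w (g y)) ws"])
   (use ws g in \<open>auto simp: comp_def intro: continuous_on_compose2[of UNIV _ UNIV g]\<close>)
qed

lemma gprod_Fil:
 assumes "!!c. c \<in> set cs ==> f c \<in> Fil k" "k >= 1"
 shows "gprod (map f cs) \<in> Fil k \<and> gprod (map f cs) - sum_list (map f cs) \<in> Fil (2 * k)"
 using assms(1)
proof (induction cs)
 case (Cons c cs)
 let ?P = "gprod (map f cs)"
 have IH: "?P \<in> Fil k" "?P - sum_list (map f cs) \<in> Fil (2 * k)" and c: "f c \<in> Fil k"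
  using Cons by auto
 have "f c \<odot> ?P - (f c + ?P) \<in> Fil (2 * k)"
  using mul_mod[OF c IH(1)] assms(2) by (simp add: mult_2)
 from Fil_add[OF this IH(2)] show ?case using mul_Fil[OF c IH(1) assms(2)] by (simp add: algebra_simps)
qed simp

text \<open>An element of the next layer is a sum of brackets of fixed horizontal vectors with
  elements of the present one. Replacing each bracket by a group commutator, and the second entry by
  its factored approximation, changes it by terms of higher degree.\<close>

lemma hfactor_layer:
 "j >= 1 ==> j <= step G ==> \<exists>\<pi>. hfactor \<pi> \<and> (\<forall>y. \<pi> y - comp j y \<in> Fil (Suc j))"
proof (induction j rule: dec_induct)
 case base
 have "hfactor (comp 1)"
  by (rule hfactor_V1) (auto intro: comp_in_V linear_continuous_on simp: linear_comp linear_conv_bounded_linear[symmetric])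
 thus ?case by (intro exI[of _ "comp 1"]) auto
next
 case (step j)
 then obtain \<pi> where \<pi>: "hfactor \<pi>" "!!y. \<pi> y - comp j y \<in> Fil (Suc j)" by auto
 let ?S = "{br x y |x y. x \<in> V 1 \<and> y \<in> V j}"
 have spanS: "span ?S = V (Suc j)" using step by (intro span_br) auto
 \<comment> \<open>A basis chosen among the brackets: its coefficients are linear, hence continuous,
   in \<open>y\<close>, and each basis element has a fixed horizontal first entry.\<close>
 obtain C where C: "C \<subseteq> ?S" "independent C" "?S \<subseteq> span C"
  using maximal_independent_subset[of ?S] by blast
 have finC: "finite C" using C(2) by (rule independent_imp_finite)
 have spanC: "span C = V (Suc j)"
  using C spanS span_mono[of C ?S] span_minimal[of ?S "span C"] by (simp add: subspace_span subset_antisym)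
 have "\<forall>c\<in>C. \<exists>x y. c = br x y \<and> x \<in> V 1 \<and> y \<in> V j" using C(1) by blast
 then obtain X Y where XY: "!!c. c \<in> C ==> c = br (X c) (Y c) \<and> X c \<in> V 1 \<and> Y c \<in> V j"
  by metis
 define lam where "lam c y = representation C (comp (Suc j) y) c *R Y c" for c y
 have in_span: "comp (Suc j) y \<in> span C" for y unfolding spanC by (rule comp_in_V)
 have lin: "linear (lam c)" for c
  by (rule linearI)
   (simp_all add: lam_def representation_add[OF C(2) in_span in_span] representation_scale[OF C(2) in_span]
    scaleR_add_left)
 have cont: "cont (lam c)" for c
  using lin linear_conv_bounded_linear linear_continuous_on by blast
 have lamV: "lam c y \<in> V j" if "c \<in> C" for c y
  using XY[OF that] subspace_V subspace_scale by (auto simp: lam_def)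
 have decomp_y: "comp (Suc j) y = (\<Sum>c\<in>C. br (X c) (lam c y))" for y
 proof -
  have "comp (Suc j) y = (\<Sum>c\<in>C. representation C (comp (Suc j) y) c *R c)"
   by (rule sum_representation_eq[symmetric]) (use C(2) in_span finC in auto)
  also have "... = (\<Sum>c\<in>C. br (X c) (lam c y))"
   using XY by (intro sum.cong refl) (simp add: lam_def br_simps)
  finally show ?thesis .
 qed
 define com where "com c y = (X c \<odot> \<pi> (lam c y)) \<odot> (- (\<pi> (lam c y) \<odot> X c))" for c y
 have hX: "hfactor (%y. X c)" if "c \<in> C" for c
  using XY[OF that] by (intro hfactor_V1) auto
 have hcom: "hfactor (com c)" if "c \<in> C" for c
  unfolding com_def
  by (intro hfactor_mul hfactor_minus hfactor_compose[OF \<pi>(1)] hX that cont)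
 have com_mod: "com c y - br (X c) (lam c y) \<in> Fil (j + 2)" if c: "c \<in> C" for c y
 proof -
  let ?l = "lam c y"
  have d: "\<pi> ?l - ?l \<in> Fil (Suc j)" using \<pi>(2)[of ?l] lamV[OF c, of y] by (simp add: comp_V)
  hence p: "\<pi> ?l \<in> Fil j"
   using Fil_add[OF Fil_antimono[of j "Suc j"] V_Fil[OF lamV[OF c, of y]], of "\<pi> ?l - ?l"] by simp
  have "br (X c) (\<pi> ?l - ?l) \<in> Fil (1 + Suc j)" using d by (intro br_Fil) auto
  hence "br (X c) (\<pi> ?l) - br (X c) ?l \<in> Fil (j + 2)" by (simp add: br_simps)
  from Fil_add[OF commutator_mod[OF p \<open>j >= 1\<close>, of "X c"] this] show ?thesis
   by (simp add: com_def)
 qed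
 have comF: "com c y \<in> Fil (Suc j)" if c: "c \<in> C" for c y
 proof -
  have "br (X c) (lam c y) \<in> Fil (1 + j)" using V_Fil[OF lamV[OF c]] by (intro br_Fil) auto
  thus ?thesis
   using Fil_add[OF Fil_antimono[OF _ com_mod[OF c, of y]], of "Suc j" "br (X c) (lam c y)"] by simp
 qed
 obtain cs where cs: "set cs = C" "distinct cs" using finite_distinct_list[OF finC] by blast
 define th where "th y = gprod (map (%c. com c y) cs)" for y
 have h: "hfactor th"
 proof -
  have "hfactor (%y. gprod (map (%c. com c y) ds))" if "set ds \<subseteq> C" for ds
   using that by (induction ds) (auto intro!: hfactor_0 hfactor_mul hcom)
  thus ?thesis using cs unfolding th_def by simp
 qed
 have "th y - comp (Suc j) y \<in> Fil (Suc (Suc j))" for y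
 proof -
  have "th y - sum_list (map (%c. com c y) cs) \<in> Fil (2 * Suc j)"
   unfolding th_def using gprod_Fil[of cs "%c. com c y" "Suc j"] comF cs by auto
  hence 1: "th y - sum_list (map (%c. com c y) cs) \<in> Fil (j + 2)"
   by (rule Fil_antimono[rotated]) simp
  have "sum_list (map (%c. com c y) cs) - comp (Suc j) y = (\<Sum>c\<in>C. com c y - br (X c) (lam c y))"
   using cs by (simp add: sum_list_distinct_conv_sum_set decomp_y sum_subtractf)
  also have "... \<in> Fil (j + 2)" by (intro Fil_sum com_mod)
  finally have "sum_list (map (%c. com c y) cs) - comp (Suc j) y \<in> Fil (j + 2)" .
  from Fil_add[OF 1 this] show ?thesis by simp
 qed
 with h show ?case by blast
qed

text \<open>The remainder modulo the factored part is corrected one layer at a time, by a horizontal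
  product with the same leading component.\<close>

lemma hfactor_mod: "k <= step G ==> \<exists>th. hfactor th \<and> (\<forall>y. (- th y) \<odot> y \<in> Fil (Suc k))"
proof (induction k)
 case 0
 show ?case by (rule exI[of _ "%y. 0"]) (simp add: hfactor_0)
next
 case (Suc k)
 then obtain th where th: "hfactor th" "!!y. (- th y) \<odot> y \<in> Fil (Suc k)" by auto
 obtain \<pi> where \<pi>: "hfactor \<pi>" "!!y. \<pi> y - comp (Suc k) y \<in> Fil (Suc (Suc k))"
  using hfactor_layer[of "Suc k"] Suc by auto
 let ?u = "%y. (- th y) \<odot> y"
 let ?th' = "%y. th y \<odot> \<pi> (?u y)"
 have "hfactor ?th'"
  by (intro hfactor_mul th hfactor_compose[OF \<pi>(1)] continuous_intros hfactor_continuous)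
 moreover have "(- ?th' y) \<odot> y \<in> Fil (Suc (Suc k))" for y
 proof -
  let ?v = "?u y" and ?p = "\<pi> (?u y)"
  have v: "?v \<in> Fil (Suc k)" by (rule th)
  have "?v - comp (Suc k) ?v \<in> Fil (Suc (Suc k))"
   using v by (auto simp: Fil_def comp_V[OF comp_in_V] less_Suc_eq)
  from Fil_diff[OF this \<pi>(2)[of ?v]] have vp: "?v - ?p \<in> Fil (Suc (Suc k))"
   by (simp add: minus_Fil[of "?p - ?v", simplified])
  hence p: "?p \<in> Fil (Suc k)"
   using Fil_diff[OF v Fil_antimono[of "Suc k" "Suc (Suc k)"], of "?v - ?p"] by simp
  have "(- ?p) \<odot> ?v - (- ?p + ?v) \<in> Fil (Suc k + Suc k)"
   by (intro mul_mod minus_Fil p v) auto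
  hence "(- ?p) \<odot> ?v - (- ?p + ?v) \<in> Fil (Suc (Suc k))"
   by (rule Fil_antimono[rotated]) simp
  from Fil_add[OF this vp] show ?thesis by (simp add: minus_mul mul_assoc)
 qed
 ultimately show ?case by blast
qed

theorem horizontal_factorization:
 obtains ws where "!!w. w \<in> set ws ==> cont w"
  "!!w y. w \<in> set ws ==> w y \<in> V 1" "!!y. gprod (map (%w. w y) ws) = y"
proof -
 obtain th where th: "hfactor th" "!!y. (- th y) \<odot> y \<in> Fil (Suc (step G))"
  using hfactor_mod[of "step G"] by auto
 have "th y = y" for y
  using Fil_trivial[OF th(2), of y] mul_cancel(2)[of "th y" y] by simp
 then obtain ws where "\<forall>w\<in>set ws. cont w \<and> range w \<subseteq> V 1" "\<forall>y. y = gprod (map (%w. w y) ws)"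
  using th(1) by (auto simp: hfactor_def)
 thus ?thesis by (intro that[of ws]) (auto simp: image_subset_iff)
qed

end

section \<open>Haar measure\<close>

locale haar_group = stratified_group +
 fixes \<nu> :: "'a measure"
 assumes haar: "haar_measure G \<nu>"
begin

abbreviation haar_integral :: "('a => real) => real" (binder "\<integral>" 10) where
 "haar_integral f == integral\<^sup>L \<nu> f"

definition left_invariant :: "'a measure => bool" where
 "left_invariant M \<longleftrightarrow> radon_measure M \<and> (\<forall>z. distr M borel ((\<odot>) z) = M)"

lemma measurable_mul [measurable]:
 assumes [measurable]: "f \<in> borel_measurable M" "g \<in> borel_measurable M"
 shows "(%x. f x \<odot> g x) \<in> borel_measurable M"
proof -
 have "cont (%p::'a \<times> 'a. fst p \<odot> snd p)"
  by (intro continuous_intros)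
 hence [measurable]: "(%p::'a \<times> 'a. fst p \<odot> snd p) \<in> Borel"
  by (rule borel_measurable_continuous_onI)
 have "(%x. (f x, g x)) \<in> borel_measurable M" by measurable
 from measurable_compose[OF this \<open>(%p::'a \<times> 'a. fst p \<odot> snd p) \<in> _\<close>] show ?thesis by simp
qed

lemma measurable_dil [measurable]: "dil r \<in> Borel"
 using linear_dil linear_conv_bounded_linear borel_measurable_continuous_onI linear_continuous_on by blast

lemma vimage_mul: "(\<odot>) z -` A = (\<odot>) (- z) ` A"
 by (force intro: image_eqI[where x = "z \<odot> x" for x])

lemma homeomorphic_images:
 "A \<in> sets borel ==> (\<odot>) z ` A \<in> sets borel"
 "compact K ==> compact ((\<odot>) z ` K)"
 "open U ==> open ((\<odot>) z ` U)"
proof -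
 have c: "cont ((\<odot>) z)" for z by (intro continuous_intros)
 have im: "(\<odot>) z ` A = (\<odot>) (- z) -` A" for A using vimage_mul[of "- z" A] by simp
 show "A \<in> sets borel ==> (\<odot>) z ` A \<in> sets borel"
  unfolding im using measurable_sets_borel[of "(\<odot>) (- z)" borel A] by simp
 show "compact K ==> compact ((\<odot>) z ` K)"
  by (rule compact_continuous_image[OF continuous_on_subset[OF c]]) auto
 show "open U ==> open ((\<odot>) z ` U)"
  unfolding im using c by (simp add: open_vimage)
qed

lemma left_invariant_haar: "left_invariant \<nu>"
 unfolding left_invariant_def
proof (intro conjI allI)
 show r: "radon_measure \<nu>" using haar by (simp add: haar_measure_def)
 hence s: "sets \<nu> = sets borel" by (simp add: radon_measure_def)
 fix z
 show "distr \<nu> borel ((\<odot>) z) = \<nu>"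
 proof (rule measure_eqI)
  fix A assume "A \<in> sets (distr \<nu> borel ((\<odot>) z))"
  hence A: "A \<in> sets borel" by simp
  have "emeasure (distr \<nu> borel ((\<odot>) z)) A = emeasure \<nu> ((\<odot>) (- z) ` A)"
   using s A by (subst emeasure_distr) (auto simp: vimage_mul sets_eq_imp_space_eq[OF s] measurable_cong_sets[OF s refl])
  also have "... = emeasure \<nu> A" using haar A by (simp add: haar_measure_def)
  finally show "emeasure (distr \<nu> borel ((\<odot>) z)) A = emeasure \<nu> A" .
 qed (use s in simp)
qed

lemma left_invariantD:
 "left_invariant M ==> sets M = sets borel"
 "left_invariant M ==> compact K ==> emeasure M K < \<infinity>"
 "left_invariant M ==> radon_measure M"
 by (simp_all add: left_invariant_def radon_measure_def)

lemma UN_cball_nat: "(\<Union>n::nat. cball (0::'a) (real n)) = UNIV"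
 by (auto simp: real_arch_simple)

lemma radonD: "radon_measure M ==> sets M = sets borel" "radon_measure M ==> compact K ==> emeasure M K < \<infinity>"
 by (auto simp: radon_measure_def)

lemma sets_haar [measurable_cong, simp]: "sets \<nu> = sets borel"
 using left_invariant_haar by (rule left_invariantD)

lemma space_haar [simp]: "space \<nu> = UNIV"
 using sets_eq_imp_space_eq[OF sets_haar] by simp

lemma emeasure_haar_compact: "compact K ==> emeasure \<nu> K < \<infinity>"
 using left_invariant_haar by (rule left_invariantD)

lemma radon_sigma_finite:
 assumes "radon_measure M"
 shows "sigma_finite_measure M"
proof
 have "space M = UNIV" using sets_eq_imp_space_eq[OF radonD(1)[OF assms]] by simp
 thus "\<exists>A. countable A \<and> A \<subseteq> sets M \<and> \<Union> A = space M \<and> (\<forall>a\<in>A. emeasure M a ~= \<infinity>)"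
  using radonD[OF assms]
  by (intro exI[of _ "range (%n::nat. cball 0 (real n))"])
   (auto simp: less_top[symmetric] real_arch_simple)
qed

lemma left_invariant_nn_integral:
 assumes M: "left_invariant M" and [measurable]: "f \<in> Borel"
 shows "(\<integral>\<^sup>+x. f (z \<odot> x) \<partial>M) = (\<integral>\<^sup>+x. f x \<partial>M)"
proof -
 have [measurable_cong]: "sets M = sets borel" using M by (rule left_invariantD)
 have "(\<integral>\<^sup>+x. f x \<partial>M) = (\<integral>\<^sup>+x. f x \<partial>distr M borel ((\<odot>) z))"
  using M by (simp add: left_invariant_def)
 also have "... = (\<integral>\<^sup>+x. f (z \<odot> x) \<partial>M)"
  by (rule nn_integral_distr) measurable
 finally show ?thesis by simp
qed

lemma left_invariant_emeasure:
 assumes "left_invariant M" "A \<in> sets borel"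
 shows "emeasure M ((\<odot>) z ` A) = emeasure M A"
proof -
 have s: "sets M = sets borel" using assms by (simp add: left_invariantD)
 have "(\<integral>\<^sup>+x. indicator ((\<odot>) z ` A) (z \<odot> x) \<partial>M) = (\<integral>\<^sup>+x. indicator ((\<odot>) z ` A) x \<partial>M)"
  using assms by (intro left_invariant_nn_integral borel_measurable_indicator homeomorphic_images)
 moreover have "indicator ((\<odot>) z ` A) (z \<odot> x) = (indicator A x :: ennreal)" for x
  by (auto simp: indicator_def) (metis mul_cancel(1))
 ultimately show ?thesis using assms homeomorphic_images by (simp add: s)
qed

text \<open>Finitely many translates of a nonempty open set cover a ball; if the set were null, all
  balls and hence the whole group would be null.\<close>

lemma haar_open_pos:
 assumes U: "open U" "U ~= {}"
 shows "emeasure \<nu> U > 0"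
proof (rule ccontr)
 assume "\<not> emeasure \<nu> U > 0"
 hence U0: "emeasure \<nu> U = 0" by simp
 obtain u where u: "u \<in> U" using U by blast
 have "emeasure \<nu> (cball 0 (real n)) = 0" for n
 proof -
  have "compact (cball (0::'a) (real n))" by simp
  moreover have "cball 0 (real n) \<subseteq> (\<Union>z\<in>cball 0 (real n). (\<odot>) (z \<odot> (- u)) ` U)"
   using u by (force intro: image_eqI[where x = u])
  ultimately obtain Z where Z: "Z \<subseteq> cball 0 (real n)" "finite Z" "cball 0 (real n) \<subseteq> (\<Union>z\<in>Z. (\<odot>) (z \<odot> (- u)) ` U)"
   using homeomorphic_images(3)[OF U(1)] by (elim compactE_image) auto
  have "emeasure \<nu> (cball 0 (real n)) <= emeasure \<nu> (\<Union>z\<in>Z. (\<odot>) (z \<odot> (- u)) ` U)"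
   by (rule emeasure_mono[OF Z(3)]) (use Z homeomorphic_images U in auto)
  also have "... <= (\<Sum>z\<in>Z. emeasure \<nu> ((\<odot>) (z \<odot> (- u)) ` U))"
   by (rule emeasure_subadditive_finite) (use Z homeomorphic_images U in auto)
  also have "... = 0"
   using U U0 left_invariant_emeasure[OF left_invariant_haar] by simp
  finally show ?thesis by simp
 qed
 hence "emeasure \<nu> (\<Union>n::nat. cball 0 (real n)) = 0"
  by (intro emeasure_UN_eq_0) auto
 thus False
  using haar UN_cball_nat by (auto simp: haar_measure_def)
qed

abbreviation "unit_ball == cball (0::'a) 1"

lemma unit_ball_pos: "0 < emeasure \<nu> unit_ball" "emeasure \<nu> unit_ball < \<infinity>"
 using order.strict_trans2[OF haar_open_pos[of "ball 0 1"] emeasure_mono[of "ball 0 1" unit_ball \<nu>]]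
  emeasure_haar_compact[of unit_ball] by auto

lemma unit_ball_emeasure: "emeasure \<nu> unit_ball = ennreal (measure \<nu> unit_ball)"
proof (rule emeasure_eq_ennreal_measure)
 show "emeasure \<nu> unit_ball ~= top" using unit_ball_pos(2) by (metis infinity_ennreal_def less_irrefl)
qed

lemma unit_ball_measure_pos: "0 < measure \<nu> unit_ball"
 using unit_ball_pos(1) unfolding unit_ball_emeasure by simp

lemmas unit_ball_measure = unit_ball_emeasure unit_ball_measure_pos

section \<open>Uniqueness of left-invariant measures up to a factor\<close>

definition right_ball_vol :: "'a => ennreal" where
 "right_ball_vol x = (\<integral>\<^sup>+y. indicator unit_ball (y \<odot> x) \<partial>\<nu>)"

text \<open>After inserting the weight \<open>right_ball_vol\<close>, one left translation for each
  of the two measures and two exchanges of integrals separate the variables. The last factor on the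
  right does not depend on \<open>M\<close>, so \<open>M\<close> is determined by its value on the
  unit ball.\<close>

lemma haar_unique_aux:
 assumes M: "left_invariant M" and f[measurable]: "f \<in> Borel"
 shows "(\<integral>\<^sup>+x. f x \<partial>M) = emeasure M unit_ball * (\<integral>\<^sup>+y. f (- y) / right_ball_vol (- y) \<partial>\<nu>)"
proof -
 let ?K = right_ball_vol
 have sM [measurable_cong]: "sets M = sets borel" using M by (rule left_invariantD)
 interpret N: sigma_finite_measure \<nu>
  using left_invariant_haar by (auto simp: left_invariant_def intro: radon_sigma_finite)
 interpret M: sigma_finite_measure M
  using M by (auto simp: left_invariant_def intro: radon_sigma_finite)
 interpret P: pair_sigma_finite M \<nu> by unfold_locales
 have [measurable]: "unit_ball \<in> sets borel" by simp
 have [measurable]: "?K \<in> Borel" unfolding right_ball_vol_def by measurable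
 have Kpos: "0 < ?K x" and Kfin: "?K x < \<infinity>" for x
 proof -
  have c: "cont (%y. y \<odot> x)" "cont (%y. y \<odot> (- x))" by (intro continuous_intros)+
  have im: "(%y. y \<odot> x) -` A = (%y. y \<odot> (- x)) ` A" for A
   by (force intro: image_eqI[where x = "y \<odot> x" for y])
  have K: "?K x = emeasure \<nu> ((%y. y \<odot> x) -` unit_ball)"
  proof -
   have "(%y. y \<odot> x) -` unit_ball \<in> sets borel"
    by (intro measurable_sets_borel[OF borel_measurable_continuous_onI[OF c(1)]]) simp
   thus ?thesis unfolding right_ball_vol_def
    by (simp add: nn_integral_indicator[symmetric] indicator_def vimage_def del: nn_integral_indicator)
  qed
  have "open ((%y. y \<odot> x) -` ball 0 1)" using c by (simp add: open_vimage)
  moreover have "- x \<in> (%y. y \<odot> x) -` ball 0 1" by simp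
  ultimately have "0 < emeasure \<nu> ((%y. y \<odot> x) -` ball 0 1)" by (intro haar_open_pos) blast+
  also have "... <= ?K x" unfolding K
   by (rule emeasure_mono)
    (auto intro!: measurable_sets_borel[OF borel_measurable_continuous_onI[OF c(1)]])
  finally show "0 < ?K x" .
  show "?K x < \<infinity>" unfolding K im
   by (rule emeasure_haar_compact, rule compact_continuous_image[OF continuous_on_subset[OF c(2)]]) auto
 qed
 define J where "J = (\<integral>\<^sup>+y. f (- y) / ?K (- y) \<partial>\<nu>)"
 have "(\<integral>\<^sup>+x. f x \<partial>M) = (\<integral>\<^sup>+x. f x / ?K x * ?K x \<partial>M)"
  using Kpos Kfin by (intro nn_integral_cong) (simp add: ennreal_divide_times ennreal_mult_divide_eq less_top[symmetric] zero_less_iff_neq_zero)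
 also have "... = (\<integral>\<^sup>+x. \<integral>\<^sup>+y. f x / ?K x * indicator unit_ball (y \<odot> x) \<partial>\<nu> \<partial>M)"
  by (intro nn_integral_cong, subst nn_integral_cmult) (auto simp: right_ball_vol_def)
 also have "... = (\<integral>\<^sup>+y. \<integral>\<^sup>+x. f x / ?K x * indicator unit_ball (y \<odot> x) \<partial>M \<partial>\<nu>)"
  by (rule P.Fubini'[symmetric]) measurable
 also have "... = (\<integral>\<^sup>+y. \<integral>\<^sup>+x. f ((- y) \<odot> x) / ?K ((- y) \<odot> x) * indicator unit_ball x \<partial>M \<partial>\<nu>)"
 proof (rule nn_integral_cong)
  fix y
  show "(\<integral>\<^sup>+x. f x / ?K x * indicator unit_ball (y \<odot> x) \<partial>M) =
   (\<integral>\<^sup>+x. f ((- y) \<odot> x) / ?K ((- y) \<odot> x) * indicator unit_ball x \<partial>M)"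
   using left_invariant_nn_integral[OF M, of "%x. f x / ?K x * indicator unit_ball (y \<odot> x)" "- y"]
   by simp
 qed
 also have "... = (\<integral>\<^sup>+x. \<integral>\<^sup>+y. f ((- y) \<odot> x) / ?K ((- y) \<odot> x) * indicator unit_ball x \<partial>\<nu> \<partial>M)"
  by (rule P.Fubini') measurable
 also have "... = (\<integral>\<^sup>+x. J * indicator unit_ball x \<partial>M)"
 proof (rule nn_integral_cong)
  fix x
  have "(\<integral>\<^sup>+y. f ((- y) \<odot> x) / ?K ((- y) \<odot> x) \<partial>\<nu>) = J"
   using left_invariant_nn_integral[OF left_invariant_haar, of "%y. f ((- y) \<odot> x) / ?K ((- y) \<odot> x)" x]
   by (simp add: J_def minus_mul mul_assoc)
  thus "(\<integral>\<^sup>+y. f ((- y) \<odot> x) / ?K ((- y) \<odot> x) * indicator unit_ball x \<partial>\<nu>) = J * indicator unit_ball x"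
   by (subst nn_integral_multc) auto
 qed
 also have "... = emeasure M unit_ball * J"
  using sM by (simp add: nn_integral_cmult_indicator mult.commute)
 finally show ?thesis by (simp add: J_def)
qed

lemma haar_unique:
 assumes M: "left_invariant M"
 obtains c where "c >= 0" "M = scale_measure (ennreal c) \<nu>"
  "emeasure M unit_ball = ennreal c * emeasure \<nu> unit_ball"
proof -
 have sM: "sets M = sets borel" and fin: "emeasure M unit_ball < \<infinity>"
  using M by (auto dest: left_invariantD(1) left_invariantD(2)[OF _ compact_cball])
 define c where "c = measure M unit_ball / measure \<nu> unit_ball"
 note N = unit_ball_measure
 have Mb: "emeasure M unit_ball = ennreal (measure M unit_ball)"
  using fin by (simp add: emeasure_eq_ennreal_measure)
 have c: "emeasure M unit_ball = ennreal c * emeasure \<nu> unit_ball"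
  using N by (simp add: Mb c_def ennreal_mult[symmetric])
 have eq: "emeasure M A = ennreal c * emeasure \<nu> A" if A: "A \<in> sets borel" for A
 proof -
  let ?J = "\<integral>\<^sup>+y. indicator A (- y) / right_ball_vol (- y) \<partial>\<nu>"
  have "emeasure M A = emeasure M unit_ball * ?J"
   using haar_unique_aux[OF M, of "indicator A"] A sM by simp
  also have "... = ennreal c * (emeasure \<nu> unit_ball * ?J)" by (simp add: c mult.assoc)
  also have "emeasure \<nu> unit_ball * ?J = emeasure \<nu> A"
   using haar_unique_aux[OF left_invariant_haar, of "indicator A"] A by simp
  finally show ?thesis .
 qed
 have "M = scale_measure (ennreal c) \<nu>"
  by (rule measure_eqI) (use sM eq in auto)
 thus ?thesis using c by (intro that[of c]) (auto simp: c_def)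
qed

lemma left_invariant_distr:
 assumes h: "cont h" "cont h'" "!!x. h (h' x) = x" "!!x. h' (h x) = x"
  and comm: "!!z. \<exists>z'. \<forall>x. z \<odot> h x = h (z' \<odot> x)"
 shows "left_invariant (distr \<nu> borel h)"
proof -
 have [measurable]: "h \<in> Borel" using h by (intro borel_measurable_continuous_onI)
 have im: "h -` A = h' ` A" for A
  using h(3,4) by (auto intro: image_eqI[where x = "h x" for x])
 have "radon_measure (distr \<nu> borel h)"
  unfolding radon_measure_def
 proof (intro conjI allI impI)
  fix K :: "'a set" assume K: "compact K"
  have "compact (h' ` K)" by (rule compact_continuous_image[OF continuous_on_subset[OF h(2)] K]) auto
  thus "emeasure (distr \<nu> borel h) K < \<infinity>"
   using emeasure_haar_compact[of "h' ` K"] K by (subst emeasure_distr) (auto simp: im compact_imp_closed)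
 qed simp
 moreover have "distr (distr \<nu> borel h) borel ((\<odot>) z) = distr \<nu> borel h" for z
 proof -
  obtain z' where z': "!!x. z \<odot> h x = h (z' \<odot> x)" using comm by blast
  have "distr (distr \<nu> borel h) borel ((\<odot>) z) = distr \<nu> borel (%x. h (z' \<odot> x))"
   by (subst distr_distr) (auto simp: comp_def z')
  also have "... = distr (distr \<nu> borel ((\<odot>) z')) borel h"
   by (subst distr_distr) (auto simp: comp_def)
  also have "distr \<nu> borel ((\<odot>) z') = \<nu>" using left_invariant_haar by (simp add: left_invariant_def)
  finally show ?thesis .
 qed
 ultimately show ?thesis by (simp add: left_invariant_def)
qed

lemma continuous_dil: "continuous_on A (dil r)"
 using linear_dil linear_conv_bounded_linear linear_continuous_on by blast

lemma continuous_on_dil [continuous_intros]: "continuous_on A f ==> continuous_on A (%x. dil r (f x))"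
 using continuous_on_compose2[OF continuous_dil[of UNIV]] by blast

lemma distr_factor:
 assumes "left_invariant (distr \<nu> borel h)" "cont h" "cont h'" "!!x. h (h' x) = x" "!!x. h' (h x) = x"
 obtains c where "c > 0" "distr \<nu> borel h = scale_measure (ennreal c) \<nu>"
proof -
 obtain c where c: "c >= 0" "distr \<nu> borel h = scale_measure (ennreal c) \<nu>"
  "emeasure (distr \<nu> borel h) unit_ball = ennreal c * emeasure \<nu> unit_ball"
  using haar_unique[OF assms(1)] by blast
 have "h \<in> Borel" using assms by (intro borel_measurable_continuous_onI)
 hence "emeasure (distr \<nu> borel h) unit_ball >= emeasure \<nu> (h -` ball 0 1)"
  by (subst emeasure_distr) (auto intro!: emeasure_mono measurable_sets_borel)
 moreover have "emeasure \<nu> (h -` ball 0 1) > 0"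
 proof (intro haar_open_pos open_vimage)
  have "h' 0 \<in> h -` ball 0 1" using assms by simp
  thus "h -` ball 0 1 ~= {}" by blast
 qed (use assms in auto)
 ultimately have "emeasure (distr \<nu> borel h) unit_ball > 0" by order
 hence "c > 0" using c by (cases "c = 0") auto
 with c show ?thesis using that by blast
qed

lemma dil_factor:
 assumes "r > 0"
 obtains c where "c > 0" "distr \<nu> borel (dil r) = scale_measure (ennreal c) \<nu>"
proof (rule distr_factor[of "dil r" "dil (1 / r)"])
 show "left_invariant (distr \<nu> borel (dil r))"
 proof (rule left_invariant_distr[of "dil r" "dil (1 / r)"])
  show "\<exists>z'. \<forall>x. z \<odot> dil r x = dil r (z' \<odot> x)" for z
   by (rule exI[of _ "dil (1 / r) z"]) (use assms in \<open>simp add: dil_mul\<close>)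
 qed (use assms in \<open>auto intro: continuous_dil\<close>)
qed (use assms in \<open>auto intro: continuous_dil\<close>)

section \<open>Unimodularity and the behaviour of volume under dilations\<close>

definition modular :: "'a => real" where
 "modular z = (SOME c. c > 0 \<and> distr \<nu> borel (%x. x \<odot> z) = scale_measure (ennreal c) \<nu>)"

lemma modular: "modular z > 0" "distr \<nu> borel (%x. x \<odot> z) = scale_measure (ennreal (modular z)) \<nu>"
proof -
 have "\<exists>c>0. distr \<nu> borel (%x. x \<odot> z) = scale_measure (ennreal c) \<nu>"
 proof (rule distr_factor[of "%x. x \<odot> z" "%x. x \<odot> (- z)"])
  show "left_invariant (distr \<nu> borel (%x. x \<odot> z))"
   by (rule left_invariant_distr[of "%x. x \<odot> z" "%x. x \<odot> (- z)"])
    (auto intro!: continuous_intros simp: mul_assoc intro: exI)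
 qed (auto intro!: continuous_intros)
 from someI_ex[OF this] show "modular z > 0" "distr \<nu> borel (%x. x \<odot> z) = scale_measure (ennreal (modular z)) \<nu>"
  by (auto simp: modular_def)
qed

lemma scale_haar_inj: "c >= 0 ==> d >= 0 ==> scale_measure (ennreal c) \<nu> = scale_measure (ennreal d) \<nu> ==> c = d"
proof -
 assume cd: "c >= 0" "d >= 0" "scale_measure (ennreal c) \<nu> = scale_measure (ennreal d) \<nu>"
 have "ennreal c * emeasure \<nu> unit_ball = ennreal d * emeasure \<nu> unit_ball"
  using arg_cong[OF cd(3), of "%M. emeasure M unit_ball"] by simp
 thus "c = d" using unit_ball_measure cd
  by (simp add: ennreal_mult[symmetric])
qed

lemma distr_scale: "h \<in> Borel ==>
  distr (scale_measure c \<nu>) borel h = scale_measure c (distr \<nu> borel h)"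
 by (rule measure_eqI) (auto simp: emeasure_distr measurable_cong_sets[OF sets_scale_measure refl] space_scale_measure)

lemma modular_mul: "modular (z \<odot> w) = modular z * modular w"
proof (rule scale_haar_inj)
 have "distr \<nu> borel (%x. x \<odot> (z \<odot> w)) = distr (distr \<nu> borel (%x. x \<odot> z)) borel (%x. x \<odot> w)"
  by (subst distr_distr) (auto simp: comp_def mul_assoc)
 also have "... = scale_measure (ennreal (modular z)) (distr \<nu> borel (%x. x \<odot> w))"
  by (subst modular(2), subst distr_scale) auto
 finally show "scale_measure (ennreal (modular (z \<odot> w))) \<nu> = scale_measure (ennreal (modular z * modular w)) \<nu>"
  using modular(1) by (simp add: modular(2) ennreal_mult less_imp_le)
qed (use modular(1) in \<open>auto intro: less_imp_le\<close>)

text \<open>Dilations are automorphisms, so conjugating the right translation by \<open>z\<close>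
  with \<open>dil r\<close> gives the one by \<open>dil r z\<close>; the factor by which
  \<open>dil r\<close> scales the measure cancels.\<close>

lemma modular_dil:
 assumes r: "r > 0"
 shows "modular (dil r z) = modular z"
proof -
 obtain c where c: "c > 0" "distr \<nu> borel (dil r) = scale_measure (ennreal c) \<nu>"
  using dil_factor[OF r] by blast
 have "distr (distr \<nu> borel (%x. x \<odot> z)) borel (dil r) = distr (distr \<nu> borel (dil r)) borel (%x. x \<odot> dil r z)"
  by (subst (1 2) distr_distr) (auto simp: comp_def dil_mul)
 moreover have "distr (distr \<nu> borel (%x. x \<odot> z)) borel (dil r) = scale_measure (ennreal (modular z * c)) \<nu>"
  using modular(1)[of z] c by (subst modular(2), subst distr_scale) (auto simp: c ennreal_mult less_imp_le)
 moreover have "distr (distr \<nu> borel (dil r)) borel (%x. x \<odot> dil r z) = scale_measure (ennreal (c * modular (dil r z))) \<nu>"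
  using modular c by (subst c(2), subst distr_scale) (auto simp: modular(2) ennreal_mult less_imp_le)
 ultimately have "modular z * c = c * modular (dil r z)"
  using modular(1) c by (intro scale_haar_inj) (auto intro: less_imp_le)
 thus ?thesis using c by simp
qed

lemma dil_small:
 assumes "e > 0"
 shows "\<exists>r>0. norm (dil r x) <= e"
proof -
 have "((%r. dil r x) \<longlongrightarrow> dil 0 x) (at_right 0)"
  unfolding dilation_def by (intro tendsto_intros)
 moreover have "dil 0 x = 0"
  by (rule comp_eqI) (auto simp: comp_dil power_0_left)
 ultimately have "\<forall>\<^sub>F r in at_right 0. dist (dil r x) 0 < e"
  using assms by (auto dest: tendstoD)
 moreover have "\<forall>\<^sub>F r in at_right (0::real). r > 0"
  by (simp add: eventually_at_right_less)
 ultimately have "\<forall>\<^sub>F r in at_right (0::real). norm (dil r x) < e \<and> r > 0"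
  by eventually_elim simp
 from eventually_happens[OF this] show ?thesis by (auto intro: less_imp_le)
qed

text \<open>
 The modular function is bounded on the unit ball and invariant under dilations, hence bounded; as
 a homomorphism it is then trivial.
\<close>
lemma modular_eq_1: "modular z = 1"
proof -
 define K where "K = (%p. fst p \<odot> (- snd p)) ` (unit_ball \<times> unit_ball)"
 have K: "compact K"
  unfolding K_def by (intro compact_continuous_image continuous_intros compact_Times compact_cball)
 define m where "m = measure \<nu> K / measure \<nu> unit_ball"
 have N: "measure \<nu> unit_ball > 0"
  using unit_ball_pos by (auto simp: measure_def enn2real_positive_iff)
 have bound: "modular z <= m" for z
 proof -
  obtain r where r: "r > 0" "norm (dil r z) <= 1" using dil_small[of 1] by auto
  let ?z = "dil r z"
  have "ennreal (modular z) * emeasure \<nu> unit_ball = emeasure (distr \<nu> borel (%x. x \<odot> ?z)) unit_ball"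
   using modular_dil[OF r(1)] by (simp add: modular(2))
  also have "... = emeasure \<nu> ((%x. x \<odot> ?z) -` unit_ball)"
   by (subst emeasure_distr) auto
  also have "... <= emeasure \<nu> K"
  proof (rule emeasure_mono)
   show "(%x. x \<odot> ?z) -` unit_ball \<subseteq> K"
    unfolding K_def using r by (force intro: image_eqI[where x = "(x \<odot> ?z, ?z)" for x])
  qed (use K in \<open>simp add: compact_imp_closed\<close>)
  finally have "ennreal (modular z) * emeasure \<nu> unit_ball <= emeasure \<nu> K" .
  moreover have "emeasure \<nu> K = ennreal (measure \<nu> K)" "emeasure \<nu> unit_ball = ennreal (measure \<nu> unit_ball)"
   using emeasure_haar_compact K by (auto simp: emeasure_eq_ennreal_measure less_top[symmetric])
  ultimately have "modular z * measure \<nu> unit_ball <= measure \<nu> K"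
   using modular(1)[of z] by (simp add: ennreal_mult[symmetric] less_imp_le)
  thus ?thesis using N by (simp add: m_def field_simps)
 qed
 have le: "modular z <= 1" for z
 proof (rule ccontr)
  assume "\<not> modular z <= 1"
  then obtain n where n: "m < modular z ^ n" using real_arch_pow by force
  have "\<exists>w. modular w = modular z ^ n" for n
  proof (induction n)
   case 0
   have "modular 0 * modular 0 = modular 0" by (simp flip: modular_mul)
   thus ?case using modular(1)[of 0] by (intro exI[of _ 0]) simp
  next
   case (Suc n)
   thus ?case by (metis modular_mul power_Suc)
  qed
  thus False using n bound by (metis not_le)
 qed
 have "modular z * modular (- z) = modular 0" by (simp flip: modular_mul)
 moreover have "modular 0 * modular 0 = modular 0" by (simp flip: modular_mul)
 ultimately have "modular z * modular (- z) = 1" using modular(1)[of 0] by simp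
 moreover have "modular z * modular (- z) <= modular z * 1"
  using le[of "- z"] modular(1)[of z] by (intro mult_left_mono) auto
 ultimately show ?thesis using le[of z] by simp
qed

lemma distr_left: "distr \<nu> borel ((\<odot>) z) = \<nu>"
 using left_invariant_haar by (simp add: left_invariant_def)

lemma distr_right: "distr \<nu> borel (%x. x \<odot> z) = \<nu>"
 by (simp add: modular(2) modular_eq_1)

text \<open>Inversion turns right invariance into left invariance, so the image is a multiple of the
  measure. The factor is 1 because the Euclidean unit ball is symmetric.\<close>

lemma distr_minus: "distr \<nu> borel uminus = \<nu>"
proof -
 have "left_invariant (distr \<nu> borel uminus)"
  unfolding left_invariant_def
 proof (intro conjI allI)
  show "radon_measure (distr \<nu> borel uminus)"
   unfolding radon_measure_def
  proof (intro conjI allI impI)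
   fix K :: "'a set" assume K: "compact K"
   have "uminus -` K = uminus ` K" by force
   thus "emeasure (distr \<nu> borel uminus) K < \<infinity>"
    using emeasure_haar_compact[OF compact_negations[OF K]] K
    by (subst emeasure_distr) (auto simp: compact_imp_closed)
  qed simp
  fix z
  have "distr (distr \<nu> borel uminus) borel ((\<odot>) z) = distr (distr \<nu> borel (%x. x \<odot> (- z))) borel uminus"
   by (subst (1 2) distr_distr) (auto simp: comp_def minus_mul)
  thus "distr (distr \<nu> borel uminus) borel ((\<odot>) z) = distr \<nu> borel uminus"
   by (simp add: distr_right)
 qed
 then obtain c where c: "c >= 0" "distr \<nu> borel uminus = scale_measure (ennreal c) \<nu>"
  "emeasure (distr \<nu> borel uminus) unit_ball = ennreal c * emeasure \<nu> unit_ball"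
  by (rule haar_unique)
 have "uminus -` unit_ball = unit_ball" by (auto simp: dist_norm)
 hence "emeasure (distr \<nu> borel uminus) unit_ball = emeasure \<nu> unit_ball"
  by (subst emeasure_distr) auto
 hence "ennreal (measure \<nu> unit_ball) = ennreal c * ennreal (measure \<nu> unit_ball)"
  using c unit_ball_measure by simp
 hence "c = 1" using unit_ball_measure(2) c by (simp add: ennreal_mult[symmetric])
 thus ?thesis using c by simp
qed

text \<open>This is \<open>r ^ Q\<close> with the homogeneous dimension \<open>Q\<close>; it enters
  the proof through its multiplicativity.\<close>

definition vol :: "real => real" where
 "vol r = (SOME c. c > 0 \<and> distr \<nu> borel (dil (1 / r)) = scale_measure (ennreal c) \<nu>)"

lemma vol: "r > 0 ==> vol r > 0" "r > 0 ==> distr \<nu> borel (dil (1 / r)) = scale_measure (ennreal (vol r)) \<nu>"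
proof -
 assume "r > 0"
 hence "\<exists>c>0. distr \<nu> borel (dil (1 / r)) = scale_measure (ennreal c) \<nu>"
  using dil_factor[of "1 / r"] by auto
 from someI_ex[OF this] show "vol r > 0" "distr \<nu> borel (dil (1 / r)) = scale_measure (ennreal (vol r)) \<nu>"
  by (auto simp: vol_def)
qed

lemma vol_mult: "r > 0 ==> s > 0 ==> vol (r * s) = vol r * vol s"
proof (rule scale_haar_inj)
 assume rs: "r > 0" "s > 0"
 have "distr \<nu> borel (dil (1 / (r * s))) = distr (distr \<nu> borel (dil (1 / r))) borel (dil (1 / s))"
  by (subst distr_distr) (auto simp: comp_def mult.commute)
 also have "... = scale_measure (ennreal (vol r)) (distr \<nu> borel (dil (1 / s)))"
  using rs by (subst vol(2), simp, subst distr_scale) auto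
 finally show "scale_measure (ennreal (vol (r * s))) \<nu> = scale_measure (ennreal (vol r * vol s)) \<nu>"
  using vol rs by (simp add: vol(2) ennreal_mult less_imp_le)
 show "0 <= vol (r * s)" "0 <= vol r * vol s" using vol rs by (auto intro: less_imp_le)
qed

lemma integral_left:
 fixes f :: "'a => real"
 assumes "f \<in> Borel"
 shows "(\<integral>x. f (z \<odot> x)) = (\<integral>x. f x)"
  and integral_right: "(\<integral>x. f (x \<odot> z)) = (\<integral>x. f x)"
  and integral_minus: "(\<integral>x. f (- x)) = (\<integral>x. f x)"
 using assms integral_distr[of "(\<odot>) z" \<nu> borel f] integral_distr[of "%x. x \<odot> z" \<nu> borel f]
  integral_distr[of uminus \<nu> borel f] by (simp_all add: distr_left distr_right distr_minus)

lemma integral_dil: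
 fixes f :: "'a => real"
 assumes "r > 0" "f \<in> Borel"
 shows "(\<integral>x. f (dil (1 / r) x)) = vol r * (\<integral>x. f x)"
proof -
 have "(\<integral>x. f (dil (1 / r) x)) = (\<integral>x. f x \<partial>scale_measure (ennreal (vol r)) \<nu>)"
  using integral_distr[of "dil (1 / r)" \<nu> borel f] assms vol[of r] by simp
 also have "scale_measure (ennreal (vol r)) \<nu> = density \<nu> (%x. ennreal (vol r))"
  by (rule measure_eqI) (auto simp: emeasure_density nn_integral_cmult_indicator)
 also have "(\<integral>x. f x \<partial>...) = (\<integral>x. vol r *R f x)"
  using assms vol(1)[of r] by (intro integral_density) (auto intro: less_imp_le)
 finally show ?thesis by simp
qed

lemma emeasure_dil:
 assumes "r > 0" "A \<in> sets borel"
 shows "emeasure \<nu> (dil r ` A) = ennreal (vol r) * emeasure \<nu> A"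
proof -
 have "dil (1 / r) -` A = dil r ` A"
  using assms by (force intro: image_eqI[where x = "dil (1 / r) x" for x])
 hence "emeasure (distr \<nu> borel (dil (1 / r))) A = emeasure \<nu> (dil r ` A)"
  using assms by (subst emeasure_distr) auto
 thus ?thesis using assms by (simp add: vol)
qed

end

section \<open>Functions of class \<open>C\<^sup>k\<close> depending on a parameter\<close>

text \<open>Derivatives are taken in the first argument and are jointly continuous with the
  parameter, as differentiation under the integral requires. The recursion runs through the
  derivatives \<open>H' v\<close> in fixed directions, so that all functions stay
  real-valued.\<close>

primrec Ck :: "nat => ('e::euclidean_space => 'p::metric_space => real) => bool" where
 "Ck 0 H \<longleftrightarrow> cont (%z. H (fst z) (snd z))"
| "Ck (Suc k) H \<longleftrightarrow> cont (%z. H (fst z) (snd z)) \<and>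
  (\<exists>H'. (\<forall>x th. ((%x. H x th) has_derivative (%v. H' v x th)) (at x)) \<and> (\<forall>v. Ck k (H' v)))"

lemma Ck_continuous: "Ck k H ==> cont (%z. H (fst z) (snd z))"
 by (cases k) auto

declare Ck.simps(2) [simp del]

lemma Ck_SucE:
 assumes "Ck (Suc k) H"
 obtains H' where "!!x th. ((%x. H x th) has_derivative (%v. H' v x th)) (at x)" "!!v. Ck k (H' v)"
 using assms by (auto simp: Ck.simps(2))

lemma Ck_SucI:
 assumes "!!x th. ((%x. H x th) has_derivative (%v. H' v x th)) (at x)" "!!v. Ck k (H' v)"
  "cont (%z. H (fst z) (snd z))"
 shows "Ck (Suc k) H"
 using assms by (auto simp: Ck.simps(2))

lemma Ck_Suc_imp: "Ck (Suc k) H ==> Ck k H"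
proof (induction k arbitrary: H)
 case 0
 thus ?case by (simp add: Ck_continuous)
next
 case (Suc k)
 from Suc.prems obtain H' where "!!x th. ((%x. H x th) has_derivative (%v. H' v x th)) (at x)"
  "!!v. Ck (Suc k) (H' v)"
  by (rule Ck_SucE) (rule that)
 thus ?case using Suc.IH Ck_continuous[OF Suc.prems] by (intro Ck_SucI[of H H']) blast+
qed

lemma Ck_mono: "Ck k H ==> j <= k ==> Ck j H"
proof (induction k)
 case (Suc k)
 thus ?case using Ck_Suc_imp by (cases "j = Suc k") auto
qed simp

lemma Ck_param:
 fixes c :: "'p::metric_space => real"
 shows "cont c ==> Ck k (%(x::'e::euclidean_space) th. c th)"
proof (induction k arbitrary: c)
 case 0
 thus ?case by (auto intro!: continuous_on_compose2[of UNIV c UNIV snd] continuous_intros)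
next
 case (Suc k)
 have "Ck k (%(x::'e) (th::'p). 0)" by (rule Suc.IH) (rule continuous_on_const)
 thus ?case
  using Suc.prems
  by (intro Ck_SucI[where H' = "%v x th. 0"])
   (auto intro!: continuous_on_compose2[of UNIV c UNIV snd] continuous_intros)
qed

lemma Ck_const [simp]: "Ck k (%x th. c)"
 by (rule Ck_param) (rule continuous_on_const)

lemma Ck_linear: "linear f ==> Ck k (%x th. f x)"
proof -
 assume f: "linear f"
 hence bl: "bounded_linear f" by (simp add: linear_conv_bounded_linear)
 have c: "cont (%z::'a \<times> 'b. f (fst z))"
  by (intro bounded_linear.continuous_on[OF bl] continuous_intros)
 show ?thesis
 proof (cases k)
  case (Suc j)
  show ?thesis unfolding Suc
   by (rule Ck_SucI[where H' = "%v x th. f v"]) (use c bl in \<open>auto intro: bounded_linear_imp_has_derivative\<close>)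
 qed (use c in simp)
qed

lemma Ck_add: "Ck k H ==> Ck k K ==> Ck k (%x th. H x th + K x th)"
proof (induction k arbitrary: H K)
 case (Suc k)
 obtain H' where H: "!!x th. ((%x. H x th) has_derivative (%v. H' v x th)) (at x)" "!!v. Ck k (H' v)"
  using Suc.prems(1) by (rule Ck_SucE) (rule that)
 obtain K' where K: "!!x th. ((%x. K x th) has_derivative (%v. K' v x th)) (at x)" "!!v. Ck k (K' v)"
  using Suc.prems(2) by (rule Ck_SucE) (rule that)
 show ?case
  by (rule Ck_SucI[where H' = "%v x th. H' v x th + K' v x th"])
   (use H K Suc Ck_continuous in \<open>auto intro!: derivative_intros continuous_intros\<close>)
qed (auto intro!: continuous_intros)

lemma Ck_mult: "Ck k H ==> Ck k K ==> Ck k (%x th. H x th * K x th)"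
proof (induction k arbitrary: H K)
 case (Suc k)
 obtain H' where H: "!!x th. ((%x. H x th) has_derivative (%v. H' v x th)) (at x)" "!!v. Ck k (H' v)"
  using Suc.prems(1) by (rule Ck_SucE) (rule that)
 obtain K' where K: "!!x th. ((%x. K x th) has_derivative (%v. K' v x th)) (at x)" "!!v. Ck k (K' v)"
  using Suc.prems(2) by (rule Ck_SucE) (rule that)
 show ?case
  by (rule Ck_SucI[where H' = "%v x th. H x th * K' v x th + H' v x th * K x th"])
   (use H K Suc Ck_continuous Ck_Suc_imp[OF Suc.prems(1)] Ck_Suc_imp[OF Suc.prems(2)] in
    \<open>auto intro!: derivative_intros continuous_intros Ck_add\<close>)
qed (auto intro!: continuous_intros)

lemma Ck_cmult: "Ck k H ==> Ck k (%x th. c * H x th)"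
 by (rule Ck_mult) auto

lemma Ck_minus: "Ck k H ==> Ck k (%x th. - H x th)"
 using Ck_cmult[of k H "-1"] by simp

lemma Ck_diff: "Ck k H ==> Ck k K ==> Ck k (%x th. H x th - K x th)"
 using Ck_add[OF _ Ck_minus, of k H K] by simp

lemma Ck_sum: "(!!i. i \<in> I ==> Ck k (H i)) ==> Ck k (%x th. \<Sum>i\<in>I. H i x th)"
 by (induction I rule: infinite_finite_induct) (auto intro: Ck_add)

lemma has_real_derivative_pos_power:
 assumes "n >= 1"
 shows "((%t::real. max 0 t ^ Suc n) has_real_derivative real (Suc n) * max 0 t ^ n) (at t)"
proof (cases t "0::real" rule: linorder_cases)
 case less
 have "((%t. 0) has_real_derivative 0) (at t)" by simp
 hence "((%t::real. max 0 t ^ Suc n) has_real_derivative 0) (at t)"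
  by (rule has_field_derivative_transform_within_open[of _ _ _ "{..<0}"]) (use less in auto)
 thus ?thesis using less assms by (simp add: max_absorb1 power_0_left del: power_Suc)
next
 case greater
 have "((%t. t ^ Suc n) has_real_derivative real (Suc n) * t ^ n) (at t)"
  by (auto intro!: derivative_eq_intros simp del: power_Suc)
 hence "((%t::real. max 0 t ^ Suc n) has_real_derivative real (Suc n) * t ^ n) (at t)"
  by (rule has_field_derivative_transform_within_open[of _ _ _ "{0<..}"]) (use greater in auto)
 thus ?thesis using greater by (simp add: max_absorb2 del: power_Suc)
next
 case equal
 have "((%h. max 0 h ^ n) \<longlongrightarrow> 0) (at (0::real))"
  using assms by (auto intro!: tendsto_eq_intros simp: power_0_left)
 hence "((%h. (if h > 0 then 1 else 0) * max 0 h ^ n) \<longlongrightarrow> 0) (at (0::real))"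
  by (rule Lim_null_comparison[rotated]) (auto simp: eventually_at_filter max_def)
 moreover have "((if h > 0 then 1 else 0) * max 0 h ^ n) = (max 0 h ^ Suc n - max 0 0 ^ Suc n) / h" for h :: real
  by (auto simp: max_def)
 ultimately show ?thesis using equal assms
  by (simp add: DERIV_def power_0_left)
qed

text \<open>Powers of the positive part provide all bumps and cut-off functions used below.\<close>

lemma Ck_pos_power: "Ck k H ==> Ck k (%x th. max 0 (H x th) ^ Suc (k + n))"
proof (induction k arbitrary: H n)
 case 0
 thus ?case by (auto intro!: continuous_intros)
next
 case (Suc k)
 obtain H' where H: "!!x th. ((%x. H x th) has_derivative (%v. H' v x th)) (at x)" "!!v. Ck k (H' v)"
  using Suc.prems(1) by (rule Ck_SucE) (rule that)
 show ?case
 proof (rule Ck_SucI[where H' = "%v x th. (real (Suc (Suc (k + n))) * max 0 (H x th) ^ Suc (k + n)) * H' v x th"])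
  show "((%x. max 0 (H x th) ^ Suc (Suc k + n)) has_derivative
    (%v. (real (Suc (Suc (k + n))) * max 0 (H x th) ^ Suc (k + n)) * H' v x th)) (at x)" for x th
   using has_derivative_compose[OF H(1)[of th x]
     has_real_derivative_pos_power[of "Suc (k + n)" "H x th", unfolded has_field_derivative_def]]
   by (simp del: power_Suc of_nat_Suc)
  show "Ck k (%x th. (real (Suc (Suc (k + n))) * max 0 (H x th) ^ Suc (k + n)) * H' v x th)" for v
   using Suc.IH[OF Ck_Suc_imp[OF Suc.prems]] H by (intro Ck_mult Ck_cmult) (simp_all del: power_Suc)
 qed (use Ck_continuous[OF Suc.prems] in \<open>auto intro!: continuous_intros\<close>)
qed

definition CkV :: "nat => ('e::euclidean_space => 'p::metric_space => 'f::euclidean_space) => bool" where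
 "CkV k P \<longleftrightarrow> (\<forall>b\<in>Basis. Ck k (%x th. P x th \<bullet> b))"

lemma CkV_Suc_imp: "CkV (Suc k) P ==> CkV k P"
 by (simp add: CkV_def Ck_Suc_imp del: Ck.simps)

lemma CkV_continuous: "CkV k P ==> cont (%z. P (fst z) (snd z))"
 unfolding CkV_def by (subst continuous_on_componentwise) (auto dest: Ck_continuous)

lemma CkV_id: "CkV k (%x th. x)"
 unfolding CkV_def by (auto intro!: Ck_linear linearI simp: inner_add_left)

lemma CkV_param: "cont c ==> CkV k (%x th. c th)"
 unfolding CkV_def by (auto intro!: Ck_param continuous_intros)

lemma CkV_linear:
 assumes "linear L" "CkV k P"
 shows "CkV k (%x th. L (P x th))"
 unfolding CkV_def
proof
 fix b :: 'b assume "b \<in> Basis"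
 have L: "L y \<bullet> b = (\<Sum>i\<in>Basis. (L i \<bullet> b) * (y \<bullet> i))" for y
 proof -
  have "L (\<Sum>i\<in>Basis. (y \<bullet> i) *R i) \<bullet> b = (\<Sum>i\<in>Basis. (L i \<bullet> b) * (y \<bullet> i))"
   by (simp add: linear_sum[OF assms(1)] linear_scale[OF assms(1)] inner_sum_left mult.commute)
  thus ?thesis by (simp add: euclidean_representation)
 qed
 have eq: "(%x th. L (P x th) \<bullet> b) = (%x th. \<Sum>i\<in>Basis. (L i \<bullet> b) * (P x th \<bullet> i))"
  by (intro ext L)
 show "Ck k (%x th. L (P x th) \<bullet> b)"
  unfolding eq using assms(2) by (intro Ck_sum Ck_cmult) (auto simp: CkV_def)
qed

lemma CkV_sum: "(!!i. i \<in> I ==> CkV k (P i)) ==> CkV k (%x th. \<Sum>i\<in>I. P i x th)"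
 unfolding CkV_def by (auto simp: inner_sum_left intro: Ck_sum)

lemma CkV_scaleR: "Ck k c ==> CkV k P ==> CkV k (%x th. c x th *R P x th)"
 unfolding CkV_def by (auto intro: Ck_mult)

lemma CkV_bilinear:
 assumes "bilinear B" "CkV k P" "CkV k Q"
 shows "CkV k (%x th. B (P x th) (Q x th))"
proof -
 have B: "B y z = (\<Sum>i\<in>Basis. \<Sum>j\<in>Basis. ((y \<bullet> i) * (z \<bullet> j)) *R B i j)" for y z
 proof -
  have "B y z = B (\<Sum>i\<in>Basis. (y \<bullet> i) *R i) (\<Sum>j\<in>Basis. (z \<bullet> j) *R j)"
   by (simp add: euclidean_representation)
  also have "... = (\<Sum>i\<in>Basis. \<Sum>j\<in>Basis. ((y \<bullet> i) * (z \<bullet> j)) *R B i j)"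
   unfolding bilinear_sum[OF assms(1)] sum.cartesian_product
   by (rule sum.cong) (auto simp: bilinear_lmul[OF assms(1)] bilinear_rmul[OF assms(1)])
  finally show ?thesis .
 qed
 have eq: "(%x th. B (P x th) (Q x th)) =
   (%x th. \<Sum>i\<in>Basis. \<Sum>j\<in>Basis. ((P x th \<bullet> i) * (Q x th \<bullet> j)) *R B i j)"
  by (intro ext B)
 show ?thesis
  unfolding eq using assms(2,3)
  by (intro CkV_sum CkV_scaleR Ck_mult CkV_param continuous_on_const) (auto simp: CkV_def)
qed

lemma continuous_on_snd_compose: "cont Q ==> cont (%z. Q (snd z))"
 by (rule continuous_on_compose2[of UNIV Q UNIV snd]) (auto intro: continuous_intros)

lemma Ck_has_derivative_sum:
 assumes H: "((%x. H x) has_derivative (%v. H' v)) (at x)"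
 shows "H' v = (\<Sum>b\<in>Basis. (v \<bullet> b) * H' b)"
proof -
 have "linear H'" using has_derivative_linear[OF H] by simp
 hence "H' (\<Sum>b\<in>Basis. (v \<bullet> b) *R b) = (\<Sum>b\<in>Basis. (v \<bullet> b) * H' b)"
  by (simp add: linear_sum linear_scale)
 thus ?thesis by (simp add: euclidean_representation)
qed

lemma Ck_compose:
 "Ck k \<beta> ==> CkV k P ==> cont Q ==> Ck k (%x th. \<beta> (P x th) (Q th))"
proof (induction k arbitrary: \<beta>)
 case 0
 have "cont (%z. (P (fst z) (snd z), Q (snd z)))"
  using CkV_continuous[OF 0(2)] 0(3)
  by (intro continuous_intros continuous_on_snd_compose)
 from continuous_on_compose2[OF Ck_continuous[OF 0(1)] this] show ?case by simp
next
 case (Suc k)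
 obtain \<beta>' where \<beta>: "!!x th. ((%x. \<beta> x th) has_derivative (%v. \<beta>' v x th)) (at x)" "!!v. Ck k (\<beta>' v)"
  using Suc.prems(1) by (rule Ck_SucE) (rule that)
 have "\<forall>b\<in>Basis. \<exists>P'. (\<forall>x th. ((%x. P x th \<bullet> b) has_derivative (%v. P' v x th)) (at x)) \<and> (\<forall>v. Ck k (P' v))"
  using Suc.prems(2) unfolding CkV_def by (simp add: Ck.simps(2))
 then obtain P' where P': "!!b x th. b \<in> Basis ==> ((%x. P x th \<bullet> b) has_derivative (%v. P' b v x th)) (at x)"
  "!!b v. b \<in> Basis ==> Ck k (P' b v)"
  by metis
 have Pd: "((%x. P x th) has_derivative (%v. \<Sum>b\<in>Basis. P' b v x th *R b)) (at x)" for x th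
  by (subst has_derivative_componentwise_within) (use P' in \<open>auto simp: inner_sum_left inner_Basis if_distrib cong: if_cong\<close>)
 show ?case
 proof (rule Ck_SucI[where H' = "%v x th. \<Sum>b\<in>Basis. P' b v x th * \<beta>' b (P x th) (Q th)"])
  show "((%x. \<beta> (P x th) (Q th)) has_derivative (%v. \<Sum>b\<in>Basis. P' b v x th * \<beta>' b (P x th) (Q th))) (at x)" for x th
  proof -
   have "((%x. \<beta> (P x th) (Q th)) has_derivative (%v. \<beta>' (\<Sum>b\<in>Basis. P' b v x th *R b) (P x th) (Q th))) (at x)"
    by (rule has_derivative_compose[OF Pd \<beta>(1)])
   moreover have "\<beta>' (\<Sum>b\<in>Basis. P' b v x th *R b) (P x th) (Q th) = (\<Sum>b\<in>Basis. P' b v x th * \<beta>' b (P x th) (Q th))" for v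
   proof -
    have lin: "linear (%v. \<beta>' v (P x th) (Q th))" using has_derivative_linear[OF \<beta>(1)] .
    show ?thesis by (simp add: linear_sum[OF lin] linear_scale[OF lin])
   qed
   ultimately show ?thesis by simp
  qed
  show "Ck k (%x th. \<Sum>b\<in>Basis. P' b v x th * \<beta>' b (P x th) (Q th))" for v
   using P' Suc.IH[OF \<beta>(2) CkV_Suc_imp[OF Suc.prems(2)] Suc.prems(3)] by (intro Ck_sum Ck_mult) auto
  have "cont (%z. (P (fst z) (snd z), Q (snd z)))"
   using CkV_continuous[OF Suc.prems(2)] Suc.prems(3)
   by (intro continuous_intros continuous_on_snd_compose)
  from continuous_on_compose2[OF Ck_continuous[OF Suc.prems(1)] this]
  show "cont (%z. \<beta> (P (fst z) (snd z)) (Q (snd z)))" by simp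
 qed
qed

lemma uniform_in_parameter:
 fixes H :: "'e::euclidean_space => 'p::metric_space => real"
 assumes "cont (%z. H (fst z) (snd z))" "compact K" "e > 0"
 obtains d where "d > 0" "!!x th. dist x x0 < d ==> th \<in> K ==> \<bar>H x th - H x0 th\<bar> < e"
proof -
 have "uniformly_continuous_on (cball x0 1 \<times> K) (%z. H (fst z) (snd z))"
  using assms by (intro compact_uniformly_continuous compact_Times continuous_on_subset[OF assms(1)]) auto
 then obtain d where d: "d > 0" "!!z z'. z \<in> cball x0 1 \<times> K ==> z' \<in> cball x0 1 \<times> K ==> dist z' z < d ==>
   dist (H (fst z') (snd z')) (H (fst z) (snd z)) < e"
  using assms(3) unfolding uniformly_continuous_on_def by metis
 show ?thesis
 proof (rule that[of "min d 1"])
  fix x th assume "dist x x0 < min d 1" "th \<in> K"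
  thus "\<bar>H x th - H x0 th\<bar> < e"
   using d(2)[of "(x0, th)" "(x, th)"] by (auto simp: dist_Pair_Pair dist_commute dist_real_def)
 qed (use d in auto)
qed

lemma integrable_weight:
 fixes H :: "'e::euclidean_space => 'p::metric_space => real"
 assumes g: "integrable m g" "!!th. th \<notin> K ==> g th = (0::real)" and K: "compact K"
  and H: "cont (%z. H (fst z) (snd z))" and m: "sets m = sets borel"
 shows "integrable m (%th. g th * H x th)"
proof -
 have c: "cont (H x)"
  using continuous_on_compose2[OF H, of UNIV "%th. (x, th)"] by (simp add: continuous_intros)
 then obtain B where B: "!!th. th \<in> K ==> \<bar>H x th\<bar> <= B"
  using compact_imp_bounded[OF compact_continuous_image[OF continuous_on_subset[OF c] K]]
  by (auto simp: bounded_iff)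
 have [measurable]: "H x \<in> borel_measurable m"
  using borel_measurable_continuous_onI[OF c] by (simp add: measurable_cong_sets[OF m refl])
 show ?thesis
 proof (rule Bochner_Integration.integrable_bound[where f = "%th. \<bar>B\<bar> * g th"])
  show "AE th in m. norm (g th * H x th) <= norm (\<bar>B\<bar> * g th)"
  proof (rule AE_I2)
   fix th
   show "norm (g th * H x th) <= norm (\<bar>B\<bar> * g th)"
   proof (cases "th \<in> K")
    case True
    hence "\<bar>H x th\<bar> <= \<bar>B\<bar>" using B by force
    hence "\<bar>g th\<bar> * \<bar>H x th\<bar> <= \<bar>g th\<bar> * \<bar>B\<bar>" by (rule mult_left_mono) simp
    thus ?thesis by (simp add: abs_mult mult.commute)
   qed (simp add: g)
  qed
 qed (use g in auto)
qed

lemma norm_lebesgue_integral_le: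
 fixes f g :: "'c => real"
 assumes "integrable M f" "integrable M g" "!!x. norm (f x) <= g x"
 shows "norm (\<integral>x. f x \<partial>M) <= (\<integral>x. g x \<partial>M)"
 using order_trans[OF integral_norm_bound Bochner_Integration.integral_mono[of M "%x. norm (f x)" g]] assms
 by simp

text \<open>The weight vanishes off a compact set, on which the derivatives are continuous in
  \<open>x\<close> uniformly in the parameter. The linearization error of the integrand is thus
  bounded by \<open>e' * norm (y - x0)\<close> for all relevant parameters at once.\<close>

lemma has_derivative_weighted_integral:
 fixes H :: "'e::euclidean_space => 'p::metric_space => real"
 assumes g: "integrable m g" "!!th. th \<notin> K ==> g th = (0::real)" and K: "compact K" and m: "sets m = sets borel"
  and H: "!!x th. ((%x. H x th) has_derivative (%v. H' v x th)) (at x)"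
  and cH: "cont (%z. H (fst z) (snd z))" "!!v. cont (%z. H' v (fst z) (snd z))"
 shows "((%x. \<integral>th. g th * H x th \<partial>m) has_derivative (%v. \<integral>th. g th * H' v x0 th \<partial>m)) (at x0)"
proof -
 let ?I = "%x. \<integral>th. g th * H x th \<partial>m" and ?I' = "%v. \<integral>th. g th * H' v x0 th \<partial>m"
 let ?N = "\<integral>th. \<bar>g th\<bar> \<partial>m"
 let ?D = "real DIM('e)"
 have N: "?N >= 0" by simp
 hence N1: "?N + 1 > 0" by linarith
 note int = integrable_weight[OF g K cH(1) m] integrable_weight[OF g K cH(2) m]
 have lin: "linear (%v. H' v x th)" for x th
  using has_derivative_linear[OF H] .
 show ?thesis
  unfolding has_derivative_within_alt
 proof (intro conjI allI impI)
  show "bounded_linear ?I'"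
   unfolding linear_conv_bounded_linear[symmetric]
  proof (rule linearI)
   show "?I' (v + w) = ?I' v + ?I' w" for v w
    by (simp add: linear_add[OF lin] distrib_left int)
   show "?I' (c *R v) = c *R ?I' v" for c v
    by (simp add: linear_scale[OF lin] mult.left_commute)
  qed
  fix e :: real assume e: "e > 0"
  define e' where "e' = e / (?N + 1)"
  have e': "e' > 0" unfolding e'_def by (rule divide_pos_pos[OF e N1])
  have "\<exists>d>0. \<forall>x th. dist x x0 < d --> th \<in> K --> \<bar>H' b x th - H' b x0 th\<bar> < e' / ?D" for b
   using uniform_in_parameter[OF cH(2) K, of "e' / ?D" x0 b] e' by (metis DIM_positive divide_pos_pos of_nat_0_less_iff)
  then obtain d where d: "!!b. d b > 0" "!!b x th. dist x x0 < d b ==> th \<in> K ==> \<bar>H' b x th - H' b x0 th\<bar> < e' / ?D"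
   by metis
  define dd where "dd = Min (d ` (Basis :: 'e set))"
  have dd: "dd > 0" "!!b. b \<in> Basis ==> dd <= d b"
   using d(1) by (auto simp: dd_def)
  have main: "\<bar>H y th - H x0 th - H' (y - x0) x0 th\<bar> <= e' * norm (y - x0)" if y: "dist y x0 < dd" and th: "th \<in> K" for y th
  proof -
   have "norm (H y th - H x0 th - H' (y - x0) x0 th) <= norm (y - x0) * e'"
   proof (rule differentiable_bound_linearization[where S = "ball x0 dd" and f' = "%x v. H' v x th"])
    show "x0 + t *R (y - x0) \<in> ball x0 dd" if "t \<in> {0..1}" for t
     using y that mult_left_le_one_le[of "norm (y - x0)" t] by (auto simp: dist_norm norm_minus_commute)
    show "((%x. H x th) has_derivative (%v. H' v x th)) (at x within ball x0 dd)" for x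
     using H by (rule has_derivative_at_withinI)
    show "onorm ((%v. H' v x th) - (%v. H' v x0 th)) <= e'" if x: "x \<in> ball x0 dd" for x
     unfolding fun_diff_def
    proof (rule onorm_le)
     fix v
     have "linear (%v. H' v x th - H' v x0 th)" by (intro linear_compose_sub lin)
     hence "(%v. H' v x th - H' v x0 th) (\<Sum>b\<in>Basis. (v \<bullet> b) *R b) = (\<Sum>b\<in>Basis. (v \<bullet> b) *R (H' b x th - H' b x0 th))"
      by (subst linear_sum) (auto simp: linear_scale[OF lin] right_diff_distrib)
     hence "norm (H' v x th - H' v x0 th) = norm (\<Sum>b\<in>Basis. (v \<bullet> b) * (H' b x th - H' b x0 th))"
      by (simp add: euclidean_representation)
     also have "... <= (\<Sum>b\<in>(Basis::'e set). norm v * (e' / ?D))"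
     proof (rule sum_norm_le)
      fix b :: 'e assume b: "b \<in> Basis"
      have "\<bar>H' b x th - H' b x0 th\<bar> <= e' / ?D"
       using d(2)[of x b th] x dd(2)[OF b] th by (auto simp: dist_commute)
      hence "\<bar>v \<bullet> b\<bar> * \<bar>H' b x th - H' b x0 th\<bar> <= norm v * (e' / ?D)"
       by (intro mult_mono Basis_le_norm[OF b]) auto
      thus "norm ((v \<bullet> b) * (H' b x th - H' b x0 th)) <= norm v * (e' / ?D)"
       by (simp only: real_norm_def abs_mult)
     qed
     also have "... = e' * norm v" by simp
     finally show "norm (H' v x th - H' v x0 th) <= e' * norm v" .
    qed
   qed (use dd in simp)
   thus ?thesis by (simp add: mult.commute)
  qed
  show "\<exists>d>0. \<forall>y\<in>UNIV. norm (y - x0) < d --> norm (?I y - ?I x0 - ?I' (y - x0)) <= e * norm (y - x0)"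
  proof (intro exI conjI ballI impI)
   fix y assume y: "norm (y - x0) < dd"
   have "?I y - ?I x0 - ?I' (y - x0) = (\<integral>th. g th * H y th - g th * H x0 th - g th * H' (y - x0) x0 th \<partial>m)"
    by (simp add: int)
   also have "norm ... <= (\<integral>th. \<bar>g th\<bar> * (e' * norm (y - x0)) \<partial>m)"
   proof (rule norm_lebesgue_integral_le)
    fix th
    have "norm (g th * H y th - g th * H x0 th - g th * H' (y - x0) x0 th) = \<bar>g th\<bar> * \<bar>H y th - H x0 th - H' (y - x0) x0 th\<bar>"
     by (simp add: abs_mult flip: right_diff_distrib)
    also have "... <= \<bar>g th\<bar> * (e' * norm (y - x0))"
     using main[of y th] y g(2)[of th]
     by (cases "th \<in> K") (auto simp: dist_norm intro!: mult_left_mono)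
    finally show "norm (g th * H y th - g th * H x0 th - g th * H' (y - x0) x0 th) <= \<bar>g th\<bar> * (e' * norm (y - x0))" .
   qed (use g int in auto)
   also have "... = ?N * e' * norm (y - x0)" by simp
   also have "... <= e * norm (y - x0)"
   proof (rule mult_right_mono)
    have "?N * e <= e * (?N + 1)" using e by (simp add: algebra_simps)
    thus "?N * e' <= e" unfolding e'_def using N1 by (simp add: pos_divide_le_eq)
   qed simp
   finally show "norm (?I y - ?I x0 - ?I' (y - x0)) <= e * norm (y - x0)" .
  qed (rule dd)
 qed
qed

lemma Ck_integral:
 fixes H :: "'e::euclidean_space => 'p::metric_space => real"
 assumes g: "integrable m g" "!!th. th \<notin> K ==> g th = (0::real)" and K: "compact K" and m: "sets m = sets borel"
 shows "Ck k H ==> Ck k (%x (q::'q::metric_space). \<integral>th. g th * H x th \<partial>m)"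
proof (induction k arbitrary: H)
 have cont: "cont (%z::'e \<times> 'q. \<integral>th. g th * H (fst z) th \<partial>m)"
  if H: "cont (%z. H (fst z) (snd z))" for H :: "'e => 'p => real"
 proof -
  let ?I = "%x. \<integral>th. g th * H x th \<partial>m"
  let ?N = "\<integral>th. \<bar>g th\<bar> \<partial>m"
  have N: "?N >= 0" by simp
  hence N1: "?N + 1 > 0" by linarith
  have "cont ?I"
   unfolding continuous_on_iff
  proof (intro ballI allI impI)
   fix x0 :: 'e and e :: real assume e: "e > 0"
   obtain d where d: "d > 0" "!!x th. dist x x0 < d ==> th \<in> K ==> \<bar>H x th - H x0 th\<bar> < e / (?N + 1)"
    using uniform_in_parameter[OF H K divide_pos_pos[OF e N1], of x0] by blast
   show "\<exists>d>0. \<forall>x\<in>UNIV. dist x x0 < d --> dist (?I x) (?I x0) < e"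
   proof (intro exI conjI ballI impI)
    fix x assume x: "dist x x0 < d"
    have "?I x - ?I x0 = (\<integral>th. g th * H x th - g th * H x0 th \<partial>m)"
     by (simp add: integrable_weight[OF g K H m])
    also have "norm ... <= (\<integral>th. \<bar>g th\<bar> * (e / (?N + 1)) \<partial>m)"
    proof (rule norm_lebesgue_integral_le)
     fix th
     have "norm (g th * H x th - g th * H x0 th) = \<bar>g th\<bar> * \<bar>H x th - H x0 th\<bar>"
      by (simp add: abs_mult flip: right_diff_distrib)
     also have "... <= \<bar>g th\<bar> * (e / (?N + 1))"
     proof (cases "th \<in> K")
      case True
      show ?thesis using d(2)[OF x True] by (intro mult_left_mono) auto
     next
      case False
      thus ?thesis using g(2) by simp
     qed
     finally show "norm (g th * H x th - g th * H x0 th) <= \<bar>g th\<bar> * (e / (?N + 1))" .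
    qed (use g in \<open>auto intro!: Bochner_Integration.integrable_diff integrable_weight[OF g K H m]\<close>)
    also have "... = ?N * (e / (?N + 1))" by simp
    also have "... < e"
    proof -
     have "?N * e < e * (?N + 1)" using e by (simp add: algebra_simps)
     thus ?thesis using N1 by (simp add: pos_divide_less_eq)
    qed
    finally show "dist (?I x) (?I x0) < e" by (simp add: dist_real_def)
   qed (rule d)
  qed
  thus ?thesis by (rule continuous_on_compose2[of UNIV ?I UNIV fst]) (auto intro: continuous_intros)
 qed
 {
  case 0
  thus ?case using cont by simp
 next
  case (Suc k)
  obtain H' where H: "!!x th. ((%x. H x th) has_derivative (%v. H' v x th)) (at x)" "!!v. Ck k (H' v)"
   using Suc.prems(1) by (rule Ck_SucE) (rule that)
  have cH: "cont (%z. H (fst z) (snd z))" "!!v. cont (%z. H' v (fst z) (snd z))"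
   using Ck_continuous[OF Suc.prems] Ck_continuous[OF H(2)] by auto
  show ?case
  proof (rule Ck_SucI[where H' = "%v x q. \<integral>th. g th * H' v x th \<partial>m"])
   fix x0 :: 'e and q :: 'q
   show "((%x. \<integral>th. g th * H x th \<partial>m) has_derivative (%v. \<integral>th. g th * H' v x0 th \<partial>m)) (at x0)"
    by (rule has_derivative_weighted_integral[OF g K m H(1) cH])
  qed (use Suc.IH[OF H(2)] cont[OF cH(1)] in auto)
 }
qed

section \<open>Left-invariant derivatives\<close>

text \<open>The real parameter is a dummy; it lets one definition serve functions and families of
  functions.\<close>

abbreviation sm :: "nat => ('e::euclidean_space => real) => bool" where
 "sm k f == Ck k (%x (q::real). f x)"

lemma sm_continuous: "sm k f ==> cont f"
 using continuous_on_compose2[OF Ck_continuous, of k "%x (q::real). f x" UNIV "%x. (x, 0)"]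
 by (simp add: continuous_intros)

lemma sm_derivative_ex:
 assumes "sm (Suc k) f"
 shows "\<exists>f'. (\<forall>x. (f has_derivative (%v. f' v x)) (at x)) \<and> (\<forall>v. sm k (f' v))"
proof -
 have "\<exists>H'. (\<forall>x (q::real). (f has_derivative (%v. H' v x q)) (at x)) \<and> (\<forall>v. Ck k (H' v))"
  using assms unfolding Ck.simps(2) by (rule conjunct2)
 then obtain H' where H': "\<forall>x (q::real). (f has_derivative (%v. H' v x q)) (at x)" "\<forall>v. Ck k (H' v)"
  by (elim exE conjE)
 have "sm k (%x. H' v x 0)" for v
  using Ck_compose[OF H'(2)[rule_format] CkV_id, of "%q::real. 0::real"] by simp
 thus ?thesis using H'(1) by (intro exI[of _ "%v x. H' v x 0"]) simp
qed

lemma sm_has_derivative: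
 assumes "sm (Suc k) f"
 obtains f' where "!!x. (f has_derivative (%v. f' v x)) (at x)" "!!v. sm k (f' v)"
proof -
 obtain f' where f': "\<forall>x. (f has_derivative (%v. f' v x)) (at x)" "\<forall>v. sm k (f' v)"
  using sm_derivative_ex[OF assms] by (elim exE conjE)
 show ?thesis by (rule that[OF f'(1)[rule_format] f'(2)[rule_format]])
qed

lemma sm_compose: "sm k f ==> CkV k P ==> Ck k (%x th. f (P x th))"
 using Ck_compose[of k "%x (q::real). f x" P "%th. 0"] by simp

definition csupp :: "('e::topological_space => real) => bool" where
 "csupp f \<longleftrightarrow> (\<exists>K. compact K \<and> (\<forall>x. x \<notin> K --> f x = 0))"

lemma csuppE:
 assumes "csupp f" obtains K where "compact K" "!!x. x \<notin> K ==> f x = 0"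
 using assms by (auto simp: csupp_def)

context stratified_group
begin

lemma CkV_mul:
 assumes "CkV k P" "CkV k Q"
 shows "CkV k (%x th. P x th \<odot> Q x th)"
proof -
 have nested: "CkV k (%x th. nested_bracket br (map (%h. h x th) hs))" if "\<forall>h\<in>set hs. CkV k h" for hs
  using that
 proof (induction hs rule: induct_list012)
  case 1
  show ?case by (simp add: CkV_param)
 next
  case (3 h h' hs)
  thus ?case by (auto intro!: CkV_bilinear[OF bilinear_br])
 qed auto
 have eq: "(%x th. P x th \<odot> Q x th) = (%x th. \<Sum>ps\<in>bch_exponents (step G). bch_coeff ps *R
   nested_bracket br (map (%h. h x th) (bch_word P Q ps)))"
  by (intro ext) (simp only: gmult_def map_bch_word)
 show ?thesis
  unfolding eq
 proof (intro CkV_sum CkV_scaleR Ck_const nested)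
  show "\<forall>h\<in>set (bch_word P Q ps). CkV k h" for ps
   using assms set_bch_word[of P Q ps] by blast
 qed
qed

abbreviation lif :: "'a => 'a => 'a" where "lif b x == left_invariant_field G b x"

lemma lif_aux: "\<exists>D. (\<forall>x. ((%y. x \<odot> y) has_derivative (%v. D v x)) (at 0)) \<and> (\<forall>v. CkV k (%x (q::real). D v x))"
proof -
 have "CkV (Suc k) (%(z::'a \<times> 'a) (q::real). fst z \<odot> snd z)"
  by (intro CkV_mul CkV_linear[OF linear_fst] CkV_linear[OF linear_snd] CkV_id)
 hence "\<forall>e\<in>Basis. \<exists>h. (\<forall>z. ((%z. (fst z \<odot> snd z) \<bullet> e) has_derivative (%v. h v z)) (at z)) \<and> (\<forall>v. sm k (h v))"
  unfolding CkV_def by (intro ballI sm_derivative_ex) (rule bspec)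
 from bchoice[OF this] obtain h where
  h0: "\<forall>e\<in>Basis. (\<forall>z. ((%z. (fst z \<odot> snd z) \<bullet> e) has_derivative (%v. h e v z)) (at z)) \<and> (\<forall>v. sm k (h e v))"
  by (rule exE)
 have h: "((%z. (fst z \<odot> snd z) \<bullet> e) has_derivative (%v. h e v z)) (at z)" "sm k (h e v)" if "e \<in> Basis" for e z v
  using bspec[OF h0 that, THEN conjunct1, THEN spec] bspec[OF h0 that, THEN conjunct2, THEN spec] by this
 define D where "D v x = (\<Sum>e\<in>Basis. h e (0, v) (x, 0) *R e)" for v x
 have "((%y. x \<odot> y) has_derivative (%v. D v x)) (at 0)" for x
 proof (subst has_derivative_componentwise_within, intro ballI)
  fix e :: 'a assume e: "e \<in> Basis"
  have "((%y. (x, y)) has_derivative (%v. (0, v))) (at 0)"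
   by (auto intro!: derivative_eq_intros)
  from has_derivative_compose[OF this h(1)[OF e, of "(x, 0)"]]
  have "((%y. (x \<odot> y) \<bullet> e) has_derivative (%v. h e (0, v) (x, 0))) (at 0)" by simp
  moreover have "D v x \<bullet> e = h e (0, v) (x, 0)" for v
   using e by (simp add: D_def inner_sum_left inner_Basis if_distrib cong: if_cong)
  ultimately show "((%y. (x \<odot> y) \<bullet> e) has_derivative (%v. D v x \<bullet> e)) (at 0)" by simp
 qed
 moreover have "CkV k (%x (q::real). D v x)" for v
 proof -
  have P: "CkV k (%(x::'a) (q::real). (x, 0::'a))"
   by (intro CkV_linear[where L = "%x. (x, 0::'a)"] CkV_id linearI) auto
  have "Ck k (%x (q::real). h e (0, v) (x, 0))" if "e \<in> Basis" for e
   using sm_compose[OF h(2)[OF that] P] .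
  thus ?thesis
   unfolding D_def by (intro CkV_sum CkV_scaleR CkV_param continuous_on_const)
 qed
 ultimately show ?thesis by blast
qed

text \<open>For each \<open>k\<close> the previous lemma gives a derivative of its own; uniqueness
  of derivatives identifies all of them with \<open>left_invariant_field\<close>, which is therefore
  of class \<open>C^k\<close> for every \<open>k\<close>.\<close>

lemma has_derivative_mul_right: "((%y. x \<odot> y) has_derivative (%b. lif b x)) (at 0)"
 and CkV_lif: "CkV k (%x (q::real). lif b x)"
proof -
 have *: "\<exists>D. ((\<forall>x. ((%y. x \<odot> y) has_derivative (%v. D v x)) (at 0)) \<and> (\<forall>v. CkV k (%x (q::real). D v x)))
  \<and> D = (%v x. lif v x)" for k
 proof -
  obtain D where D: "!!x. ((%y. x \<odot> y) has_derivative (%v. D v x)) (at 0)" "!!v. CkV k (%x (q::real). D v x)"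
   using lif_aux[of k] by blast
  have "lif b x = D b x" for b x
  proof -
   have "((%t::real. t *R b) has_derivative (%t. t *R b)) (at 0)"
    by (auto intro!: derivative_eq_intros)
   from has_derivative_compose[OF this, of "%y. x \<odot> y" "%v. D v x"] D(1)[of x]
   have "((%t::real. x \<odot> (t *R b)) has_derivative (%t. D (t *R b) x)) (at 0)" by simp
   moreover have "D (t *R b) x = t *R D b x" for t
    using has_derivative_linear[OF D(1)[of x]] by (rule linear_scale)
   ultimately have "((%t::real. x \<odot> (t *R b)) has_vector_derivative D b x) (at 0)"
    by (simp add: has_vector_derivative_def)
   thus ?thesis unfolding left_invariant_field_def by (rule vector_derivative_at)
  qed
  hence "D = (%v x. lif v x)" by (intro ext) simp
  thus ?thesis using D by blast
 qed
 thus "((%y. x \<odot> y) has_derivative (%b. lif b x)) (at 0)" "CkV k (%x (q::real). lif b x)"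
  by blast+
qed

lemma linear_lif: "linear (%b. lif b x)"
 using has_derivative_linear[OF has_derivative_mul_right] .

definition X :: "'a => ('a => real) => 'a => real" where
 "X b f x = vector_derivative (%t. f (x \<odot> (t *R b))) (at 0)"

lemma X_eq:
 assumes "(f has_derivative f') (at x)"
 shows "X b f x = f' (lif b x)" "((%t. f (x \<odot> (t *R b))) has_real_derivative X b f x) (at 0)"
proof -
 have 1: "((%t::real. t *R b) has_derivative (%t. t *R b)) (at 0)"
  by (auto intro!: derivative_eq_intros)
 have 2: "((%t::real. x \<odot> (t *R b)) has_derivative (%t. lif (t *R b) x)) (at 0)"
  using has_derivative_compose[OF 1, of "%y. x \<odot> y" "%b. lif b x"] has_derivative_mul_right[of x] by simp
 have "((%t::real. f (x \<odot> (t *R b))) has_derivative (%t. f' (lif (t *R b) x))) (at 0)"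
  using has_derivative_compose[OF 2, of f f'] assms by simp
 moreover have "f' (lif (t *R b) x) = t *R f' (lif b x)" for t
  by (simp add: linear_scale[OF linear_lif] linear_scale[OF has_derivative_linear[OF assms]])
 ultimately have 3: "((%t::real. f (x \<odot> (t *R b))) has_vector_derivative f' (lif b x)) (at 0)"
  by (simp add: has_vector_derivative_def)
 thus *: "X b f x = f' (lif b x)" unfolding X_def by (rule vector_derivative_at)
 show "((%t. f (x \<odot> (t *R b))) has_real_derivative X b f x) (at 0)"
  using 3 unfolding * has_real_derivative_iff_has_vector_derivative .
qed

lemma X_deriv:
 assumes "sm (Suc k) f"
 shows "((%t. f (x \<odot> (t *R b))) has_real_derivative X b f (x \<odot> (t *R b))) (at t)"
proof -
 obtain f' where f': "!!x. (f has_derivative (%v. f' v x)) (at x)"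
  by (rule sm_has_derivative[OF assms]) (rule that)
 have "((%h. f (x \<odot> ((t + h) *R b))) has_real_derivative X b f (x \<odot> (t *R b))) (at 0)"
  using X_eq(2)[OF f', of "x \<odot> (t *R b)" b] by (simp add: mul_assoc mul_parallel)
 thus ?thesis
  using DERIV_shift[of "%t. f (x \<odot> (t *R b))" _ 0 t] by (simp add: add.commute)
qed

lemma X_deriv0:
 assumes "sm (Suc k) f"
 shows "((%t. f (x \<odot> (t *R b))) has_real_derivative X b f x) (at 0)"
 using X_deriv[OF assms, of x b 0] by simp

lemma X_unique: "((%t. f (x \<odot> (t *R b))) has_real_derivative d) (at 0) ==> X b f x = d"
 unfolding X_def has_real_derivative_iff_has_vector_derivative by (rule vector_derivative_at)

lemma sm_X: assumes "sm (Suc k) f" shows "sm k (X b f)"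
proof -
 obtain f' where f': "!!x. (f has_derivative (%v. f' v x)) (at x)" "!!v. sm k (f' v)"
  by (rule sm_has_derivative[OF assms]) (rule that)
 have eq: "(%x (q::real). X b f x) = (%x q. \<Sum>e\<in>Basis. (lif b x \<bullet> e) * f' e x)"
  using X_eq(1)[OF f'(1)] Ck_has_derivative_sum[OF f'(1)] by (intro ext) metis
 show ?thesis
  unfolding eq using CkV_lif[of k b] f'(2) by (intro Ck_sum Ck_mult) (auto simp: CkV_def)
qed

lemma X_mult: "sm (Suc k) f ==> sm (Suc k) g ==> X b (%x. f x * g x) x = f x * X b g x + X b f x * g x"
 by (rule X_unique) (auto intro!: derivative_eq_intros X_deriv0 simp: algebra_simps)

lemma X_add: "sm (Suc k) f ==> sm (Suc k) g ==> X b (%x. f x + g x) x = X b f x + X b g x"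
 by (rule X_unique) (auto intro!: derivative_eq_intros X_deriv0)

lemma X_cmult: "sm (Suc k) f ==> X b (%x. c * f x) x = c * X b f x"
 by (rule X_unique) (auto intro!: derivative_eq_intros X_deriv0)

lemma X_sum: "(!!i. i \<in> I ==> sm (Suc k) (f i)) ==> X b (%x. \<Sum>i\<in>I. f i x) x = (\<Sum>i\<in>I. X b (f i) x)"
 by (rule X_unique) (auto intro!: derivative_eq_intros X_deriv0)

lemma X_linear:
 assumes "sm (Suc k) f"
 shows "X (\<Sum>i\<in>I. c i *R v i) f x = (\<Sum>i\<in>I. c i * X (v i) f x)"
proof -
 obtain f' where f': "!!x. (f has_derivative (%v. f' v x)) (at x)"
  by (rule sm_has_derivative[OF assms]) (rule that)
 have lin: "linear (%b. f' (lif b x) x)"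
  using linear_compose[OF linear_lif has_derivative_linear[OF f']] by (simp add: comp_def)
 thus ?thesis
  unfolding X_eq(1)[OF f'] by (simp add: linear_sum[OF lin] linear_scale[OF lin])
qed

lemma X_left: "X b (%x. f (z \<odot> x)) x = X b f (z \<odot> x)"
 by (simp add: X_def mul_assoc)

lemma X_dil: "sm (Suc k) f ==> b \<in> V 1 ==> X b (%x. f (dil r x)) x = r * X b f (dil r x)"
proof (rule X_unique)
 assume f: "sm (Suc k) f" and b: "b \<in> V 1"
 have "((%t. f (dil r x \<odot> ((r * t) *R b))) has_real_derivative X b f (dil r x \<odot> ((r * 0) *R b)) * r) (at 0)"
  by (rule DERIV_chain2[OF X_deriv[OF f]]) (auto intro!: derivative_eq_intros)
 thus "((%t. f (dil r (x \<odot> (t *R b)))) has_real_derivative r * X b f (dil r x)) (at 0)"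
  by (simp add: dil_mul linear_scale[OF linear_dil] dil_V[OF b] mult.commute)
qed

lemma sm_left: "sm k f ==> sm k (%x. f (z \<odot> x))"
 by (rule sm_compose[where P = "%x q. z \<odot> x"]) (intro CkV_mul CkV_id CkV_param continuous_on_const | assumption)+

lemma sm_dil: "sm k f ==> sm k (%x. f (dil r x))"
 by (rule sm_compose[where P = "%x q. dil r x"]) (intro CkV_linear[OF linear_dil] CkV_id | assumption)+

lemma X_zero_off_compact:
 assumes "closed K" "!!x. x \<notin> K ==> f x = 0" "x \<notin> K"
 shows "X b f x = 0"
proof (rule X_unique)
 have c: "cont (%t::real. x \<odot> (t *R b))" by (intro continuous_intros)
 have op: "open ((%t::real. x \<odot> (t *R b)) -` (- K))" using c assms(1) by (intro open_vimage) auto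
 have "((%t::real. 0) has_real_derivative 0) (at 0)" by simp
 thus "((%t. f (x \<odot> (t *R b))) has_real_derivative 0) (at 0)"
  by (rule has_field_derivative_transform_within_open[OF _ op]) (use assms in auto)
qed

end

section \<open>Convolution\<close>

lemma csupp_bounded:
 assumes "csupp f" "cont f"
 obtains B where "!!x. \<bar>f x\<bar> <= B"
proof -
 obtain K where K: "compact K" "!!x. x \<notin> K ==> f x = 0" using assms(1) by (rule csuppE) (rule that)
 have "bounded (f ` K)"
  by (intro compact_imp_bounded compact_continuous_image[OF continuous_on_subset[OF assms(2)] K(1)]) auto
 then obtain B where B: "!!x. x \<in> K ==> \<bar>f x\<bar> <= B" by (auto simp: bounded_iff)
 have "\<bar>f x\<bar> <= \<bar>B\<bar>" for x using B[of x] K(2)[of x] by (cases "x \<in> K") auto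
 thus ?thesis by (rule that)
qed

text \<open>Bounded Borel functions of compact support are integrable and closed under products,
  translations and convolution; all exchanges of integrals in the convolution calculus stay within
  this class.\<close>

definition bm :: "('e::euclidean_space => real) => bool" where
 "bm f \<longleftrightarrow> f \<in> Borel \<and> (\<exists>B. \<forall>x. \<bar>f x\<bar> <= B) \<and> csupp f"

lemma bm_measurable: "bm f ==> f \<in> Borel" by (simp add: bm_def)

lemma bmE:
 assumes "bm f" obtains B K where "B >= 0" "!!x. \<bar>f x\<bar> <= B" "compact K" "!!x. x \<notin> K ==> f x = 0"
 using assms by (metis bm_def csupp_def abs_ge_zero order_trans)

lemma bmI: "f \<in> Borel ==> (!!x. \<bar>f x\<bar> <= B) ==> compact K ==> (!!x. x \<notin> K ==> f x = 0) ==> bm f"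
 by (auto simp: bm_def csupp_def)

lemma bm_continuous: "cont f ==> csupp f ==> bm f"
 by (metis bm_def borel_measurable_continuous_onI csupp_bounded)

lemma bm_mult_bounded:
 assumes f: "bm f" and g: "g \<in> Borel" "!!x. \<bar>g x\<bar> <= B"
 shows "bm (%x. f x * g x)"
proof -
 obtain A K where A: "A >= 0" "!!x. \<bar>f x\<bar> <= A" "compact K" "!!x. x \<notin> K ==> f x = 0" using f by (rule bmE) (rule that)
 have "\<bar>f x * g x\<bar> <= A * B" for x using A g(2)[of x] by (auto simp: abs_mult intro!: mult_mono)
 thus ?thesis using A bm_measurable[OF f] g by (intro bmI[of _ "A * B" K]) auto
qed

lemma bm_mult: "bm f ==> bm g ==> bm (%x. f x * g x)"
 by (metis bmE bm_measurable bm_mult_bounded)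

lemma bm_0 [simp]: "bm (%x. 0)"
 by (rule bmI[of _ 0 "{}"]) auto

lemma bm_cmult: "bm f ==> bm (%x. c * f x)"
 using bm_mult_bounded[of f "%x. c" "\<bar>c\<bar>"] by (simp add: mult.commute)

lemma bm_add: "bm f ==> bm g ==> bm (%x. f x + g x)"
proof -
 assume f: "bm f" and g: "bm g"
 obtain A K where A: "!!x. \<bar>f x\<bar> <= A" "compact K" "!!x. x \<notin> K ==> f x = 0" using f by (rule bmE) (rule that)
 obtain B L where B: "!!x. \<bar>g x\<bar> <= B" "compact L" "!!x. x \<notin> L ==> g x = 0" using g by (rule bmE) (rule that)
 have "\<bar>f x + g x\<bar> <= A + B" for x using A(1)[of x] B(1)[of x] by linarith
 thus ?thesis using A B bm_measurable[OF f] bm_measurable[OF g]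
  by (intro bmI[of _ "A + B" "K \<union> L"]) auto
qed

lemma bm_minus: "bm f ==> bm (%x. - f x)"
 using bm_cmult[of f "-1"] by simp

lemma bm_diff: "bm f ==> bm g ==> bm (%x. f x - g x)"
 using bm_add[OF _ bm_minus, of f g] by simp

lemma bm_sum: "(!!i. i \<in> I ==> bm (f i)) ==> bm (%x. \<Sum>i\<in>I. f i x)"
 by (induction I rule: infinite_finite_induct) (auto intro: bm_add)

lemma bm_abs: "bm f ==> bm (%x. \<bar>f x\<bar>)"
 unfolding bm_def csupp_def by auto

lemma bm_power2: "bm f ==> bm (%x. (f x)\<^sup>2)"
 using bm_mult[of f f] by (simp add: power2_eq_square)

lemma bm_indicator: "A \<in> sets borel ==> compact K ==> A \<subseteq> K ==> bm (indicator A)"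
 by (rule bmI[of _ 1 K]) (auto simp: indicator_def)

context haar_group
begin

sublocale sigma_finite_measure \<nu>
 using left_invariant_haar by (auto simp: left_invariant_def intro: radon_sigma_finite)

sublocale PP: pair_sigma_finite \<nu> \<nu> ..

lemma bm_integrable:
 assumes "bm f"
 shows "integrable \<nu> f"
proof -
 obtain B K where B: "B >= 0" "!!x. \<bar>f x\<bar> <= B" "compact K" "!!x. x \<notin> K ==> f x = 0"
  using assms by (rule bmE) (rule that)
 show ?thesis
 proof (rule Bochner_Integration.integrable_bound[where f = "%x. B * indicator K x"])
  show "integrable \<nu> (%x. B * indicator K x :: real)"
   using emeasure_haar_compact[OF B(3)] B(3)
   by (intro integrable_mult_right integrable_real_indicator) (auto simp: compact_imp_closed)
  show "AE x in \<nu>. norm (f x) <= norm (B * indicator K x)"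
   using B by (intro AE_I2) (auto simp: indicator_def)
 qed (use bm_measurable[OF assms] in simp)
qed

definition conv :: "('a => real) => ('a => real) => 'a => real" where
 "conv f et x = (\<integral>y. f y * et ((- y) \<odot> x))"

lemma bm_left: "bm f ==> bm (%x. f (z \<odot> x))"
 and bm_reflect: "bm f ==> bm (%x. f ((- x) \<odot> z))"
proof -
 assume f: "bm f"
 obtain B K where B: "B >= 0" "!!x. \<bar>f x\<bar> <= B" "compact K" "!!x. x \<notin> K ==> f x = 0"
  using f by (rule bmE) (rule that)
 have [measurable]: "f \<in> Borel" using f by (rule bm_measurable)
 have "compact ((\<odot>) (- z) ` K)" using B(3) by (rule homeomorphic_images)
 thus "bm (%x. f (z \<odot> x))"
  by (rule bmI[rotated 2]) (use B in \<open>auto intro!: B(4) intro: image_eqI[where x = "z \<odot> x" for x]\<close>)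
 have "compact ((%k. z \<odot> (- k)) ` K)" by (intro compact_continuous_image continuous_intros B)
 moreover have "f ((- x) \<odot> z) = 0" if "x \<notin> (%k. z \<odot> (- k)) ` K" for x
 proof (rule B(4), rule notI)
  assume "(- x) \<odot> z \<in> K"
  hence "z \<odot> (- ((- x) \<odot> z)) \<in> (%k. z \<odot> (- k)) ` K" by (rule imageI)
  thus False using that by (simp add: minus_mul)
 qed
 ultimately show "bm (%x. f ((- x) \<odot> z))"
  by (intro bmI[of _ B]) (use B in auto)
qed

lemma integral_reflect:
 fixes f :: "'a => real"
 assumes "f \<in> Borel"
 shows "(\<integral>y. f ((- y) \<odot> x)) = (\<integral>y. f y)"
 using integral_minus[of "%y. f (y \<odot> x)"] integral_right[OF assms, of x] assms by simp

lemma conv_alt: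
 assumes "bm f" "bm et"
 shows "conv f et x = (\<integral>y. f (x \<odot> (- y)) * et y)"
proof -
 have [measurable]: "f \<in> Borel" "et \<in> Borel" using assms bm_measurable by auto
 have "(\<integral>y. f y * et ((- y) \<odot> x)) = (\<integral>y. f (x \<odot> y) * et ((- (x \<odot> y)) \<odot> x))"
  by (rule integral_left[symmetric]) measurable
 also have "... = (\<integral>y. f (x \<odot> y) * et (- y))" by (simp add: minus_mul mul_assoc)
 also have "... = (\<integral>y. f (x \<odot> (- y)) * et (- (- y)))"
  by (rule integral_minus[symmetric]) measurable
 finally show ?thesis by (simp add: conv_def)
qed

lemma conv_integrand_bm: "bm f ==> bm et ==> bm (%y. f y * et ((- y) \<odot> x))"
 by (intro bm_mult bm_reflect)

lemma conv_bound:
 assumes "bm f" "bm et" "!!x. \<bar>et x\<bar> <= B"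
 shows "\<bar>conv f et x\<bar> <= B * (\<integral>y. \<bar>f y\<bar>)"
proof -
 have "norm (\<integral>y. f y * et ((- y) \<odot> x)) <= (\<integral>y. B * \<bar>f y\<bar>)"
 proof (rule norm_lebesgue_integral_le)
  show "norm (f y * et ((- y) \<odot> x)) <= B * \<bar>f y\<bar>" for y
   using mult_right_mono[OF assms(3)[of "(- y) \<odot> x"], of "\<bar>f y\<bar>"] by (simp add: abs_mult mult.commute)
 qed (intro bm_integrable conv_integrand_bm bm_cmult bm_abs assms)+
 thus ?thesis by (simp add: conv_def)
qed

lemma conv_zero:
 assumes "!!y. f y ~= 0 ==> et ((- y) \<odot> x) = 0"
 shows "conv f et x = 0"
proof -
 have "(%y. f y * et ((- y) \<odot> x)) = (%y. 0)" using assms by (intro ext) auto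
 thus ?thesis by (simp add: conv_def)
qed

lemma conv_measurable [measurable]:
 assumes [measurable]: "f \<in> Borel" "et \<in> Borel"
 shows "conv f et \<in> Borel"
proof -
 have "(%x. \<integral>y. f y * et ((- y) \<odot> x)) \<in> Borel"
  by measurable
 thus ?thesis by (simp add: conv_def[abs_def])
qed

lemma conv_support:
 assumes "!!x. x \<notin> K ==> f x = 0" "!!x. x \<notin> L ==> et x = 0" "x \<notin> (%z. fst z \<odot> snd z) ` (K \<times> L)"
 shows "conv f et x = 0"
proof (rule conv_zero)
 fix y assume "f y ~= 0"
 hence "y \<in> K" using assms by blast
 hence "(- y) \<odot> x \<notin> L"
  using assms(3) image_eqI[of x "%z. fst z \<odot> snd z" "(y, (- y) \<odot> x)" "K \<times> L"] by auto
 thus "et ((- y) \<odot> x) = 0" by (rule assms)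
qed

lemma conv_bm:
 assumes f: "bm f" and et: "bm et"
 shows "bm (conv f et)"
proof -
 obtain K where K: "compact K" "!!x. x \<notin> K ==> f x = 0" using f by (rule bmE) (rule that)
 obtain B L where L: "!!x. \<bar>et x\<bar> <= B" "compact L" "!!x. x \<notin> L ==> et x = 0" using et by (rule bmE) (rule that)
 show ?thesis
 proof (rule bmI)
  show "conv f et \<in> Borel" using f et by (intro conv_measurable bm_measurable)
  show "\<bar>conv f et x\<bar> <= B * (\<integral>y. \<bar>f y\<bar>)" for x by (rule conv_bound[OF f et L(1)])
  show "compact ((%z. fst z \<odot> snd z) ` (K \<times> L))"
   by (intro compact_continuous_image continuous_intros compact_Times K L)
  show "conv f et x = 0" if "x \<notin> (%z. fst z \<odot> snd z) ` (K \<times> L)" for x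
   using K(2) L(3) that by (rule conv_support)
 qed
qed

lemma pair_integrable:
 fixes h :: "'a \<times> 'a => real"
 assumes [measurable]: "h \<in> borel_measurable (borel \<Otimes>\<^sub>M borel)"
  and B: "!!z. \<bar>h z\<bar> <= B" and K: "compact K" "compact L" "!!x y. h (x, y) ~= 0 ==> x \<in> K \<and> y \<in> L"
 shows "integrable (\<nu> \<Otimes>\<^sub>M \<nu>) h"
proof (rule Bochner_Integration.integrable_bound[where f = "%z. B * indicator (K \<times> L) z"])
 have "emeasure (\<nu> \<Otimes>\<^sub>M \<nu>) (K \<times> L) = emeasure \<nu> K * emeasure \<nu> L"
  using K by (intro emeasure_pair_measure_Times) (auto simp: compact_imp_closed)
 also have "... < \<infinity>"
  using emeasure_haar_compact K by (simp add: ennreal_mult_less_top)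
 finally show "integrable (\<nu> \<Otimes>\<^sub>M \<nu>) (%z. B * indicator (K \<times> L) z)"
  using K by (intro integrable_mult_right integrable_real_indicator) (auto simp: compact_imp_closed)
 show "AE z in \<nu> \<Otimes>\<^sub>M \<nu>. norm (h z) <= norm (B * indicator (K \<times> L) z)"
 proof (rule AE_I2)
  fix z show "norm (h z) <= norm (B * indicator (K \<times> L) z)"
   using B[of z] K(3)[of "fst z" "snd z"] abs_ge_zero[of "h z"] by (cases z) (auto simp: indicator_def)
 qed
 show "h \<in> borel_measurable (\<nu> \<Otimes>\<^sub>M \<nu>)" by measurable
qed

lemma fubini_bm:
 fixes f g :: "'a => real" and h :: "'a \<times> 'a => real"
 assumes f: "bm f" and g: "bm g" and h: "h \<in> borel_measurable (borel \<Otimes>\<^sub>M borel)" "!!z. \<bar>h z\<bar> <= B"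
 shows "(\<integral>x. \<integral>y. f x * g y * h (x, y)) = (\<integral>y. \<integral>x. f x * g y * h (x, y))"
proof -
 obtain A K where K: "A >= 0" "!!x. \<bar>f x\<bar> <= A" "compact K" "!!x. x \<notin> K ==> f x = 0" using f by (rule bmE) (rule that)
 obtain A' L where L: "A' >= 0" "!!x. \<bar>g x\<bar> <= A'" "compact L" "!!x. x \<notin> L ==> g x = 0" using g by (rule bmE) (rule that)
 have [measurable]: "f \<in> Borel" "g \<in> Borel" using f g bm_measurable by auto
 note h(1) [measurable]
 have "integrable (\<nu> \<Otimes>\<^sub>M \<nu>) (%z. f (fst z) * g (snd z) * h z)"
 proof (rule pair_integrable[where B = "A * A' * B"])
  show "\<bar>f (fst z) * g (snd z) * h z\<bar> <= A * A' * B" for z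
   using K L h(2)[of z] by (simp add: abs_mult mult_mono)
  show "compact K" "compact L" by (rule K L)+
  show "x \<in> K \<and> y \<in> L" if "f (fst (x, y)) * g (snd (x, y)) * h (x, y) ~= 0" for x y
   using that K(4)[of x] L(4)[of y] by auto
 qed measurable
 hence "integrable (\<nu> \<Otimes>\<^sub>M \<nu>) (case_prod (%x y. f x * g y * h (x, y)))"
  by (simp add: case_prod_unfold)
 from PP.Fubini_integral[OF this] show ?thesis by simp
qed

lemma integral_conv:
 assumes f: "bm f" and et: "bm et"
 shows "(\<integral>x. conv f et x) = (\<integral>x. f x) * (\<integral>x. et x)"
proof -
 obtain K where K: "compact K" "!!x. x \<notin> K ==> f x = 0" using f by (rule bmE) (rule that)
 obtain B L where L: "!!x. \<bar>et x\<bar> <= B" "compact L" "!!x. x \<notin> L ==> et x = 0" using et by (rule bmE) (rule that)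
 have [measurable]: "f \<in> Borel" "et \<in> Borel" using f et bm_measurable by auto
 let ?M = "(%z. fst z \<odot> snd z) ` (K \<times> L)"
 have M: "compact ?M" by (intro compact_continuous_image continuous_intros compact_Times K L)
 hence [measurable]: "?M \<in> sets borel" by (simp add: compact_imp_closed)
 \<comment> \<open>The indicator of the compact product set supplies the compact support in
   \<open>x\<close> that \<open>fubini_bm\<close> asks for.\<close>
 have eq: "f y * et ((- y) \<odot> x) = indicator ?M x * f y * et ((- y) \<odot> x)" for x y
 proof (cases "f y * et ((- y) \<odot> x) = 0")
  case False
  hence "y \<in> K" "(- y) \<odot> x \<in> L" using K L by auto
  hence "x \<in> ?M" using image_eqI[of x "%z. fst z \<odot> snd z" "(y, (- y) \<odot> x)" "K \<times> L"] by auto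
  thus ?thesis by simp
 qed auto
 have "(\<integral>x. conv f et x) = (\<integral>x. \<integral>y. indicator ?M x * f y * et ((- y) \<odot> x))"
  unfolding conv_def by (subst eq) simp
 also have "... = (\<integral>y. \<integral>x. indicator ?M x * f y * et ((- y) \<odot> x))"
  using fubini_bm[OF bm_indicator[OF _ M] f, of ?M "%z. et ((- snd z) \<odot> fst z)" B] L(1) by simp
 also have "... = (\<integral>y. f y * (\<integral>x. et ((- y) \<odot> x)))"
  by (subst eq[symmetric]) simp
 also have "... = (\<integral>x. f x) * (\<integral>x. et x)"
  by (simp add: integral_left)
 finally show ?thesis .
qed

section \<open>Quadratic estimates, adjoints and integration by parts\<close>

definition ip :: "('a => real) => ('a => real) => real" where
 "ip f g = (\<integral>x. f x * g x)"

definition L1 :: "('a => real) => real" where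
 "L1 f = (\<integral>x. \<bar>f x\<bar>)"

lemma L1_nonneg: "L1 f >= 0" by (simp add: L1_def)

lemma ip_self_nonneg: "ip f f >= 0" by (simp add: ip_def)

lemma ip_commute: "ip f g = ip g f" by (simp add: ip_def mult.commute)

lemma ip_sum: "(!!i. i \<in> I ==> bm (f i)) ==> bm h ==> ip (%x. \<Sum>i\<in>I. f i x) h = (\<Sum>i\<in>I. ip (f i) h)"
 by (simp add: ip_def sum_distrib_right bm_integrable bm_mult)

lemma ip_sum_right: "(!!i. i \<in> I ==> bm (f i)) ==> bm h ==> ip h (%x. \<Sum>i\<in>I. f i x) = (\<Sum>i\<in>I. ip h (f i))"
 using ip_sum[of I f h] by (simp add: ip_commute)

lemma ip_amgm:
 assumes "bm f" "bm g" "c > 0"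
 shows "\<bar>ip f g\<bar> <= (ip f f / c + c * ip g g) / 2"
proof -
 have "norm (\<integral>x. f x * g x) <= (\<integral>x. (1 / (2 * c)) * (f x * f x) + (c / 2) * (g x * g x))"
 proof (rule norm_lebesgue_integral_le)
  show "norm (f x * g x) <= (1 / (2 * c)) * (f x * f x) + (c / 2) * (g x * g x)" for x
  proof -
   have "0 <= (\<bar>f x\<bar> - c * \<bar>g x\<bar>)\<^sup>2" by simp
   hence "2 * c * (\<bar>f x\<bar> * \<bar>g x\<bar>) <= f x * f x + c * c * (g x * g x)"
    by (simp add: power2_eq_square algebra_simps)
   thus ?thesis using assms(3) by (simp add: abs_mult field_simps)
  qed
 qed (intro bm_integrable bm_mult bm_add bm_cmult assms)+
 also have "... = (ip f f / c + c * ip g g) / 2"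
  using assms by (simp add: ip_def bm_integrable bm_mult field_simps)
 finally show ?thesis by (simp add: ip_def)
qed

lemma abs_conv_le: "bm f ==> bm et ==> \<bar>conv f et x\<bar> <= conv (%x. \<bar>f x\<bar>) (%x. \<bar>et x\<bar>) x"
 unfolding conv_def abs_mult[symmetric] by (rule integral_abs_bound)

text \<open>Schur's test. The product of values of \<open>f\<close> and \<open>g\<close> is bounded
  by half the sum of their squares, and the kernel has the integral \<open>L1 et\<close> in either
  variable, by left invariance in one and by inversion and right invariance in the other.\<close>

lemma schur:
 assumes f: "bm f" and et: "bm et" and g: "bm g"
 shows "\<bar>ip (conv f et) g\<bar> <= L1 et * (ip f f + ip g g) / 2"
proof -
 have [measurable]: "et \<in> Borel" using et by (rule bm_measurable)
 let ?e = "%x. \<bar>et x\<bar>"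
 have e: "bm ?e" using et by (rule bm_abs)
 have pt: "\<bar>conv f et x * g x\<bar> <= (conv (%x. (f x)\<^sup>2) ?e x + L1 et * (g x)\<^sup>2) / 2" for x
 proof -
  have "\<bar>conv f et x * g x\<bar> <= conv (%x. \<bar>f x\<bar>) ?e x * \<bar>g x\<bar>"
   using abs_conv_le[OF f et] by (simp add: abs_mult mult_right_mono)
  also have "... = (\<integral>y. \<bar>f y\<bar> * ?e ((- y) \<odot> x) * \<bar>g x\<bar>)"
   by (simp add: conv_def)
  also have "... <= (\<integral>y. ((f y)\<^sup>2 * ?e ((- y) \<odot> x) + ?e ((- y) \<odot> x) * (g x)\<^sup>2) / 2)"
  proof (rule Bochner_Integration.integral_mono)
   show "integrable \<nu> (%y. \<bar>f y\<bar> * ?e ((- y) \<odot> x) * \<bar>g x\<bar>)"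
    using f et by (intro integrable_mult_left bm_integrable conv_integrand_bm bm_abs)
   show "integrable \<nu> (%y. ((f y)\<^sup>2 * ?e ((- y) \<odot> x) + ?e ((- y) \<odot> x) * (g x)\<^sup>2) / 2)"
    using f e by (intro integrable_divide_zero Bochner_Integration.integrable_add integrable_mult_left bm_integrable
      conv_integrand_bm bm_power2 bm_reflect) auto
   fix y
   have "0 <= (\<bar>f y\<bar> - \<bar>g x\<bar>)\<^sup>2" by simp
   hence "\<bar>f y\<bar> * \<bar>g x\<bar> <= ((f y)\<^sup>2 + (g x)\<^sup>2) / 2" by (simp add: power2_diff)
   hence "?e ((- y) \<odot> x) * (\<bar>f y\<bar> * \<bar>g x\<bar>) <= ?e ((- y) \<odot> x) * (((f y)\<^sup>2 + (g x)\<^sup>2) / 2)"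
    by (rule mult_left_mono) simp
   thus "\<bar>f y\<bar> * ?e ((- y) \<odot> x) * \<bar>g x\<bar> <= ((f y)\<^sup>2 * ?e ((- y) \<odot> x) + ?e ((- y) \<odot> x) * (g x)\<^sup>2) / 2"
    by (simp add: field_simps)
  qed
  also have "... = (conv (%x. (f x)\<^sup>2) ?e x + L1 et * (g x)\<^sup>2) / 2"
   using bm_integrable[OF conv_integrand_bm[OF bm_power2[OF f] e]] bm_integrable[OF bm_reflect[OF e]]
    integral_reflect[of ?e x]
   by (simp add: conv_def L1_def)
  finally show ?thesis .
 qed
 have "norm (\<integral>x. conv f et x * g x) <= (\<integral>x. (conv (%x. (f x)\<^sup>2) ?e x + L1 et * (g x)\<^sup>2) / 2)"
  using f g e et pt
  by (intro norm_lebesgue_integral_le bm_integrable integrable_divide_zero Bochner_Integration.integrable_add)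
   (auto intro!: bm_integrable bm_mult conv_bm bm_power2 bm_cmult)
 also have "... = L1 et * (ip f f + ip g g) / 2"
  using f g e by (simp add: bm_integrable conv_bm bm_power2 integral_conv)
   (simp add: L1_def ip_def power2_eq_square algebra_simps)
 finally show ?thesis by (simp add: ip_def)
qed

lemma conv_assoc:
 assumes f: "bm f" and et: "bm et" and ka: "bm ka"
 shows "conv (conv f et) ka = conv f (conv et ka)"
proof
 fix x
 obtain B where B: "!!x. \<bar>et x\<bar> <= B" using et by (rule bmE) (rule that)
 have [measurable]: "f \<in> Borel" "et \<in> Borel" "ka \<in> Borel"
  using assms bm_measurable by auto
 have "conv (conv f et) ka x = (\<integral>u. \<integral>y. ka ((- u) \<odot> x) * f y * et ((- y) \<odot> u))"
  unfolding conv_def by (simp add: mult.assoc mult.commute[of _ "ka _"] flip: integral_mult_right_zero)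
 also have "... = (\<integral>y. \<integral>u. ka ((- u) \<odot> x) * f y * et ((- y) \<odot> u))"
  using fubini_bm[OF bm_reflect[OF ka] f, of "%z. et ((- snd z) \<odot> fst z)" B x] B by simp
 also have "... = (\<integral>y. f y * (\<integral>u. et ((- y) \<odot> u) * ka ((- u) \<odot> x)))"
  by (simp add: mult.assoc mult.left_commute mult.commute flip: integral_mult_right_zero)
 also have "... = (\<integral>y. f y * (\<integral>u. et u * ka ((- u) \<odot> ((- y) \<odot> x))))"
 proof (rule Bochner_Integration.integral_cong[OF refl])
  fix y
  have "(\<integral>u. et ((- y) \<odot> u) * ka ((- u) \<odot> x)) =
   (\<integral>u. et ((- y) \<odot> (y \<odot> u)) * ka ((- (y \<odot> u)) \<odot> x))"
   by (rule integral_left[symmetric]) measurable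
  thus "f y * (\<integral>u. et ((- y) \<odot> u) * ka ((- u) \<odot> x)) = f y * (\<integral>u. et u * ka ((- u) \<odot> ((- y) \<odot> x)))"
   by (simp add: minus_mul mul_assoc)
 qed
 finally show "conv (conv f et) ka x = conv f (conv et ka) x" by (simp add: conv_def)
qed

lemma bm_uminus: "bm (et :: 'a => real) ==> bm (%x. et (- x))"
 using bm_reflect[of et 0] by simp

lemma conv_adjoint:
 assumes f: "bm f" and et: "bm et" and g: "bm g"
 shows "ip (conv f et) g = ip f (conv g (%x. et (- x)))"
proof -
 obtain B where B: "!!x. \<bar>et x\<bar> <= B" using et by (rule bmE) (rule that)
 have [measurable]: "et \<in> Borel" using et by (rule bm_measurable)
 have "ip (conv f et) g = (\<integral>x. \<integral>y. g x * f y * et ((- y) \<odot> x))"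
  unfolding ip_def conv_def by (simp add: mult.assoc mult.commute[of _ "g _"] flip: integral_mult_right_zero)
 also have "... = (\<integral>y. \<integral>x. g x * f y * et ((- y) \<odot> x))"
  using fubini_bm[OF g f, of "%z. et ((- snd z) \<odot> fst z)" B] B by simp
 also have "... = ip f (conv g (%x. et (- x)))"
  unfolding ip_def conv_def by (simp add: minus_mul mult.assoc mult.left_commute flip: integral_mult_right_zero)
 finally show ?thesis .
qed

lemma conv_add_left: "bm f ==> bm g ==> bm et ==> conv (%x. f x + g x) et x = conv f et x + conv g et x"
 by (simp add: conv_def distrib_right bm_integrable conv_integrand_bm)

lemma conv_cmult_left: "conv (%x. c * f x) et x = c * conv f et x"
 by (simp add: conv_def mult.assoc)

lemma conv_cmult_right: "conv f (%x. c * et x) x = c * conv f et x"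
 by (simp add: conv_def mult.left_commute)

lemma conv_sum_left: "(!!i. i \<in> I ==> bm (f i)) ==> bm et ==> conv (%x. \<Sum>i\<in>I. f i x) et x = (\<Sum>i\<in>I. conv (f i) et x)"
 by (simp add: conv_def sum_distrib_right bm_integrable conv_integrand_bm)

lemma conv_sum_right: "bm f ==> (!!i. i \<in> I ==> bm (et i)) ==> conv f (%x. \<Sum>i\<in>I. et i x) x = (\<Sum>i\<in>I. conv f (et i) x)"
 by (simp add: conv_def sum_distrib_left bm_integrable conv_integrand_bm)

lemma sm_conv:
 assumes f: "bm f" and et: "sm k et"
 shows "sm k (conv f et)"
proof -
 obtain K where K: "compact K" "!!x. x \<notin> K ==> f x = 0" using f by (rule bmE) (rule that)
 have "Ck k (%x y. et ((- y) \<odot> x))"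
  by (rule sm_compose[OF et]) (intro CkV_mul CkV_id CkV_param continuous_intros)
 thus ?thesis
  unfolding conv_def[abs_def]
  using Ck_integral[OF bm_integrable[OF f] K(2,1) sets_haar, where 'q = real and k = k and H = "%x y. et ((- y) \<odot> x)"]
  by simp
qed

lemma X_conv:
 assumes f: "bm f" and et: "sm (Suc k) et"
 shows "X b (conv f et) x = conv f (X b et) x"
proof -
 obtain K where K: "compact K" "!!x. x \<notin> K ==> f x = 0" using f by (rule bmE) (rule that)
 have H: "Ck (Suc k) (%x y. et ((- y) \<odot> x))"
  by (rule sm_compose[OF et]) (intro CkV_mul CkV_id CkV_param continuous_intros)
 then obtain H' where H': "!!x y. ((%x. et ((- y) \<odot> x)) has_derivative (%v. H' v x y)) (at x)" "!!v. Ck k (H' v)"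
  by (rule Ck_SucE) (rule that)
 have "(conv f et has_derivative (%v. \<integral>y. f y * H' v x y)) (at x)"
  unfolding conv_def[abs_def]
  by (rule has_derivative_weighted_integral[OF bm_integrable[OF f] K(2,1) sets_haar H'(1)
     Ck_continuous[OF H] Ck_continuous[OF H'(2)]])
 hence "X b (conv f et) x = (\<integral>y. f y * H' (lif b x) x y)" by (rule X_eq)
 moreover have "H' (lif b x) x y = X b et ((- y) \<odot> x)" for y
  using X_eq(1)[OF H'(1), of b y x] X_left[of b et "- y" x] by simp
 ultimately show ?thesis by (simp add: conv_def)
qed

text \<open>Right invariance makes the integral of the translate by \<open>t *R b\<close> constant
  in \<open>t\<close>; its derivative at 0 is the integral of \<open>X b f\<close>.\<close>

lemma integral_X:
 assumes f: "sm (Suc k) f" "csupp f"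
 shows "(\<integral>x. X b f x) = 0"
proof -
 obtain K where K: "compact K" "!!x. x \<notin> K ==> f x = 0" using f(2) by (rule csuppE) (rule that)
 \<comment> \<open>This compact set contains the supports of all translates with \<open>t\<close>
   between -1 and 1, so its indicator may serve as the weight in differentiating under the
   integral.\<close>
 let ?L = "(%z. fst z \<odot> (- (snd z *R b))) ` (K \<times> {-1..1::real})"
 have L: "compact ?L" by (intro compact_continuous_image continuous_intros compact_Times K compact_Icc)
 have g: "bm (indicator ?L)" by (rule bm_indicator[OF _ L]) (use L in \<open>auto simp: compact_imp_closed\<close>)
 have fm: "f \<in> Borel"
  using sm_continuous[OF f(1)] by (rule borel_measurable_continuous_onI)
 have H: "Ck (Suc k) (%(t::real) x. f (x \<odot> (t *R b)))"
  by (rule sm_compose[OF f(1)])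
   (intro CkV_mul CkV_param CkV_linear[of "%t. t *R b"] CkV_id continuous_intros linearI; simp add: scaleR_add_left)
 have der: "((%t. f (x \<odot> (t *R b))) has_derivative (%h. X b f (x \<odot> (t *R b)) * h)) (at t)" for x t
  using X_deriv[OF f(1)] by (simp add: has_field_derivative_def)
 have cX: "cont (%z. X b f (snd z \<odot> (fst z *R b)) * v)" for v :: real
  by (intro continuous_intros continuous_on_compose2[OF sm_continuous[OF sm_X[OF f(1)]]]) auto
 have d1: "((%t. \<integral>x. indicator ?L x * f (x \<odot> (t *R b))) has_derivative
   (%h. \<integral>x. indicator ?L x * (X b f (x \<odot> (0 *R b)) * h))) (at 0)"
  by (rule has_derivative_weighted_integral[OF bm_integrable[OF g] _ L sets_haar der Ck_continuous[OF H] cX]) auto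
 have d2: "(\<integral>x. indicator ?L x * f (x \<odot> (t *R b))) = (\<integral>x. f x)" if "t \<in> {-1<..<1}" for t
 proof -
  have "indicator ?L x * f (x \<odot> (t *R b)) = f (x \<odot> (t *R b))" for x
  proof (cases "x \<in> ?L")
   case False
   have "x \<odot> (t *R b) \<notin> K"
    using False that image_eqI[of x "%z. fst z \<odot> (- (snd z *R b))" "(x \<odot> (t *R b), t)" "K \<times> {-1..1}"] by auto
   thus ?thesis using K by simp
  qed simp
  hence "(%x. indicator ?L x * f (x \<odot> (t *R b))) = (%x. f (x \<odot> (t *R b)))" by (rule ext)
  thus ?thesis using integral_right[OF fm] by (simp only:)
 qed
 have d3: "((%t. \<integral>x. f x) has_derivative
   (%h. \<integral>x. indicator ?L x * (X b f (x \<odot> (0 *R b)) * h))) (at (0::real))"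
  by (rule has_derivative_transform_within_open[OF d1 open_greaterThanLessThan _ d2]) simp_all
 have "(%h. \<integral>x. indicator ?L x * (X b f (x \<odot> (0 *R b)) * h)) = (%h::real. 0)"
  by (rule has_derivative_unique[OF d3 has_derivative_const])
 from fun_cong[OF this, of 1] have "(\<integral>x. indicator ?L x * (X b f x * 1)) = 0"
  by (simp only: scaleR_zero_left mul_0)
 moreover have "(%x. indicator ?L x * (X b f x * 1)) = X b f"
 proof
  fix x show "indicator ?L x * (X b f x * 1) = X b f x"
  proof (cases "x \<in> ?L")
   case False
   hence "x \<notin> K" using image_eqI[of x "%z. fst z \<odot> (- (snd z *R b))" "(x, 0)" "K \<times> {-1..1}"] by auto
   thus ?thesis using X_zero_off_compact[OF compact_imp_closed[OF K(1)] K(2)] by simp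
  qed simp
 qed
 ultimately show ?thesis by (simp only:)
qed

lemma csupp_X: assumes "csupp f" shows "csupp (X b f)"
proof -
 obtain K where K: "compact K" "!!x. x \<notin> K ==> f x = 0" using assms by (rule csuppE) (rule that)
 have "\<forall>x. x \<notin> K --> X b f x = 0"
  using X_zero_off_compact[OF compact_imp_closed[OF K(1)] K(2)] by simp
 with K(1) show ?thesis unfolding csupp_def by (intro exI conjI)
qed

lemma csupp_mult_right: "csupp g ==> csupp (%x. f x * g x)"
proof -
 assume "csupp g"
 then obtain K where K: "compact K" "!!x. x \<notin> K ==> g x = 0" by (rule csuppE) (rule that)
 have "\<forall>x. x \<notin> K --> f x * g x = 0" using K(2) by simp
 with K(1) show ?thesis unfolding csupp_def by (intro exI conjI)
qed

lemma integral_by_parts: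
 assumes f: "sm (Suc k) f" and g: "sm (Suc k) g" "csupp g"
 shows "(\<integral>x. X b f x * g x) = - (\<integral>x. f x * X b g x)"
proof -
 have cs: "csupp (%x. f x * g x)" using g(2) by (rule csupp_mult_right)
 have c: "cont f" "cont (X b f)" "cont g" "cont (X b g)"
  using f g sm_continuous sm_X by blast+
 have "integrable \<nu> (%x. X b f x * g x)" "integrable \<nu> (%x. f x * X b g x)"
  by (intro bm_integrable bm_continuous continuous_on_mult c csupp_mult_right csupp_X g)+
 thus ?thesis
  using integral_X[OF Ck_mult[OF f g(1)] cs, of b] X_mult[OF f g(1)] by simp
qed

end

section \<open>Dilated kernels and almost orthogonality\<close>

lemma Ck1_lipschitz_at_0:
 fixes H :: "'e::euclidean_space => 'p::metric_space => real"
 assumes H: "Ck (Suc k) H" and K: "compact K"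
 obtains C where "C >= 0" "!!u th. norm u <= R ==> th \<in> K ==> \<bar>H u th - H 0 th\<bar> <= C * norm u"
proof -
 obtain H' where H': "!!x th. ((%x. H x th) has_derivative (%v. H' v x th)) (at x)" "!!v. Ck k (H' v)"
  using H by (rule Ck_SucE) (rule that)
 have "\<exists>B. \<forall>x\<in>cball 0 R. \<forall>th\<in>K. \<bar>H' b x th\<bar> <= B" for b
 proof -
  have "compact ((%z. H' b (fst z) (snd z)) ` (cball 0 R \<times> K))"
   by (intro compact_continuous_image continuous_on_subset[OF Ck_continuous[OF H'(2)]] compact_Times K compact_cball) auto
  then obtain B where "\<forall>y\<in>(%z. H' b (fst z) (snd z)) ` (cball 0 R \<times> K). norm y <= B"
   using compact_imp_bounded bounded_iff by metis
  thus ?thesis by (intro exI[of _ B]) auto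
 qed
 then obtain B where B: "!!b x th. x \<in> cball 0 R ==> th \<in> K ==> \<bar>H' b x th\<bar> <= B b" by metis
 define C where "C = (\<Sum>b\<in>Basis. \<bar>B b\<bar>)"
 have C0: "C >= 0" by (simp add: C_def sum_nonneg)
 show ?thesis
 proof (rule that[OF C0])
  fix u :: 'e and th assume u: "norm u <= R" and th: "th \<in> K"
  have "norm (H u th - H 0 th) <= C * norm (u - 0)"
  proof (rule differentiable_bound[where f' = "%x v. H' v x th" and S = "cball 0 R"])
   show "((%x. H x th) has_derivative (%v. H' v x th)) (at x within cball 0 R)" for x
    using H'(1) by (rule has_derivative_at_withinI)
   show "onorm (%v. H' v x th) <= C" if x: "x \<in> cball 0 R" for x
   proof (rule onorm_le)
    fix v
    have "norm (H' v x th) = norm (\<Sum>b\<in>Basis. (v \<bullet> b) * H' b x th)"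
     using Ck_has_derivative_sum[OF H'(1)[of th x], of v] by simp
    also have "... <= (\<Sum>b\<in>Basis. norm v * \<bar>B b\<bar>)"
    proof (rule sum_norm_le)
     fix b :: 'e assume b: "b \<in> Basis"
     have "\<bar>v \<bullet> b\<bar> * \<bar>H' b x th\<bar> <= norm v * \<bar>B b\<bar>"
      using B[OF x th, of b] by (intro mult_mono Basis_le_norm[OF b]) auto
     thus "norm ((v \<bullet> b) * H' b x th) <= norm v * \<bar>B b\<bar>" by (simp only: real_norm_def abs_mult)
    qed
    also have "... = C * norm v" by (simp add: C_def sum_distrib_left mult.commute)
    finally show "norm (H' v x th) <= C * norm v" .
   qed
   show "(0::'e) \<in> cball 0 R" using u norm_ge_zero[of u] by (simp del: norm_ge_zero)
  qed (use u in auto)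
  thus "\<bar>H u th - H 0 th\<bar> <= C * norm u" by simp
 qed
qed

context stratified_group
begin

text \<open>Balls of a homogeneous quasi-norm. They are compact, symmetric and scale exactly under
  dilations; the constant \<open>a\<close> fixed below takes the place of the triangle
  inequality.\<close>

definition U :: "real => 'a set" where
 "U r = {x. \<forall>i\<in>{1..step G}. norm (comp i x) <= r ^ i}"

lemma continuous_comp: "continuous_on A (comp i)"
 using linear_comp linear_conv_bounded_linear linear_continuous_on by blast

lemma U_dil: "r > 0 ==> s > 0 ==> dil s x \<in> U r \<longleftrightarrow> x \<in> U (r / s)"
 by (simp add: U_def comp_dil power_divide pos_le_divide_eq mult.commute)

lemma U_minus [simp]: "- x \<in> U r \<longleftrightarrow> x \<in> U r"
 by (simp add: U_def)

lemma zero_in_U [simp]: "r >= 0 ==> 0 \<in> U r"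
 by (simp add: U_def)

lemma U_mono: "0 <= r ==> r <= s ==> U r \<subseteq> U s"
 unfolding U_def using power_mono[of r s] order_trans by (blast intro: order_trans)

lemma norm_U: assumes "x \<in> U r" "0 <= r" "r <= 1" shows "norm x <= real (step G) * r"
proof -
 have "norm x = norm (\<Sum>i=1..step G. comp i x)" by (simp add: sum_comps)
 also have "... <= (\<Sum>i=1..step G. r)"
 proof (rule sum_norm_le)
  fix i assume i: "i \<in> {1..step G}"
  hence "norm (comp i x) <= r ^ i" using assms(1) by (auto simp: U_def)
  also have "... <= r ^ 1" using i assms by (intro power_decreasing) auto
  finally show "norm (comp i x) <= r" by simp
 qed
 finally show ?thesis by simp
qed

lemma compact_U: "compact (U r)"
 unfolding compact_eq_bounded_closed
proof
 show "bounded (U r)"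
  unfolding bounded_iff
 proof (intro exI ballI)
  fix x assume x: "x \<in> U r"
  have "norm x = norm (\<Sum>i=1..step G. comp i x)" by (simp add: sum_comps)
  also have "... <= (\<Sum>i=1..step G. r ^ i)" using x by (intro sum_norm_le) (auto simp: U_def)
  finally show "norm x <= (\<Sum>i=1..step G. r ^ i)" .
 qed
 have "U r = (\<Inter>i\<in>{1..step G}. {x. norm (comp i x) <= r ^ i})" by (auto simp: U_def)
 also have "closed ..."
  by (intro closed_INT ballI closed_Collect_le continuous_intros continuous_comp)
 finally show "closed (U r)" .
qed

lemma U_nbhd: assumes "r > 0" obtains e where "e > 0" "ball 0 e \<subseteq> U r"
proof -
 have "open (\<Inter>i\<in>{1..step G}. {x. norm (comp i x) < r ^ i})"
  by (intro open_INT ballI open_Collect_less continuous_intros continuous_comp) auto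
 moreover have "0 \<in> (\<Inter>i\<in>{1..step G}. {x. norm (comp i x) < r ^ i})" using assms by auto
 ultimately obtain e where e: "e > 0" "ball 0 e \<subseteq> (\<Inter>i\<in>{1..step G}. {x. norm (comp i x) < r ^ i})"
  by (rule openE)
 have "(\<Inter>i\<in>{1..step G}. {x. norm (comp i x) < r ^ i}) \<subseteq> U r" by (rule subsetI) (simp add: U_def less_imp_le)
 with e(2) have "ball 0 e \<subseteq> U r" by (rule subset_trans)
 thus ?thesis by (rule that[OF e(1)])
qed

lemma bounded_subset_U:
 assumes "compact K" obtains r where "r >= 2" "K \<subseteq> U r"
proof -
 have "\<exists>B. \<forall>x\<in>K. norm (comp i x) <= B" for i
  using compact_imp_bounded[OF compact_continuous_image[OF continuous_comp assms]] by (auto simp: bounded_iff)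
 then obtain B where B: "!!i x. x \<in> K ==> norm (comp i x) <= B i" by metis
 define r where "r = 2 + (\<Sum>i=1..step G. \<bar>B i\<bar>)"
 have r2: "r >= 2" by (simp add: r_def sum_nonneg)
 have "norm (comp i x) <= r ^ i" if "x \<in> K" "i \<in> {1..step G}" for i x
 proof -
  have "norm (comp i x) <= \<bar>B i\<bar>" using B[OF that(1), of i] by simp
  also have "... <= (\<Sum>i=1..step G. \<bar>B i\<bar>)" using that by (intro member_le_sum) auto
  also have "... <= r ^ 1" by (simp add: r_def)
  also have "... <= r ^ i" using that r2 by (intro power_increasing) auto
  finally show ?thesis .
 qed
 hence "K \<subseteq> U r" by (intro subsetI) (simp add: U_def)
 thus ?thesis by (rule that[OF r2])
qed

lemma dilation_base_exists:
 obtains a where "a >= 2" "!!x y z. x \<in> U 1 ==> y \<in> U 1 ==> z \<in> U 1 ==> x \<odot> y \<odot> z \<in> U a"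
proof -
 let ?K = "(%p. fst p \<odot> fst (snd p) \<odot> snd (snd p)) ` (U 1 \<times> U 1 \<times> U 1)"
 have "compact ?K" by (intro compact_continuous_image continuous_intros compact_Times compact_U)
 then obtain a where "a >= 2" "?K \<subseteq> U a" by (rule bounded_subset_U)
 thus ?thesis by (intro that[of a]) force+
qed

end

text \<open>The constant \<open>a\<close> plays two roles: it is the constant of the quasi-triangle
  inequality and the ratio between consecutive scales \<open>1 / a ^ k\<close>.\<close>

locale dilation_base = haar_group +
 fixes a :: real
 assumes a2: "a >= 2" and U3_base: "x \<in> U 1 ==> y \<in> U 1 ==> z \<in> U 1 ==> x \<odot> y \<odot> z \<in> U a"
begin

lemma a_pos [simp]: "a > 0" "a >= 0" "a ~= 0" "a >= 1" using a2 by auto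

lemma U3: "r > 0 ==> x \<in> U r ==> y \<in> U r ==> z \<in> U r ==> x \<odot> y \<odot> z \<in> U (a * r)"
 using U3_base[of "dil (1 / r) x" "dil (1 / r) y" "dil (1 / r) z"]
 by (simp add: U_dil flip: dil_mul)

lemma U2: "r > 0 ==> x \<in> U r ==> y \<in> U r ==> x \<odot> y \<in> U (a * r)"
 using U3[of r x y 0] by simp

lemma vol_1: "vol 1 = 1"
 using vol_mult[of 1 1] vol(1)[of 1] by simp

lemma vol_power: "vol (a ^ k) = vol a ^ k"
 by (induction k) (auto simp: vol_1 vol_mult)

lemma vol_inverse_power: "vol (1 / a ^ k) = 1 / vol a ^ k"
 using vol_mult[of "1 / a ^ k" "a ^ k"] vol(1)[of a] by (simp add: vol_1 vol_power field_simps)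

lemma vol_a_pos [simp]: "vol a > 0" "vol a >= 0" "vol a ~= 0"
 using vol(1)[of a] by auto

text \<open>The dilate to the scale \<open>1 / a ^ k\<close>, normalized so that the integral is
  preserved.\<close>

definition sc :: "nat => ('a => real) => 'a => real" where
 "sc k et x = vol a ^ k * et (dil (a ^ k) x)"

lemma bm_dil: assumes "bm f" "r > 0" shows "bm (%x. f (dil r x))"
proof -
 obtain B K where B: "B >= 0" "!!x. \<bar>f x\<bar> <= B" "compact K" "!!x. x \<notin> K ==> f x = 0"
  using assms(1) by (rule bmE) (rule that)
 have [measurable]: "f \<in> Borel" using assms(1) by (rule bm_measurable)
 have "compact (dil (1 / r) ` K)" using B(3) by (intro compact_continuous_image continuous_dil)
 moreover have "f (dil r x) = 0" if "x \<notin> dil (1 / r) ` K" for x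
  using that assms(2) by (intro B(4)) (auto intro: image_eqI[where x = "dil r x"])
 ultimately show ?thesis by (intro bmI[of _ B]) (use B in auto)
qed

lemma bm_sc: "bm et ==> bm (sc k et)"
 unfolding sc_def[abs_def] by (intro bm_cmult bm_dil) auto

lemma integral_sc: "f \<in> Borel ==> (\<integral>x. vol a ^ k * f (dil (a ^ k) x)) = (\<integral>x. f x)"
 using integral_dil[of "1 / a ^ k" f] by (simp add: vol_inverse_power)

lemma L1_sc: "bm et ==> L1 (sc k et) = L1 et"
 using integral_sc[of "%x. \<bar>et x\<bar>" k] bm_measurable[of et]
 by (simp add: L1_def sc_def abs_mult)

lemma conv_sc:
 assumes "bm f" "bm g"
 shows "conv (sc k f) (sc k g) = sc k (conv f g)"
proof
 fix x
 have [measurable]: "f \<in> Borel" "g \<in> Borel" using assms bm_measurable by auto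
 have "conv (sc k f) (sc k g) x =
  (\<integral>y. vol a ^ k * (%y. vol a ^ k * (f y * g ((- y) \<odot> dil (a ^ k) x))) (dil (a ^ k) y))"
  by (simp add: conv_def sc_def dil_mul mult_ac)
 also have "... = (\<integral>y. vol a ^ k * (f y * g ((- y) \<odot> dil (a ^ k) x)))"
  by (rule integral_sc) measurable
 finally show "conv (sc k f) (sc k g) x = sc k (conv f g) x" by (simp add: sc_def conv_def)
qed

lemma sc_0 [simp]: "sc 0 et = et"
 by (rule ext) (simp add: sc_def)

definition kern :: "('a => real) => bool" where
 "kern et \<longleftrightarrow> sm 1 et \<and> (\<forall>x. x \<notin> U 1 --> et x = 0)"

lemma kern_csupp: "kern et ==> csupp et"
 using compact_U unfolding kern_def csupp_def by blast

lemma kern_bm: "kern et ==> bm et"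
 using kern_csupp sm_continuous unfolding kern_def by (blast intro: bm_continuous)

lemma kern_uminus: "kern et ==> kern (%x. et (- x))"
 unfolding kern_def
 using sm_compose[of 1 et "%x q. - x"] CkV_linear[OF linear_uminus CkV_id, of 1]
 by (auto simp: kern_def)

lemma sc_support: "kern et ==> sc k et x ~= 0 ==> x \<in> U (1 / a ^ k)"
proof -
 assume "kern et" "sc k et x ~= 0"
 hence "dil (a ^ k) x \<in> U 1" by (auto simp: kern_def sc_def)
 thus ?thesis by (simp add: U_dil)
qed

lemma modulus_aux:
 assumes H: "Ck (Suc 0) (%u x. H u x)" and supp: "!!u x. u \<in> U 1 ==> x \<notin> U a ==> H u x = H 0 x"
 obtains C where "C >= 0" "!!n u. u \<in> U (1 / a ^ n) ==> (\<integral>x. \<bar>H u x - H 0 x\<bar>) <= C / a ^ n"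
proof -
 obtain C where C: "C >= 0" "!!u x. norm u <= real (step G) ==> x \<in> U a ==> \<bar>H u x - H 0 x\<bar> <= C * norm u"
  using Ck1_lipschitz_at_0[OF H compact_U[of a], of "real (step G)"] by metis
 let ?m = "measure \<nu> (U a)"
 show ?thesis
 proof (rule that)
  show "C * real (step G) * ?m >= 0" using C by simp
  fix n u assume u: "u \<in> U (1 / a ^ n)"
  have le1: "1 / a ^ n <= 1" by simp
  have u1: "u \<in> U 1" using u U_mono[of "1 / a ^ n" 1] le1 by auto
  have un: "norm u <= real (step G) * (1 / a ^ n)" using norm_U[OF u] le1 by simp
  also have "... <= real (step G) * 1" using le1 by (intro mult_left_mono) auto
  finally have us: "norm u <= real (step G)" by simp
  have ind: "integrable \<nu> (%x. C * real (step G) * (1 / a ^ n) * indicator (U a) x :: real)"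
   by (intro bm_integrable bm_cmult bm_indicator[OF _ compact_U[of a] subset_refl] borel_closed compact_imp_closed compact_U)
  have pt: "\<bar>H u x - H 0 x\<bar> <= C * real (step G) * (1 / a ^ n) * indicator (U a) x" for x
  proof (cases "x \<in> U a")
   case True
   have "\<bar>H u x - H 0 x\<bar> <= C * norm u" using C(2)[OF us True] .
   also have "... <= C * (real (step G) * (1 / a ^ n))" using un C(1) by (rule mult_left_mono)
   finally show ?thesis using True by simp
  qed (use supp[OF u1] in simp)
  have "(\<integral>x. \<bar>H u x - H 0 x\<bar>) <= (\<integral>x. C * real (step G) * (1 / a ^ n) * indicator (U a) x)"
   by (rule Bochner_Integration.integral_mono'[OF ind pt]) (use C in simp)
  also have "... = C * real (step G) * ?m / a ^ n"
   using compact_U by (simp add: compact_imp_closed)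
  finally show "(\<integral>x. \<bar>H u x - H 0 x\<bar>) <= C * real (step G) * ?m / a ^ n" .
 qed
qed

lemma kern_modulus:
 assumes et: "kern et"
 obtains C where "C >= 0" "!!n u. u \<in> U (1 / a ^ n) ==> (\<integral>x. \<bar>et (u \<odot> x) - et x\<bar>) <= C / a ^ n"
proof -
 have sm: "sm (Suc 0) et" using et by (simp add: kern_def)
 have z: "et x = 0" if "x \<notin> U a" for x
  using that et U_mono[of 1 a] by (auto simp: kern_def)
 have z1: "et (u \<odot> x) = 0" if "u \<in> U 1" "x \<notin> U a" for u x
 proof (rule ccontr)
  assume "et (u \<odot> x) ~= 0"
  hence "u \<odot> x \<in> U 1" using et by (auto simp: kern_def)
  hence "(- u) \<odot> (u \<odot> x) \<in> U (a * 1)" using that by (intro U2) auto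
  thus False using that by simp
 qed
 have H: "Ck (Suc 0) (%u x. et (u \<odot> x))"
  by (rule sm_compose[OF sm]) (intro CkV_mul CkV_id CkV_param continuous_on_id)
 show ?thesis
  by (rule modulus_aux[OF H]) (simp add: z z1, rule that, assumption, simp)
qed

text \<open>Minkowski's integral inequality: the norm of an average is at most the average of the
  norms. The support condition on \<open>h\<close> confines the exchange of integrals to a compact
  set.\<close>

lemma L1_average:
 assumes w: "bm w" "!!y. w y ~= 0 ==> y \<in> U (1 / a ^ n)"
  and h: "(%z. h (fst z) (snd z)) \<in> borel_measurable (borel \<Otimes>\<^sub>M borel)" "!!x y. \<bar>h x y\<bar> <= B"
   "!!x y. y \<in> U 1 ==> x \<notin> U a ==> h x y = 0"
  and int: "!!y. y \<in> U (1 / a ^ n) ==> (\<integral>x. \<bar>h x y\<bar>) <= c"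
 shows "(\<integral>x. \<bar>\<integral>y. w y * h x y\<bar>) <= c * L1 w"
proof -
 note h(1) [measurable]
 have [measurable]: "w \<in> Borel" using w by (simp add: bm_measurable)
 have hx [measurable]: "(%y. h x y) \<in> Borel" "(%x. h x y) \<in> Borel" for x y
  using measurable_compose[of "%y. (x, y)" borel, OF _ h(1)] measurable_compose[of "%x. (x, y)" borel, OF _ h(1)] by auto
 have U1: "y \<in> U 1" if "y \<in> U (1 / a ^ n)" for y
  using that U_mono[of "1 / a ^ n" 1] by auto
 let ?I = "indicator (U a) :: 'a => real"
 have I: "bm ?I" using compact_U[of a] by (intro bm_indicator) (auto simp: compact_imp_closed)
 have eq: "\<bar>w y\<bar> * \<bar>h x y\<bar> = ?I x * \<bar>w y\<bar> * \<bar>h x y\<bar>" for x y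
  using h(3)[OF U1[OF w(2)], of y x] by (cases "w y = 0") (auto simp: indicator_def)
 have hy: "bm (%y. \<bar>w y\<bar> * \<bar>h x y\<bar>)" for x
  using h(2) by (intro bm_mult_bounded[OF bm_abs[OF w(1)], of _ B]) auto
 have m: "(%x. \<integral>y. \<bar>w y\<bar> * \<bar>h x y\<bar>) \<in> Borel"
  by measurable
 have outer: "integrable \<nu> (%x. \<integral>y. \<bar>w y\<bar> * \<bar>h x y\<bar>)"
 proof (rule bm_integrable, rule bmI[OF m])
  show "compact (U a)" by (rule compact_U)
  show "(\<integral>y. \<bar>w y\<bar> * \<bar>h x y\<bar>) = 0" if "x \<notin> U a" for x
   by (subst eq) (use that in simp)
  show "\<bar>\<integral>y. \<bar>w y\<bar> * \<bar>h x y\<bar>\<bar> <= (\<integral>y. \<bar>w y\<bar> * \<bar>B\<bar>)" for x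
  proof -
   have "norm (\<integral>y. \<bar>w y\<bar> * \<bar>h x y\<bar>) <= (\<integral>y. \<bar>w y\<bar> * \<bar>B\<bar>)"
   proof (rule norm_lebesgue_integral_le)
    show "norm (\<bar>w y\<bar> * \<bar>h x y\<bar>) <= \<bar>w y\<bar> * \<bar>B\<bar>" for y
     using h(2)[of x y] by (simp add: abs_mult mult_left_mono)
   qed (intro bm_integrable hy integrable_mult_left bm_abs w)+
   thus ?thesis by simp
  qed
 qed
 have "(\<integral>x. \<bar>\<integral>y. w y * h x y\<bar>) <= (\<integral>x. \<integral>y. \<bar>w y\<bar> * \<bar>h x y\<bar>)"
 proof (rule Bochner_Integration.integral_mono'[OF outer])
  show "\<bar>\<integral>y. w y * h x y\<bar> <= (\<integral>y. \<bar>w y\<bar> * \<bar>h x y\<bar>)" for x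
   unfolding abs_mult[symmetric] by (rule integral_abs_bound)
 qed simp
 also have "... = (\<integral>x. \<integral>y. ?I x * \<bar>w y\<bar> * \<bar>h x y\<bar>)" by (subst eq) simp
 also have "... = (\<integral>y. \<integral>x. ?I x * \<bar>w y\<bar> * \<bar>h x y\<bar>)"
  using fubini_bm[OF I bm_abs[OF w(1)], of "%z. \<bar>h (fst z) (snd z)\<bar>" B] h(2) by simp
 also have "... = (\<integral>y. \<bar>w y\<bar> * (\<integral>x. \<bar>h x y\<bar>))"
  by (subst eq[symmetric]) simp
 also have "... <= (\<integral>y. \<bar>w y\<bar> * c)"
 proof (rule Bochner_Integration.integral_mono')
  show "integrable \<nu> (%y. \<bar>w y\<bar> * c)" by (intro integrable_mult_left bm_integrable bm_abs w)
  show "\<bar>w y\<bar> * (\<integral>x. \<bar>h x y\<bar>) <= \<bar>w y\<bar> * c" for y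
   using int[OF w(2), of y] by (cases "w y = 0") (auto intro: mult_left_mono)
  show "0 <= \<bar>w y\<bar> * c" for y
  proof (cases "w y = 0")
   case False
   have "0 <= (\<integral>x. \<bar>h x y\<bar>)" by simp
   hence "0 <= c" using int[OF w(2)[OF False]] by (rule order_trans)
   thus ?thesis by simp
  qed simp
 qed
 finally show ?thesis by (simp add: L1_def mult.commute)
qed

definition bl :: "'a => real => 'a set" where "bl z r = {x. (- z) \<odot> x \<in> U r}"

lemma conv_left: "f \<in> Borel ==> et \<in> Borel ==>
 conv (%y. f (z \<odot> y)) et x = conv f et (z \<odot> x)"
 using integral_left(1)[of "%y. f y * et ((- y) \<odot> (z \<odot> x))" z]
 by (simp add: conv_def minus_mul mul_assoc)

lemma L1_left: "f \<in> Borel ==> L1 (%y. f (z \<odot> y)) = L1 f"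
 using integral_left(1)[of "%x. \<bar>f x\<bar>" z] by (simp add: L1_def)

text \<open>Since \<open>w\<close> has mean zero, \<open>ka x\<close> may be subtracted from the
  kernel, which leaves its modulus of continuity at the scale of the support of \<open>w\<close>.
  Translation and dilation reduce the general case to a ball around 0 and \<open>k = 0\<close>, so
  that the gain is the ratio of the two scales.\<close>

lemma L1_conv_mean_zero:
 assumes ka: "kern ka"
 obtains C where "C >= 0" "!!w z n k. bm w ==> (\<integral>x. w x) = 0 ==> (\<forall>y. w y ~= 0 --> y \<in> bl z (1 / a ^ n)) ==>
  k <= n ==> L1 (conv w (sc k ka)) <= C / a ^ (n - k) * L1 w"
proof -
 obtain C where C: "C >= 0" "!!n u. u \<in> U (1 / a ^ n) ==> (\<integral>x. \<bar>ka (u \<odot> x) - ka x\<bar>) <= C / a ^ n"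
  using ka by (rule kern_modulus) (rule that)
 have bka: "bm ka" using ka by (rule kern_bm)
 have [measurable]: "ka \<in> Borel" using bka by (rule bm_measurable)
 obtain B where B: "!!x. \<bar>ka x\<bar> <= B" using bka by (rule bmE) (rule that)
 have B2: "\<bar>ka x - ka y\<bar> <= 2 * B" for x y using B[of x] B[of y] by linarith
 have out: "ka x = 0" "ka ((- y) \<odot> x) = 0" if "y \<in> U 1" "x \<notin> U a" for x y
 proof -
  show "ka x = 0" using that ka U_mono[of 1 a] by (auto simp: kern_def)
  have "(- y) \<odot> x \<notin> U 1" using U2[of 1 y "(- y) \<odot> x"] that by auto
  thus "ka ((- y) \<odot> x) = 0" using ka by (auto simp: kern_def)
 qed
 have base: "L1 (conv w ka) <= C / a ^ n * L1 w"
  if w: "bm w" "(\<integral>x. w x) = 0" "!!y. w y ~= 0 ==> y \<in> U (1 / a ^ n)" for w n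
 proof -
  have "conv w ka x = (\<integral>y. w y * (ka ((- y) \<odot> x) - ka x))" for x
   using bm_integrable[OF w(1)] bm_integrable[OF conv_integrand_bm[OF w(1) bka]]
   by (simp add: conv_def right_diff_distrib w(2))
  hence "L1 (conv w ka) = (\<integral>x. \<bar>\<integral>y. w y * (ka ((- y) \<odot> x) - ka x)\<bar>)"
   by (simp add: L1_def)
  also have "... <= C / a ^ n * L1 w"
  proof (rule L1_average[where B = "2 * B"])
   show "(\<integral>x. \<bar>ka ((- y) \<odot> x) - ka x\<bar>) <= C / a ^ n" if "y \<in> U (1 / a ^ n)" for y
    using C(2)[of "- y"] that by simp
  qed (use w B2 out in auto)
  finally show ?thesis .
 qed
 show ?thesis
 proof (rule that[OF C(1)])
  fix w z and n k :: nat assume w: "bm w" "(\<integral>x. w x) = 0" "\<forall>y. w y ~= 0 --> y \<in> bl z (1 / a ^ n)" and kn: "k <= n"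
  have [measurable]: "w \<in> Borel" using w(1) by (rule bm_measurable)
  let ?v = "%y. w (z \<odot> y)"
  define u where "u y = ?v (dil (1 / a ^ k) y) / vol a ^ k" for y
  have v: "bm ?v" using w(1) by (rule bm_left)
  have u: "bm u" unfolding u_def[abs_def] using bm_cmult[OF bm_dil[OF v, of "1 / a ^ k"], of "1 / vol a ^ k"] by simp
  have scu: "sc k u = ?v" by (rule ext) (simp add: sc_def u_def)
  have u0: "(\<integral>x. u x) = 0"
  proof -
   have "(\<integral>x. u x) = (\<integral>x. sc k u x)"
    using integral_sc[OF bm_measurable[OF u], of k] by (simp add: sc_def)
   thus ?thesis using integral_left(1)[of w z] w(2) by (simp add: scu)
  qed
  have us: "y \<in> U (1 / a ^ (n - k))" if "u y ~= 0" for y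
  proof -
   have "z \<odot> dil (1 / a ^ k) y \<in> bl z (1 / a ^ n)" using that w(3) by (auto simp: u_def)
   hence "y \<in> U (1 / a ^ n / (1 / a ^ k))" by (simp add: bl_def U_dil)
   thus ?thesis using kn by (simp add: power_diff)
  qed
  have "L1 (conv w (sc k ka)) = L1 (conv ?v (sc k ka))"
  proof -
   have m: "sc k ka \<in> Borel" using bka by (intro bm_measurable bm_sc)
   have "conv ?v (sc k ka) = (%x. conv w (sc k ka) (z \<odot> x))" by (rule ext) (simp add: conv_left m)
   moreover have "conv w (sc k ka) \<in> Borel" using m by measurable
   ultimately show ?thesis using L1_left[of "conv w (sc k ka)" z] by simp
  qed
  also have "... = L1 (conv u ka)" using u bka by (simp add: scu[symmetric] conv_sc L1_sc conv_bm)
  also have "... <= C / a ^ (n - k) * L1 u" by (rule base[OF u u0 us])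
  also have "L1 u = L1 w" using L1_sc[OF u, of k] scu L1_left[of w z] by simp
  finally show "L1 (conv w (sc k ka)) <= C / a ^ (n - k) * L1 w" .
 qed
qed

lemma L1_conv_reflect:
 assumes f: "bm f" and et: "bm et"
 shows "L1 (conv (%x. et (- x)) (%x. f (- x))) = L1 (conv f et)"
proof -
 have [measurable]: "f \<in> Borel" "et \<in> Borel" using assms bm_measurable by auto
 have "conv (%x. et (- x)) (%x. f (- x)) x = conv f et (- x)" for x
  using integral_minus[of "%y. f ((- x) \<odot> (- y)) * et y"] by (simp add: conv_alt[OF f et]) (simp add: conv_def minus_mul mult.commute)
 thus ?thesis
  using integral_minus[of "%x. \<bar>conv f et x\<bar>"] conv_measurable[of f et] by (simp add: L1_def)
qed

lemma sum_geometric_le: "(\<Sum>n\<in>I. 1 / a ^ n) <= 2" if "finite I"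
proof -
 have "(\<Sum>n\<in>I. 1 / a ^ n) <= (\<Sum>n\<in>I. (1 / 2) ^ n)"
 proof (rule sum_mono)
  fix n
  have "(1 / a) ^ n <= (1 / 2) ^ n" using a2 by (intro power_mono divide_left_mono) auto
  thus "1 / a ^ n <= (1 / 2) ^ n" by (simp add: power_divide)
 qed
 also have "... <= (\<Sum>n. (1 / 2 :: real) ^ n)"
  using that by (intro sum_le_suminf summable_geometric) auto
 also have "... = 2" by (simp add: suminf_geometric)
 finally show ?thesis .
qed

lemma sum_abs_diff_le: "(\<Sum>l\<le>M. 1 / a ^ (if k <= l then l - k else k - l)) <= 4" for k M :: nat
proof -
 have "(\<Sum>l\<le>M. 1 / a ^ (if k <= l then l - k else k - l)) =
  (\<Sum>l\<in>{..M} \<inter> {l. k <= l}. 1 / a ^ (l - k)) + (\<Sum>l\<in>{..M} \<inter> - {l. k <= l}. 1 / a ^ (k - l))"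
  by (simp add: sum.If_cases[symmetric] if_distrib)
 also have "(\<Sum>l\<in>{..M} \<inter> {l. k <= l}. 1 / a ^ (l - k)) = (\<Sum>n\<in>(%l. l - k) ` ({..M} \<inter> {l. k <= l}). 1 / a ^ n)"
  by (subst sum.reindex) (auto simp: inj_on_def)
 also have "(\<Sum>l\<in>{..M} \<inter> - {l. k <= l}. 1 / a ^ (k - l)) = (\<Sum>n\<in>(%l. k - l) ` ({..M} \<inter> - {l. k <= l}). 1 / a ^ n)"
  by (subst sum.reindex) (auto simp: inj_on_def)
 finally show ?thesis
  using sum_geometric_le[of "(%l. l - k) ` ({..M} \<inter> {l. k <= l})"]
   sum_geometric_le[of "(%l. k - l) ` ({..M} \<inter> - {l. k <= l})"] by simp
qed

text \<open>The almost orthogonality argument of Cotlar and Stein. With \<open>S\<close> the sum of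
  the adjoint operators applied to the pieces \<open>u k\<close>, the left-hand side is
  \<open>ip f S\<close>. Its square norm is in turn bounded by the left-hand side, because the
  composition of the operator at one scale with the adjoint at another has a kernel whose L1 norm
  decays in the distance of the scales.\<close>

lemma square_function_bound:
 assumes ka: "kern ka" "(\<integral>x. ka x) = 0"
 obtains C where "C > 0" "!!M (f :: 'a => real). bm f ==> (\<Sum>k\<le>M. ip (conv f (sc k ka)) (conv f (sc k ka))) <= C * ip f f"
proof -
 let ?ka' = "%x. ka (- x)"
 have ka': "kern ?ka'" using ka by (intro kern_uminus)
 have b: "bm ka" "bm ?ka'" using ka ka' kern_bm by auto
 have zero': "(\<integral>x. ?ka' x) = 0" using integral_minus[OF bm_measurable[OF b(1)]] ka by simp
 obtain C where C: "C >= 0" "!!w z n k. bm w ==> (\<integral>x. w x) = 0 ==> (\<forall>y. w y ~= 0 --> y \<in> bl z (1 / a ^ n)) ==>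
  k <= n ==> L1 (conv w (sc k ka)) <= C / a ^ (n - k) * L1 w"
  using ka(1) by (rule L1_conv_mean_zero) (rule that)
 define A where "A = C * L1 ?ka' + 1"
 have A: "A > 0" using C L1_nonneg by (simp add: A_def add_nonneg_pos)
 let ?d = "%k l::nat. if k <= l then l - k else k - l"
 have base: "L1 (conv (sc n ?ka') (sc k ka)) <= A / a ^ (n - k)" if "k <= n" for k n
 proof -
  have "(\<integral>x. sc n ?ka' x) = 0"
   using integral_sc[OF bm_measurable[OF b(2)], of n] zero' by (simp add: sc_def)
  hence "L1 (conv (sc n ?ka') (sc k ka)) <= C / a ^ (n - k) * L1 (sc n ?ka')"
   using sc_support[OF ka'] b by (intro C(2)[where z = 0] bm_sc that) (auto simp: bl_def)
  also have "... = C * L1 ?ka' / a ^ (n - k)" by (simp only: L1_sc[OF b(2)]) simp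
  also have "... <= A / a ^ (n - k)" by (intro divide_right_mono) (auto simp: A_def)
  finally show ?thesis .
 qed
 have off: "L1 (conv (sc k ?ka') (sc l ka)) <= A / a ^ ?d k l" for k l
 proof (cases "k <= l")
  case True
  have "L1 (conv (sc k ?ka') (sc l ka)) = L1 (conv (sc l ?ka') (sc k ka))"
   using L1_conv_reflect[OF bm_sc[OF b(2)] bm_sc[OF b(1)], of k l] by (simp add: sc_def[abs_def])
  thus ?thesis using base[OF True] True by simp
 next
  case False
  thus ?thesis using base[of l k] by simp
 qed
 have sc': "(%x. sc k ka (- x)) = sc k ?ka'" for k by (rule ext) (simp add: sc_def)
 show ?thesis
 proof (rule that[of "4 * A"])
  fix M :: nat and f :: "'a => real" assume f: "bm f"
  define u where "u k = conv f (sc k ka)" for k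
  have u: "bm (u k)" for k unfolding u_def using f b by (intro conv_bm bm_sc)
  define v where "v k = conv (u k) (sc k ?ka')" for k
  have v: "bm (v k)" for k unfolding v_def using u b by (intro conv_bm bm_sc)
  define S where "S x = (\<Sum>k\<le>M. v k x)" for x
  have S: "bm S" unfolding S_def[abs_def] by (rule bm_sum) (rule v)
  let ?Q = "\<Sum>k\<le>M. ip (u k) (u k)"
  have Q: "?Q = ip f S"
  proof -
   have "ip (u k) (u k) = ip f (v k)" for k
    using conv_adjoint[OF f bm_sc[OF b(1)] u, of k k] by (simp add: u_def[symmetric] v_def sc')
   thus ?thesis using v f by (simp add: S_def[abs_def] ip_sum_right)
  qed
  have vv: "ip (v k) (v l) <= A / a ^ ?d k l * (ip (u k) (u k) + ip (u l) (u l)) / 2" for k l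
  proof -
   have "ip (v k) (v l) = ip (conv (v k) (sc l ka)) (u l)"
    using conv_adjoint[OF v bm_sc[OF b(1)] u, of k l l] by (simp add: v_def[of l] sc')
   also have "conv (v k) (sc l ka) = conv (u k) (conv (sc k ?ka') (sc l ka))"
    unfolding v_def using u b by (intro conv_assoc bm_sc)
   also have "ip (conv (u k) (conv (sc k ?ka') (sc l ka))) (u l) <=
    L1 (conv (sc k ?ka') (sc l ka)) * (ip (u k) (u k) + ip (u l) (u l)) / 2"
    using schur[OF u conv_bm[OF bm_sc[OF b(2)] bm_sc[OF b(1)]] u, of k k l l] by (rule order_trans[OF abs_ge_self])
   also have "... <= A / a ^ ?d k l * (ip (u k) (u k) + ip (u l) (u l)) / 2"
    using off[of k l] ip_self_nonneg by (intro divide_right_mono mult_right_mono add_nonneg_nonneg) auto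
   finally show ?thesis .
  qed
  have "ip S S = (\<Sum>k\<le>M. \<Sum>l\<le>M. ip (v k) (v l))"
   using v S by (simp add: S_def[abs_def] ip_sum ip_sum_right bm_sum)
  also have "... <= (\<Sum>k\<le>M. \<Sum>l\<le>M. A / a ^ ?d k l * (ip (u k) (u k) + ip (u l) (u l)) / 2)"
   by (intro sum_mono vv)
  also have "... = (\<Sum>k\<le>M. \<Sum>l\<le>M. A / a ^ ?d k l * ip (u k) (u k) / 2) + (\<Sum>k\<le>M. \<Sum>l\<le>M. A / a ^ ?d k l * ip (u l) (u l) / 2)"
   by (simp add: sum.distrib[symmetric] distrib_left add_divide_distrib)
  also have "(\<Sum>k\<le>M. \<Sum>l\<le>M. A / a ^ ?d k l * ip (u l) (u l) / 2) = (\<Sum>k\<le>M. \<Sum>l\<le>M. A / a ^ ?d k l * ip (u k) (u k) / 2)"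
   by (subst sum.swap) (intro sum.cong refl, auto)
  also have "(\<Sum>k\<le>M. \<Sum>l\<le>M. A / a ^ ?d k l * ip (u k) (u k) / 2) = (\<Sum>k\<le>M. A * ip (u k) (u k) / 2 * (\<Sum>l\<le>M. 1 / a ^ ?d k l))"
   by (simp add: sum_distrib_left mult_ac)
  also have "... <= (\<Sum>k\<le>M. A * ip (u k) (u k) / 2 * 4)"
   using A ip_self_nonneg by (intro sum_mono mult_left_mono sum_abs_diff_le) auto
  finally have SS: "ip S S <= 4 * A * ?Q"
   using \<open>(\<Sum>k\<le>M. A * ip (u k) (u k) / 2 * (\<Sum>l\<le>M. 1 / a ^ ?d k l)) <= (\<Sum>k\<le>M. A * ip (u k) (u k) / 2 * 4)\<close>
   by (simp add: sum_distrib_left sum_distrib_right mult_ac)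
  \<comment> \<open>The weight \<open>4 * A\<close> makes the first term at most \<open>?Q\<close>,
    half of which is absorbed on the left.\<close>
  have "?Q <= (ip S S / (4 * A) + 4 * A * ip f f) / 2"
   using ip_amgm[OF S f, of "4 * A"] A Q by (simp add: ip_commute)
  moreover have "ip S S / (4 * A) <= ?Q" using SS A by (simp add: field_simps)
  ultimately have "?Q <= 4 * A * ip f f" by argo
  thus "(\<Sum>k\<le>M. ip (conv f (sc k ka)) (conv f (sc k ka))) <= 4 * A * ip f f" by (simp add: u_def)
 qed (use A in simp)
qed

lemma sm_sc: "sm k et ==> sm k (sc j et)"
 unfolding sc_def[abs_def] by (intro Ck_cmult sm_dil)

lemma X_sc: "sm (Suc k) ps ==> b \<in> V 1 ==> X b (sc j ps) x = a ^ j * sc j (X b ps) x"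
 unfolding sc_def by (simp add: X_cmult[OF sm_dil] X_dil mult_ac)

lemma X_kern:
 assumes "sm (Suc (Suc k)) ps" "!!x. x \<notin> U 1 ==> ps x = 0"
 shows "kern (X b ps)"
proof -
 have "sm 1 (X b ps)" by (rule Ck_mono[OF sm_X[OF assms(1)]]) simp
 moreover have "X b ps x = 0" if "x \<notin> U 1" for x
  by (rule X_zero_off_compact[OF compact_imp_closed[OF compact_U] assms(2) that])
 ultimately show ?thesis by (simp add: kern_def)
qed

text \<open>
 The derivative is moved from the finer to the coarser kernel; both \<open>ps\<close> and
 \<open>X X ps\<close> have mean zero, so two square functions appear.
\<close>
theorem L2_bound:
 assumes ps: "sm 3 ps" "!!x. x \<notin> U 1 ==> ps x = 0" "(\<integral>x. ps x) = 0" and b: "b \<in> V 1"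
 obtains C where "C > 0" "!!M (f :: 'a => real). bm f ==>
  ip (%x. \<Sum>k\<le>M. conv f (sc k (X b ps)) x) (%x. \<Sum>k\<le>M. conv f (sc k (X b ps)) x) <= C * ip f f"
proof -
 have sm3: "sm (Suc (Suc (Suc 0))) ps" using ps(1) by (simp add: numeral_3_eq_3)
 let ?et = "X b ps" let ?th = "X b (X b ps)"
 have smet: "sm (Suc (Suc 0)) ?et" using sm_X[OF sm3] .
 have cs: "csupp ps" using ps(2) compact_U unfolding csupp_def by blast
 have kps: "kern ps" using ps(2) Ck_mono[OF sm3, of 1] by (simp add: kern_def)
 have ket: "kern ?et" using X_kern[OF sm3 ps(2)] by simp
 have kth: "kern ?th"
  using X_kern[OF smet] ket by (simp add: kern_def)
 have zth: "(\<integral>x. ?th x) = 0" by (rule integral_X[OF smet csupp_X[OF cs]])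
 have bm: "bm ps" "bm ?et" "bm ?th" using kps ket kth kern_bm by auto
 obtain C1 where C1: "C1 > 0" "!!M (f :: 'a => real). bm f ==> (\<Sum>k\<le>M. ip (conv f (sc k ps)) (conv f (sc k ps))) <= C1 * ip f f"
  using kps ps(3) by (rule square_function_bound) (rule that)
 obtain C2 where C2: "C2 > 0" "!!M (f :: 'a => real). bm f ==> (\<Sum>k\<le>M. ip (conv f (sc k ?th)) (conv f (sc k ?th))) <= C2 * ip f f"
  using kth zth by (rule square_function_bound) (rule that)
 show ?thesis
 proof (rule that[of "4 * (C1 + C2)"])
  fix M :: nat and f :: "'a => real" assume f: "bm f"
  define P where "P k = conv f (sc k ps)" for k
  define Q where "Q k = conv f (sc k ?th)" for k
  define E where "E k = conv f (sc k ?et)" for k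
  have bP: "bm (P k)" and bQ: "bm (Q k)" and bE: "bm (E k)" for k
   unfolding P_def Q_def E_def using f bm by (auto intro!: conv_bm bm_sc)
  have smE: "sm (Suc 0) (E k)" for k
   unfolding E_def by (rule sm_conv[OF f]) (rule sm_sc, rule Ck_mono[OF smet], simp)
  have smP: "sm (Suc 0) (P k)" for k
   unfolding P_def by (rule sm_conv[OF f]) (rule sm_sc, rule Ck_mono[OF sm3], simp)
  have XP: "X b (P l) x = a ^ l * E l x" for l x
  proof -
   have "X b (P l) x = conv f (X b (sc l ps)) x"
    unfolding P_def by (rule X_conv[OF f sm_sc[OF sm3]])
   also have "X b (sc l ps) = (%x. a ^ l * sc l ?et x)" using X_sc[OF sm3 b] by (intro ext)
   finally show ?thesis by (simp add: conv_cmult_right E_def)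
  qed
  have XE: "X b (E k) x = a ^ k * Q k x" for k x
  proof -
   have "X b (E k) x = conv f (X b (sc k ?et)) x"
    unfolding E_def by (rule X_conv[OF f sm_sc[OF smet]])
   also have "X b (sc k ?et) = (%x. a ^ k * sc k ?th x)" using X_sc[OF smet b] by (intro ext)
   finally show ?thesis by (simp add: conv_cmult_right Q_def)
  qed
  \<comment> \<open>Here \<open>E l\<close> is \<open>X b (P l)\<close> divided by
    \<open>a ^ l\<close>, and \<open>X b (E k)\<close> is \<open>a ^ k\<close> times
    \<open>Q k\<close>; exchanging the derivative thus gains the factor
    \<open>a ^ k / a ^ l\<close>.\<close>
  have pair: "ip (E k) (E l) <= 1 / a ^ (l - k) * (ip (Q k) (Q k) + ip (P l) (P l)) / 2" if "k <= l" for k l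
  proof -
   have csP: "csupp (P l)" using bP[of l] by (simp add: bm_def)
   have "(\<integral>x. X b (E k) x * P l x) = - (\<integral>x. E k x * X b (P l) x)"
    by (rule integral_by_parts[OF smE smP csP])
   hence "a ^ k * ip (Q k) (P l) = - (a ^ l * ip (E k) (E l))"
    by (simp add: XE XP ip_def mult.assoc) (subst mult.left_commute, simp)
   moreover have "a ^ l = a ^ k * a ^ (l - k)" using that by (simp flip: power_add)
   ultimately have "a ^ k * ip (Q k) (P l) = a ^ k * - (a ^ (l - k) * ip (E k) (E l))" by simp
   hence "ip (Q k) (P l) = - (a ^ (l - k) * ip (E k) (E l))" by (simp only: mult_cancel_left) simp
   hence "ip (E k) (E l) = - (1 / a ^ (l - k) * ip (Q k) (P l))" by (simp add: field_simps)
   also have "... = 1 / a ^ (l - k) * (- ip (Q k) (P l))" by simp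
   also have "... <= 1 / a ^ (l - k) * ((ip (Q k) (Q k) + ip (P l) (P l)) / 2)"
    using ip_amgm[OF bQ bP, of 1 k l] by (intro mult_left_mono) auto
   finally show ?thesis by simp
  qed
  let ?d = "%k l::nat. if k <= l then l - k else k - l"
  have pair': "ip (E k) (E l) <= 1 / a ^ ?d k l * (ip (Q k) (Q k) + ip (P k) (P k) + (ip (Q l) (Q l) + ip (P l) (P l))) / 2" for k l
  proof -
   have mono: "1 / a ^ n * (s + t) / 2 <= 1 / a ^ n * (s + s' + (t' + t)) / 2" if "s' >= 0" "t' >= 0" for n s t s' t'
    using that by (intro divide_right_mono mult_left_mono) auto
   show ?thesis
   proof (cases "k <= l")
    case True
    show ?thesis using order_trans[OF pair[OF True] mono] ip_self_nonneg True by simp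
   next
    case False
    hence "l <= k" by simp
    show ?thesis
     using order_trans[OF pair[OF \<open>l <= k\<close>] mono[of "ip (P l) (P l)" "ip (Q k) (Q k)"]] ip_self_nonneg False
     by (simp add: ip_commute[of "E k" "E l"] add_ac)
   qed
  qed
  define N where "N k = ip (Q k) (Q k) + ip (P k) (P k)" for k
  have N: "N k >= 0" for k using ip_self_nonneg by (simp add: N_def)
  have "ip (%x. \<Sum>k\<le>M. E k x) (%x. \<Sum>k\<le>M. E k x) = (\<Sum>k\<le>M. \<Sum>l\<le>M. ip (E k) (E l))"
   using bE by (simp add: ip_sum ip_sum_right bm_sum)
  also have "... <= (\<Sum>k\<le>M. \<Sum>l\<le>M. 1 / a ^ ?d k l * (N k + N l) / 2)"
   unfolding N_def by (intro sum_mono pair')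
  also have "... = (\<Sum>k\<le>M. \<Sum>l\<le>M. 1 / a ^ ?d k l * N k / 2) + (\<Sum>k\<le>M. \<Sum>l\<le>M. 1 / a ^ ?d k l * N l / 2)"
   by (simp add: sum.distrib[symmetric] distrib_left add_divide_distrib)
  also have "(\<Sum>k\<le>M. \<Sum>l\<le>M. 1 / a ^ ?d k l * N l / 2) = (\<Sum>k\<le>M. \<Sum>l\<le>M. 1 / a ^ ?d k l * N k / 2)"
   by (subst sum.swap) (intro sum.cong refl, auto)
  also have "(\<Sum>k\<le>M. \<Sum>l\<le>M. 1 / a ^ ?d k l * N k / 2) = (\<Sum>k\<le>M. N k / 2 * (\<Sum>l\<le>M. 1 / a ^ ?d k l))"
   by (simp add: sum_distrib_left mult_ac)
  also have "... + ... <= (\<Sum>k\<le>M. N k / 2 * 4) + (\<Sum>k\<le>M. N k / 2 * 4)"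
   using N by (intro add_mono sum_mono mult_left_mono sum_abs_diff_le) auto
  also have "... = 4 * ((\<Sum>k\<le>M. ip (Q k) (Q k)) + (\<Sum>k\<le>M. ip (P k) (P k)))"
   by (simp add: N_def sum.distrib sum_distrib_left add_divide_distrib)
  also have "... <= 4 * (C2 * ip f f + C1 * ip f f)"
   unfolding P_def Q_def by (intro mult_left_mono add_mono C1 C2 f) auto
  finally show "ip (%x. \<Sum>k\<le>M. conv f (sc k (X b ps)) x) (%x. \<Sum>k\<le>M. conv f (sc k (X b ps)) x) <= 4 * (C1 + C2) * ip f f"
   by (simp add: E_def algebra_simps)
 qed (use C1 C2 in simp)
qed

end

section \<open>The weak type estimate\<close>

text \<open>Greedy selection, level by level, of a maximal disjoint subfamily.\<close>
lemma vitali_select: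
 fixes J :: "'x => nat" and B :: "'x => 'y set"
 assumes bound: "!!Z. finite Z ==> Z \<subseteq> E ==> disjoint_family_on B Z ==> card Z <= N"
  and ne: "!!x. x \<in> E ==> B x ~= {}"
 shows "\<exists>Z. finite Z \<and> Z \<subseteq> {x\<in>E. J x < n} \<and> disjoint_family_on B Z \<and>
  (\<forall>y\<in>E. J y < n --> (\<exists>z\<in>Z. J z <= J y \<and> B z \<inter> B y ~= {}))"
proof (induction n)
 case 0
 show ?case by (intro exI[of _ "{}"]) (simp add: disjoint_family_on_def)
next
 case (Suc n)
 then obtain Z where Z: "finite Z" "Z \<subseteq> {x\<in>E. J x < n}" "disjoint_family_on B Z"
  "!!y. y \<in> E ==> J y < n ==> \<exists>z\<in>Z. J z <= J y \<and> B z \<inter> B y ~= {}" by blast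
 define P where "P Z' \<longleftrightarrow> finite Z' \<and> Z \<subseteq> Z' \<and> Z' \<subseteq> {x\<in>E. J x < Suc n} \<and> disjoint_family_on B Z'" for Z'
 have PZ: "P Z" using Z by (auto simp: P_def)
 have "card Z' < Suc N" if "P Z'" for Z'
  using that by (auto simp: P_def less_Suc_eq_le intro!: bound)
 \<comment> \<open>A family of largest cardinality is maximal; it exists because disjoint families
   have bounded cardinality.\<close>
 hence "\<exists>Z'. P Z' \<and> (\<forall>Y. P Y --> card Y <= card Z')"
  by (intro ex_has_greatest_nat[of P Z card "Suc N", OF PZ]) simp
 then obtain Z' where Z': "P Z'" "!!Y. P Y ==> card Y <= card Z'" by auto
 have "\<exists>z\<in>Z'. J z <= J y \<and> B z \<inter> B y ~= {}" if y: "y \<in> E" "J y < Suc n" for y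
 proof (cases "J y < n")
  case True
  thus ?thesis using Z(4)[OF y(1)] Z'(1) unfolding P_def by blast
 next
  case False
  hence le: "J z <= J y" if "z \<in> Z'" for z using that y Z'(1) by (auto simp: P_def)
  show ?thesis
  proof (rule ccontr)
   assume "\<not> ?thesis"
   hence *: "B z \<inter> B y = {}" if "z \<in> Z'" for z using le that by blast
   hence yZ: "y \<notin> Z'" using ne[OF y(1)] by auto
   have "disjoint_family_on B (insert y Z')"
    using * Z'(1) yZ by (auto simp: P_def disjoint_family_on_insert)
   hence "P (insert y Z')" using Z'(1) y by (auto simp: P_def)
   thus False using Z'(2)[of "insert y Z'"] Z'(1) yZ by (simp add: P_def)
  qed
 qed
 thus ?case using Z'(1) by (intro exI[of _ Z']) (auto simp: P_def)
qed

context dilation_base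
begin

lemma bl_eq: "bl z r = (\<odot>) z ` U r"
 unfolding bl_def by (auto intro: image_eqI[where x = "(- z) \<odot> x" for x])

lemma compact_bl: "compact (bl z r)"
 unfolding bl_eq by (intro homeomorphic_images compact_U)

lemma bl_borel [measurable, simp]: "bl z r \<in> sets borel"
 using compact_bl by (simp add: compact_imp_closed)

lemma U_borel [measurable, simp]: "U r \<in> sets borel"
 using compact_U by (simp add: compact_imp_closed)

lemma measure_bl: "measure \<nu> (bl z r) = measure \<nu> (U r)"
 unfolding bl_eq measure_def by (subst left_invariant_emeasure[OF left_invariant_haar]) auto

lemma measure_U_mult: "r > 0 ==> measure \<nu> (U (a * r)) = vol a * measure \<nu> (U r)"
proof -
 assume r: "r > 0"
 have "U (a * r) = dil a ` U r"
 proof (intro equalityI subsetI)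
  fix x assume "x \<in> U (a * r)"
  hence "dil (1 / a) x \<in> U r" using r by (simp add: U_dil mult.commute)
  thus "x \<in> dil a ` U r" by (intro image_eqI[where x = "dil (1 / a) x"]) auto
 qed (use r in \<open>auto simp: U_dil\<close>)
 thus ?thesis unfolding measure_def by (simp add: emeasure_dil enn2real_mult)
qed

lemma measure_U_pos: "r > 0 ==> measure \<nu> (U r) > 0"
proof -
 assume "r > 0"
 then obtain e where e: "e > 0" "ball 0 e \<subseteq> U r" by (rule U_nbhd)
 have "0 < emeasure \<nu> (ball 0 e)" using e by (intro haar_open_pos) auto
 also have "... <= emeasure \<nu> (U r)" by (intro emeasure_mono e) simp
 finally show ?thesis using emeasure_haar_compact[OF compact_U, of r] by (simp add: measure_def enn2real_positive_iff)
qed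

lemma bl_mono: "0 <= r ==> r <= s ==> bl z r \<subseteq> bl z s"
 unfolding bl_def using U_mono[of r s] by auto

lemma center_bl [simp]: "r >= 0 ==> z \<in> bl z r"
 by (simp add: bl_def)

lemma measure_U_power: "measure \<nu> (U (1 / a ^ n)) = vol a * measure \<nu> (U (1 / a ^ Suc n))"
 using measure_U_mult[of "1 / a ^ Suc n"] by simp

lemma measure_U_antimono: "i <= j ==> measure \<nu> (U (1 / a ^ j)) <= measure \<nu> (U (1 / a ^ i))"
 using emeasure_haar_compact[OF compact_U] compact_U
 by (intro measure_mono_fmeasurable U_mono fmeasurableI divide_left_mono power_increasing) auto

lemma bm_bl: "bm (indicator (bl z r))"
 by (rule bm_indicator[OF bl_borel compact_bl subset_refl])

lemma integral_indicator_bl [simp]: "(\<integral>x. indicator (bl z r) x) = measure \<nu> (U r)"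
 by (simp add: measure_bl)

lemma small_power:
 assumes "e > 0" obtains n where "1 / a ^ n < e"
proof -
 obtain n where "(1 / 2) ^ n < e" using real_arch_pow_inv[OF assms, of "1 / 2"] by auto
 moreover have "1 / a ^ n <= (1 / 2) ^ n"
  using power_mono[of "1 / a" "1 / 2" n] a2 by (simp add: power_divide divide_simps)
 ultimately show ?thesis using that[of n] by simp
qed

lemma U_small: assumes "e > 0" obtains n where "!!k x. k >= n ==> x \<in> U (1 / a ^ k) ==> norm x < e"
proof -
 obtain n where n: "1 / a ^ n < e / (real (step G) + 1)" using small_power[of "e / (real (step G) + 1)"] assms by auto
 show ?thesis
 proof (rule that[of n])
  fix k x assume k: "k >= n" and "x \<in> U (1 / a ^ k)"
  hence "norm x <= real (step G) * (1 / a ^ k)" by (intro norm_U) auto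
  also have "... <= (real (step G) + 1) * (1 / a ^ n)"
   using k by (intro mult_mono divide_left_mono power_increasing) auto
  also have "... < e" using n by (simp add: field_simps)
  finally show "norm x < e" .
 qed
qed

lemma uniform_right:
 assumes g: "cont (g :: 'a => real)" "csupp g" and e: "e > 0"
 obtains n where "!!x u. u \<in> U (1 / a ^ n) ==> \<bar>g (x \<odot> u) - g x\<bar> < e"
proof -
 obtain K where K: "compact K" "!!x. x \<notin> K ==> g x = 0" using g(2) by (rule csuppE) (rule that)
 let ?L = "(%z. fst z \<odot> (- snd z)) ` (K \<times> U 1)"
 have L: "compact ?L" by (intro compact_continuous_image continuous_intros compact_Times K compact_U)
 have inL: "x \<in> ?L" if "x \<odot> u \<in> K" "u \<in> U 1" for x u
  by (rule image_eqI[where x = "(x \<odot> u, u)"]) (use that in auto)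
 have "cont (%z. g (snd z \<odot> fst z))"
  by (rule continuous_on_compose2[OF g(1)]) (intro continuous_intros, simp)
 then obtain d where d: "d > 0" "!!u x. dist u 0 < d ==> x \<in> ?L ==> \<bar>g (x \<odot> u) - g (x \<odot> 0)\<bar> < e"
  using L e by (rule uniform_in_parameter) (rule that)
 obtain n where n: "!!k x. k >= n ==> x \<in> U (1 / a ^ k) ==> norm x < d" using d(1) by (rule U_small) (rule that)
 show ?thesis
 proof (rule that[of n])
  fix x u assume u: "u \<in> U (1 / a ^ n)"
  have u1: "u \<in> U 1" using u U_mono[of "1 / a ^ n" 1] by auto
  show "\<bar>g (x \<odot> u) - g x\<bar> < e"
  proof (cases "x \<in> ?L")
   case True
   thus ?thesis using d(2)[of u x] n[OF order_refl u] by simp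
  next
   case False
   hence "x \<odot> u \<notin> K" "x \<notin> K" using inL[of x u] inL[of x 0] u1 by auto
   thus ?thesis using K(2) e by simp
  qed
 qed
qed

text \<open>
 The enlarged maximal balls that cover the bad set may overlap, so \<open>g\<close> is split by the
 weights \<open>h\<close> instead of by a partition.
\<close>
lemma calderon_zygmund:
 assumes g: "cont g" "csupp g" and al: "al > 0" "L1 g <= al * measure \<nu> (U 1)"
 obtains Z n good b where "finite Z" "bm good" "!!x. \<bar>good x\<bar> <= (vol a + 2) * al" "L1 good <= L1 g"
  "!!z. z \<in> Z ==> bm (b z)" "!!z. z \<in> Z ==> (\<integral>x. b z x) = 0"
  "!!z y. b z y ~= 0 ==> y \<in> bl z (1 / a ^ n z)"
  "!!x. g x = good x + (\<Sum>z\<in>Z. b z x)" "(\<Sum>z\<in>Z. L1 (b z)) <= 2 * L1 g"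
  "(\<Sum>z\<in>Z. measure \<nu> (U (1 / a ^ n z))) <= vol a * L1 g / al"
proof -
 have bg: "bm g" using g by (rule bm_continuous)
 have [measurable]: "g \<in> Borel" using bg by (rule bm_measurable)
 define v where "v j = measure \<nu> (U (1 / a ^ j))" for j :: nat
 have v_pos: "v j > 0" for j by (simp add: v_def measure_U_pos)
 have v_Suc: "v j = vol a * v (Suc j)" for j unfolding v_def by (rule measure_U_power)
 define N where "N j x = (\<integral>y. \<bar>g y\<bar> * indicator (bl x (1 / a ^ j)) y)" for j x
 have bgi: "bm (%y. \<bar>g y\<bar> * indicator (bl x r) y)" for x r by (intro bm_mult bm_abs bg bm_bl)
 \<comment> \<open>Below this scale \<open>g\<close> varies by less than \<open>al\<close>. Stopping
   the search there leaves finitely many scales, and off the bad set it gives \<open>2 * al\<close>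
   as a pointwise bound of the continuous function \<open>g\<close>.\<close>
 obtain m where m: "!!x u. u \<in> U (1 / a ^ m) ==> \<bar>g (x \<odot> u) - g x\<bar> < al"
  using g al(1) by (rule uniform_right) (rule that)
 define E where "E = {x. \<exists>i<m. N (Suc i) x > al * v (Suc i)}"
 \<comment> \<open>The ball of index \<open>Suc (n x)\<close> is the largest bad one, so the mean
   over the ball of index \<open>n x\<close> is at most \<open>al\<close>. For
   \<open>n x = 0\<close> this is the hypothesis on \<open>L1 g\<close>.\<close>
 define n where "n x = (LEAST i. N (Suc i) x > al * v (Suc i))" for x
 have n: "n x < m" "N (Suc (n x)) x > al * v (Suc (n x))" "N (n x) x <= al * v (n x)" if xE: "x \<in> E" for x
 proof -
  obtain i where i: "i < m" "N (Suc i) x > al * v (Suc i)" using xE unfolding E_def by blast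
  show "N (Suc (n x)) x > al * v (Suc (n x))" unfolding n_def using i(2) by (rule LeastI)
  show "n x < m" using Least_le[of "%i. N (Suc i) x > al * v (Suc i)", OF i(2)] i(1) by (simp add: n_def)
  show "N (n x) x <= al * v (n x)"
  proof (cases "n x")
   case 0
   have "N 0 x <= L1 g" unfolding N_def L1_def
    by (intro Bochner_Integration.integral_mono bm_integrable bgi bm_abs bg) (auto simp: indicator_def)
   thus ?thesis using al 0 by (simp add: v_def)
  next
   case (Suc j)
   thus ?thesis using not_less_Least[of j "%i. N (Suc i) x > al * v (Suc i)"] by (simp add: n_def not_less)
  qed
 qed
 have small: "\<bar>g x\<bar> <= 2 * al" if "x \<notin> E" for x
 proof -
  have Nm: "N m x <= al * v m"
  proof (cases m)
   case 0
   have "N 0 x <= L1 g" unfolding N_def L1_def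
    by (intro Bochner_Integration.integral_mono bm_integrable bgi bm_abs bg) (auto simp: indicator_def)
   thus ?thesis using al 0 by (simp add: v_def)
  next
   case (Suc j)
   have "\<not> (j < m \<and> N (Suc j) x > al * v (Suc j))" using that unfolding E_def by blast
   thus ?thesis using Suc by simp
  qed
  have "(\<integral>y. (\<bar>g x\<bar> - al) * indicator (bl x (1 / a ^ m)) y) <= N m x"
   unfolding N_def
  proof (intro Bochner_Integration.integral_mono bm_integrable bgi bm_cmult bm_bl)
   fix y
   show "(\<bar>g x\<bar> - al) * indicator (bl x (1 / a ^ m)) y <= \<bar>g y\<bar> * indicator (bl x (1 / a ^ m)) y"
    using m[of "(- x) \<odot> y" x] by (auto simp: indicator_def bl_def)
  qed
  hence "(\<bar>g x\<bar> - al) * v m <= al * v m" using Nm by (simp add: v_def measure_bl)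
  thus ?thesis using v_pos[of m] by simp
 qed
 define B where "B z = bl z (1 / a ^ Suc (n z))" for z
 define W where "W z = bl z (1 / a ^ n z)" for z
 have [measurable]: "B z \<in> sets borel" "W z \<in> sets borel" for z by (simp_all add: B_def W_def)
 have sumv: "(\<Sum>z\<in>Z. al * v (Suc (n z))) <= L1 g" if Z: "finite Z" "Z \<subseteq> E" "disjoint_family_on B Z" for Z
 proof -
  have "(\<Sum>z\<in>Z. al * v (Suc (n z))) <= (\<Sum>z\<in>Z. N (Suc (n z)) z)"
   using n(2) Z(2) by (intro sum_mono) (auto intro: less_imp_le)
  also have "... = (\<integral>y. (\<Sum>z\<in>Z. \<bar>g y\<bar> * indicator (B z) y))"
   unfolding N_def B_def by (intro Bochner_Integration.integral_sum[symmetric] bm_integrable bgi)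
  also have "... = (\<integral>y. \<bar>g y\<bar> * indicator (\<Union>z\<in>Z. B z) y)"
   using Z by (simp add: indicator_UN_disjoint sum_distrib_left)
  also have "... <= L1 g" unfolding L1_def
   by (rule Bochner_Integration.integral_mono'[OF bm_integrable[OF bm_abs[OF bg]]]) (auto simp: indicator_def)
  finally show ?thesis .
 qed
 have card: "card Z <= nat \<lceil>L1 g / (al * v m)\<rceil>" if Z: "finite Z" "Z \<subseteq> E" "disjoint_family_on B Z" for Z
 proof -
  have "real (card Z) * (al * v m) = (\<Sum>z\<in>Z. al * v m)" by simp
  also have "... <= (\<Sum>z\<in>Z. al * v (Suc (n z)))"
   using Z(2) n(1) al unfolding v_def by (intro sum_mono mult_left_mono measure_U_antimono) (auto simp: Suc_le_eq)
  also have "... <= L1 g" by (rule sumv[OF Z])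
  finally have "real (card Z) <= L1 g / (al * v m)" using al v_pos[of m] by (simp add: pos_le_divide_eq)
  thus ?thesis by linarith
 qed
 have ne: "B x ~= {}" for x
 proof -
  have "x \<in> B x" unfolding B_def by (rule center_bl) simp
  thus ?thesis by blast
 qed
 have "\<exists>Z. finite Z \<and> Z \<subseteq> {x\<in>E. n x < m} \<and> disjoint_family_on B Z \<and>
  (\<forall>y\<in>E. n y < m --> (\<exists>z\<in>Z. n z <= n y \<and> B z \<inter> B y ~= {}))"
  by (rule vitali_select[where N = "nat \<lceil>L1 g / (al * v m)\<rceil>"]) (rule card, assumption+, rule ne)
 then obtain Z where Z: "finite Z" "Z \<subseteq> {x\<in>E. n x < m}" "disjoint_family_on B Z"
  "!!y. y \<in> E ==> n y < m ==> \<exists>z\<in>Z. n z <= n y \<and> B z \<inter> B y ~= {}"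
  by blast
 have ZE: "Z \<subseteq> E" using Z(2) by auto
 have cover: "\<exists>z\<in>Z. y \<in> W z" if yE: "y \<in> E" for y
 proof -
  obtain z x where z: "z \<in> Z" "n z <= n y" "x \<in> B z" "x \<in> B y" using Z(4)[OF yE n(1)[OF yE]] by auto
  let ?r = "1 / a ^ Suc (n z)"
  have "(- z) \<odot> x \<in> U ?r" using z by (simp add: B_def bl_def)
  moreover have "- ((- y) \<odot> x) \<in> U ?r"
   using bl_mono[of "1 / a ^ Suc (n y)" ?r y] z by (auto simp: B_def bl_def divide_left_mono power_increasing simp del: power_Suc)
  ultimately have "((- z) \<odot> x) \<odot> (- ((- y) \<odot> x)) \<in> U (a * ?r)" by (intro U2) auto
  moreover have "((- z) \<odot> x) \<odot> (- ((- y) \<odot> x)) = (- z) \<odot> y"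
   by (simp add: minus_mul mul_assoc)
  ultimately show ?thesis using z(1) by (auto simp: W_def bl_def)
 qed
 define cnt where "cnt x = (\<Sum>z\<in>Z. indicator (W z) x :: real)" for x
 define h where "h z x = indicator (W z) x / cnt x" for z x
 have cnt1: "cnt x >= 1" if "z \<in> Z" "x \<in> W z" for z x
  using member_le_sum[of z Z "%z. indicator (W z) x :: real"] that Z(1) by (simp add: cnt_def)
 have cnt0: "cnt x >= 0" for x by (simp add: cnt_def sum_nonneg)
 have sumh: "(\<Sum>z\<in>Z. h z x) = (if cnt x = 0 then 0 else 1)" for x
  by (simp add: h_def cnt_def flip: sum_divide_distrib)
 have h0: "h z x >= 0" for z x using cnt0 by (simp add: h_def)
 have h1: "h z x <= indicator (W z) x" if "z \<in> Z" for z x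
  using cnt1[OF that, of x] by (cases "x \<in> W z") (auto simp: h_def)
 have [measurable]: "cnt \<in> Borel" unfolding cnt_def[abs_def] by measurable
 have [measurable]: "h z \<in> Borel" for z unfolding h_def[abs_def] by measurable
 have habs: "\<bar>h z x\<bar> <= 1" if "z \<in> Z" for z x
  using h0[of z x] h1[OF that, of x] by (cases "x \<in> W z") auto
 have bgh: "bm (%x. g x * h z x)" if "z \<in> Z" for z
  by (rule bm_mult_bounded[OF bg, of _ 1]) (use habs[OF that] in auto)
 define p where "p z = (\<integral>x. g x * h z x)" for z
 define q where "q z = (\<integral>x. \<bar>g x\<bar> * h z x)" for z
 have bgh': "bm (%x. \<bar>g x\<bar> * h z x)" if "z \<in> Z" for z
  by (rule bm_mult_bounded[OF bm_abs[OF bg], of _ 1]) (use habs[OF that] in auto)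
 have pq: "\<bar>p z\<bar> <= q z" for z
  using integral_abs_bound[of \<nu> "%x. g x * h z x"] h0 by (simp add: p_def q_def abs_mult)
 have q: "q z <= vol a * al * v (Suc (n z))" if "z \<in> Z" for z
 proof -
  have "q z <= N (n z) z" unfolding q_def N_def
  proof (intro Bochner_Integration.integral_mono bm_integrable bgi bgh'[OF that])
   fix x show "\<bar>g x\<bar> * h z x <= \<bar>g x\<bar> * indicator (bl z (1 / a ^ n z)) x"
    using h1[OF that, of x] by (intro mult_left_mono) (auto simp: W_def)
  qed
  also have "... <= al * v (n z)" using n(3) that ZE by auto
  also have "... = vol a * al * v (Suc (n z))" by (simp add: v_Suc[of "n z"])
  finally show ?thesis .
 qed
 \<comment> \<open>The integral \<open>p z\<close> is spread evenly over the small ball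
   \<open>B z\<close>. These balls are disjoint, so the corrections do not accumulate in
   \<open>good\<close>.\<close>
 define c where "c z = p z / v (Suc (n z))" for z
 have c: "\<bar>c z\<bar> <= vol a * al" if "z \<in> Z" for z
  using order_trans[OF pq q[OF that]] v_pos[of "Suc (n z)"] by (simp add: c_def abs_divide pos_divide_le_eq)
 define good where "good x = g x * (1 - (\<Sum>z\<in>Z. h z x)) + (\<Sum>z\<in>Z. c z * indicator (B z) x)" for x
 define b where "b z x = g x * h z x - c z * indicator (B z) x" for z x
 have bmB: "bm (%x. c z * indicator (B z) x)" for z unfolding B_def by (intro bm_cmult bm_bl)
 have bg1: "bm (%x. g x * (1 - (\<Sum>z\<in>Z. h z x)))"
  by (rule bm_mult_bounded[OF bg, of _ 1]) (auto simp: sumh)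
 have B_int: "(\<integral>x. c z * indicator (B z) x) = p z" for z
  using v_pos[of "Suc (n z)"] by (simp add: B_def c_def v_def measure_bl)
 show ?thesis
 proof (rule that[of Z good b n])
  show "finite Z" by (rule Z)
  show bgood: "bm good" unfolding good_def[abs_def] by (intro bm_add bg1 bm_sum bmB)
  show "\<bar>good x\<bar> <= (vol a + 2) * al" for x
  proof -
   have "\<bar>g x * (1 - (\<Sum>z\<in>Z. h z x))\<bar> <= 2 * al"
   proof (cases "cnt x = 0")
    case True
    have "x \<notin> E"
    proof
     assume "x \<in> E"
     then obtain z where "z \<in> Z" "x \<in> W z" using cover by auto
     thus False using cnt1[of z x] True by simp
    qed
    thus ?thesis using small[of x] True by (simp add: sumh)
   qed (use al in \<open>simp add: sumh\<close>)
   moreover have "\<bar>\<Sum>z\<in>Z. c z * indicator (B z) x\<bar> <= vol a * al"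
   proof -
    have "\<bar>\<Sum>z\<in>Z. c z * indicator (B z) x\<bar> <= (\<Sum>z\<in>Z. vol a * al * indicator (B z) x)"
     using c by (intro order_trans[OF sum_abs] sum_mono) (auto simp: abs_mult intro!: mult_right_mono)
    also have "... = vol a * al * indicator (\<Union>z\<in>Z. B z) x"
     using Z by (simp add: indicator_UN_disjoint sum_distrib_left)
    also have "... <= vol a * al" using al by (simp add: indicator_def)
    finally show ?thesis .
   qed
   ultimately have "\<bar>good x\<bar> <= 2 * al + vol a * al"
    unfolding good_def by (intro order_trans[OF abs_triangle_ineq] add_mono)
   thus ?thesis by (simp add: algebra_simps)
  qed
  have Bi: "(\<integral>x. \<bar>c z * indicator (B z) x\<bar>) = \<bar>p z\<bar>" for z
   using v_pos[of "Suc (n z)"] by (simp add: B_def c_def v_def measure_bl abs_mult)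
  show "L1 good <= L1 g"
  proof -
   have "L1 good <= (\<integral>x. \<bar>g x\<bar> * (1 - (\<Sum>z\<in>Z. h z x)) + (\<Sum>z\<in>Z. \<bar>c z * indicator (B z) x\<bar>))"
    unfolding L1_def
   proof (rule Bochner_Integration.integral_mono)
    show "integrable \<nu> (%x. \<bar>good x\<bar>)" by (intro bm_integrable bm_abs bgood)
    show "integrable \<nu> (%x. \<bar>g x\<bar> * (1 - (\<Sum>z\<in>Z. h z x)) + (\<Sum>z\<in>Z. \<bar>c z * indicator (B z) x\<bar>))"
     by (intro bm_integrable bm_add bm_sum bm_abs bmB bm_mult_bounded[OF bm_abs[OF bg], of _ 1]) (auto simp: sumh)
    show "\<bar>good x\<bar> <= \<bar>g x\<bar> * (1 - (\<Sum>z\<in>Z. h z x)) + (\<Sum>z\<in>Z. \<bar>c z * indicator (B z) x\<bar>)" for x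
     unfolding good_def
     by (intro order_trans[OF abs_triangle_ineq] add_mono sum_abs) (simp add: abs_mult sumh)
   qed
   also have "... = (\<integral>x. \<bar>g x\<bar> - (\<Sum>z\<in>Z. \<bar>g x\<bar> * h z x) + (\<Sum>z\<in>Z. \<bar>c z * indicator (B z) x\<bar>))"
    by (simp add: right_diff_distrib sum_distrib_left)
   also have "... = L1 g - (\<Sum>z\<in>Z. q z) + (\<Sum>z\<in>Z. \<bar>p z\<bar>)"
    unfolding Bi[symmetric] q_def L1_def using bm_integrable[OF bgh'] bm_integrable[OF bm_abs[OF bg]] bm_integrable[OF bm_abs[OF bmB]]
    by (subst Bochner_Integration.integral_add, simp, simp, subst Bochner_Integration.integral_diff, simp, simp)
     (simp add: Bochner_Integration.integral_sum)
   also have "... <= L1 g" using sum_mono[of Z "%z. \<bar>p z\<bar>" q] pq by simp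
   finally show ?thesis .
  qed
  show bb: "bm (b z)" if "z \<in> Z" for z unfolding b_def[abs_def] by (intro bm_diff bgh that bmB)
  show "(\<integral>x. b z x) = 0" if "z \<in> Z" for z
   unfolding b_def using bm_integrable[OF bgh[OF that]] bm_integrable[OF bmB] B_int[of z]
   by (subst Bochner_Integration.integral_diff) (auto simp: p_def)
  show "y \<in> bl z (1 / a ^ n z)" if "b z y ~= 0" for z y
  proof (rule ccontr)
   assume y: "y \<notin> bl z (1 / a ^ n z)"
   have "B z \<subseteq> W z" unfolding B_def W_def by (rule bl_mono) (auto simp: divide_simps)
   hence "y \<notin> B z" "y \<notin> W z" using y by (auto simp: W_def)
   thus False using that by (simp add: b_def h_def)
  qed
  show "g x = good x + (\<Sum>z\<in>Z. b z x)" for x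
   by (simp add: good_def b_def sum_subtractf algebra_simps sum_distrib_left)
  show "(\<Sum>z\<in>Z. L1 (b z)) <= 2 * L1 g"
  proof -
   have "L1 (b z) <= 2 * q z" if "z \<in> Z" for z
   proof -
    have "L1 (b z) <= (\<integral>x. \<bar>g x\<bar> * h z x + \<bar>c z * indicator (B z) x\<bar>)"
     unfolding L1_def
    proof (rule Bochner_Integration.integral_mono)
     show "integrable \<nu> (%x. \<bar>b z x\<bar>)" by (intro bm_integrable bm_abs bb that)
     show "integrable \<nu> (%x. \<bar>g x\<bar> * h z x + \<bar>c z * indicator (B z) x\<bar>)"
      by (intro bm_integrable bm_add bm_abs bmB bgh' that)
     show "\<bar>b z x\<bar> <= \<bar>g x\<bar> * h z x + \<bar>c z * indicator (B z) x\<bar>" for x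
      unfolding b_def using h0[of z x] by (intro order_trans[OF abs_triangle_ineq4]) (simp add: abs_mult)
    qed
    also have "... = q z + \<bar>p z\<bar>"
     using bm_integrable[OF bgh'[OF that]] bm_integrable[OF bm_abs[OF bmB]] Bi[of z]
     by (subst Bochner_Integration.integral_add) (auto simp: q_def)
    also have "... <= 2 * q z" using pq[of z] by simp
    finally show ?thesis .
   qed
   hence "(\<Sum>z\<in>Z. L1 (b z)) <= 2 * (\<Sum>z\<in>Z. q z)" by (simp add: sum_distrib_left sum_mono)
   also have "(\<Sum>z\<in>Z. q z) = (\<integral>x. (\<Sum>z\<in>Z. \<bar>g x\<bar> * h z x))"
    unfolding q_def by (intro Bochner_Integration.integral_sum[symmetric] bm_integrable bgh')
   also have "... <= L1 g" unfolding L1_def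
    by (rule Bochner_Integration.integral_mono'[OF bm_integrable[OF bm_abs[OF bg]]])
     (auto simp: sumh simp flip: sum_distrib_left)
   finally show ?thesis by simp
  qed
  have "al * (\<Sum>z\<in>Z. v (n z)) = vol a * (\<Sum>z\<in>Z. al * v (Suc (n z)))"
   by (subst v_Suc) (simp add: sum_distrib_left mult_ac)
  also have "... <= vol a * L1 g" using sumv[OF Z(1) ZE Z(3)] by (intro mult_left_mono) auto
  finally show "(\<Sum>z\<in>Z. measure \<nu> (U (1 / a ^ n z))) <= vol a * L1 g / al"
   using al by (simp add: v_def pos_le_divide_eq mult.commute)
 qed
qed

text \<open>Convolution with \<open>\<Sum>k\<le>M. sc k ka\<close>, a singular kernel truncated at
  the scale \<open>1 / a ^ M\<close>. All bounds have to be uniform in \<open>M\<close>.\<close>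

definition osc :: "('a => real) => nat => ('a => real) => 'a => real" where
 "osc ka M f x = (\<Sum>k\<le>M. conv f (sc k ka) x)"

lemma bm_osc: "bm f ==> bm ka ==> bm (osc ka M f)"
 unfolding osc_def[abs_def] by (intro bm_sum conv_bm bm_sc)

lemma markov:
 assumes "bm h" "!!x. h x >= 0" "c > 0"
 shows "measure \<nu> {x. h x > c} <= (\<integral>x. h x) / c"
proof -
 have [measurable]: "h \<in> Borel" using assms by (simp add: bm_measurable)
 have m: "{x. h x >= c} \<in> sets \<nu>" by simp
 have int: "integrable \<nu> h" using assms(1) by (rule bm_integrable)
 have "emeasure \<nu> {x\<in>space \<nu>. h x >= c} <= ennreal (1 / c * (\<integral>x. h x))"
  by (rule integral_Markov_inequality[OF int]) (use assms in auto)
 hence "{x. h x >= c} \<in> fmeasurable \<nu>"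
  using m by (intro fmeasurableI) (auto intro: le_less_trans)
 hence "measure \<nu> {x. h x > c} <= measure \<nu> {x. h x >= c}"
  by (intro measure_mono_fmeasurable) auto
 also have "... <= (\<integral>x. h x) / c"
  using integral_Markov_inequality_measure[OF int m] assms(2,3) by simp
 finally show ?thesis .
qed

text \<open>The good part is handled by the quadratic bound and Markov's inequality. Outside the
  enlarged ball a bad piece \<open>b z\<close> meets no kernel of a scale up to its own radius,
  since the kernels have compact support; the coarser scales gain a geometric factor from its mean
  zero.\<close>

theorem weak_type:
 assumes ka: "kern ka" and A: "A > 0" "!!M (f :: 'a => real). bm f ==> ip (osc ka M f) (osc ka M f) <= A * ip f f"
 obtains C where "C > 0" "!!M g al. cont g ==> csupp g ==> al > 0 ==> L1 g <= al * measure \<nu> (U 1) ==>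
  measure \<nu> {x. \<bar>osc ka M g x\<bar> > al} <= C * L1 g / al"
proof -
 obtain C where C: "C >= 0" "!!w z n k. bm w ==> (\<integral>x. w x) = 0 ==> (\<forall>y. w y ~= 0 --> y \<in> bl z (1 / a ^ n)) ==>
  k <= n ==> L1 (conv w (sc k ka)) <= C / a ^ (n - k) * L1 w"
  using ka by (rule L1_conv_mean_zero) (rule that)
 have bka: "bm ka" using ka by (rule kern_bm)
 let ?D = "vol a"
 show ?thesis
 proof (rule that[of "4 * A * (?D + 2) + ?D * ?D + 8 * C + 1"])
  show "4 * A * (?D + 2) + ?D * ?D + 8 * C + 1 > 0" using A C by (intro add_nonneg_pos add_nonneg_nonneg mult_nonneg_nonneg) auto
  fix M g al assume g: "cont g" "csupp g" and al: "al > 0" "L1 g <= al * measure \<nu> (U 1)"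
  obtain Z n good b where Z: "finite Z" and good: "bm good" "!!x. \<bar>good x\<bar> <= (?D + 2) * al" "L1 good <= L1 g"
   and b: "!!z. z \<in> Z ==> bm (b z)" "!!z. z \<in> Z ==> (\<integral>x. b z x) = 0"
    "!!z y. b z y ~= 0 ==> y \<in> bl z (1 / a ^ n z)"
   and split: "!!x. g x = good x + (\<Sum>z\<in>Z. b z x)" and Lb: "(\<Sum>z\<in>Z. L1 (b z)) <= 2 * L1 g"
   and vb: "(\<Sum>z\<in>Z. measure \<nu> (U (1 / a ^ n z))) <= ?D * L1 g / al"
   using g al by (rule calderon_zygmund) (rule that)
  have bg: "bm g" using g by (rule bm_continuous)
  define \<Omega> where "\<Omega> = (\<Union>z\<in>Z. bl z (a * (1 / a ^ n z)))"
  define I where "I z = {..M} \<inter> {..<n z}" for z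
  define H where "H x = (\<Sum>z\<in>Z. \<Sum>k\<in>I z. \<bar>conv (b z) (sc k ka) x\<bar>)" for x
  have bH: "bm H" unfolding H_def[abs_def] by (intro bm_sum bm_abs conv_bm b bm_sc bka)
  have H0: "H x >= 0" for x by (simp add: H_def sum_nonneg)
  have far: "conv (b z) (sc k ka) x = 0" if z: "z \<in> Z" "k >= n z" "x \<notin> \<Omega>" for z k x
  proof (rule conv_zero)
   fix y assume "b z y ~= 0"
   hence y: "(- z) \<odot> y \<in> U (1 / a ^ n z)" using b(3) by (simp add: bl_def)
   show "sc k ka ((- y) \<odot> x) = 0"
   proof (rule ccontr)
    assume "sc k ka ((- y) \<odot> x) ~= 0"
    hence "(- y) \<odot> x \<in> U (1 / a ^ k)" using ka by (intro sc_support)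
    hence "(- y) \<odot> x \<in> U (1 / a ^ n z)"
     using U_mono[of "1 / a ^ k" "1 / a ^ n z"] z(2) by (auto simp: divide_left_mono power_increasing)
    hence "((- z) \<odot> y) \<odot> ((- y) \<odot> x) \<in> U (a * (1 / a ^ n z))" using y by (intro U2) auto
    hence "x \<in> \<Omega>" using z(1) unfolding \<Omega>_def by (auto simp: bl_def mul_assoc)
    thus False using z(3) by simp
   qed
  qed
  have dec: "\<bar>osc ka M g x\<bar> <= \<bar>osc ka M good x\<bar> + H x" if x: "x \<notin> \<Omega>" for x
  proof -
   have "conv g (sc k ka) x = conv good (sc k ka) x + (\<Sum>z\<in>Z. conv (b z) (sc k ka) x)" for k
   proof -
    have "conv g (sc k ka) x = conv (%x. good x + (\<Sum>z\<in>Z. b z x)) (sc k ka) x" using split by (simp add: conv_def)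
    also have "... = conv good (sc k ka) x + (\<Sum>z\<in>Z. conv (b z) (sc k ka) x)"
     using good(1) b(1) bka by (simp add: conv_add_left conv_sum_left bm_sum bm_sc)
    finally show ?thesis .
   qed
   hence "osc ka M g x = osc ka M good x + (\<Sum>k\<le>M. \<Sum>z\<in>Z. conv (b z) (sc k ka) x)"
    by (simp add: osc_def sum.distrib)
   also have "(\<Sum>k\<le>M. \<Sum>z\<in>Z. conv (b z) (sc k ka) x) = (\<Sum>z\<in>Z. \<Sum>k\<le>M. conv (b z) (sc k ka) x)" by (rule sum.swap)
   also have "... = (\<Sum>z\<in>Z. \<Sum>k\<in>I z. conv (b z) (sc k ka) x)"
    using far x by (intro sum.cong refl sum.mono_neutral_right) (auto simp: I_def not_less)
   finally have "\<bar>osc ka M g x\<bar> <= \<bar>osc ka M good x\<bar> + \<bar>\<Sum>z\<in>Z. \<Sum>k\<in>I z. conv (b z) (sc k ka) x\<bar>"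
    by (simp add: abs_triangle_ineq)
   also have "\<bar>\<Sum>z\<in>Z. \<Sum>k\<in>I z. conv (b z) (sc k ka) x\<bar> <= H x"
    unfolding H_def by (intro order_trans[OF sum_abs] sum_mono sum_abs)
   finally show ?thesis by simp
  qed
  have [measurable]: "osc ka M good \<in> Borel" "H \<in> Borel" "\<Omega> \<in> sets borel"
   using bm_measurable[OF bm_osc[OF good(1) bka]] bm_measurable[OF bH] Z by (auto simp: \<Omega>_def)
  let ?G = "{x. (osc ka M good x)\<^sup>2 > (al / 2)\<^sup>2}" and ?H = "{x. H x > al / 2}"
  have fin: "?G \<union> \<Omega> \<union> ?H \<in> fmeasurable \<nu>"
  proof -
   have F: "{x. h x > c} \<in> fmeasurable \<nu>" if h: "bm h" "c >= 0" for h :: "'a => real" and c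
   proof -
    obtain K where K: "compact K" "!!x. x \<notin> K ==> h x = 0" using h(1) by (rule bmE) (rule that)
    have "x \<in> K" if "h x > c" for x using K(2)[of x] h(2) that by (cases "x \<in> K") auto
    hence 1: "{x. h x > c} \<subseteq> K" by blast
    have 2: "{x. h x > c} \<in> sets \<nu>" using bm_measurable[OF h(1)] by simp
    have 3: "K \<in> fmeasurable \<nu>" using K(1) emeasure_haar_compact by (intro fmeasurableI) (auto simp: compact_imp_closed)
    show ?thesis by (rule fmeasurableI2[OF 3 1 2])
   qed
   have "\<Omega> \<in> fmeasurable \<nu>" unfolding \<Omega>_def
    using emeasure_haar_compact[OF compact_bl] Z by (intro fmeasurable.finite_UN) (auto intro!: fmeasurableI)
   thus ?thesis by (intro fmeasurable.Un F bm_power2 bm_osc good bka bH) (use al in auto)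
  qed
  have "{x. \<bar>osc ka M g x\<bar> > al} \<subseteq> ?G \<union> \<Omega> \<union> ?H"
  proof (rule subsetI, rule ccontr)
   fix x assume x: "x \<in> {x. \<bar>osc ka M g x\<bar> > al}" "x \<notin> ?G \<union> \<Omega> \<union> ?H"
   have "\<bar>osc ka M good x\<bar> <= al / 2" using x(2) al(1) abs_le_square_iff[of "osc ka M good x" "al / 2"] by (simp add: not_less)
   thus False using dec[of x] x by simp
  qed
  hence "measure \<nu> {x. \<bar>osc ka M g x\<bar> > al} <= measure \<nu> (?G \<union> \<Omega> \<union> ?H)"
   using bm_measurable[OF bm_osc[OF bg bka, of M]] fin by (intro measure_mono_fmeasurable) auto
  also have "... <= measure \<nu> ?G + measure \<nu> \<Omega> + measure \<nu> ?H"
   by (intro order_trans[OF measure_Un_le] add_mono measure_Un_le order_refl) auto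
  also have "measure \<nu> ?G <= 4 * A * (?D + 2) * L1 g / al"
  proof -
   have "measure \<nu> ?G <= (\<integral>x. (osc ka M good x)\<^sup>2) / (al / 2)\<^sup>2"
    by (rule markov) (use bm_power2[OF bm_osc[OF good(1) bka]] al in auto)
   also have "... <= A * ((?D + 2) * al * L1 g) / (al / 2)\<^sup>2"
   proof (rule divide_right_mono)
    have "(\<integral>x. (osc ka M good x)\<^sup>2) <= A * ip good good"
     using A(2)[OF good(1), of M] by (simp add: ip_def power2_eq_square)
    also have "ip good good <= (\<integral>x. (?D + 2) * al * \<bar>good x\<bar>)" unfolding ip_def
    proof (rule Bochner_Integration.integral_mono)
     show "good x * good x <= (?D + 2) * al * \<bar>good x\<bar>" for x
      using mult_right_mono[OF good(2)[of x], of "\<bar>good x\<bar>"] by simp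
    qed (intro bm_integrable bm_mult bm_cmult bm_abs good)+
    also have "... = (?D + 2) * al * L1 good" by (simp add: L1_def)
    also have "... <= (?D + 2) * al * L1 g" using good(3) al by (intro mult_left_mono) (auto intro!: mult_nonneg_nonneg add_nonneg_nonneg)
    finally show "(\<integral>x. (osc ka M good x)\<^sup>2) <= A * ((?D + 2) * al * L1 g)" using A(1) by simp
   qed simp
   also have "... = 4 * A * (?D + 2) * L1 g / al" using al(1) by (simp add: power2_eq_square field_simps)
   finally show ?thesis .
  qed
  also have "measure \<nu> \<Omega> <= ?D * ?D * L1 g / al"
  proof -
   have "measure \<nu> \<Omega> <= (\<Sum>z\<in>Z. measure \<nu> (bl z (a * (1 / a ^ n z))))"
    unfolding \<Omega>_def using Z by (intro measure_UNION_le) auto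
   also have "... = ?D * (\<Sum>z\<in>Z. measure \<nu> (U (1 / a ^ n z)))"
    unfolding measure_bl sum_distrib_left by (intro sum.cong refl measure_U_mult) simp
   also have "... <= ?D * (?D * L1 g / al)" using vb by (intro mult_left_mono) auto
   finally show ?thesis by simp
  qed
  also have "measure \<nu> ?H <= 8 * C * L1 g / al"
  proof -
   have "measure \<nu> ?H <= (\<integral>x. H x) / (al / 2)" by (rule markov[OF bH H0]) (use al in simp)
   also have "(\<integral>x. H x) = (\<Sum>z\<in>Z. \<Sum>k\<in>I z. L1 (conv (b z) (sc k ka)))"
    unfolding H_def L1_def using bm_integrable[OF bm_abs[OF conv_bm[OF b(1) bm_sc[OF bka]]]]
    by (simp add: Bochner_Integration.integral_sum)
   also have "... <= (\<Sum>z\<in>Z. \<Sum>k\<in>I z. C / a ^ (n z - k) * L1 (b z))"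
   proof (intro sum_mono)
    fix z k assume "z \<in> Z" "k \<in> I z"
    thus "L1 (conv (b z) (sc k ka)) <= C / a ^ (n z - k) * L1 (b z)"
     using C(2)[of "b z" z "n z" k] b(1,2)[of z] b(3)[of z] by (simp add: I_def)
   qed
   also have "... = (\<Sum>z\<in>Z. C * L1 (b z) * (\<Sum>k\<in>I z. 1 / a ^ (n z - k)))"
    by (simp add: sum_distrib_left mult_ac)
   also have "... <= (\<Sum>z\<in>Z. C * L1 (b z) * 2)"
   proof (intro sum_mono mult_left_mono)
    fix z
    have "(\<Sum>k\<in>I z. 1 / a ^ (n z - k)) = (\<Sum>j\<in>(%k. n z - k) ` I z. 1 / a ^ j)"
     by (subst sum.reindex) (auto simp: inj_on_def I_def)
    also have "... <= 2" by (rule sum_geometric_le) (simp add: I_def)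
    finally show "(\<Sum>k\<in>I z. 1 / a ^ (n z - k)) <= 2" .
   qed (use C L1_nonneg in auto)
   also have "... = C * 2 * (\<Sum>z\<in>Z. L1 (b z))" by (simp add: sum_distrib_left mult_ac)
   also have "... <= C * 2 * (2 * L1 g)" using Lb C by (intro mult_left_mono) auto
   finally show ?thesis using al(1) by (simp add: divide_right_mono field_simps)
  qed
  finally have "measure \<nu> {x. \<bar>osc ka M g x\<bar> > al} <=
   4 * A * (?D + 2) * L1 g / al + ?D * ?D * L1 g / al + 8 * C * L1 g / al" by simp
  also have "... <= 4 * A * (?D + 2) * L1 g / al + ?D * ?D * L1 g / al + 8 * C * L1 g / al + L1 g / al"
   using al L1_nonneg[of g] by simp
  also have "... = (4 * A * (?D + 2) + ?D * ?D + 8 * C + 1) * L1 g / al"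
   by (simp add: add_divide_distrib distrib_right)
  finally show "measure \<nu> {x. \<bar>osc ka M g x\<bar> > al} <= (4 * A * (?D + 2) + ?D * ?D + 8 * C + 1) * L1 g / al" .
 qed
qed

lemma osc_adjoint:
 assumes f: "bm f" and ka: "bm ka" and g: "bm g"
 shows "ip (osc ka M f) g = ip f (osc (%x. ka (- x)) M g)"
proof -
 have s: "(%x. sc k ka (- x)) = sc k (%x. ka (- x))" for k by (rule ext) (simp add: sc_def)
 have "ip (conv f (sc k ka)) g = ip f (conv g (sc k (%x. ka (- x))))" for k
  using conv_adjoint[OF f bm_sc[OF ka] g, of k] by (simp add: s)
 thus ?thesis
  unfolding osc_def[abs_def] using f g ka by (simp add: ip_sum ip_sum_right conv_bm bm_sc bm_uminus)
qed

text \<open>If \<open>T\<close> is the operator and \<open>T'\<close> its adjoint, the square norm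
  of \<open>T' f\<close> is the product of \<open>T (T' f)\<close> with \<open>f\<close>; the
  quadratic bound for \<open>T\<close> and the weighted inequality \<open>ip_amgm\<close> absorb
  half of it.\<close>

lemma osc_adjoint_L2:
 assumes ka: "bm ka" and A: "A > 0" "!!M (f :: 'a => real). bm f ==> ip (osc ka M f) (osc ka M f) <= A * ip f f" and f: "bm f"
 shows "ip (osc (%x. ka (- x)) M f) (osc (%x. ka (- x)) M f) <= A * ip f f"
proof -
 let ?g = "osc (%x. ka (- x)) M f"
 have g: "bm ?g" using f ka by (intro bm_osc bm_uminus)
 have Tg: "bm (osc ka M ?g)" using g ka by (rule bm_osc)
 have "ip ?g ?g = ip (osc ka M ?g) f" using osc_adjoint[OF g ka f, of M] by simp
 hence "ip ?g ?g <= (ip (osc ka M ?g) (osc ka M ?g) / A + A * ip f f) / 2"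
  using ip_amgm[OF Tg f A(1)] by simp
 moreover have "ip (osc ka M ?g) (osc ka M ?g) / A <= ip ?g ?g" using A(1) A(2)[OF g, of M] by (simp add: pos_divide_le_eq mult.commute)
 ultimately show ?thesis by argo
qed

end

section \<open>Densities with bounded truncated singular integrals\<close>

definition excess :: "real => real => real" where
 "excess l t = t - max (- l) (min l t)"

text \<open>\<open>excess l u\<close> is the difference of \<open>u\<close> and its nearest point
  \<open>c\<close> in the interval from \<open>- l\<close> to \<open>l\<close>. The moved value is
  at most as far from the interval as from \<open>c\<close>, and
  \<open>e * c = l * \<bar>e\<bar>\<close> for \<open>e = excess l u\<close>.\<close>

lemma excess_convex:
 assumes "l >= 0"
 shows "(excess l ((1 - t) * u + t * u'))\<^sup>2 <=
  (excess l u)\<^sup>2 + 2 * t * (excess l u * u' - (excess l u)\<^sup>2 - l * \<bar>excess l u\<bar>) + t\<^sup>2 * (u' - u)\<^sup>2"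
proof -
 define c where "c = max (- l) (min l u)"
 define e where "e = excess l u"
 have c: "\<bar>c\<bar> <= l" and ec: "e * c = l * \<bar>e\<bar>" and u: "u = e + c"
  using assms by (auto simp: c_def e_def excess_def max_def min_def abs_if algebra_simps)
 let ?v = "(1 - t) * u + t * u'"
 have "\<bar>excess l ?v\<bar> <= \<bar>?v - c\<bar>" using c by (auto simp: excess_def max_def min_def)
 hence "(excess l ?v)\<^sup>2 <= (?v - c)\<^sup>2" by (simp add: abs_le_square_iff)
 also have "?v - c = e + t * (u' - u)" by (simp add: u algebra_simps)
 also have "(e + t * (u' - u))\<^sup>2 = e\<^sup>2 + 2 * t * (e * u' - e * e - e * c) + t\<^sup>2 * (u' - u)\<^sup>2"
  by (simp add: u power2_eq_square algebra_simps)
 finally show ?thesis by (simp add: ec power2_eq_square flip: e_def)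
qed

lemma continuous_excess: "continuous_on A f ==> continuous_on A (%x. excess l (f x))"
 unfolding excess_def by (intro continuous_intros)

context dilation_base
begin

lemma osc_lincomb:
 assumes "bm f" "bm g" "bm ka"
 shows "osc ka M (%x. c * f x + d * g x) x = c * osc ka M f x + d * osc ka M g x"
 using assms by (simp add: osc_def conv_add_left conv_cmult_left bm_cmult bm_sc sum.distrib sum_distrib_left)

lemma continuous_osc: "bm f ==> kern ka ==> cont (osc ka M f)"
 unfolding osc_def[abs_def] kern_def by (intro continuous_on_sum sm_continuous[OF sm_conv] sm_sc) auto

text \<open>A convex set of relaxed indicators: \<open>W\<close> is a window, \<open>E\<close> will
  be a neighbourhood of the null set, and half of the mass of \<open>W\<close> has to be
  kept.\<close>

definition densities :: "'a set => 'a set => ('a => real) set" where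
 "densities W E = {ph. bm ph \<and> (\<forall>x. 0 <= ph x \<and> ph x <= 1) \<and> (\<forall>x. x \<notin> W \<or> x \<in> E --> ph x = 0) \<and>
  measure \<nu> W / 2 <= (\<integral>x. ph x)}"

lemma densities_convex:
 assumes "ph \<in> densities W E" "ph' \<in> densities W E" "0 <= t" "t <= 1"
 shows "(%x. (1 - t) * ph x + t * ph' x) \<in> densities W E"
proof -
 have b: "bm ph" "bm ph'" using assms by (auto simp: densities_def)
 have "0 <= (1 - t) * ph x + t * ph' x" "(1 - t) * ph x + t * ph' x <= 1" for x
  using assms by (auto simp: densities_def intro!: convex_bound_le)
 moreover have "measure \<nu> W / 2 <= (1 - t) * (\<integral>x. ph x) + t * (\<integral>x. ph' x)"
 proof -
  have "(1 - t) * (measure \<nu> W / 2) + t * (measure \<nu> W / 2) <= (1 - t) * (\<integral>x. ph x) + t * (\<integral>x. ph' x)"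
   using assms by (intro add_mono mult_left_mono) (auto simp: densities_def)
  moreover have "(1 - t) * (measure \<nu> W / 2) + t * (measure \<nu> W / 2) = measure \<nu> W / 2" by (simp add: field_simps)
  ultimately show ?thesis by simp
 qed
 ultimately show ?thesis
  using assms b bm_integrable[OF b(1)] bm_integrable[OF b(2)] by (auto simp: densities_def bm_add bm_cmult)
qed

text \<open>For given test functions the indicator of the part of \<open>W\<close> outside
  \<open>E\<close> on which all adjoint operators are at most \<open>al\<close> does the job. The
  weak type estimate bounds the excluded sets by a quarter of \<open>W\<close>, whatever
  \<open>M\<close>, \<open>E\<close> and the test functions are.\<close>

lemma density_dual:
 fixes ka :: "'q => 'a => real"
 assumes Q: "finite Q" and ka: "!!q. q \<in> Q ==> kern (ka q)"
  and L2: "!!q. q \<in> Q ==> \<exists>A>0. \<forall>M f. bm f --> ip (osc (ka q) M f) (osc (ka q) M f) <= A * ip f f"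
  and W: "compact W" "measure \<nu> W > 0"
 obtains l where "l > 0" "!!M E e s. E \<in> sets borel ==> measure \<nu> (E \<inter> W) <= measure \<nu> W / 4 ==>
  (!!q. q \<in> Q ==> cont (e q) \<and> csupp (e q)) ==> s > 0 ==> (\<Sum>q\<in>Q. L1 (e q)) <= s ==>
  \<exists>ph\<in>densities W E. (\<Sum>q\<in>Q. ip (e q) (osc (ka q) M ph)) <= l * s"
proof -
 let ?ka' = "%q x. ka q (- x)"
 let ?m = "measure \<nu> W" and ?v = "measure \<nu> (U 1)"
 have "\<forall>q\<in>Q. \<exists>C>0. \<forall>M g al. cont g --> csupp g --> al > 0 --> L1 g <= al * ?v -->
   measure \<nu> {x. \<bar>osc (?ka' q) M g x\<bar> > al} <= C * L1 g / al"
 proof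
  fix q assume q: "q \<in> Q"
  obtain A where A: "A > 0" "!!M (f :: 'a => real). bm f ==> ip (osc (ka q) M f) (osc (ka q) M f) <= A * ip f f"
   using L2[OF q] by blast
  have L2': "!!M (f :: 'a => real). bm f ==> ip (osc (?ka' q) M f) (osc (?ka' q) M f) <= A * ip f f"
   by (rule osc_adjoint_L2[OF kern_bm[OF ka[OF q]] A])
  obtain C where "C > 0" "!!M g al. cont g ==> csupp g ==> al > 0 ==> L1 g <= al * ?v ==>
   measure \<nu> {x. \<bar>osc (?ka' q) M g x\<bar> > al} <= C * L1 g / al"
   by (rule weak_type[OF kern_uminus[OF ka[OF q]] A(1)], rule L2', assumption, rule that)
  thus "\<exists>C>0. \<forall>M g al. cont g --> csupp g --> al > 0 --> L1 g <= al * ?v -->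
   measure \<nu> {x. \<bar>osc (?ka' q) M g x\<bar> > al} <= C * L1 g / al" by (intro exI conjI allI impI)
 qed
 from bchoice[OF this] obtain C where C: "!!q. q \<in> Q ==> C q > 0"
  "!!q M g al. q \<in> Q ==> cont g ==> csupp g ==> al > 0 ==> L1 g <= al * ?v ==>
   measure \<nu> {x. \<bar>osc (?ka' q) M g x\<bar> > al} <= C q * L1 g / al" by blast
 \<comment> \<open>The first summand secures the smallness of \<open>L1 g\<close> that the weak type
   estimate presupposes, the second makes the exceptional sets fill at most a quarter of
   \<open>W\<close>.\<close>
 define \<Lambda> where "\<Lambda> = 1 / ?v + 4 * sum C Q / ?m"
 have v: "?v > 0" by (simp add: measure_U_pos)
 have sumC: "sum C Q >= 0" using C by (intro sum_nonneg) (auto intro: less_imp_le)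
 have \<Lambda>: "\<Lambda> > 0" "1 <= \<Lambda> * ?v" "4 * sum C Q <= \<Lambda> * ?m"
  using v W sumC by (auto simp: \<Lambda>_def distrib_right add_pos_nonneg)
 show ?thesis
 proof (rule that[of "real (card Q) * \<Lambda> * ?m + 1"])
  show "real (card Q) * \<Lambda> * ?m + 1 > 0" using \<Lambda> W by (intro add_nonneg_pos) auto
  fix M E e and s :: real
  assume E: "E \<in> sets borel" "measure \<nu> (E \<inter> W) <= ?m / 4"
   and e: "!!q. q \<in> Q ==> cont (e q) \<and> csupp (e q)" and s: "s > 0" "(\<Sum>q\<in>Q. L1 (e q)) <= s"
  define al where "al = \<Lambda> * s"
  have al: "al > 0" using \<Lambda> s by (simp add: al_def)
  have Le: "L1 (e q) <= s" if "q \<in> Q" for q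
   using member_le_sum[of q Q "%q. L1 (e q)"] that Q L1_nonneg s(2) by simp
  define B where "B q = {x. \<bar>osc (?ka' q) M (e q) x\<bar> > al}" for q
  have be: "bm (e q)" if "q \<in> Q" for q using e[OF that] by (intro bm_continuous) auto
  have bka: "bm (ka q)" if "q \<in> Q" for q using ka[OF that] by (rule kern_bm)
  have Bm: "B q \<in> sets borel" if "q \<in> Q" for q
  proof -
   have [measurable]: "osc (?ka' q) M (e q) \<in> Borel"
    by (intro bm_measurable bm_osc be bm_uminus bka that)
   show ?thesis unfolding B_def by measurable
  qed
  have Bsmall: "measure \<nu> (B q) <= C q / \<Lambda>" if "q \<in> Q" for q
  proof -
   have "1 * s <= (\<Lambda> * ?v) * s" using \<Lambda> s by (intro mult_right_mono) auto
   hence "L1 (e q) <= al * ?v" using Le[OF that] by (simp add: al_def mult_ac)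
   hence "measure \<nu> (B q) <= C q * L1 (e q) / al"
    unfolding B_def using C(2)[OF that, of "e q" al M] e[OF that] al by simp
   also have "... <= C q * s / al" using Le[OF that] C(1)[OF that] al by (intro divide_right_mono mult_left_mono) auto
   also have "... = C q / \<Lambda>" using s \<Lambda> by (simp add: al_def)
   finally show ?thesis .
  qed
  define F where "F = W - E - (\<Union>q\<in>Q. B q)"
  have sets: "W \<in> sets borel" "F \<in> sets borel" "(\<Union>q\<in>Q. B q) \<in> sets borel"
   using W(1) E Q Bm by (auto simp: F_def compact_imp_closed intro!: sets.finite_UN)
  have Wf: "W \<in> fmeasurable \<nu>" using W(1) emeasure_haar_compact sets by (intro fmeasurableI) auto
  have "?m <= measure \<nu> (F \<union> (E \<inter> W) \<union> (\<Union>q\<in>Q. B q) \<inter> W)"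
   using sets E by (intro measure_mono_fmeasurable) (auto simp: F_def intro!: fmeasurableI2[OF Wf])
  also have "... <= measure \<nu> F + measure \<nu> (E \<inter> W) + measure \<nu> ((\<Union>q\<in>Q. B q) \<inter> W)"
   using sets E by (intro order_trans[OF measure_Un_le] add_mono measure_Un_le order_refl) auto
  also have "measure \<nu> ((\<Union>q\<in>Q. B q) \<inter> W) <= (\<Sum>q\<in>Q. measure \<nu> (B q \<inter> W))"
   unfolding UN_extend_simps using Q sets Bm by (intro measure_UNION_le) auto
  also have "... <= (\<Sum>q\<in>Q. C q / \<Lambda>)"
  proof (intro sum_mono)
   fix q assume q: "q \<in> Q"
   have be': "bm (osc (?ka' q) M (e q))" by (intro bm_osc be bm_uminus bka q)
   then obtain K where K: "compact K" "!!x. x \<notin> K ==> osc (?ka' q) M (e q) x = 0" by (rule bmE) (rule that)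
   have "x \<in> K" if "x \<in> B q" for x using K(2)[of x] that al by (cases "x \<in> K") (auto simp: B_def)
   hence sub: "B q \<subseteq> K" by blast
   have Kf: "K \<in> fmeasurable \<nu>" using K(1) emeasure_haar_compact by (intro fmeasurableI) (auto simp: compact_imp_closed)
   have "B q \<in> sets \<nu>" using Bm[OF q] by simp
   from fmeasurableI2[OF Kf sub this] have "measure \<nu> (B q \<inter> W) <= measure \<nu> (B q)"
    using Bm[OF q] sets by (intro measure_mono_fmeasurable) auto
   thus "measure \<nu> (B q \<inter> W) <= C q / \<Lambda>" using Bsmall[OF q] by simp
  qed
  also have "... <= ?m / 4" using \<Lambda> by (simp add: sum_divide_distrib[symmetric] pos_divide_le_eq mult.commute)
  finally have F: "?m / 2 <= measure \<nu> F" using E by simp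
  let ?ph = "indicator F :: 'a => real"
  have ph: "?ph \<in> densities W E"
  proof -
   have "bm ?ph" by (rule bm_indicator[OF sets(2) W(1)]) (auto simp: F_def)
   moreover have "x \<notin> F" if "x \<notin> W \<or> x \<in> E" for x using that by (auto simp: F_def)
   ultimately show ?thesis using F sets by (auto simp: densities_def)
  qed
  have bph: "bm ?ph" using ph by (simp add: densities_def)
  have "ip (e q) (osc (ka q) M ?ph) <= al * ?m" if q: "q \<in> Q" for q
  proof -
   have "ip (e q) (osc (ka q) M ?ph) = ip ?ph (osc (?ka' q) M (e q))"
    using osc_adjoint[OF bph bka[OF q] be[OF q], of M] by (simp add: ip_commute)
   also have "... <= (\<integral>x. al * indicator W x)"
    unfolding ip_def
   proof (rule Bochner_Integration.integral_mono)
    show "integrable \<nu> (%x. ?ph x * osc (?ka' q) M (e q) x)"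
     by (intro bm_integrable bm_mult bph bm_osc be bm_uminus bka q)
    show "integrable \<nu> (%x. al * indicator W x)"
     by (intro bm_integrable bm_cmult bm_indicator[OF sets(1) W(1)] subset_refl)
    show "?ph x * osc (?ka' q) M (e q) x <= al * indicator W x" for x
     using al q by (auto simp: F_def B_def indicator_def)
   qed
   also have "... = al * ?m" using sets by simp
   finally show ?thesis .
  qed
  hence "(\<Sum>q\<in>Q. ip (e q) (osc (ka q) M ?ph)) <= (\<Sum>q\<in>Q. al * ?m)" by (intro sum_mono)
  also have "... <= (real (card Q) * \<Lambda> * ?m + 1) * s" using s by (simp add: al_def algebra_simps)
  finally show "\<exists>ph\<in>densities W E. (\<Sum>q\<in>Q. ip (e q) (osc (ka q) M ph)) <= (real (card Q) * \<Lambda> * ?m + 1) * s"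
   using ph by blast
 qed
qed

text \<open>
 The dual estimate makes the squared excess of \<open>osc (ka q) M ph\<close> over the level
 \<open>l\<close> arbitrarily small, by moving \<open>ph\<close> towards the competitor supplied by
 the previous lemma; equicontinuity turns this into a pointwise bound.
\<close>
theorem bounded_density:
 fixes ka :: "'q => 'a => real"
 assumes Q: "finite Q" and ka: "!!q. q \<in> Q ==> kern (ka q)"
  and L2: "!!q. q \<in> Q ==> \<exists>A>0. \<forall>M f. bm f --> ip (osc (ka q) M f) (osc (ka q) M f) <= A * ip f f"
  and W: "compact W" "measure \<nu> W > 0"
 obtains l where "l > 0" "!!M E. E \<in> sets borel ==> measure \<nu> (E \<inter> W) <= measure \<nu> W / 4 ==>
  \<exists>ph\<in>densities W E. \<forall>q\<in>Q. \<forall>x. \<bar>osc (ka q) M ph x\<bar> <= l"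
proof -
 obtain l where l: "l > 0" "!!M E e s. E \<in> sets borel ==> measure \<nu> (E \<inter> W) <= measure \<nu> W / 4 ==>
  (!!q. q \<in> Q ==> cont (e q) \<and> csupp (e q)) ==> s > 0 ==> (\<Sum>q\<in>Q. L1 (e q)) <= s ==>
  \<exists>ph\<in>densities W E. (\<Sum>q\<in>Q. ip (e q) (osc (ka q) M ph)) <= l * s"
  using density_dual[where Q = Q and ka = ka and W = W, OF assms] by blast
 from bchoice[of Q "%q A. A > 0 \<and> (\<forall>M f. bm f --> ip (osc (ka q) M f) (osc (ka q) M f) <= A * ip f f)"]
 obtain A where A: "!!q. q \<in> Q ==> A q > 0"
  "!!q M f. q \<in> Q ==> bm f ==> ip (osc (ka q) M f) (osc (ka q) M f) <= A q * ip f f" using L2 by blast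
 let ?m = "measure \<nu> W"
 have bka: "bm (ka q)" if "q \<in> Q" for q using ka[OF that] by (rule kern_bm)
 have Wb: "W \<in> sets borel" using W(1) by (simp add: compact_imp_closed)
 have bW: "bm (indicator W)" by (rule bm_indicator[OF Wb W(1) subset_refl])
 show ?thesis
 proof (rule that[of "l + 2"])
  fix M E assume E: "E \<in> sets borel" "measure \<nu> (E \<inter> W) <= ?m / 4"
  let ?D = "densities W E"
  define e where "e ph q x = excess l (osc (ka q) M ph x)" for ph q x
  define S where "S ph = (\<Sum>q\<in>Q. ip (e ph q) (e ph q))" for ph
  have S0: "S ph >= 0" for ph by (simp add: S_def sum_nonneg ip_self_nonneg)
  have bD: "bm ph" if "ph \<in> ?D" for ph using that by (simp add: densities_def)
  have ce: "cont (e ph q)" "csupp (e ph q)" "bm (e ph q)" if D: "ph \<in> ?D" and q: "q \<in> Q" for ph q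
  proof -
   show c: "cont (e ph q)" unfolding e_def[abs_def] using D q bD ka by (intro continuous_excess continuous_osc)
   obtain K where K: "compact K" "!!x. x \<notin> K ==> osc (ka q) M ph x = 0"
    using bm_osc[OF bD[OF D] bka[OF q]] by (rule bmE) (rule that)
   have "\<forall>x. x \<notin> K --> e ph q x = 0" using K(2) l(1) by (simp add: e_def excess_def)
   with K(1) show s: "csupp (e ph q)" unfolding csupp_def by (intro exI conjI)
   show "bm (e ph q)" using c s by (rule bm_continuous)
  qed
  \<comment> \<open>The coefficient of \<open>t\<^sup>2\<close>: the sum bounds the quadratic terms,
    since two densities differ by at most 1 on \<open>W\<close>, and \<open>2 * l\<close> pays for
    the extra \<open>t\<close> in \<open>?s\<close>.\<close>
  define R where "R = 2 * l + (\<Sum>q\<in>Q. A q * ?m)"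
  have "0 <= (\<Sum>q\<in>Q. A q * ?m)" by (intro sum_nonneg mult_nonneg_nonneg) (auto intro: less_imp_le A(1))
  hence R: "R > 0" using l(1) by (simp add: R_def)
  have step: "\<exists>ph''\<in>?D. S ph'' <= (1 - 2 * t) * S ph + t\<^sup>2 * R" if ph: "ph \<in> ?D" and t: "0 < t" "t <= 1" for ph t
  proof -
   \<comment> \<open>The summand \<open>t\<close> keeps the bound positive, as
     \<open>density_dual\<close> requires, even when all excesses vanish.\<close>
   let ?s = "(\<Sum>q\<in>Q. L1 (e ph q)) + t"
   have "?s > 0" using t by (intro add_nonneg_pos sum_nonneg L1_nonneg)
   then obtain ph' where ph': "ph' \<in> ?D" "(\<Sum>q\<in>Q. ip (e ph q) (osc (ka q) M ph')) <= l * ?s"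
    using l(2)[OF E, of "e ph" ?s M] ce[OF ph] t by auto
   let ?ph = "%x. (1 - t) * ph x + t * ph' x"
   have D: "?ph \<in> ?D" using ph ph' t by (intro densities_convex) auto
   have "ip (e ?ph q) (e ?ph q) <= ip (e ph q) (e ph q) +
     2 * t * (ip (e ph q) (osc (ka q) M ph') - ip (e ph q) (e ph q) - l * L1 (e ph q)) + t\<^sup>2 * (A q * ?m)" if q: "q \<in> Q" for q
   proof -
    let ?u = "osc (ka q) M ph" and ?u' = "osc (ka q) M ph'" and ?e = "e ph q"
    let ?d = "%x. 1 * ph' x + (- 1) * ph x"
    have bu: "bm ?u" "bm ?u'" using ph ph' bD bka[OF q] by (auto intro: bm_osc)
    have be: "bm ?e" using ce ph q by blast
    have bd: "bm ?d" using ph ph' bD by (intro bm_add bm_cmult) auto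
    have ud: "osc (ka q) M ?d x = ?u' x - ?u x" for x
     using osc_lincomb[of ph' ph "ka q" M 1 "- 1" x] ph ph' bD bka[OF q] by simp
    have "ip (e ?ph q) (e ?ph q) <= (\<integral>x. ?e x * ?e x + 2 * t * (?e x * ?u' x - ?e x * ?e x - l * \<bar>?e x\<bar>) + t\<^sup>2 * ((?u' x - ?u x) * (?u' x - ?u x)))"
     unfolding ip_def
    proof (rule Bochner_Integration.integral_mono)
     show "integrable \<nu> (%x. e ?ph q x * e ?ph q x)" using ce D q by (intro bm_integrable bm_mult) auto
     show "integrable \<nu> (%x. ?e x * ?e x + 2 * t * (?e x * ?u' x - ?e x * ?e x - l * \<bar>?e x\<bar>) + t\<^sup>2 * ((?u' x - ?u x) * (?u' x - ?u x)))"
      by (intro bm_integrable bm_add bm_mult bm_cmult bm_diff bm_abs be bu)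
     show "e ?ph q x * e ?ph q x <= ?e x * ?e x + 2 * t * (?e x * ?u' x - ?e x * ?e x - l * \<bar>?e x\<bar>) + t\<^sup>2 * ((?u' x - ?u x) * (?u' x - ?u x))" for x
      using excess_convex[of l t "?u x" "?u' x"] l(1) osc_lincomb[of ph ph' "ka q" M "1 - t" t x] ph ph' bD bka[OF q]
      by (simp add: e_def power2_eq_square)
    qed
    also have "... = ip ?e ?e + 2 * t * (ip ?e ?u' - ip ?e ?e - l * L1 ?e) + t\<^sup>2 * ip (osc (ka q) M ?d) (osc (ka q) M ?d)"
     unfolding ip_def L1_def ud
     using bm_integrable[OF bm_mult[OF be be]] bm_integrable[OF bm_mult[OF be bu(2)]] bm_integrable[OF bm_abs[OF be]]
      bm_integrable[OF bm_mult[OF bm_diff[OF bu(2) bu(1)] bm_diff[OF bu(2) bu(1)]]]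
     by simp
    also have "ip (osc (ka q) M ?d) (osc (ka q) M ?d) <= A q * ?m"
    proof -
     have "ip (osc (ka q) M ?d) (osc (ka q) M ?d) <= A q * ip ?d ?d" by (rule A(2)[OF q bd])
     also have "ip ?d ?d <= (\<integral>x. indicator W x)"
      unfolding ip_def
     proof (rule Bochner_Integration.integral_mono[OF bm_integrable[OF bm_mult[OF bd bd]] bm_integrable[OF bW]])
      fix x
      have "\<bar>ph' x - ph x\<bar> <= 1" "x \<notin> W ==> ph' x - ph x = 0"
       using ph ph'(1) by (auto simp: densities_def abs_le_iff intro: order_trans[of _ 1]) (smt (verit))+
      thus "?d x * ?d x <= indicator W x"
       using mult_mono[of "\<bar>ph' x - ph x\<bar>" 1 "\<bar>ph' x - ph x\<bar>" 1] by (cases "x \<in> W") auto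
     qed
     finally show ?thesis using Wb A(1)[OF q] by simp
    qed
    finally show ?thesis by (simp add: mult_left_mono)
   qed
   hence "S ?ph <= (\<Sum>q\<in>Q. ip (e ph q) (e ph q) +
     2 * t * (ip (e ph q) (osc (ka q) M ph') - ip (e ph q) (e ph q) - l * L1 (e ph q)) + t\<^sup>2 * (A q * ?m))"
    unfolding S_def by (rule sum_mono)
   also have "... = S ph + 2 * t * ((\<Sum>q\<in>Q. ip (e ph q) (osc (ka q) M ph')) - S ph - l * (\<Sum>q\<in>Q. L1 (e ph q))) + t\<^sup>2 * (\<Sum>q\<in>Q. A q * ?m)"
    by (simp add: S_def sum.distrib sum_distrib_left sum_subtractf right_diff_distrib)
   also have "... <= S ph + 2 * t * (l * ?s - S ph - l * (\<Sum>q\<in>Q. L1 (e ph q))) + t\<^sup>2 * (\<Sum>q\<in>Q. A q * ?m)"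
    using ph'(2) t by (intro add_mono mult_left_mono diff_mono order_refl) auto
   also have "... = (1 - 2 * t) * S ph + t\<^sup>2 * R" by (simp add: R_def algebra_simps power2_eq_square)
   finally show ?thesis using D by blast
  qed
  have small: "\<exists>ph\<in>?D. S ph < d" if d: "d > 0" for d
  proof -
   have ne: "?D ~= {}"
   proof -
    have "csupp (%x::'a. 0)" unfolding csupp_def by (intro exI[of _ "{}"]) simp
    thus ?thesis using l(2)[OF E, of "%q x. 0" 1] by (auto simp: L1_def)
   qed
   have bdd: "bdd_below (S ` ?D)" using S0 by (intro bdd_belowI[of _ 0]) auto
   define i where "i = (INF ph\<in>?D. S ph)"
   define t where "t = min (1 / 4) (d / R)"
   have t: "0 < t" "t <= 1 / 4" "t * R <= d" using d R by (auto simp: t_def min_def field_simps)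
   \<comment> \<open>The infimum inherits \<open>i <= (1 - 2 * t) * i + t\<^sup>2 * R\<close>, hence
     \<open>2 * i <= t * R\<close>, and \<open>t\<close> was chosen to make this at most
     \<open>d\<close>.\<close>
   have "(i - t\<^sup>2 * R) / (1 - 2 * t) <= i"
    unfolding i_def[symmetric] unfolding i_def
   proof (rule cINF_greatest[OF ne])
    fix ph assume "ph \<in> ?D"
    then obtain ph'' where "ph'' \<in> ?D" "S ph'' <= (1 - 2 * t) * S ph + t\<^sup>2 * R" using step[of ph t] t by auto
    hence "i <= (1 - 2 * t) * S ph + t\<^sup>2 * R" using cINF_lower[OF bdd, of ph''] by (simp add: i_def)
    thus "((INF ph\<in>?D. S ph) - t\<^sup>2 * R) / (1 - 2 * t) <= S ph" using t by (simp add: i_def pos_divide_le_eq mult.commute)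
   qed
   hence "i - t\<^sup>2 * R <= i * (1 - 2 * t)" using t by (simp add: pos_divide_le_eq)
   hence "t * (2 * i) <= t * (t * R)" by (simp add: algebra_simps power2_eq_square)
   hence "2 * i <= t * R" using t by simp
   hence "i < d" using t d by linarith
   thus ?thesis using cINF_less_iff[OF ne bdd] by (simp add: i_def)
  qed
  \<comment> \<open>The modulus of continuity depends on \<open>M\<close>, but it decides how small
    \<open>S\<close> has to be and does not enter the final bound.\<close>
  have eqc: "\<exists>n. \<forall>ph\<in>?D. \<forall>x u. u \<in> U (1 / a ^ n) --> \<bar>osc (ka q) M ph (x \<odot> u) - osc (ka q) M ph x\<bar> <= 1" if q: "q \<in> Q" for q
  proof -
   let ?K = "%x. \<Sum>k\<le>M. sc k (ka q) x"
   have bK: "bm ?K" by (intro bm_sum bm_sc bka q)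
   have cK: "cont ?K" using ka[OF q] unfolding kern_def
    by (intro continuous_on_sum sm_continuous[OF sm_sc]) auto
   have cs: "csupp ?K" using bK by (simp add: bm_def)
   have pos: "1 / (?m + 1) > 0" using W by simp
   obtain n where n: "!!x u. u \<in> U (1 / a ^ n) ==> \<bar>?K (x \<odot> u) - ?K x\<bar> < 1 / (?m + 1)"
    by (rule uniform_right[OF cK cs pos]) (rule that)
   show ?thesis
   proof (intro exI[of _ n] ballI allI impI)
    fix ph x u assume ph: "ph \<in> ?D" and u: "u \<in> U (1 / a ^ n)"
    have b: "bm ph" using ph by (rule bD)
    have cv: "osc (ka q) M ph x = conv ph ?K x" for x
     using b bka[OF q] by (simp add: osc_def conv_sum_right bm_sc)
    have "osc (ka q) M ph (x \<odot> u) - osc (ka q) M ph x = (\<integral>y. ph y * ?K ((- y) \<odot> (x \<odot> u)) - ph y * ?K ((- y) \<odot> x))"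
     unfolding cv conv_def using bm_integrable[OF conv_integrand_bm[OF b bK]] by simp
    also have "norm ... <= (\<integral>y. 1 / (?m + 1) * indicator W y)"
    proof (rule norm_lebesgue_integral_le)
     show "integrable \<nu> (%y. ph y * ?K ((- y) \<odot> (x \<odot> u)) - ph y * ?K ((- y) \<odot> x))"
      by (intro bm_integrable bm_diff conv_integrand_bm b bK)
     show "integrable \<nu> (%y. 1 / (?m + 1) * indicator W y)" by (intro bm_integrable bm_cmult bW)
     fix y
     have "\<bar>ph y\<bar> * \<bar>?K ((- y) \<odot> x \<odot> u) - ?K ((- y) \<odot> x)\<bar> <= indicator W y * (1 / (?m + 1))"
      using ph n[OF u, of "(- y) \<odot> x"] by (intro mult_mono) (auto simp: densities_def indicator_def)
     thus "norm (ph y * ?K ((- y) \<odot> (x \<odot> u)) - ph y * ?K ((- y) \<odot> x)) <= 1 / (?m + 1) * indicator W y"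
      unfolding right_diff_distrib[symmetric] real_norm_def abs_mult mul_assoc[symmetric] by (simp add: mult.commute)
    qed
    also have "... <= 1" using Wb W by simp
    finally show "\<bar>osc (ka q) M ph (x \<odot> u) - osc (ka q) M ph x\<bar> <= 1" by simp
   qed
  qed
  then obtain N where N: "!!q ph x u. q \<in> Q ==> ph \<in> ?D ==> u \<in> U (1 / a ^ N q) ==> \<bar>osc (ka q) M ph (x \<odot> u) - osc (ka q) M ph x\<bar> <= 1"
   by metis
  define n where "n = (\<Sum>q\<in>Q. N q)"
  have n: "U (1 / a ^ n) \<subseteq> U (1 / a ^ N q)" if "q \<in> Q" for q
   using member_le_sum[of q Q N] that Q by (intro U_mono divide_left_mono power_increasing) (auto simp: n_def)
  obtain ph where ph: "ph \<in> ?D" "S ph < measure \<nu> (U (1 / a ^ n))"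
   using small[of "measure \<nu> (U (1 / a ^ n))"] by (auto simp: measure_U_pos)
  \<comment> \<open>A value above \<open>l + 2\<close> would stay above \<open>l + 1\<close> on a
    whole ball, making the excess at least 1 there, against the smallness of
    \<open>S\<close>.\<close>
  have "\<bar>osc (ka q) M ph x\<bar> <= l + 2" if q: "q \<in> Q" for q x
  proof (rule ccontr)
   assume big: "\<not> \<bar>osc (ka q) M ph x\<bar> <= l + 2"
   have "measure \<nu> (U (1 / a ^ n)) = (\<integral>y. indicator (bl x (1 / a ^ n)) y)" by (simp add: measure_bl)
   also have "... <= ip (e ph q) (e ph q)"
    unfolding ip_def
   proof (intro Bochner_Integration.integral_mono bm_integrable bm_bl bm_mult ce ph q)
    fix y
    show "indicator (bl x (1 / a ^ n)) y <= e ph q y * e ph q y"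
    proof (cases "y \<in> bl x (1 / a ^ n)")
     case True
     hence "(- x) \<odot> y \<in> U (1 / a ^ N q)" using n[OF q] by (auto simp: bl_def)
     from N[OF q ph(1) this, of x] have "\<bar>osc (ka q) M ph y\<bar> > l + 1" using big by simp
     hence "\<bar>e ph q y\<bar> >= 1" using l(1) by (auto simp: e_def excess_def max_def min_def)
     hence "1 * 1 <= \<bar>e ph q y\<bar> * \<bar>e ph q y\<bar>" by (intro mult_mono) auto
     thus ?thesis using True by simp
    qed simp
   qed
   also have "... <= S ph" unfolding S_def using Q q ip_self_nonneg by (intro member_le_sum) auto
   finally show False using ph(2) by simp
  qed
  thus "\<exists>ph\<in>?D. \<forall>q\<in>Q. \<forall>x. \<bar>osc (ka q) M ph x\<bar> <= l + 2" using ph(1) by blast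
 qed (use l in simp)
qed

end

section \<open>Mean zero bumps in divergence form\<close>

context stratified_group
begin

lemma comp1_mul: "comp 1 (x \<odot> y) = comp 1 x + comp 1 y"
proof -
 have "x \<odot> y - (x + y) \<in> Fil (1 + 1)" by (rule mul_mod) auto
 hence "comp 1 (x \<odot> y - (x + y)) = 0" by (auto simp: Fil_def)
 thus ?thesis using linear_comp[of 1] by (simp add: linear_diff linear_add)
qed

definition hbasis :: "'a set" where
 "hbasis = (SOME B. B \<subseteq> V 1 \<and> pairwise orthogonal B \<and> (\<forall>x\<in>B. norm x = 1) \<and> independent B \<and> span B = V 1)"

lemma hbasis: "hbasis \<subseteq> V 1" "pairwise orthogonal hbasis" "!!b. b \<in> hbasis ==> norm b = 1"
 "finite hbasis" "span hbasis = V 1"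
proof -
 obtain B where "B \<subseteq> V 1" "pairwise orthogonal B" "!!x. x \<in> B ==> norm x = 1" "independent B" "span B = V 1"
  using orthonormal_basis_subspace[OF subspace_V[of 1]] by metis
 hence "\<exists>B. B \<subseteq> V 1 \<and> pairwise orthogonal B \<and> (\<forall>x\<in>B. norm x = 1) \<and> independent B \<and> span B = V 1" by blast
 from someI_ex[OF this, folded hbasis_def] show "hbasis \<subseteq> V 1" "pairwise orthogonal hbasis"
  "!!b. b \<in> hbasis ==> norm b = 1" "finite hbasis" "span hbasis = V 1"
  using independent_imp_finite by auto
qed

lemma hbasis_expand: "w \<in> V 1 ==> (\<Sum>b\<in>hbasis. (w \<bullet> b) *R b) = w"
 using hbasis by (intro orthonormal_basis_expand) auto

lemma hbasis_inner: "b \<in> hbasis ==> c \<in> hbasis ==> b \<bullet> c = (if b = c then 1 else 0)"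
 using hbasis(2,3) by (auto simp: pairwise_def orthogonal_def dot_square_norm)

lemma X_hbasis: "sm (Suc k) f ==> w \<in> V 1 ==> X w f x = (\<Sum>b\<in>hbasis. (w \<bullet> b) * X b f x)"
 using X_linear[of k f "%b. w \<bullet> b" "%b. b" hbasis x] by (simp add: hbasis_expand)

end

context haar_group
begin

text \<open>The difference is the integral, over the segment between the two points, of the
  derivative along \<open>w p\<close>. Expanding \<open>w p\<close> in \<open>hbasis\<close> and
  integrating over the time in the unit interval and over \<open>p\<close> makes it a horizontal
  divergence.\<close>

lemma div_step:
 fixes H :: "'a => 'a => real"
 assumes H: "Ck (Suc k) H" and K: "compact K" "compact L" "!!x p. H x p ~= 0 ==> x \<in> K \<and> p \<in> L"
  and w: "cont w" "range w \<subseteq> V 1"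
 shows "\<exists>ps. (\<forall>b\<in>hbasis. sm (Suc k) (ps b) \<and> csupp (ps b)) \<and>
  (\<forall>x. (\<Sum>b\<in>hbasis. X b (ps b) x) = (\<integral>p. H x p - H (x \<odot> (- w p)) p))"
proof -
 define m where "m = (lborel :: real measure) \<Otimes>\<^sub>M \<nu>"
 have sm: "sets m = sets borel" unfolding m_def by (subst borel_prod[symmetric]) (rule sets_pair_measure_cong, auto)
 interpret P: pair_sigma_finite "lborel :: real measure" \<nu> ..
 define g :: "real \<times> 'a => real" where "g = indicator ({0..1} \<times> L)"
 have TL: "compact ({0..1::real} \<times> L)" using K by (intro compact_Times) auto
 have g: "integrable m g"
 proof -
  have "emeasure m ({0..1} \<times> L) = emeasure lborel {0..1::real} * emeasure \<nu> L"
   unfolding m_def using K by (intro emeasure_pair_measure_Times) (auto simp: compact_imp_closed)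
  also have "... < \<infinity>" using emeasure_haar_compact[OF K(2)] by (simp add: ennreal_mult_less_top)
  finally show ?thesis unfolding g_def using TL
   by (intro integrable_real_indicator) (auto simp: sm compact_imp_closed)
 qed
 have g0: "g th = 0" if "th \<notin> {0..1} \<times> L" for th using that by (simp add: g_def)
 define q where "q x th = x \<odot> (- (fst th *R w (snd th)))" for x and th :: "real \<times> 'a"
 have w2: "cont (%th::real \<times> 'a. w (snd th))" by (rule continuous_on_compose2[OF w(1)]) (auto intro: continuous_intros)
 have Hq: "Ck (Suc k) (%x th. H (q x th) (snd th))"
  unfolding q_def by (rule Ck_compose[OF H]) (intro CkV_mul CkV_id CkV_param continuous_intros w2)+
 obtain H' where H': "!!x th. ((%x. H (q x th) (snd th)) has_derivative (%v. H' v x th)) (at x)" "!!v. Ck k (H' v)"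
  using Hq by (rule Ck_SucE) (rule that)
 define F where "F b x th = (w (snd th) \<bullet> b) * H (q x th) (snd th)" for b x th
 have F: "Ck (Suc k) (F b)" for b
  unfolding F_def by (intro Ck_mult Hq Ck_param continuous_intros w2)
 define ps where "ps b x = (\<integral>th. g th * F b x th \<partial>m)" for b x
 have smps: "sm (Suc k) (ps b)" for b
  unfolding ps_def by (rule Ck_integral[OF g g0 TL sm F])
 have cs: "csupp (ps b)" for b
 proof -
  let ?M = "(%z. fst z \<odot> snd z) ` (K \<times> (%th. fst th *R w (snd th)) ` ({0..1} \<times> L))"
  have "compact ?M"
   using TL K by (intro compact_continuous_image continuous_intros compact_Times continuous_on_subset[OF w2]) auto
  moreover have "ps b x = 0" if x: "x \<notin> ?M" for x
  proof -
   have "g th * F b x th = 0" for th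
   proof (rule ccontr)
    assume "g th * F b x th ~= 0"
    hence "g th ~= 0" "q x th \<in> K" using K(3) by (auto simp: F_def)
    hence th: "th \<in> {0..1} \<times> L" "q x th \<in> K" using g0[of th] by metis+
    have "x = q x th \<odot> (fst th *R w (snd th))" by (simp add: q_def mul_assoc)
    thus False using x th by (auto intro!: image_eqI[where x = "(q x th, fst th *R w (snd th))"])
   qed
   hence "(%th. g th * F b x th) = (%th. 0)" by (intro ext)
   thus ?thesis by (simp add: ps_def)
  qed
  ultimately show ?thesis unfolding csupp_def by (intro exI conjI) auto
 qed
 have Xps: "X b (ps b) x = (\<integral>th. g th * ((w (snd th) \<bullet> b) * H' (lif b x) x th) \<partial>m)" for b x
 proof -
  have "(ps b has_derivative (%v. \<integral>th. g th * ((w (snd th) \<bullet> b) * H' v x th) \<partial>m)) (at x)"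
   unfolding ps_def[abs_def]
   by (rule has_derivative_weighted_integral[OF g g0 TL sm _ Ck_continuous[OF F]])
    (auto simp: F_def intro!: derivative_eq_intros H'(1) continuous_intros Ck_continuous[OF H'(2)] continuous_on_compose2[OF w2])
  thus ?thesis by (rule X_eq)
 qed
 define D where "D x th = (\<Sum>b\<in>hbasis. (w (snd th) \<bullet> b) * H' (lif b x) x th)" for x th
 have contH': "cont (H' v x)" for v x
  using continuous_on_compose2[OF Ck_continuous[OF H'(2)], of UNIV "%th. (x, th)"] by (simp add: continuous_intros)
 have contD: "cont (D x)" for x
  unfolding D_def by (intro continuous_intros w2 contH')
 have intD: "integrable m (%th. g th * D x th)" for x
 proof -
  have "cont (%z::'a \<times> (real \<times> 'a). D x (snd z))"
   by (rule continuous_on_compose2[OF contD]) (auto intro: continuous_intros)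
  from integrable_weight[OF g g0 TL this sm] show ?thesis .
 qed
 have sumX: "(\<Sum>b\<in>hbasis. X b (ps b) x) = (\<integral>th. g th * D x th \<partial>m)" for x
 proof -
  have "integrable m (%th. g th * ((w (snd th) \<bullet> b) * H' (lif b x) x th))" for b
  proof -
   have c: "cont (%th. (w (snd th) \<bullet> b) * H' (lif b x) x th)" by (intro continuous_intros w2 contH')
   have "cont (%z::'a \<times> (real \<times> 'a). (w (snd (snd z)) \<bullet> b) * H' (lif b x) x (snd z))"
    by (rule continuous_on_compose2[OF c]) (auto intro: continuous_intros)
   from integrable_weight[OF g g0 TL this sm] show ?thesis .
  qed
  thus ?thesis by (simp add: Xps D_def sum_distrib_left)
 qed
 have DX: "((%t. - H (q x (t, p)) p) has_real_derivative D x (t, p)) (at t)" for x t p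
 proof -
  let ?f = "%x. H (q x (t, p)) p"
  have f: "sm (Suc k) ?f"
   using Ck_compose[OF Hq CkV_id, of "%q::real. (t, p)"] by simp
  have D: "D x (t, p) = X (w p) ?f x"
  proof -
   have "w p \<in> V 1" using w(2) by auto
   from X_hbasis[OF f this, of x] show ?thesis using X_eq(1)[OF H'(1), of _ "(t, p)" x] by (simp add: D_def)
  qed
  \<comment> \<open>Right translation by \<open>s *R w p\<close> runs through the segment backwards;
    this explains the minus sign in \<open>DX\<close>.\<close>
  have eq: "?f (x \<odot> (s *R w p)) = H (q x (t - s, p)) p" for s
   by (simp add: q_def mul_assoc scaleR_left_diff_distrib flip: scaleR_minus_left mul_parallel)
    (simp add: mul_parallel algebra_simps flip: scaleR_minus_left)
  have "((%s. H (q x (t - s, p)) p) has_real_derivative D x (t, p)) (at 0)"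
   using X_deriv0[OF f, of x "w p"] by (simp add: eq D)
  hence "((%s. H (q x (t - (t - s), p)) p) has_real_derivative D x (t, p) * (0 - 1)) (at t)"
   by (intro DERIV_chain2[of "%s. H (q x (t - s, p)) p" _ "%s. t - s"]) (auto intro!: derivative_eq_intros)
  thus ?thesis by (auto intro!: derivative_eq_intros)
 qed
 have "(\<integral>th. g th * D x th \<partial>m) = (\<integral>p. H x p - H (x \<odot> (- w p)) p)" for x
 proof -
  have "(\<integral>th. g th * D x th \<partial>m) = (\<integral>p. \<integral>t. g (t, p) * D x (t, p) \<partial>lborel)"
   using P.integral_snd[of "%t p. g (t, p) * D x (t, p)"] intD[of x] by (simp add: m_def case_prod_beta')
  also have "(%p. \<integral>t. g (t, p) * D x (t, p) \<partial>lborel) = (%p. H x p - H (x \<odot> (- w p)) p)"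
  proof
   fix p
   have cD: "isCont (%t. D x (t, p)) t" for t
    using continuous_on_compose2[OF contD[of x], of UNIV "%t. (t, p)"] by (auto simp: continuous_on_eq_continuous_at continuous_intros)
   have FTC: "(\<integral>t. D x (t, p) * indicator {0..1} t \<partial>lborel) = H x p - H (x \<odot> (- w p)) p"
    using has_bochner_integral_FTC_Icc_real[of 0 1 "%t. - H (q x (t, p)) p" "%t. D x (t, p)"] DX cD
    by (auto simp: q_def has_bochner_integral_iff has_real_derivative_iff_has_vector_derivative[symmetric])
   show "(\<integral>t. g (t, p) * D x (t, p) \<partial>lborel) = H x p - H (x \<odot> (- w p)) p"
   proof (cases "p \<in> L")
    case True
    hence "(%t. g (t, p) * D x (t, p)) = (%t. D x (t, p) * indicator {0..1} t)" by (intro ext) (simp add: g_def indicator_def)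
    thus ?thesis using FTC by simp
   next
    case False
    hence "H y p = 0" for y using K(3)[of y p] by blast
    thus ?thesis using False by (simp add: g_def)
   qed
  qed
  finally show ?thesis .
 qed
 thus ?thesis using smps cs sumX by (intro exI[of _ ps]) auto
qed

text \<open>The factors are peeled off one by one: \<open>div_step\<close> treats the difference due
  to the head, and the induction hypothesis is applied to the function translated by it.\<close>

lemma div_list:
 fixes H :: "'a => 'a => real"
 assumes "\<forall>w\<in>set ws. cont w \<and> range w \<subseteq> V 1"
 shows "Ck (Suc k) H ==> compact K ==> compact L ==> (!!x p. H x p ~= 0 ==> x \<in> K \<and> p \<in> L) ==>
  \<exists>ps. (\<forall>b\<in>hbasis. sm (Suc k) (ps b) \<and> csupp (ps b)) \<and>
  (\<forall>x. (\<Sum>b\<in>hbasis. X b (ps b) x) = (\<integral>p. H x p - H (x \<odot> (- gprod (map (%w. w p) ws))) p))"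
 using assms
proof (induction ws arbitrary: H K)
 case Nil
 have "csupp (%x::'a. 0)" unfolding csupp_def by (intro exI[of _ "{}"]) simp
 thus ?case
  by (intro exI[of _ "%b x. 0"]) (simp add: X_def)
next
 case (Cons w ws)
 have w: "cont w" "range w \<subseteq> V 1" using Cons.prems by auto
 let ?H = "%x p. H (x \<odot> (- w p)) p" and ?P = "%p. gprod (map (%w. w p) ws)"
 let ?K = "(%z. fst z \<odot> w (snd z)) ` (K \<times> L)"
 have cw: "cont (%z::'a \<times> 'a. w (snd z))" by (rule continuous_on_compose2[OF w(1)]) (auto intro: continuous_intros)
 have K': "compact ?K"
  by (intro compact_continuous_image continuous_intros compact_Times Cons.prems continuous_on_subset[OF cw]) auto
 have H': "Ck (Suc k) ?H"
  by (rule Ck_compose[OF Cons.prems(1), where Q = "%p. p"]) (intro CkV_mul CkV_id CkV_param continuous_intros w)+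
 have "x \<in> ?K \<and> p \<in> L" if "?H x p ~= 0" for x p
  using Cons.prems(4)[OF that] by (auto intro!: image_eqI[where x = "(x \<odot> (- w p), p)"] simp: mul_assoc)
 from Cons.IH[OF H' K' Cons.prems(3) this] Cons.prems(5) obtain ps1 where ps1: "\<forall>b\<in>hbasis. sm (Suc k) (ps1 b) \<and> csupp (ps1 b)"
  "!!x. (\<Sum>b\<in>hbasis. X b (ps1 b) x) = (\<integral>p. ?H x p - ?H (x \<odot> (- ?P p)) p)" by auto
 obtain ps2 where ps2: "\<forall>b\<in>hbasis. sm (Suc k) (ps2 b) \<and> csupp (ps2 b)"
  "!!x. (\<Sum>b\<in>hbasis. X b (ps2 b) x) = (\<integral>p. H x p - ?H x p)"
  using div_step[OF Cons.prems(1-4) w] by auto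
 have cP: "cont ?P"
  using Cons.prems(5) by (induction ws) (auto intro!: continuous_intros)
 have int: "integrable \<nu> (%p. H (x \<odot> r p) p)" if r: "cont r" for x r
 proof -
  have "cont (%p. H (x \<odot> r p) p)"
   using continuous_on_compose2[OF Ck_continuous[OF Cons.prems(1)], of UNIV "%p. (x \<odot> r p, p)"] r by (simp add: continuous_intros)
  moreover have "csupp (%p. H (x \<odot> r p) p)"
   unfolding csupp_def using Cons.prems(3,4) by (intro exI[of _ L]) blast
  ultimately show ?thesis by (intro bm_integrable bm_continuous)
 qed
 show ?case
 proof (intro exI[of _ "%b x. ps1 b x + ps2 b x"] conjI ballI allI)
  fix b assume b: "b \<in> hbasis"
  thus sm: "sm (Suc k) (%x. ps1 b x + ps2 b x)" using ps1 ps2 by (intro Ck_add) auto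
  have "sm (Suc k) (ps1 b)" "csupp (ps1 b)" "sm (Suc k) (ps2 b)" "csupp (ps2 b)" using ps1(1) ps2(1) b by auto
  hence "bm (ps1 b)" "bm (ps2 b)" by (auto intro: bm_continuous[OF sm_continuous])
  thus "csupp (%x. ps1 b x + ps2 b x)" using bm_add by (auto simp: bm_def)
 next
  fix x
  have "(\<Sum>b\<in>hbasis. X b (%x. ps1 b x + ps2 b x) x) = (\<Sum>b\<in>hbasis. X b (ps1 b) x + X b (ps2 b) x)"
   using ps1 ps2 by (intro sum.cong refl X_add) auto
  also have "... = (\<integral>p. ?H x p - ?H (x \<odot> (- ?P p)) p) + (\<integral>p. H x p - ?H x p)"
   by (simp add: sum.distrib ps1 ps2)
  also have "... = (\<integral>p. H x p - ?H (x \<odot> (- ?P p)) p)"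
   using int[of "%p. 0" x] int[of "%p. - w p" x] int[of "%p. (- ?P p) \<odot> (- w p)" x] w cP
   by (simp add: continuous_intros mul_assoc)
  finally show "(\<Sum>b\<in>hbasis. X b (%x. ps1 b x + ps2 b x) x) = (\<integral>p. H x p - H (x \<odot> (- gprod (map (%w. w p) (w # ws)))) p)"
   by (simp add: minus_mul mul_assoc)
 qed
qed

end

context dilation_base
begin

lemma bump_exists:
 obtains \<Phi> c p where "sm 3 \<Phi>" "!!x. x \<notin> U 1 ==> \<Phi> x = 0" "!!x. \<Phi> x >= 0" "!!x. \<Phi> (- x) = \<Phi> x"
  "(\<integral>x. \<Phi> x) = 1" "c > 0" "!!x. x \<in> U (1 / a ^ p) ==> \<Phi> x >= c"
proof -
 have "(1::real) > 0" by simp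
 then obtain e where e: "e > 0" "ball 0 e \<subseteq> U 1" by (rule U_nbhd)
 \<comment> \<open>The fourth power of the positive part is of class \<open>C^3\<close>. The
   function is even, which will make the means of the fields vanish.\<close>
 define f where "f x = max 0 (1 - 1 / e\<^sup>2 * (x \<bullet> x)) ^ Suc (3 + 0)" for x :: 'a
 have "sm 3 (%x::'a. \<Sum>i\<in>Basis. (x \<bullet> i) * (x \<bullet> i))"
  by (intro Ck_sum Ck_mult Ck_linear linearI) (auto simp: inner_add_left)
 hence sf: "sm 3 f" unfolding f_def by (subst euclidean_inner) (intro Ck_pos_power Ck_diff Ck_cmult Ck_const)
 have f_nz: "f x = 0" if "norm x >= e" for x
  using that e power_mono[of e "norm x" 2] by (simp add: f_def dot_square_norm pos_le_divide_eq)
 have supp: "f x = 0" if "x \<notin> U 1" for x using that e(2) by (intro f_nz) (auto simp: subset_iff not_less[symmetric])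
 have bf: "bm f" by (rule kern_bm) (use Ck_mono[OF sf, of 1] supp in \<open>auto simp: kern_def\<close>)
 have "e / 2 > 0" using e by simp
 then obtain p where p: "!!k x. k >= p ==> x \<in> U (1 / a ^ k) ==> norm x < e / 2" by (rule U_small) (rule that)
 have ge: "f x >= (3 / 4) ^ 4" if "x \<in> U (1 / a ^ p)" for x
 proof -
  have "x \<bullet> x <= (e / 2)\<^sup>2" using p[OF order_refl that] by (simp add: dot_square_norm power_mono)
  hence "3 / 4 <= 1 - 1 / e\<^sup>2 * (x \<bullet> x)" using e by (simp add: power2_eq_square field_simps)
  hence "3 / 4 <= max 0 (1 - 1 / e\<^sup>2 * (x \<bullet> x))" by (rule order_trans[OF _ max.cobounded2])
  hence "(3 / 4) ^ Suc (3 + 0) <= f x" unfolding f_def by (rule power_mono) simp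
  thus ?thesis by (simp add: numeral_eq_Suc)
 qed
 let ?I = "\<integral>x. f x"
 have "0 < (3 / 4) ^ 4 * measure \<nu> (U (1 / a ^ p))" by (simp add: measure_U_pos)
 also have "... = (\<integral>x. (3 / 4) ^ 4 * indicator (bl 0 (1 / a ^ p)) x)" by (simp add: measure_bl)
 also have "... <= ?I"
  by (intro Bochner_Integration.integral_mono bm_integrable bf bm_cmult bm_bl)
   (use ge in \<open>auto simp: indicator_def bl_def f_def\<close>)
 finally have I: "?I > 0" .
 show ?thesis
 proof (rule that[of "%x. 1 / ?I * f x" "1 / ?I * (3 / 4) ^ 4" p])
  show "sm 3 (%x. 1 / ?I * f x)" by (rule Ck_cmult[OF sf])
  show "1 / ?I * f x >= 1 / ?I * (3 / 4) ^ 4" if "x \<in> U (1 / a ^ p)" for x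
   using ge[OF that] I by (intro mult_left_mono) auto
 qed (use supp I in \<open>auto simp: f_def\<close>)
qed

text \<open>
 For a mean zero bump \<open>\<beta>\<close>, averaging \<open>\<beta> (x p) \<Phi> x - \<beta> x \<Phi> (x p\<^sup>-\<^sup>1)\<close>
 over \<open>p\<close> gives \<open>- \<beta> x\<close>, and a factorization of \<open>p\<close> into elements of the first
 layer turns each difference into a sum of horizontal derivatives. The fields \<open>ps b\<close> have mean
 zero because \<open>\<beta>\<close> is even, hence orthogonal to the linear coordinates of the first layer.
\<close>
theorem divergence_form:
 obtains \<Phi> c p ps where "sm 1 \<Phi>" "!!x. x \<notin> U 1 ==> \<Phi> x = 0" "!!x. \<Phi> x >= 0" "c > 0" "!!x. x \<in> U (1 / a ^ p) ==> \<Phi> x >= c"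
  "!!b. b \<in> hbasis ==> sm 3 (ps b)" "!!b x. b \<in> hbasis ==> x \<notin> U 1 ==> ps b x = 0" "!!b. b \<in> hbasis ==> (\<integral>x. ps b x) = 0"
  "!!x. (\<Sum>b\<in>hbasis. X b (ps b) x) = \<Phi> x - sc 1 \<Phi> x"
proof -
 obtain \<Phi> c p where \<Phi>: "sm 3 \<Phi>" "!!x. x \<notin> U 1 ==> \<Phi> x = 0" "!!x. \<Phi> x >= 0" "!!x. \<Phi> (- x) = \<Phi> x"
  "(\<integral>x. \<Phi> x) = 1" "c > 0" "!!x. x \<in> U (1 / a ^ p) ==> \<Phi> x >= c" by (rule bump_exists) (rule that)
 have b\<Phi>: "bm \<Phi>" by (rule kern_bm) (use Ck_mono[OF \<Phi>(1), of 1] \<Phi>(2) in \<open>auto simp: kern_def\<close>)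
 define \<beta> where "\<beta> x = \<Phi> x - sc 1 \<Phi> x" for x
 have sm\<beta>: "sm 3 \<beta>" unfolding \<beta>_def by (intro Ck_diff \<Phi> sm_sc)
 have b\<beta>: "bm \<beta>" unfolding \<beta>_def[abs_def] by (intro bm_diff bm_sc b\<Phi>)
 have \<beta>0: "(\<integral>x. \<beta> x) = 0"
 proof -
  have "(\<integral>x. sc 1 \<Phi> x) = (\<integral>x. \<Phi> x)"
   using integral_sc[OF bm_measurable[OF b\<Phi>], of 1] by (simp add: sc_def)
  thus ?thesis unfolding \<beta>_def
   by (subst Bochner_Integration.integral_diff) (auto intro!: bm_integrable b\<Phi> bm_sc)
 qed
 have \<beta>U: "\<beta> x = 0" if "x \<notin> U 1" for x
 proof -
  have "dil a x \<notin> U 1" using that U_mono[of "1 / a" 1] by (auto simp: U_dil)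
  thus ?thesis using that \<Phi>(2) by (simp add: \<beta>_def sc_def)
 qed
 obtain ws where ws: "\<forall>w\<in>set ws. cont w \<and> range w \<subseteq> V 1" "!!y. gprod (map (%w. w y) ws) = y"
  by (rule horizontal_factorization) (rule that, auto)
 let ?H = "%x p. \<beta> (x \<odot> p) * \<Phi> x"
 have "Ck (Suc 2) ?H"
 proof (rule Ck_mult)
  have "Ck 3 (%x p. \<beta> (x \<odot> p))" by (rule sm_compose[OF sm\<beta>]) (intro CkV_mul CkV_id CkV_param continuous_on_id)
  moreover have "Ck 3 (%x (p::'a). \<Phi> x)" by (rule sm_compose[OF \<Phi>(1) CkV_id])
  ultimately show "Ck (Suc 2) (%x p. \<beta> (x \<odot> p))" "Ck (Suc 2) (%x (p::'a). \<Phi> x)" by (simp_all add: numeral_3_eq_3 numeral_2_eq_2)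
 qed
 moreover have "x \<in> U 1 \<and> p \<in> U (a * 1)" if "?H x p ~= 0" for x p
 proof -
  have "x \<in> U 1" "x \<odot> p \<in> U 1" using that \<Phi>(2) \<beta>U by auto
  thus ?thesis using U2[of 1 "- x" "x \<odot> p"] by simp
 qed
 ultimately obtain ps where ps: "\<forall>b\<in>hbasis. sm (Suc 2) (ps b) \<and> csupp (ps b)"
  "!!x. (\<Sum>b\<in>hbasis. X b (ps b) x) = (\<integral>p. ?H x p - ?H (x \<odot> (- gprod (map (%w. w p) ws))) p)"
  using div_list[OF ws(1) _ compact_U compact_U] by blast
 have div: "(\<Sum>b\<in>hbasis. X b (ps b) x) = - \<beta> x" for x
 proof -
  have int: "integrable \<nu> (%p. \<beta> (x \<odot> p) * \<Phi> x)" "integrable \<nu> (%p. \<beta> x * \<Phi> (x \<odot> (- p)))"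
   using bm_integrable[OF bm_left[OF b\<beta>, of x]] bm_integrable[OF bm_uminus[OF bm_left[OF b\<Phi>, of x]]] by auto
  have "(\<integral>p. \<Phi> (x \<odot> (- p))) = 1"
   using integral_minus[of "%p. \<Phi> (x \<odot> p)"] integral_left(1)[of \<Phi> x] bm_measurable[OF b\<Phi>] \<Phi>(5) by simp
  moreover have "(\<integral>p. \<beta> (x \<odot> p)) = 0" using integral_left(1)[of \<beta> x] bm_measurable[OF b\<beta>] \<beta>0 by simp
  ultimately show ?thesis
   using int by (simp add: ps(2) ws(2) mul_assoc)
 qed
 have zero: "(\<integral>x. ps b x) = 0" if b: "b \<in> hbasis" for b
 proof -
  let ?l = "%x. comp 1 x \<bullet> b"
  have lin: "linear ?l" using linear_comp[of 1] by (intro linearI) (simp_all add: linear_add linear_scale inner_add_left)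
  have sl: "sm (Suc 2) ?l" by (rule Ck_linear[OF lin])
  have Xl: "X d ?l x = (if d = b then 1 else 0)" if d: "d \<in> hbasis" for d x
  proof (rule X_unique)
   have "d \<in> V 1" using hbasis(1) d by auto
   hence "comp 1 d = d" by (simp add: comp_V)
   thus "((%t. comp 1 (x \<odot> (t *R d)) \<bullet> b) has_real_derivative (if d = b then 1 else 0)) (at 0)"
    using hbasis_inner[OF d b] by (auto intro!: derivative_eq_intros simp: comp1_mul linear_scale[OF linear_comp] inner_add_left simp del: One_nat_def)
  qed
  have i: "integrable \<nu> (%x. ?l x * X d (ps d) x)" if d: "d \<in> hbasis" for d
  proof -
   have "sm (Suc 2) (ps d)" "csupp (ps d)" using ps(1) d by auto
   thus ?thesis
    by (intro bm_integrable bm_continuous continuous_on_mult sm_continuous[OF sl] sm_continuous[OF sm_X] csupp_mult_right csupp_X)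
  qed
  have "(\<integral>x. ?l x * - \<beta> x) = (\<Sum>d\<in>hbasis. \<integral>x. ?l x * X d (ps d) x)"
   using i by (simp add: div[symmetric] sum_distrib_left Bochner_Integration.integral_sum)
  also have "... = (\<Sum>d\<in>hbasis. - (\<integral>x. X d ?l x * ps d x))"
   using integral_by_parts[OF sl] ps(1) by (intro sum.cong refl) simp
  also have "... = (\<Sum>d\<in>hbasis. if d = b then - (\<integral>x. ps b x) else 0)"
   using Xl by (intro sum.cong refl) auto
  also have "... = - (\<integral>x. ps b x)" using b hbasis(4) by simp
  finally have 1: "(\<integral>x. ps b x) = (\<integral>x. ?l x * \<beta> x)" by simp
  have "\<beta> (- x) = \<beta> x" for x using \<Phi>(4)[of "dil a x"] by (simp add: \<beta>_def sc_def \<Phi>(4) linear_neg[OF linear_dil])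
  hence neg: "(\<integral>x. ?l (- x) * \<beta> (- x)) = - (\<integral>x. ?l x * \<beta> x)"
   using linear_neg[OF linear_comp[of 1]] by (simp del: One_nat_def)
  moreover have "(\<integral>x. ?l (- x) * \<beta> (- x)) = (\<integral>x. ?l x * \<beta> x)"
   using borel_measurable_continuous_onI[OF sm_continuous[OF sl]] bm_measurable[OF b\<beta>] by (intro integral_minus borel_measurable_times)
  ultimately show ?thesis using 1 by simp
 qed
 have "\<exists>n. \<forall>x. ps b x ~= 0 --> x \<in> U (a ^ n)" if b: "b \<in> hbasis" for b
 proof -
  obtain K where K: "compact K" "!!x. x \<notin> K ==> ps b x = 0"
   using ps(1)[rule_format, OF b, THEN conjunct2] by (rule csuppE) (rule that)
  obtain r where r: "r >= 2" "K \<subseteq> U r" using bounded_subset_U[OF K(1)] by blast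
  obtain n where "r < a ^ n" using real_arch_pow[of a r] a2 by auto
  hence "K \<subseteq> U (a ^ n)" using r U_mono[of r "a ^ n"] by auto
  thus ?thesis using K(2) by (intro exI[of _ n]) blast
 qed
 then obtain n where n: "!!b x. b \<in> hbasis ==> ps b x ~= 0 ==> x \<in> U (a ^ n b)" by metis
 define N where "N = (\<Sum>b\<in>hbasis. n b)"
 have N: "x \<in> U (a ^ N)" if "b \<in> hbasis" "ps b x ~= 0" for b x
  using n[OF that] member_le_sum[of b hbasis n] that(1) hbasis(4) U_mono[of "a ^ n b" "a ^ N"]
  by (auto simp: N_def power_increasing)
 \<comment> \<open>The dilation by \<open>a ^ N\<close> brings all supports into \<open>U 1\<close>
   and multiplies horizontal derivatives by \<open>a ^ N\<close>, which the coefficient cancels; the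
   sign turns the divergence \<open>- \<beta>\<close> into a difference of two bumps in the desired
   order.\<close>
 define \<xi> where "\<xi> b x = - (1 / a ^ N) * sc N (ps b) x" for b x
 show ?thesis
 proof (rule that[of "sc N \<Phi>" "vol a ^ N * c" "p + N" \<xi>])
  show "sm 1 (sc N \<Phi>)" by (rule sm_sc[OF Ck_mono[OF \<Phi>(1)]]) simp
  show "sc N \<Phi> x = 0" if "x \<notin> U 1" for x
  proof -
   have "dil (a ^ N) x \<notin> U 1" using that U_mono[of "1 / a ^ N" 1] by (auto simp: U_dil)
   thus ?thesis using \<Phi>(2) by (simp add: sc_def)
  qed
  show "sc N \<Phi> x >= 0" for x using \<Phi>(3) by (simp add: sc_def)
  show "vol a ^ N * c > 0" using \<Phi>(6) by simp
  show "sc N \<Phi> x >= vol a ^ N * c" if "x \<in> U (1 / a ^ (p + N))" for x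
   using that \<Phi>(7)[of "dil (a ^ N) x"] by (simp add: sc_def U_dil power_add)
  fix b assume b: "b \<in> hbasis"
  have sps: "sm (Suc 2) (ps b)" using ps(1) b by blast
  show "sm 3 (\<xi> b)" unfolding \<xi>_def using sm_sc[OF sps, of N] by (intro Ck_cmult) (simp add: numeral_3_eq_3 numeral_2_eq_2)
  show "\<xi> b x = 0" if "x \<notin> U 1" for x
  proof (rule ccontr)
   assume "\<xi> b x ~= 0"
   hence "dil (a ^ N) x \<in> U (a ^ N)" using N[OF b] by (auto simp: \<xi>_def sc_def)
   thus False using that by (simp add: U_dil)
  qed
  have "bm (ps b)" using ps(1) b sm_continuous by (blast intro: bm_continuous)
  from integral_sc[OF bm_measurable[OF this], of N] show "(\<integral>x. \<xi> b x) = 0" using zero[OF b] by (simp add: \<xi>_def sc_def)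
 next
  fix x
  have "X b (\<xi> b) x = - sc N (X b (ps b)) x" if b: "b \<in> hbasis" for b
  proof -
   have sps: "sm (Suc 2) (ps b)" and bV: "b \<in> V 1" using ps(1) b hbasis(1) by auto
   have "X b (\<xi> b) x = - (1 / a ^ N) * X b (sc N (ps b)) x" unfolding \<xi>_def by (rule X_cmult[OF sm_sc[OF sps]])
   thus ?thesis using X_sc[OF sps bV, of N x] by simp
  qed
  hence "(\<Sum>b\<in>hbasis. X b (\<xi> b) x) = - (vol a ^ N * (\<Sum>b\<in>hbasis. X b (ps b) (dil (a ^ N) x)))"
   by (simp add: sum_negf sc_def sum_distrib_left)
  also have "... = sc N \<Phi> x - sc 1 (sc N \<Phi>) x"
   by (simp add: div \<beta>_def sc_def right_diff_distrib mult_ac)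
  finally show "(\<Sum>b\<in>hbasis. X b (\<xi> b) x) = sc N \<Phi> x - sc 1 (sc N \<Phi>) x" .
 qed
qed

end

section \<open>Vector fields with small values and large divergence on a null set\<close>

context dilation_base
begin

text \<open>The compact sets decrease to a subset of \<open>N\<close>, which is null, and continuity
  from above applies within the compact window \<open>W\<close>.\<close>

lemma thickening_small:
 assumes N: "compact N" "emeasure \<nu> N = 0" and W: "compact W" and d: "d > 0"
 obtains M where "compact ((%z. fst z \<odot> snd z) ` (N \<times> U (1 / a ^ Suc M)))"
  "measure \<nu> ((%z. fst z \<odot> snd z) ` (N \<times> U (1 / a ^ Suc M)) \<inter> W) < d"
proof -
 define T where "T j = (%z. fst z \<odot> snd z) ` (N \<times> U (1 / a ^ j))" for j :: nat
 have T: "compact (T j)" for j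
  unfolding T_def by (intro compact_continuous_image continuous_intros compact_Times N compact_U)
 have Tb: "T j \<inter> W \<in> sets \<nu>" for j using T[of j] W by (simp add: compact_imp_closed)
 have "decseq (%j. T j \<inter> W)"
 proof (rule decseq_SucI)
  fix j
  have "U (1 / a ^ Suc j) \<subseteq> U (1 / a ^ j)" by (rule U_mono) (auto simp: divide_simps)
  thus "T (Suc j) \<inter> W \<subseteq> T j \<inter> W" unfolding T_def by (intro Int_mono image_mono Sigma_mono) auto
 qed
 hence lim: "(%j. measure \<nu> (T j \<inter> W)) \<longlonglongrightarrow> measure \<nu> (\<Inter>j. T j \<inter> W)"
  using Tb emeasure_haar_compact[OF compact_Int[OF T W]] by (intro Lim_measure_decseq) (auto simp: less_top)
 have sub: "(\<Inter>j. T j \<inter> W) \<subseteq> N"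
 proof (rule subsetI, rule ccontr)
  fix x assume x: "x \<in> (\<Inter>j. T j \<inter> W)" "x \<notin> N"
  have "open ((%u. x \<odot> (- u)) -` (- N))"
   using N(1) by (intro open_vimage continuous_intros) (simp add: compact_imp_closed open_Compl)
  moreover have "0 \<in> (%u. x \<odot> (- u)) -` (- N)" using x by simp
  ultimately obtain e where e: "e > 0" "ball 0 e \<subseteq> (%u. x \<odot> (- u)) -` (- N)" by (rule openE)
  obtain n where n: "!!k u. k >= n ==> u \<in> U (1 / a ^ k) ==> norm u < e" using e(1) by (rule U_small) (rule that)
  have "x \<in> T n" using x by auto
  then obtain y u where y: "y \<in> N" "u \<in> U (1 / a ^ n)" "x = y \<odot> u" by (auto simp: T_def)
  hence "x \<odot> (- u) \<notin> N" using n[OF order_refl y(2)] e(2) by auto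
  thus False using y by (simp add: mul_assoc)
 qed
 have nullN: "N \<in> null_sets \<nu>" using N by (auto simp: compact_imp_closed)
 have "closed (\<Inter>j. T j \<inter> W)" using T W by (intro closed_INT ballI compact_imp_closed compact_Int)
 hence bor: "(\<Inter>j. T j \<inter> W) \<in> sets \<nu>" by simp
 have "(\<Inter>j. T j \<inter> W) \<in> null_sets \<nu>" by (rule null_sets_subset[OF nullN bor sub])
 hence "measure \<nu> (\<Inter>j. T j \<inter> W) = 0" by (rule measure_eq_0_null_sets)
 hence "\<forall>\<^sub>F j in sequentially. measure \<nu> (T j \<inter> W) < d" using lim d by (auto dest: order_tendstoD)
 then obtain j0 where "\<forall>j\<ge>j0. measure \<nu> (T j \<inter> W) < d" by (auto simp: eventually_sequentially)
 hence "measure \<nu> (T (Suc j0) \<inter> W) < d" by simp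
 thus ?thesis by (rule that[OF T[of "Suc j0", unfolded T_def], unfolded T_def[symmetric]])
qed

lemma abs_conv_le_L1:
 assumes "bm f" "bm et" "!!x. \<bar>f x\<bar> <= 1" shows "\<bar>conv f et x\<bar> <= L1 et"
proof -
 have [measurable]: "f \<in> Borel" using assms by (simp add: bm_measurable)
 have "norm (\<integral>y. f (x \<odot> (- y)) * et y) <= (\<integral>y. \<bar>et y\<bar>)"
 proof (rule norm_lebesgue_integral_le)
  have "bm (%y. et y * f (x \<odot> (- y)))" using assms(3) by (intro bm_mult_bounded[OF assms(2)]) auto
  thus "integrable \<nu> (%y. f (x \<odot> (- y)) * et y)" by (simp add: bm_integrable mult.commute)
  show "norm (f (x \<odot> (- y)) * et y) <= \<bar>et y\<bar>" for y
   using mult_right_mono[OF assms(3)[of "x \<odot> (- y)"], of "\<bar>et y\<bar>"] by (simp add: abs_mult)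
 qed (intro bm_integrable bm_abs assms)
 thus ?thesis using assms by (simp add: conv_alt L1_def)
qed

text \<open>The lower bound \<open>c\<close> holds near the origin, but the divergence is
  nonnegative on all of \<open>N\<close>; translated copies can therefore be added without
  cancellation.\<close>

definition local_field :: "nat => real => real => 'a set => ('a => 'a => real) => bool" where
 "local_field p C c N F \<longleftrightarrow> (\<forall>b\<in>hbasis. sm 1 (F b) \<and> (\<forall>x. x \<notin> U a --> F b x = 0) \<and> (\<forall>x. \<bar>F b x\<bar> <= C) \<and> (\<forall>d\<in>hbasis. \<forall>x. \<bar>X d (F b) x\<bar> <= C)) \<and>
   (\<forall>x\<in>N. (\<Sum>b\<in>hbasis. X b (F b) x) >= 0 \<and> (x \<in> U (1 / a ^ p) --> (\<Sum>b\<in>hbasis. X b (F b) x) >= c))"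

text \<open>
 The divergence of \<open>F b = (\<Sum>k\<le>M. a\<^sup>-\<^sup>k ph * sc k (ps b))\<close> telescopes to
 \<open>ph * \<Phi> - ph * sc (Suc M) \<Phi>\<close>, and the last term vanishes on \<open>N\<close> because
 \<open>ph\<close> vanishes near \<open>N\<close>.
\<close>
lemma local_field_exists:
 obtains p C c where "C > 0" "c > 0" "!!N. compact N ==> emeasure \<nu> N = 0 ==>
  \<exists>F. local_field p C c N F"
proof -
 obtain \<Phi> c p ps where \<Phi>: "sm 1 \<Phi>" "!!x. x \<notin> U 1 ==> \<Phi> x = 0" "!!x. \<Phi> x >= 0" "c > 0" "!!x. x \<in> U (1 / a ^ p) ==> \<Phi> x >= c"
  and ps: "!!b. b \<in> hbasis ==> sm 3 (ps b)" "!!b x. b \<in> hbasis ==> x \<notin> U 1 ==> ps b x = 0"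
   "!!b. b \<in> hbasis ==> (\<integral>x. ps b x) = 0"
  and div: "!!x. (\<Sum>b\<in>hbasis. X b (ps b) x) = \<Phi> x - sc 1 \<Phi> x" by (rule divergence_form) (rule that)
 have k\<Phi>: "kern \<Phi>" using \<Phi> by (simp add: kern_def)
 hence b\<Phi>: "bm \<Phi>" by (rule kern_bm)
 have kps: "kern (ps b)" if "b \<in> hbasis" for b using ps(2)[OF that] Ck_mono[OF ps(1)[OF that], of 1] by (simp add: kern_def)
 have sps: "sm (Suc (Suc (Suc 0))) (ps b)" if "b \<in> hbasis" for b using ps(1)[OF that] by (simp add: numeral_3_eq_3)
 have hV: "d \<in> V 1" if "d \<in> hbasis" for d using that hbasis(1) by blast
 define ka where "ka q = X (fst q) (ps (snd q))" for q
 \<comment> \<open>The window is one scale smaller than the ball where \<Phi> is at least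
   \<open>c\<close>, so that \<open>(- y) \<odot> x\<close> lies in that ball for all
   \<open>x\<close> and \<open>y\<close> in the window.\<close>
 let ?Q = "hbasis \<times> hbasis" and ?W = "U (1 / a ^ Suc p)"
 have Q: "finite ?Q" using hbasis by simp
 have kka: "kern (ka q)" if "q \<in> ?Q" for q
  using that X_kern[OF sps ps(2)] by (auto simp: ka_def)
 have L2: "\<exists>A>0. \<forall>M f. bm f --> ip (osc (ka q) M f) (osc (ka q) M f) <= A * ip f f" if q: "q \<in> ?Q" for q
 proof -
  have s: "snd q \<in> hbasis" "fst q \<in> hbasis" using q by auto
  obtain A where "A > 0" "!!M (f :: 'a => real). bm f ==>
   ip (%x. \<Sum>k\<le>M. conv f (sc k (X (fst q) (ps (snd q)))) x) (%x. \<Sum>k\<le>M. conv f (sc k (X (fst q) (ps (snd q)))) x) <= A * ip f f"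
   by (rule L2_bound[OF ps(1)[OF s(1)] ps(2)[OF s(1)] ps(3)[OF s(1)] hV[OF s(2)]]) (assumption, rule that)
  thus ?thesis by (intro exI[of _ A]) (auto simp: osc_def[abs_def] ka_def)
 qed
 have mW: "measure \<nu> ?W > 0" by (simp add: measure_U_pos)
 obtain l where l: "l > 0" "!!M E. E \<in> sets borel ==> measure \<nu> (E \<inter> ?W) <= measure \<nu> ?W / 4 ==>
  \<exists>ph\<in>densities ?W E. \<forall>q\<in>?Q. \<forall>x. \<bar>osc (ka q) M ph x\<bar> <= l"
  by (rule bounded_density[OF Q kka L2 compact_U[of "1 / a ^ Suc p"] mW]) (assumption, assumption, rule that)
 \<comment> \<open>The first summand bounds the derivatives, the second the values, through the
   geometric series of the factors \<open>1 / a ^ k\<close>.\<close>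
 define C where "C = l + 2 * (\<Sum>b\<in>hbasis. L1 (ps b))"
 have sL: "(\<Sum>b\<in>hbasis. L1 (ps b)) >= 0" by (intro sum_nonneg L1_nonneg)
 show ?thesis
 proof (rule that[of C "c * (measure \<nu> ?W / 2)" "Suc p"])
  show "C > 0" "c * (measure \<nu> ?W / 2) > 0" using l(1) sL \<Phi>(4) mW by (auto simp: C_def)
  fix N assume N: "compact N" "emeasure \<nu> N = 0"
  let ?T = "%M. (%z. fst z \<odot> snd z) ` (N \<times> U (1 / a ^ Suc M))"
  \<comment> \<open>The null set enters here: it determines the truncation \<open>M\<close>, on
    which the bound \<open>l\<close> does not depend.\<close>
  obtain M where M: "compact (?T M)" "measure \<nu> (?T M \<inter> ?W) < measure \<nu> ?W / 4"
   by (rule thickening_small[OF N compact_U[of "1 / a ^ Suc p"], of "measure \<nu> ?W / 4"]) (use mW in simp, rule that)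
  have "(?T M) \<in> sets borel" using M(1) by (simp add: compact_imp_closed)
  from l(2)[OF this less_imp_le[OF M(2)], of M]
  obtain ph where ph: "ph \<in> densities ?W (?T M)" "!!q x. q \<in> ?Q ==> \<bar>osc (ka q) M ph x\<bar> <= l" by blast
  have bph: "bm ph" and ph01: "!!x. 0 <= ph x" "!!x. ph x <= 1" and phW: "!!x. ph x ~= 0 ==> x \<in> ?W"
   and phE: "!!x. x \<in> (?T M) ==> ph x = 0" and phI: "measure \<nu> ?W / 2 <= (\<integral>x. ph x)"
   using ph(1) unfolding densities_def by blast+
  have W1: "?W \<subseteq> U 1" by (rule U_mono) (simp_all del: power_Suc)
  define F where "F b x = (\<Sum>k\<le>M. (1 / a ^ k) * conv ph (sc k (ps b)) x)" for b x
  have smk: "sm (Suc 0) (conv ph (sc k (ps b)))" if "b \<in> hbasis" for b k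
   by (rule sm_conv[OF bph sm_sc[OF Ck_mono[OF sps[OF that]]]]) simp
  have XF: "X d (F b) x = osc (ka (d, b)) M ph x" if b: "b \<in> hbasis" and d: "d \<in> hbasis" for b d x
  proof -
   have "X d (F b) x = (\<Sum>k\<le>M. X d (%x. (1 / a ^ k) * conv ph (sc k (ps b)) x) x)"
    unfolding F_def by (rule X_sum[where k = 0]) (intro Ck_cmult smk b)
   also have "... = (\<Sum>k\<le>M. (1 / a ^ k) * conv ph (X d (sc k (ps b))) x)"
    by (simp only: X_cmult[OF smk[OF b]] X_conv[OF bph sm_sc[OF sps[OF b]]])
   also have "... = (\<Sum>k\<le>M. (1 / a ^ k) * conv ph (%x. a ^ k * sc k (X d (ps b)) x) x)"
    using X_sc[OF sps[OF b] hV[OF d]] by (simp add: conv_def)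
   also have "... = osc (ka (d, b)) M ph x" by (simp add: conv_cmult_right osc_def ka_def)
   finally show ?thesis .
  qed
  have sumX: "(\<Sum>b\<in>hbasis. X b (F b) x) = conv ph \<Phi> x" if x: "x \<in> N" for x
  proof -
   have bX: "bm (sc k (X b (ps b)))" if "b \<in> hbasis" for k b
    using kern_bm[OF kka[of "(b, b)"]] that by (intro bm_sc) (simp add: ka_def)
   have "(\<Sum>b\<in>hbasis. X b (F b) x) = (\<Sum>b\<in>hbasis. \<Sum>k\<le>M. conv ph (sc k (X b (ps b))) x)"
    using XF by (simp add: osc_def ka_def)
   also have "... = (\<Sum>k\<le>M. \<Sum>b\<in>hbasis. conv ph (sc k (X b (ps b))) x)" by (rule sum.swap)
   also have "... = (\<Sum>k\<le>M. conv ph (sc k \<Phi>) x - conv ph (sc (Suc k) \<Phi>) x)"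
   proof (rule sum.cong)
    fix k
    have "(\<Sum>b\<in>hbasis. conv ph (sc k (X b (ps b))) x) = conv ph (%x. \<Sum>b\<in>hbasis. sc k (X b (ps b)) x) x"
     using bX by (simp add: conv_sum_right[OF bph])
    also have "(%x. \<Sum>b\<in>hbasis. sc k (X b (ps b)) x) = (%x. sc k \<Phi> x - sc (Suc k) \<Phi> x)"
     by (rule ext) (simp add: sc_def sum_distrib_left[symmetric] div right_diff_distrib mult_ac)
    also have "conv ph (%x. sc k \<Phi> x - sc (Suc k) \<Phi> x) x = conv ph (sc k \<Phi>) x - conv ph (sc (Suc k) \<Phi>) x"
     using bm_integrable[OF conv_integrand_bm[OF bph bm_sc[OF b\<Phi>]]] by (simp add: conv_def right_diff_distrib)
    finally show "(\<Sum>b\<in>hbasis. conv ph (sc k (X b (ps b))) x) = conv ph (sc k \<Phi>) x - conv ph (sc (Suc k) \<Phi>) x" .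
   qed simp
   also have "... = conv ph (sc 0 \<Phi>) x - conv ph (sc (Suc M) \<Phi>) x" by (rule sum_telescope)
   also have "conv ph (sc (Suc M) \<Phi>) x = 0"
   proof (rule conv_zero, rule ccontr)
    fix y assume y: "ph y ~= 0" "sc (Suc M) \<Phi> ((- y) \<odot> x) ~= 0"
    have "- ((- y) \<odot> x) \<in> U (1 / a ^ Suc M)" using sc_support[OF k\<Phi> y(2)] by simp
    hence "y \<in> (?T M)" using x by (intro image_eqI[where x = "(x, - ((- y) \<odot> x))"]) (auto simp: minus_mul)
    thus False using phE y(1) by blast
   qed
   finally show ?thesis by simp
  qed
  have "sm 1 (F b) \<and> (\<forall>x. x \<notin> U a --> F b x = 0) \<and> (\<forall>x. \<bar>F b x\<bar> <= C) \<and> (\<forall>d\<in>hbasis. \<forall>x. \<bar>X d (F b) x\<bar> <= C)" if b: "b \<in> hbasis" for b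
  proof (intro conjI allI impI ballI)
   show "sm 1 (F b)" unfolding F_def One_nat_def by (intro Ck_sum Ck_cmult smk b)
   show "\<bar>X d (F b) x\<bar> <= C" if "d \<in> hbasis" for d x
    using ph(2)[of "(d, b)" x] that b XF[OF b that, of x] sL by (simp add: C_def)
   show "F b x = 0" if x: "x \<notin> U a" for x
   proof -
    have "conv ph (sc k (ps b)) x = 0" for k
    proof (rule conv_zero, rule ccontr)
     fix y assume y: "ph y ~= 0" "sc k (ps b) ((- y) \<odot> x) ~= 0"
     have "(- y) \<odot> x \<in> U 1" using sc_support[OF kps[OF b] y(2)] U_mono[of "1 / a ^ k" 1] by auto
     hence "y \<odot> ((- y) \<odot> x) \<in> U (a * 1)" using phW[OF y(1)] W1 by (intro U2) auto
     thus False using x by simp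
    qed
    thus ?thesis by (simp add: F_def)
   qed
   show "\<bar>F b x\<bar> <= C" for x
   proof -
    have "\<bar>F b x\<bar> <= (\<Sum>k\<le>M. 1 / a ^ k * L1 (ps b))"
     unfolding F_def
    proof (intro order_trans[OF sum_abs] sum_mono)
     fix k
     have "\<bar>conv ph (sc k (ps b)) x\<bar> <= L1 (sc k (ps b))"
      using ph01 kern_bm[OF kps[OF b]] by (intro abs_conv_le_L1 bph bm_sc) auto
     thus "\<bar>1 / a ^ k * conv ph (sc k (ps b)) x\<bar> <= 1 / a ^ k * L1 (ps b)"
      using L1_sc[OF kern_bm[OF kps[OF b]], of k] by (simp add: abs_mult divide_right_mono)
    qed
    also have "... = (\<Sum>k\<le>M. 1 / a ^ k) * L1 (ps b)" by (simp add: sum_distrib_right)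
    also have "... <= 2 * L1 (ps b)" by (intro mult_right_mono sum_geometric_le L1_nonneg) simp
    also have "... <= 2 * (\<Sum>b\<in>hbasis. L1 (ps b))"
     using member_le_sum[of b hbasis "%b. L1 (ps b)"] b hbasis(4) L1_nonneg by simp
    also have "... <= C" using l(1) by (simp add: C_def)
    finally show ?thesis .
   qed
  qed
  moreover have "(\<Sum>b\<in>hbasis. X b (F b) x) >= 0 \<and> (x \<in> U (1 / a ^ Suc p) --> (\<Sum>b\<in>hbasis. X b (F b) x) >= c * (measure \<nu> ?W / 2))"
   if x: "x \<in> N" for x
   unfolding sumX[OF x]
  proof (intro conjI impI)
   show "conv ph \<Phi> x >= 0" unfolding conv_def using ph01 \<Phi>(3) by (intro Bochner_Integration.integral_nonneg mult_nonneg_nonneg) auto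
   assume xW: "x \<in> ?W"
   have "c * (measure \<nu> ?W / 2) <= c * (\<integral>y. ph y)" using phI \<Phi>(4) by (intro mult_left_mono) auto
   also have "... = (\<integral>y. ph y * c)" by simp
   also have "... <= conv ph \<Phi> x" unfolding conv_def
   proof (rule Bochner_Integration.integral_mono)
    show "integrable \<nu> (%y. ph y * c)" using bm_integrable[OF bph] by simp
    show "integrable \<nu> (%y. ph y * \<Phi> ((- y) \<odot> x))" by (intro bm_integrable conv_integrand_bm bph b\<Phi>)
    fix y
    show "ph y * c <= ph y * \<Phi> ((- y) \<odot> x)"
    proof (cases "ph y = 0")
     case False
     have "(- y) \<odot> x \<in> U (a * (1 / a ^ Suc p))" using phW[OF False] xW by (intro U2) auto
     thus ?thesis using \<Phi>(5) ph01(1) by (intro mult_left_mono) auto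
    qed simp
   qed
   finally show "c * (measure \<nu> ?W / 2) <= conv ph \<Phi> x" .
  qed
  ultimately show "\<exists>F. local_field (Suc p) C (c * (measure \<nu> ?W / 2)) N F"
   unfolding local_field_def by (intro exI[of _ F] conjI ballI) auto
 qed
qed

lemma card_disjoint_balls:
 assumes Z: "finite Z" "disjoint_family_on (%z. bl z r) Z" "!!z. z \<in> Z ==> bl z r \<subseteq> S" and S: "compact S"
 shows "real (card Z) * measure \<nu> (U r) <= measure \<nu> S"
proof -
 have "real (card Z) * measure \<nu> (U r) = (\<Sum>z\<in>Z. measure \<nu> (bl z r))" by (simp add: measure_bl)
 also have "... = measure \<nu> (\<Union>z\<in>Z. bl z r)"
  using Z emeasure_haar_compact[OF compact_bl] by (intro measure_finite_Union[symmetric]) (auto simp: less_top)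
 also have "... <= measure \<nu> S"
  using Z S emeasure_haar_compact[OF S] by (intro measure_mono_fmeasurable fmeasurableI) (auto simp: compact_imp_closed)
 finally show ?thesis .
qed

definition small_field :: "real => real => real => 'a set => ('a => 'a => real) => bool" where
 "small_field e C c N F \<longleftrightarrow> (\<forall>b\<in>hbasis. sm 1 (F b) \<and> csupp (F b) \<and> (\<forall>x. \<bar>F b x\<bar> <= e) \<and> (\<forall>d\<in>hbasis. \<forall>x. \<bar>X d (F b) x\<bar> <= C)) \<and>
   (\<forall>x\<in>N. (\<Sum>b\<in>hbasis. X b (F b) x) >= c)"

text \<open>Translated and dilated local fields overlap boundedly often at every scale.\<close>
theorem small_field_exists:
 obtains C c where "C > 0" "c > 0" "!!N e. compact N ==> emeasure \<nu> N = 0 ==> e > 0 ==>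
  \<exists>F. small_field e C c N F"
proof -
 obtain p C c where C: "C > 0" "c > 0" and loc: "!!N. compact N ==> emeasure \<nu> N = 0 ==>
  \<exists>F. local_field p C c N F"
  by (rule local_field_exists) (rule that)
 \<comment> \<open>A bound for the overlap: disjoint balls of radius
   \<open>1 / a ^ (n + p + 1)\<close> are packed into a ball whose radius is larger by the factor
   \<open>a ^ (p + 3)\<close>.\<close>
 define J where "J = vol a ^ (p + 3)"
 have J: "J > 0" by (simp add: J_def)
 show ?thesis
 proof (rule that[of "J * C" c])
  show "J * C > 0" "c > 0" using J C by auto
  fix N and e :: real assume N: "compact N" "emeasure \<nu> N = 0" and e: "e > 0"
  obtain n where "1 / a ^ n < e / (J * C)" using small_power[of "e / (J * C)"] e J C by auto
  hence n: "J * (C / a ^ n) <= e" using J C by (simp add: field_simps)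
  \<comment> \<open>Balls of this radius around the selected centres are disjoint, and those of
    radius \<open>a * r\<close> cover \<open>N\<close>; the latter is the radius at which a local
    field dilated by \<open>a ^ n\<close> has large divergence.\<close>
  define r where "r = 1 / a ^ Suc (n + p)"
  have r0: "r > 0" by (simp add: r_def)
  have ar: "a * r = 1 / a ^ (n + p)" by (simp add: r_def)
  let ?S = "(%z. fst z \<odot> snd z) ` (N \<times> U r)"
  have S: "compact ?S" by (intro compact_continuous_image continuous_intros compact_Times N compact_U)
  have cardb: "card Z <= nat \<lceil>measure \<nu> ?S / measure \<nu> (U r)\<rceil>" if Z: "finite Z" "Z \<subseteq> N" "disjoint_family_on (%z. bl z r) Z" for Z
  proof -
   have "bl z r \<subseteq> ?S" if z: "z \<in> Z" for z
   proof
    fix y assume "y \<in> bl z r"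
    thus "y \<in> ?S" using z Z(2) by (intro image_eqI[where x = "(z, (- z) \<odot> y)"]) (auto simp: bl_def)
   qed
   from card_disjoint_balls[OF Z(1,3) this S] have "real (card Z) <= measure \<nu> ?S / measure \<nu> (U r)"
    using measure_U_pos[OF r0] by (simp add: pos_le_divide_eq)
   thus ?thesis by linarith
  qed
  have ne: "bl y r ~= {}" for y
  proof -
   have "y \<in> bl y r" using r0 by (intro center_bl) simp
   thus ?thesis by blast
  qed
  have "\<exists>Z. finite Z \<and> Z \<subseteq> {x\<in>N. (0::nat) < Suc 0} \<and> disjoint_family_on (%z. bl z r) Z \<and>
    (\<forall>y\<in>N. (0::nat) < Suc 0 --> (\<exists>z\<in>Z. (0::nat) <= 0 \<and> bl z r \<inter> bl y r ~= {}))"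
   by (rule vitali_select[where J = "%_. 0"]) (rule cardb, assumption+, rule ne)
  then obtain Z where Z: "finite Z" "Z \<subseteq> N" "disjoint_family_on (%z. bl z r) Z" "!!y. y \<in> N ==> \<exists>z\<in>Z. bl z r \<inter> bl y r ~= {}"
   by auto
  have cover: "\<exists>z\<in>Z. y \<in> bl z (1 / a ^ (n + p))" if "y \<in> N" for y
  proof -
   obtain z x where z: "z \<in> Z" "x \<in> bl z r" "x \<in> bl y r" using Z(4)[OF \<open>y \<in> N\<close>] by blast
   have "((- z) \<odot> x) \<odot> (- ((- y) \<odot> x)) \<in> U (a * r)" using z r0 by (intro U2) (auto simp: bl_def)
   hence "y \<in> bl z (a * r)" by (simp add: bl_def minus_mul mul_assoc)
   thus ?thesis using z(1) unfolding ar by blast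
  qed
  have mult: "real (card {z\<in>Z. x \<in> bl z (a / a ^ n)}) <= J" for x
  proof -
   let ?Z = "{z\<in>Z. x \<in> bl z (a / a ^ n)}" and ?R = "a * (a * (1 / a ^ n))"
   have rle: "r <= a / a ^ n"
   proof -
    have "1 / a ^ Suc (n + p) <= 1 / a ^ n" by (intro divide_left_mono power_increasing) auto
    also have "... <= a / a ^ n" by (intro divide_right_mono) auto
    finally show ?thesis by (simp add: r_def)
   qed
   have "bl z r \<subseteq> bl x ?R" if "z \<in> ?Z" for z
   proof
    fix w assume "w \<in> bl z r"
    hence "(- z) \<odot> w \<in> U (a / a ^ n)" using U_mono[OF less_imp_le[OF r0] rle] by (auto simp: bl_def)
    moreover have "- ((- z) \<odot> x) \<in> U (a / a ^ n)" using that by (simp add: bl_def)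
    ultimately have "(- ((- z) \<odot> x)) \<odot> ((- z) \<odot> w) \<in> U (a * (a / a ^ n))" by (intro U2) auto
    thus "w \<in> bl x ?R" by (simp add: bl_def minus_mul mul_assoc)
   qed
   moreover have "disjoint_family_on (%z. bl z r) ?Z" using Z(3) by (rule disjoint_family_on_mono[rotated]) auto
   ultimately have "real (card ?Z) * measure \<nu> (U r) <= measure \<nu> (bl x ?R)"
    using Z(1) by (intro card_disjoint_balls compact_bl) auto
   also have "... = vol a ^ 2 * measure \<nu> (U (1 / a ^ n))"
    using measure_U_mult[of "1 / a ^ n"] measure_U_mult[of "a * (1 / a ^ n)"] by (simp add: measure_bl power2_eq_square)
   also have "measure \<nu> (U (1 / a ^ n)) = vol a ^ m * measure \<nu> (U (1 / a ^ (n + m)))" for m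
   proof (induction m)
    case (Suc m)
    thus ?case using measure_U_power[of "n + m"] by simp
   qed simp
   from this[of "Suc p"] have "measure \<nu> (U (1 / a ^ n)) = vol a ^ Suc p * measure \<nu> (U r)" by (simp add: r_def)
   finally have "real (card ?Z) * measure \<nu> (U r) <= J * measure \<nu> (U r)"
    by (simp add: J_def power_add power2_eq_square numeral_3_eq_3 mult_ac)
   thus ?thesis using measure_U_pos[OF r0] by simp
  qed
  have overlap: "\<bar>\<Sum>z\<in>Z. f z\<bar> <= J * B" if f: "!!z. z \<in> Z ==> x \<notin> bl z (a / a ^ n) ==> f z = 0" "!!z. z \<in> Z ==> \<bar>f z\<bar> <= B" "B >= 0" for f :: "'a => real" and x B
  proof -
   have "(\<Sum>z\<in>Z. f z) = (\<Sum>z\<in>{z\<in>Z. x \<in> bl z (a / a ^ n)}. f z)"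
    using Z(1) f(1) by (intro sum.mono_neutral_right) auto
   also have "\<bar>...\<bar> <= real (card {z\<in>Z. x \<in> bl z (a / a ^ n)}) * B"
    using f(2) by (intro order_trans[OF sum_abs] sum_bounded_above) auto
   also have "... <= J * B" using mult[of x] f(3) by (intro mult_right_mono) auto
   finally show ?thesis .
  qed
  define q where "q z x = dil (a ^ n) ((- z) \<odot> x)" for z x
  have "\<exists>F. local_field p C c (q z ` N) F" for z
  proof (rule loc)
   have im: "q z ` N = dil (a ^ n) ` ((\<odot>) (- z) ` N)" by (auto simp: q_def)
   have cN: "compact ((\<odot>) (- z) ` N)" using N(1) by (rule homeomorphic_images)
   show "compact (q z ` N)" unfolding im by (rule compact_continuous_image[OF _ cN]) (rule continuous_on_dil[OF continuous_on_id])
   show "emeasure \<nu> (q z ` N) = 0" unfolding im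
    using cN N by (subst emeasure_dil) (auto simp: compact_imp_closed left_invariant_emeasure[OF left_invariant_haar])
  qed
  hence "\<forall>z. \<exists>F. local_field p C c (q z ` N) F" by (rule allI)
  from choice[OF this] obtain F where F0: "\<forall>z. local_field p C c (q z ` N) (F z)" by (rule exE)
  hence F: "!!z b. b \<in> hbasis ==> sm 1 (F z b)" "!!z b x. b \<in> hbasis ==> x \<notin> U a ==> F z b x = 0"
   "!!z b x. b \<in> hbasis ==> \<bar>F z b x\<bar> <= C" "!!z b d x. b \<in> hbasis ==> d \<in> hbasis ==> \<bar>X d (F z b) x\<bar> <= C"
   "!!z x. x \<in> q z ` N ==> (\<Sum>b\<in>hbasis. X b (F z b) x) >= 0"
   "!!z x. x \<in> q z ` N ==> x \<in> U (1 / a ^ p) ==> (\<Sum>b\<in>hbasis. X b (F z b) x) >= c" unfolding local_field_def by blast+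
  \<comment> \<open>The factor \<open>1 / a ^ n\<close> makes the values small, while it cancels the
    factor that the dilation produces in horizontal derivatives.\<close>
  define H where "H b x = (\<Sum>z\<in>Z. (1 / a ^ n) * F z b (q z x))" for b x
  have sq: "sm (Suc 0) (%x. F z b (q z x))" if "b \<in> hbasis" for z b
   using sm_left[OF sm_dil[OF F(1)[OF that], where r = "a ^ n"], where z = "- z"] by (simp add: q_def)
  have XH: "X d (H b) x = (\<Sum>z\<in>Z. X d (F z b) (q z x))" if b: "b \<in> hbasis" and d: "d \<in> hbasis" for b d x
  proof -
   have "X d (H b) x = (\<Sum>z\<in>Z. X d (%x. (1 / a ^ n) * F z b (q z x)) x)"
    unfolding H_def by (rule X_sum[where k = 0]) (intro Ck_cmult sq b)
   also have "... = (\<Sum>z\<in>Z. X d (F z b) (q z x))"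
   proof (rule sum.cong)
    fix z
    have "X d (%x. (1 / a ^ n) * F z b (q z x)) x = (1 / a ^ n) * X d (%x. F z b (q z x)) x"
     by (rule X_cmult[OF sq[OF b]])
    also have "X d (%x. F z b (q z x)) x = a ^ n * X d (F z b) (q z x)"
     using X_left[of d "%x. F z b (dil (a ^ n) x)" "- z" x] X_dil[of 0 "F z b" d "a ^ n"] F(1)[OF b, of z] d hbasis(1)
     by (auto simp: q_def)
    finally show "X d (%x. (1 / a ^ n) * F z b (q z x)) x = X d (F z b) (q z x)" by simp
   qed simp
   finally show ?thesis .
  qed
  have out: "q z x \<notin> U a" if "x \<notin> bl z (a / a ^ n)" for z x using that by (simp add: q_def U_dil bl_def)
  have "sm 1 (H b) \<and> csupp (H b) \<and> (\<forall>x. \<bar>H b x\<bar> <= e) \<and> (\<forall>d\<in>hbasis. \<forall>x. \<bar>X d (H b) x\<bar> <= J * C)" if b: "b \<in> hbasis" for b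
  proof (intro conjI allI ballI)
   show "sm 1 (H b)" unfolding H_def One_nat_def by (intro Ck_sum Ck_cmult sq b)
   have "compact (\<Union>z\<in>Z. bl z (a / a ^ n))" using Z(1) compact_bl by (intro compact_UN) auto
   moreover have "H b x = 0" if "x \<notin> (\<Union>z\<in>Z. bl z (a / a ^ n))" for x
    unfolding H_def using that F(2)[OF b out] by (intro sum.neutral) auto
   ultimately show "csupp (H b)" unfolding csupp_def by (intro exI conjI) auto
   show "\<bar>H b x\<bar> <= e" for x
   proof -
    have "\<bar>H b x\<bar> <= J * (C / a ^ n)" unfolding H_def
     by (rule overlap[of x]) (use F(2)[OF b out] F(3)[OF b] C in \<open>auto simp: divide_right_mono\<close>)
    thus ?thesis using n by simp
   qed
   show "\<bar>X d (H b) x\<bar> <= J * C" if d: "d \<in> hbasis" for d x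
    unfolding XH[OF b d]
   proof (rule overlap[of x])
    show "X d (F z b) (q z x) = 0" if "x \<notin> bl z (a / a ^ n)" for z
     by (rule X_zero_off_compact[OF compact_imp_closed[OF compact_U] F(2)[OF b] out[OF that]])
   qed (use F(4)[OF b d] C in auto)
  qed
  moreover have "(\<Sum>b\<in>hbasis. X b (H b) x) >= c" if x: "x \<in> N" for x
  proof -
   obtain z where z: "z \<in> Z" "x \<in> bl z (1 / a ^ (n + p))" using cover[OF x] by blast
   have "q z x \<in> U (1 / a ^ p)" using z(2) by (simp add: q_def U_dil bl_def power_add mult.commute)
   hence "c <= (\<Sum>b\<in>hbasis. X b (F z b) (q z x))" using F(6)[of "q z x" z] x by simp
   also have "... <= (\<Sum>z\<in>Z. \<Sum>b\<in>hbasis. X b (F z b) (q z x))"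
    using Z(1) z(1) F(5) x by (intro member_le_sum) auto
   also have "... = (\<Sum>b\<in>hbasis. X b (H b) x)" using XH by (subst sum.swap) simp
   finally show ?thesis .
  qed
  ultimately show "\<exists>F. small_field e (J * C) c N F" unfolding small_field_def by (intro exI[of _ H] conjI ballI) auto
 qed
qed

end

section \<open>The Carnot--Caratheodory distance\<close>

context stratified_group
begin

lemma segment_derivative:
 "((%t. p \<odot> (t *R w)) has_vector_derivative lif w (p \<odot> (t *R w))) (at t)"
proof -
 have "((%s::real. s *R w) has_derivative (%s. s *R w)) (at 0)" by (auto intro!: derivative_eq_intros)
 hence "((%s. (p \<odot> (t *R w)) \<odot> (s *R w)) has_derivative (%s. lif (s *R w) (p \<odot> (t *R w)))) (at 0)"
  using has_derivative_compose[of "%s. s *R w", OF _ has_derivative_mul_right[of "p \<odot> (t *R w)", folded scaleR_zero_left[of w]]] by simp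
 hence "((%s. p \<odot> ((t + s) *R w)) has_derivative (%s. s *R lif w (p \<odot> (t *R w)))) (at 0)"
  by (simp add: mul_assoc mul_parallel linear_scale[OF linear_lif])
 moreover have "((%s. s - t) has_derivative (%s. s)) (at t)" by (auto intro!: derivative_eq_intros)
 ultimately show ?thesis
  using has_derivative_compose[of "%s. s - t" "%s. s" t UNIV "%s. p \<odot> ((t + s) *R w)" "%s. s *R lif w (p \<odot> (t *R w))"]
  by (simp add: has_vector_derivative_def)
qed

text \<open>Piecewise differentiable horizontal curves with bounded Borel controls; the finite set
  \<open>S\<close> contains the joints. They serve to show that points can be connected and to bound
  distances from above.\<close>

definition joined :: "(real => 'a) => (real => 'a) => 'a => 'a => bool" where
 "joined ga u x y \<longleftrightarrow> continuous_on {0..1} ga \<and> ga 0 = x \<and> ga 1 = y \<and> u \<in> Borel \<and>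
  (\<exists>B. \<forall>t. norm (u t) <= B) \<and> (\<forall>t. u t \<in> V 1) \<and>
  (\<exists>S. finite S \<and> (\<forall>t\<in>{0<..<1} - S. (ga has_vector_derivative lif (u t) (ga t)) (at t)))"

lemma joined_segment: "w \<in> V 1 ==> joined (%t. x \<odot> (t *R w)) (%t. w) x (x \<odot> w)"
 unfolding joined_def by (auto intro!: continuous_intros segment_derivative exI[of _ "{}"])

lemma joined_curve:
 assumes "joined ga u x y" shows "horizontal_curve G ga u"
proof -
 have ga: "continuous_on {0..1} ga" and u: "u \<in> Borel" "!!t. u t \<in> V 1" using assms by (auto simp: joined_def)
 obtain B where B: "!!t. norm (u t) <= B" using assms by (auto simp: joined_def)
 obtain S where S: "finite S" "!!t. t \<in> {0<..<1} - S ==> (ga has_vector_derivative lif (u t) (ga t)) (at t)"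
  using assms unfolding joined_def by blast
 have "u absolutely_integrable_on {0..1}"
  by (rule measurable_bounded_by_integrable_imp_absolutely_integrable[where g = "%_. B"])
   (use u(1) B in \<open>auto intro!: measurable_restrict_space1 measurable_completion\<close>)
 moreover have "((%s. lif (u s) (ga s)) has_integral (ga t - ga 0)) {0..t}" if "t \<in> {0..1}" for t
  using that S(2)
  by (intro fundamental_theorem_of_calculus_interior_strong[OF S(1)] continuous_on_subset[OF ga]) auto
 ultimately show ?thesis using ga u by (simp add: horizontal_curve_def)
qed

lemma joined_trans:
 assumes "joined ga u x y" "joined ga' u' y z"
 shows "joined (ga +++ ga') (%t. if t <= 1 / 2 then 2 *R u (2 * t) else 2 *R u' (2 * t - 1)) x z"
proof -
 let ?u = "%t. if t <= 1 / 2 then 2 *R u (2 * t) else 2 *R u' (2 * t - 1)"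
 obtain B where B: "!!t. norm (u t) <= B" using assms(1) by (auto simp: joined_def)
 obtain B' where B': "!!t. norm (u' t) <= B'" using assms(2) by (auto simp: joined_def)
 obtain S where S: "finite S" "!!t. t \<in> {0<..<1} - S ==> (ga has_vector_derivative lif (u t) (ga t)) (at t)"
  using assms(1) unfolding joined_def by blast
 obtain S' where S': "finite S'" "!!t. t \<in> {0<..<1} - S' ==> (ga' has_vector_derivative lif (u' t) (ga' t)) (at t)"
  using assms(2) unfolding joined_def by blast
 have u: "u \<in> Borel" "u' \<in> Borel" "!!t. u t \<in> V 1" "!!t. u' t \<in> V 1"
  and c: "path ga" "path ga'" "pathfinish ga = pathstart ga'" and ends: "ga 0 = x" "ga' 1 = z"
  using assms by (auto simp: joined_def path_def pathfinish_def pathstart_def)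
 let ?S = "insert (1 / 2) ((%s. s / 2) ` S \<union> (%s. (s + 1) / 2) ` S')"
 have "((ga +++ ga') has_vector_derivative lif (?u t) ((ga +++ ga') t)) (at t)" if t: "t \<in> {0<..<1} - ?S" for t
 proof (cases "t < 1 / 2")
  case True
  have "2 * t \<notin> S"
  proof
   assume "2 * t \<in> S"
   hence "t \<in> (%s. s / 2) ` S" by (intro image_eqI[where x = "2 * t"]) auto
   thus False using t by simp
  qed
  hence "2 * t \<in> {0<..<1} - S" using t True by auto
  moreover have "((%t. 2 * t) has_vector_derivative 2) (at t)"
   by (auto intro!: derivative_eq_intros simp: has_real_derivative_iff_has_vector_derivative[symmetric])
  ultimately have "((%t. ga (2 * t)) has_vector_derivative 2 *R lif (u (2 * t)) (ga (2 * t))) (at t)"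
   using vector_diff_chain_at[of "%t. 2 * t" 2 t ga "lif (u (2 * t)) (ga (2 * t))"] S(2)
   by (auto simp: o_def)
  hence "((ga +++ ga') has_vector_derivative 2 *R lif (u (2 * t)) (ga (2 * t))) (at t)"
   by (rule has_vector_derivative_transform_within_open[where S = "{..<1 / 2}"]) (use True in \<open>auto simp: joinpaths_def\<close>)
  thus ?thesis using True by (simp add: joinpaths_def linear_scale[OF linear_lif])
 next
  case False
  hence t2: "t > 1 / 2" using t by auto
  have "2 * t - 1 \<notin> S'"
  proof
   assume "2 * t - 1 \<in> S'"
   hence "t \<in> (%s. (s + 1) / 2) ` S'" by (intro image_eqI[where x = "2 * t - 1"]) auto
   thus False using t by simp
  qed
  hence "2 * t - 1 \<in> {0<..<1} - S'" using t t2 by auto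
  moreover have "((%t. 2 * t - 1) has_vector_derivative 2) (at t)"
   by (auto intro!: derivative_eq_intros simp: has_real_derivative_iff_has_vector_derivative[symmetric])
  ultimately have "((%t. ga' (2 * t - 1)) has_vector_derivative 2 *R lif (u' (2 * t - 1)) (ga' (2 * t - 1))) (at t)"
   using vector_diff_chain_at[of "%t. 2 * t - 1" 2 t ga' "lif (u' (2 * t - 1)) (ga' (2 * t - 1))"] S'(2)
   by (auto simp: o_def)
  hence "((ga +++ ga') has_vector_derivative 2 *R lif (u' (2 * t - 1)) (ga' (2 * t - 1))) (at t)"
   by (rule has_vector_derivative_transform_within_open[where S = "{1 / 2<..}"]) (use t2 in \<open>auto simp: joinpaths_def\<close>)
  thus ?thesis using t2 by (simp add: joinpaths_def linear_scale[OF linear_lif])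
 qed
 moreover have "norm (?u t) <= 2 * max B B'" for t using B[of "2 * t"] B'[of "2 * t - 1"] by (auto simp: max_def)
 moreover have "?u t \<in> V 1" for t using u subspace_scale[OF subspace_V[of 1]] by simp
 moreover have "?u \<in> Borel" using u(1,2) by measurable
 moreover have "continuous_on {0..1} (ga +++ ga')" using path_join_imp[OF c] by (simp add: path_def)
 moreover have "finite ?S" using S(1) S'(1) by simp
 moreover have "(ga +++ ga') 0 = x" "(ga +++ ga') 1 = z" using ends by (auto simp: joinpaths_def)
 ultimately show ?thesis unfolding joined_def
  by (intro conjI exI[of _ "2 * max B B'"] exI[of _ ?S] allI ballI)
qed

text \<open>Chow's connectivity: the horizontal factorization of \<open>(- x) \<odot> y\<close> is a
  path of horizontal segments from \<open>x\<close> to \<open>y\<close>.\<close>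

lemma joined_exists: "\<exists>ga u. joined ga u x y"
proof -
 obtain ws where ws: "\<forall>w\<in>set ws. cont w \<and> range w \<subseteq> V 1" "!!y. gprod (map (%w. w y) ws) = y"
  by (rule horizontal_factorization) (rule that, auto)
 have "\<exists>ga u. joined ga u x (x \<odot> gprod vs)" if "set vs \<subseteq> V 1" for vs x
  using that
 proof (induction vs arbitrary: x)
  case Nil
  show ?case using joined_segment[of 0 x] subspace_0[OF subspace_V[of 1]] by auto
 next
  case (Cons v vs)
  then obtain ga u where "joined ga u (x \<odot> v) ((x \<odot> v) \<odot> gprod vs)" by fastforce
  from joined_trans[OF joined_segment[of v x] this] Cons.prems show ?case by (auto simp: mul_assoc)
 qed
 moreover have "set (map (%w. w ((- x) \<odot> y)) ws) \<subseteq> V 1" using ws(1) by auto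
 ultimately have "\<exists>ga u. joined ga u x (x \<odot> gprod (map (%w. w ((- x) \<odot> y)) ws))" by blast
 thus ?thesis by (simp add: ws(2))
qed

lemma cc_le: "horizontal_curve G ga u ==> cc_distance G (ga 0) (ga 1) <= integral {0..1} (%t. norm (u t))"
 unfolding cc_distance_def
 by (rule cInf_lower) (auto intro!: bdd_belowI[of _ 0] Henstock_Kurzweil_Integration.integral_nonneg set_integral_norm_bound
   simp: horizontal_curve_def absolutely_integrable_on_def)

lemma cc_ray: "w \<in> V 1 ==> t >= 0 ==> cc_distance G (t *R w) 0 <= t * norm w"
proof -
 assume w: "w \<in> V 1" and t: "t >= 0"
 have "(- t) *R w \<in> V 1" using w subspace_scale[OF subspace_V[of 1]] by blast
 from cc_le[OF joined_curve[OF joined_segment[OF this, of "t *R w"]]] show ?thesis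
  using t mul_parallel[of t w "- t"] by simp
qed

text \<open>The control of a horizontal curve is merely integrable. Near each time \<open>f\<close>
  is linearized at one point and the integral equation of the curve is inserted; the error is an
  arbitrarily small multiple of the length.\<close>

theorem cc_lipschitz:
 assumes f: "sm (Suc k) f" and C: "C >= 0" "!!u x. u \<in> V 1 ==> \<bar>X u f x\<bar> <= C * norm u"
 shows "\<bar>f y - f x\<bar> <= C * cc_distance G x y"
proof -
 have main: "\<bar>f (ga 1) - f (ga 0)\<bar> <= C * integral {0..1} (%t. norm (u t))" if hc: "horizontal_curve G ga u" for ga u
 proof -
  have ga: "continuous_on {0..1} ga" and uV: "!!t. t \<in> {0..1} ==> u t \<in> V 1"
   and int: "!!t. t \<in> {0..1} ==> ((%s. lif (u s) (ga s)) has_integral (ga t - ga 0)) {0..t}"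
   and nu: "(%t. norm (u t)) integrable_on {0..1}"
   using hc by (auto simp: horizontal_curve_def absolutely_integrable_on_def)
  have nu': "(%t. norm (u t)) integrable_on {s..r}" if "0 <= s" "r <= 1" for s r
   by (rule integrable_on_subinterval[OF nu]) (use that in auto)
  have nuc: "(%t. c * norm (u t)) integrable_on {s..r}" if "0 <= s" "r <= 1" for c s r
   using integrable_cmul[OF nu'[OF that], of c] by simp
  have combine: "c * integral {p..r} (%t. norm (u t)) = c * integral {p..q} (%t. norm (u t)) + c * integral {q..r} (%t. norm (u t))"
   if "0 <= p" "p <= q" "q <= r" "r <= 1" for c p q r
   unfolding Henstock_Kurzweil_Integration.integral_combine[OF that(2,3) nu'[OF that(1,4)], symmetric] by (rule distrib_left)
  have int': "((%s. lif (u s) (ga s)) has_integral (ga r - ga s)) {s..r}" if sr: "0 <= s" "s <= r" "r <= 1" for s r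
  proof -
   have i: "(%s. lif (u s) (ga s)) integrable_on {0..r}" using int[of r] sr by auto
   have "integral {0..s} (%s. lif (u s) (ga s)) + integral {s..r} (%s. lif (u s) (ga s)) = integral {0..r} (%s. lif (u s) (ga s))"
    by (rule Henstock_Kurzweil_Integration.integral_combine[OF _ _ i]) (use sr in auto)
   hence "integral {s..r} (%s. lif (u s) (ga s)) = ga r - ga s"
    using int[of r] int[of s] sr by (simp add: integral_unique algebra_simps)
   moreover have "(%s. lif (u s) (ga s)) integrable_on {s..r}" by (rule integrable_on_subinterval[OF i]) (use sr in auto)
   ultimately show ?thesis by (metis integrable_integral)
  qed
  have cl: "cont (lif b)" for b
   using continuous_on_compose2[OF CkV_continuous[OF CkV_lif[of 0 b]], of UNIV "%x. (x, 0::real)"] by (simp add: continuous_intros)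
  have "compact ((%t. lif b (ga t)) ` {0..1})" for b
   by (intro compact_continuous_image continuous_on_compose2[OF cl ga]) auto
  from compact_imp_bounded[OF this] have "\<exists>B. \<forall>t\<in>{0..1}. norm (lif b (ga t)) <= B" for b
   unfolding bounded_iff by simp
  then obtain B where B: "!!b t. t \<in> {0..1} ==> norm (lif b (ga t)) <= B b" by metis
  have expand: "L (lif w p) = (\<Sum>b\<in>hbasis. (w \<bullet> b) *R L (lif b p))" if "w \<in> V 1" "linear L" for w p and L :: "'a => 'c::real_vector"
  proof -
   have "L (lif (\<Sum>b\<in>hbasis. (w \<bullet> b) *R b) p) = (\<Sum>b\<in>hbasis. (w \<bullet> b) *R L (lif b p))"
    by (simp add: linear_sum[OF linear_lif] linear_sum[OF that(2)] linear_scale[OF linear_lif] linear_scale[OF that(2)])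
   thus ?thesis by (simp add: hbasis_expand[OF that(1)])
  qed
  have inner: "\<bar>w \<bullet> b\<bar> <= norm w" if "b \<in> hbasis" for w b
   using Cauchy_Schwarz_ineq2[of w b] hbasis(3)[OF that] by simp
  define BB where "BB = (\<Sum>b\<in>hbasis. \<bar>B b\<bar>)"
  have BB: "BB >= 0" by (simp add: BB_def sum_nonneg)
  have lifB: "norm (lif w (ga t)) <= BB * norm w" if "w \<in> V 1" "t \<in> {0..1}" for w t
  proof -
   have "norm (lif w (ga t)) <= (\<Sum>b\<in>hbasis. norm w * \<bar>B b\<bar>)"
    using expand[OF that(1) linear_id, of "ga t"]
   proof (simp, intro sum_norm_le)
    fix b assume b: "b \<in> hbasis"
    thus "norm ((w \<bullet> b) *R lif b (ga t)) <= norm w * \<bar>B b\<bar>"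
     using inner[OF b, of w] B[OF that(2), of b] by (auto intro!: mult_mono)
   qed
   thus ?thesis by (simp add: BB_def sum_distrib_left mult.commute)
  qed
  have eps: "\<bar>f (ga 1) - f (ga 0)\<bar> <= (C + e * (1 + BB)) * integral {0..1} (%t. norm (u t))" if e: "e > 0" for e
  proof -
   let ?C = "C + e * (1 + BB)"
   have near: "\<exists>d>0. \<forall>s r. 0 <= s \<and> s <= r \<and> r <= 1 \<and> (s = t \<or> r = t) \<and> r - s < d -->
     \<bar>f (ga r) - f (ga s)\<bar> <= ?C * integral {s..r} (%t. norm (u t))" if t: "t \<in> {0..1}" for t
   proof -
    let ?x = "ga t"
    obtain f' where f': "!!x. (f has_derivative (%v. f' v x)) (at x)" by (rule sm_has_derivative[OF f]) (rule that)
    define L where "L v = f' v ?x" for v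
    have fL: "(f has_derivative L) (at ?x)" using f'[of ?x] by (simp add: L_def[abs_def])
    have lin: "linear L" using fL by (rule has_derivative_linear)
    have XL: "X v f ?x = L (lif v ?x)" for v by (rule X_eq[OF fL])
    obtain d1 where d1: "d1 > 0" "!!y. norm (y - ?x) < d1 ==> norm (f y - f ?x - L (y - ?x)) <= e * norm (y - ?x)"
     using fL e unfolding has_derivative_at_alt by blast
    have "cont (%y. \<Sum>b\<in>hbasis. \<bar>L (lif b y) - L (lif b ?x)\<bar>)"
     using lin linear_continuous_on[of L UNIV] by (intro continuous_intros continuous_on_compose2[OF _ cl]) (auto simp: linear_conv_bounded_linear)
    then obtain d2 where d2: "d2 > 0" "!!y. dist y ?x < d2 ==> (\<Sum>b\<in>hbasis. \<bar>L (lif b y) - L (lif b ?x)\<bar>) < e"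
     using e unfolding continuous_on_iff by (fastforce simp: dist_real_def)
    obtain d where d: "d > 0" "!!s. s \<in> {0..1} ==> dist s t < d ==> dist (ga s) ?x < min d1 d2"
     using ga t d1(1) d2(1) unfolding continuous_on_iff by (metis min_less_iff_conj)
    show ?thesis
    proof (intro exI[of _ d] conjI allI impI d(1))
     fix s r assume sr: "0 <= s \<and> s <= r \<and> r <= 1 \<and> (s = t \<or> r = t) \<and> r - s < d"
     let ?I = "integral {s..r} (%t. norm (u t))"
     have cl: "dist (ga q) ?x < min d1 d2" if "q \<in> {s..r}" for q using sr that by (intro d(2)) (auto simp: dist_real_def)
     have Lb: "\<bar>L (lif (u q) (ga q))\<bar> <= (C + e) * norm (u q)" if q: "q \<in> {s..r}" for q
     proof -
      have v: "u q \<in> V 1" using uV q sr by auto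
      have "\<bar>L (lif (u q) (ga q)) - L (lif (u q) ?x)\<bar> = \<bar>\<Sum>b\<in>hbasis. (u q \<bullet> b) * (L (lif b (ga q)) - L (lif b ?x))\<bar>"
       by (simp add: expand[OF v lin] sum_subtractf right_diff_distrib)
      also have "... <= (\<Sum>b\<in>hbasis. norm (u q) * \<bar>L (lif b (ga q)) - L (lif b ?x)\<bar>)"
       using inner by (intro order_trans[OF sum_abs] sum_mono) (simp add: abs_mult mult_right_mono)
      also have "... <= norm (u q) * e"
       using d2(2)[of "ga q"] cl[OF q] by (simp add: sum_distrib_left[symmetric] mult_left_mono)
      finally show ?thesis using C(2)[OF v, of ?x] XL[of "u q"] by (simp add: algebra_simps)
     qed
     have srr: "0 <= s" "s <= r" "r <= 1" using sr by auto
     have "norm (L (ga r - ga s)) <= integral {s..r} (%q. (C + e) * norm (u q))"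
     proof -
      have "((L \<circ> (%s. lif (u s) (ga s))) has_integral L (ga r - ga s)) {s..r}"
       using lin by (intro has_integral_linear[OF int'[OF srr]]) (simp add: linear_conv_bounded_linear)
      hence L: "((%s. L (lif (u s) (ga s))) has_integral L (ga r - ga s)) {s..r}" by (simp add: o_def)
      thus ?thesis
       using integral_norm_bound_integral[OF has_integral_integrable[OF L], of "%q. (C + e) * norm (u q)"] Lb nuc[of s r] sr
       by (auto simp: integral_unique[OF L])
     qed
     hence 1: "\<bar>L (ga r - ga s)\<bar> <= (C + e) * ?I" by simp
     have "norm (ga r - ga s) <= integral {s..r} (%q. BB * norm (u q))"
      using integral_norm_bound_integral[OF has_integral_integrable[OF int'[OF srr]], of "%q. BB * norm (u q)"]
       lifB uV nuc[of s r] sr by (auto simp: integral_unique[OF int'[OF srr]])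
     hence 2: "norm (ga r - ga s) <= BB * ?I" by simp
     have "\<bar>f (ga r) - f (ga s)\<bar> <= \<bar>L (ga r - ga s)\<bar> + e * norm (ga r - ga s)"
     proof (cases "s = t")
      case True
      have "norm (f (ga r) - f ?x - L (ga r - ?x)) <= e * norm (ga r - ?x)" using cl[of r] srr by (intro d1(2)) (simp add: dist_norm)
      thus ?thesis using True by simp
     next
      case False
      hence r: "r = t" using sr by simp
      have "norm (f (ga s) - f ?x - L (ga s - ?x)) <= e * norm (ga s - ?x)" using cl[of s] srr by (intro d1(2)) (simp add: dist_norm)
      thus ?thesis using r by (simp add: linear_diff[OF lin] norm_minus_commute)
     qed
     also have "... <= (C + e) * ?I + e * (BB * ?I)" using 1 2 e by (intro add_mono mult_left_mono) auto
     also have "... = ?C * ?I" by (simp add: algebra_simps)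
     finally show "\<bar>f (ga r) - f (ga s)\<bar> <= ?C * ?I" .
    qed
   qed
   \<comment> \<open>The estimate is additive over adjacent intervals and holds on short intervals
     containing any given time, so bisection extends it to the unit interval.\<close>
   have "0 <= (0::real) --> (1::real) <= 1 --> \<bar>f (ga 1) - f (ga 0)\<bar> <= ?C * integral {0..1} (%t. norm (u t))"
   proof (rule Bolzano[of 0 1 "%p q. 0 <= p --> q <= 1 --> \<bar>f (ga q) - f (ga p)\<bar> <= ?C * integral {p..q} (%t. norm (u t))"])
    show "(0::real) <= 1" by simp
   next
    fix p q r :: real
    assume IH: "0 <= p --> q <= 1 --> \<bar>f (ga q) - f (ga p)\<bar> <= ?C * integral {p..q} (%t. norm (u t))"
     "0 <= q --> r <= 1 --> \<bar>f (ga r) - f (ga q)\<bar> <= ?C * integral {q..r} (%t. norm (u t))" and pqr: "p <= q" "q <= r"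
    show "0 <= p --> r <= 1 --> \<bar>f (ga r) - f (ga p)\<bar> <= ?C * integral {p..r} (%t. norm (u t))"
    proof (intro impI)
     assume "0 <= p" "r <= 1"
     thus "\<bar>f (ga r) - f (ga p)\<bar> <= ?C * integral {p..r} (%t. norm (u t))"
      using IH pqr combine[of p q r ?C] by simp
    qed
   next
    fix t :: real assume t: "0 <= t" "t <= 1"
    then obtain d where d: "d > 0" "\<forall>s r. 0 <= s \<and> s <= r \<and> r <= 1 \<and> (s = t \<or> r = t) \<and> r - s < d -->
     \<bar>f (ga r) - f (ga s)\<bar> <= ?C * integral {s..r} (%t. norm (u t))" using near[of t] by auto
    show "\<exists>d>0. \<forall>p q. p <= t \<and> t <= q \<and> q - p < d -->
     (0 <= p --> q <= 1 --> \<bar>f (ga q) - f (ga p)\<bar> <= ?C * integral {p..q} (%t. norm (u t)))"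
    proof (intro exI[of _ d] conjI allI impI d(1))
     fix p q assume pq: "p <= t \<and> t <= q \<and> q - p < d" "0 <= p" "q <= 1"
     have "\<bar>f (ga t) - f (ga p)\<bar> <= ?C * integral {p..t} (%t. norm (u t))"
      "\<bar>f (ga q) - f (ga t)\<bar> <= ?C * integral {t..q} (%t. norm (u t))"
      using d(2)[rule_format, of p t] d(2)[rule_format, of t q] pq t by auto
     thus "\<bar>f (ga q) - f (ga p)\<bar> <= ?C * integral {p..q} (%t. norm (u t))"
      using pq combine[of p t q ?C] by simp
    qed
   qed
   thus ?thesis by simp
  qed
  let ?I = "integral {0..1} (%t. norm (u t))"
  have "((%e. (C + e * (1 + BB)) * ?I) \<longlongrightarrow> (C + 0 * (1 + BB)) * ?I) (at_right 0)" by (intro tendsto_intros)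
  from tendsto_lowerbound[OF this, of "\<bar>f (ga 1) - f (ga 0)\<bar>"] show ?thesis
   using eps by (auto simp: eventually_at_right_less intro: eventually_mono[OF eventually_at_right_less])
 qed
 \<comment> \<open>A joining curve is needed because the infimum of an empty set would carry no
   information.\<close>
 obtain ga u where ga: "joined ga u x y" using joined_exists by blast
 let ?S = "{integral {0..1} (%t. norm (u t)) |ga u. horizontal_curve G ga u \<and> ga 0 = x \<and> ga 1 = y}"
 have ne: "?S ~= {}" using joined_curve[OF ga] ga unfolding joined_def by blast
 have le: "\<bar>f y - f x\<bar> <= C * s" if "s \<in> ?S" for s using that main by auto
 show ?thesis
 proof (cases "C = 0")
  case True
  thus ?thesis using le ne by auto
 next
  case False
  hence "\<bar>f y - f x\<bar> / C <= Inf ?S"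
   using le C(1) by (intro cInf_greatest[OF ne]) (simp add: pos_divide_le_eq mult.commute)
  thus ?thesis using False C(1) by (simp add: cc_distance_def pos_divide_le_eq mult.commute)
 qed
qed

end

section \<open>A Lipschitz function without derivatives on a null set\<close>

context dilation_base
begin

text \<open>
 The fields of the previous theorem for a fixed bound form a convex set. Elements of almost minimal
 energy on \<open>N\<close> are Cauchy by the parallelogram identity, so their derivatives converge.
\<close>
lemma convergent_fields:
 assumes \<mu>: "radon_measure \<mu>" and N: "compact N" "emeasure \<nu> N = 0" "emeasure \<mu> N > 0"
 obtains f b C c K where "b \<in> hbasis" "C > 0" "c > 0" "compact K" "K \<subseteq> N" "emeasure \<mu> K > 0"
  "!!k. sm 1 (f k)" "!!k. csupp (f k)" "!!k x. \<bar>f k x\<bar> <= 1 / real (Suc k)"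
  "!!k d x. d \<in> hbasis ==> \<bar>X d (f k) x\<bar> <= C" "!!k x. x \<in> K ==> X b (f k) x >= c"
  "!!n d x. x \<in> K ==> d \<in> hbasis ==> (\<Sum>k<n. \<bar>X d (f (Suc k)) x - X d (f k) x\<bar>) <= c"
proof -
 obtain C c where C: "C > 0" "c > 0" and field: "!!N e. compact N ==> emeasure \<nu> N = 0 ==> e > 0 ==>
  \<exists>F. small_field e C c N F" by (rule small_field_exists) (rule that)
 have \<mu>b: "sets \<mu> = sets borel" and \<mu>K: "!!K. compact K ==> emeasure \<mu> K < \<infinity>" using \<mu> by (auto simp: radon_measure_def)
 have Nb: "N \<in> sets \<mu>" using N(1) \<mu>b by (simp add: compact_imp_closed)
 let ?m = "measure \<mu> N"
 have m: "?m > 0" using N(3) \<mu>K[OF N(1)] by (simp add: measure_def enn2real_positive_iff)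
 have Nf: "integrable \<mu> (indicator N :: 'a => real)" using Nb \<mu>K[OF N(1)] by (intro integrable_real_indicator) auto
 have int: "integrable \<mu> (%x. indicator N x * h x)" if h: "cont h" for h :: "'a => real"
 proof -
  have "cont (%z::'a \<times> 'a. h (snd z))" by (rule continuous_on_compose2[OF h]) (auto intro: continuous_intros)
  from integrable_weight[OF Nf _ N(1) this \<mu>b] show ?thesis by simp
 qed
 define J where "J h = (\<integral>x. indicator N x * h x \<partial>\<mu>)" for h :: "'a => real"
 have J_mono: "J g <= J h" if "cont g" "cont h" "!!x. x \<in> N ==> g x <= h x" for g h
  unfolding J_def by (rule Bochner_Integration.integral_mono[OF int int]) (use that in \<open>auto simp: indicator_def\<close>)
 have J_lin: "J (%x. r * g x + s * h x) = r * J g + s * J h" if "cont g" "cont h" for r s g h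
  using int[OF that(1)] int[OF that(2)] unfolding J_def by (simp add: distrib_left mult.left_commute)
 have J1: "J (%x. s) = s * ?m" for s using Nb by (simp add: J_def mult.commute)
 have J_sum: "J (%x. \<Sum>i\<in>I. h i x) = (\<Sum>i\<in>I. J (h i))" if "!!i. i \<in> I ==> cont (h i)" for I :: "'j set" and h :: "'j => 'a => real"
  using int[OF that] unfolding J_def by (simp add: sum_distrib_left Bochner_Integration.integral_sum)
 define S where "S n = {F. small_field (1 / real (Suc n)) C c N F}" for n
 have S_ne: "S n ~= {}" for n using field[OF N(1,2), of "1 / real (Suc n)"] by (auto simp: S_def)
 have S_mono: "S m \<subseteq> S n" if "n <= m" for n m
 proof -
  have "1 / real (Suc m) <= 1 / real (Suc n)" using that by (simp add: divide_left_mono)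
  thus ?thesis unfolding S_def small_field_def by (auto intro: order_trans)
 qed
 let ?P = "hbasis \<times> hbasis"
 define D where "D F q = X (snd q) (F (fst q))" for F :: "'a => 'a => real" and q
 have smS: "sm (Suc 0) (F b)" if "F \<in> S n" "b \<in> hbasis" for F n b using that by (auto simp: S_def small_field_def)
 have cD: "cont (D F q)" if "F \<in> S n" "q \<in> ?P" for F n q
  using that sm_continuous[OF sm_X[OF smS]] by (auto simp: D_def)
 define E where "E F = (\<Sum>q\<in>?P. J (%x. (D F q x)\<^sup>2))" for F
 have E0: "E F >= 0" for F unfolding E_def J_def by (intro sum_nonneg Bochner_Integration.integral_nonneg) auto
 define mean where "mean F G b x = (1 / 2) * F b x + (1 / 2) * G b x" for F G :: "'a => 'a => real" and b x
 have mid: "mean F G \<in> S n" "!!q x. q \<in> ?P ==> D (mean F G) q x = (1 / 2) * D F q x + (1 / 2) * D G q x" if F: "F \<in> S n" and G: "G \<in> S n" for F G n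
 proof -
  have XM: "X d (mean F G b) x = (1 / 2) * X d (F b) x + (1 / 2) * X d (G b) x" if b: "b \<in> hbasis" for b d x
   unfolding mean_def using X_add[OF Ck_cmult[OF smS[OF F b]] Ck_cmult[OF smS[OF G b]], of d "1 / 2" "1 / 2" x]
    X_cmult[OF smS[OF F b], of d "1 / 2" x] X_cmult[OF smS[OF G b], of d "1 / 2" x] by simp
  thus "!!q x. q \<in> ?P ==> D (mean F G) q x = (1 / 2) * D F q x + (1 / 2) * D G q x"
   by (auto simp: D_def)
  have half: "\<bar>(1 / 2) * r + (1 / 2) * s\<bar> <= B" if "\<bar>r\<bar> <= B" "\<bar>s\<bar> <= B" for r s B :: real using that by linarith
  have cs: "csupp (mean F G b)" if b: "b \<in> hbasis" for b
  proof -
   have "bm (F b)" "bm (G b)" using F G b smS[OF F b] smS[OF G b] by (auto simp: S_def small_field_def intro!: bm_continuous sm_continuous)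
   hence "bm (mean F G b)" unfolding mean_def by (intro bm_add bm_cmult)
   thus ?thesis by (simp add: bm_def)
  qed
  have "sm 1 (mean F G b)" if b: "b \<in> hbasis" for b
   using smS[OF F b] smS[OF G b] unfolding One_nat_def mean_def by (intro Ck_add Ck_cmult)
  moreover have "\<bar>mean F G b x\<bar> <= 1 / real (Suc n)" if "b \<in> hbasis" for b x
   using F G that unfolding mean_def S_def small_field_def by (intro half) blast+
  moreover have "\<bar>X d (mean F G b) x\<bar> <= C" if "b \<in> hbasis" "d \<in> hbasis" for b d x
   unfolding XM[OF that(1)] using F G that unfolding S_def small_field_def by (intro half) blast+
  moreover have "(\<Sum>b\<in>hbasis. X b (mean F G b) x) >= c" if "x \<in> N" for x
  proof -
   have "(\<Sum>b\<in>hbasis. X b (F b) x) >= c" "(\<Sum>b\<in>hbasis. X b (G b) x) >= c" using F G that by (auto simp: S_def small_field_def)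
   moreover have "(\<Sum>b\<in>hbasis. X b (mean F G b) x) = (\<Sum>b\<in>hbasis. (1 / 2) * X b (F b) x + (1 / 2) * X b (G b) x)"
    by (rule sum.cong[OF refl XM])
   ultimately show ?thesis by (simp add: sum.distrib flip: sum_divide_distrib)
  qed
  ultimately show "mean F G \<in> S n" using cs unfolding S_def small_field_def by blast
 qed
 define I where "I n = (INF F\<in>S n. E F)" for n
 have bdd: "bdd_below (E ` A)" for A using E0 by (intro bdd_belowI[of _ 0]) auto
 have I_le: "I n <= E F" if "F \<in> S n" for F n unfolding I_def using that by (intro cINF_lower bdd)
 have I_mono: "I n <= I m" if "n <= m" for n m
  unfolding I_def using S_mono[OF that] S_ne bdd by (intro cINF_superset_mono) auto
 have I_bdd: "I n <= real (card ?P) * (C\<^sup>2 * ?m)" for n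
 proof -
  obtain F where F: "F \<in> S n" using S_ne by blast
  have "E F <= (\<Sum>q\<in>?P. C\<^sup>2 * ?m)" unfolding E_def J1[symmetric]
  proof (intro sum_mono J_mono continuous_on_power cD[OF F] continuous_on_const)
   fix q x assume "q \<in> ?P"
   hence "\<bar>D F q x\<bar> <= C" using F by (auto simp: S_def small_field_def D_def)
   thus "(D F q x)\<^sup>2 <= C\<^sup>2" using C by (simp add: abs_le_square_iff[symmetric])
  qed auto
  thus ?thesis using I_le[OF F] by simp
 qed
 have "incseq I" using I_mono by (auto simp: incseq_def)
 then obtain L where L: "I \<longlonglongrightarrow> L" "!!n. I n <= L" using incseq_convergent[of I] I_bdd by metis
 have "\<exists>n. I n >= L - (1 / 4) ^ k" for k
 proof -
  have "\<forall>\<^sub>F n in sequentially. I n > L - (1 / 4) ^ k" by (rule order_tendstoD(1)[OF L(1)]) simp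
  thus ?thesis by (auto simp: eventually_sequentially intro: less_imp_le)
 qed
 then obtain n0 where n0: "!!k. I (n0 k) >= L - (1 / 4) ^ k" by metis
 \<comment> \<open>The sum makes \<open>n\<close> increasing and at least \<open>n0\<close>; the
   summand \<open>k\<close> ensures that the values of the \<open>k\<close>-th field are at most
   \<open>1 / (k + 1)\<close>.\<close>
 define n where "n k = (\<Sum>j\<le>k. n0 j) + k" for k
 have n: "n k <= n (Suc k)" "k <= n k" for k by (auto simp: n_def)
 have In: "I (n k) >= L - (1 / 4) ^ k" for k
  using n0[of k] I_mono[of "n0 k" "n k"] member_le_sum[of k "{..k}" n0] by (simp add: n_def)
 have "\<exists>F\<in>S (n k). E F < I (n k) + (1 / 4) ^ k" for k
  using cINF_less_iff[OF S_ne bdd, of "n k" "I (n k) + (1 / 4) ^ k"] by (simp add: I_def)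
 then obtain F where F: "!!k. F k \<in> S (n k)" "!!k. E (F k) < I (n k) + (1 / 4) ^ k" by metis
 \<comment> \<open>By the parallelogram identity with the mean, whose energy is at least
   \<open>I (n k)\<close>, the left-hand side is at most \<open>2 * (L - I (n k))\<close> plus four
   errors of the size \<open>(1 / 4) ^ k\<close>.\<close>
 have diff: "(\<Sum>q\<in>?P. J (%x. (D (F (Suc k)) q x - D (F k) q x)\<^sup>2)) <= 6 * (1 / 4) ^ k" for k
 proof -
  let ?F = "F k" and ?G = "F (Suc k)"
  have G: "?G \<in> S (n k)" using F(1)[of "Suc k"] S_mono[OF n(1)[of k]] by blast
  let ?M = "mean ?F ?G"
  have M: "?M \<in> S (n k)" by (rule mid(1)[OF F(1) G])
  have "J (%x. (D ?G q x - D ?F q x)\<^sup>2) = 2 * J (%x. (D ?F q x)\<^sup>2) + 2 * J (%x. (D ?G q x)\<^sup>2) - 4 * J (%x. (D ?M q x)\<^sup>2)" if q: "q \<in> ?P" for q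
  proof -
   note c = cD[OF F(1)[of k] q] cD[OF G q] cD[OF M q]
   have e: "(D ?G q x - D ?F q x)\<^sup>2 = 1 * (2 * (D ?F q x)\<^sup>2 + 2 * (D ?G q x)\<^sup>2) + (- 4) * (D ?M q x)\<^sup>2" for x
    unfolding mid(2)[OF F(1) G q] by (simp add: power2_eq_square algebra_simps)
   show ?thesis unfolding e by (subst J_lin, (intro continuous_intros c)+, subst J_lin, (intro continuous_intros c)+) simp
  qed
  hence "(\<Sum>q\<in>?P. J (%x. (D ?G q x - D ?F q x)\<^sup>2)) = 2 * E ?F + 2 * E ?G - 4 * E ?M"
   by (simp add: E_def sum.distrib sum_subtractf sum_distrib_left)
  moreover have "(1 / 4 :: real) ^ Suc k <= (1 / 4) ^ k" by (rule power_decreasing) auto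
  hence "E ?F <= I (n k) + (1 / 4) ^ k" "E ?G <= L + (1 / 4) ^ k" "E ?M >= I (n k)" "L - I (n k) <= (1 / 4) ^ k"
   using F(2)[of k] F(2)[of "Suc k"] L(2)[of "n (Suc k)"] I_le[OF M] In[of k] by linarith+
  ultimately show ?thesis by linarith
 qed
 define v where "v k x = (\<Sum>q\<in>?P. \<bar>D (F (Suc k)) q x - D (F k) q x\<bar>)" for k x
 have cv: "cont (v k)" for k unfolding v_def using cD[OF F(1)] by (intro continuous_intros) auto
 define K0 where "K0 = 3 + real (card ?P) * ?m / 2"
 have Jv: "J (v k) <= K0 * (1 / 2) ^ k" for k
 proof -
  \<comment> \<open>The weight \<open>2 ^ k\<close> converts the square bound of order
    \<open>(1 / 4) ^ k\<close> into a bound of order \<open>(1 / 2) ^ k\<close> for the absolute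
    value, which is summable.\<close>
  have "\<bar>s\<bar> <= (2 ^ k / 2) * s\<^sup>2 + (1 / 2) * (1 / 2) ^ k" for s :: real
   using zero_le_power2[of "2 ^ k * \<bar>s\<bar> - 1"] by (simp add: power2_eq_square field_simps power_mult_distrib)
  hence "J (v k) <= (\<Sum>q\<in>?P. J (%x. (2 ^ k / 2) * (D (F (Suc k)) q x - D (F k) q x)\<^sup>2 + (1 / 2) * (1 / 2) ^ k))"
   unfolding v_def using cD[OF F(1)]
   by (subst J_sum, (intro continuous_intros, auto)[1]) (intro sum_mono J_mono continuous_intros, auto)
  also have "... = (\<Sum>q\<in>?P. (2 ^ k / 2) * J (%x. (D (F (Suc k)) q x - D (F k) q x)\<^sup>2) + (1 / 2) ^ k * ?m / 2)"
  proof (rule sum.cong)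
   fix q assume "q \<in> ?P"
   thus "J (%x. (2 ^ k / 2) * (D (F (Suc k)) q x - D (F k) q x)\<^sup>2 + (1 / 2) * (1 / 2) ^ k) =
    (2 ^ k / 2) * J (%x. (D (F (Suc k)) q x - D (F k) q x)\<^sup>2) + (1 / 2) ^ k * ?m / 2"
    using J_lin[of "%x. (D (F (Suc k)) q x - D (F k) q x)\<^sup>2" "%x. (1 / 2) ^ k" "2 ^ k / 2" "1 / 2"] cD[OF F(1)] J1[of "(1 / 2) ^ k"]
    by (simp add: continuous_intros)
  qed simp
  also have "... = (2 ^ k / 2) * (\<Sum>q\<in>?P. J (%x. (D (F (Suc k)) q x - D (F k) q x)\<^sup>2)) + real (card ?P) * ((1 / 2) ^ k * ?m / 2)"
   by (simp add: sum.distrib sum_distrib_left)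
  also have "... <= (2 ^ k / 2) * (6 * (1 / 4) ^ k) + real (card ?P) * ((1 / 2) ^ k * ?m / 2)"
   using diff by (intro add_mono mult_left_mono) auto
  also have "(2 ^ k / 2) * (6 * (1 / 4) ^ k) = 3 * (1 / 2 :: real) ^ k"
   by (simp add: power_mult_distrib[symmetric] field_simps)
  finally show ?thesis by (simp add: K0_def algebra_simps)
 qed
 have hne: "card hbasis > 0"
 proof -
  obtain x where "x \<in> N" using N(3) by fastforce
  hence "(\<Sum>b\<in>hbasis. X b (F 0 b) x) >= c" using F(1)[of 0] by (auto simp: S_def small_field_def)
  hence "hbasis ~= {}" using C by auto
  thus ?thesis using hbasis(4) by (simp add: card_gt_0_iff)
 qed
 \<comment> \<open>Some component of a divergence of at least \<open>c\<close> is at least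
   \<open>2 * th\<close>; a total variation of at most \<open>th\<close> along the sequence then
   leaves \<open>th\<close> for every field.\<close>
 define th where "th = c / (2 * real (card hbasis))"
 have th: "th > 0" using C hne by (simp add: th_def)
 have K0: "K0 > 0" using m by (simp add: K0_def add_pos_nonneg)
 obtain k0 where "(1 / 2) ^ k0 < th * ?m / (4 * K0)"
  using real_arch_pow_inv[of "th * ?m / (4 * K0)" "1 / 2"] th m K0 by auto
 hence k0: "2 * K0 * (1 / 2) ^ k0 <= th * (?m / 2)" using K0 by (simp add: field_simps)
 \<comment> \<open>By Markov's inequality each of these sets carries at least half of the mass of
   \<open>N\<close>. They decrease, so their intersection does as well, and there the total
   variation from index \<open>k0\<close> on is at most \<open>th\<close>.\<close>
 define A where "A n = N \<inter> {x. (\<Sum>k<n. v (k0 + k) x) <= th}" for n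
 have cA: "compact (A n)" for n
  unfolding A_def by (intro compact_Int_closed N closed_Collect_le continuous_intros cv)
 have Ab: "A n \<in> sets \<mu>" for n using cA[of n] \<mu>b by (simp add: compact_imp_closed)
 have v0: "v k x >= 0" for k x by (simp add: v_def sum_nonneg)
 have "decseq A" unfolding decseq_def A_def using v0 by (auto intro: order_trans[OF sum_mono2])
 hence lim: "(%n. measure \<mu> (A n)) \<longlonglongrightarrow> measure \<mu> (\<Inter>n. A n)"
  using Ab \<mu>K[OF cA] by (intro Lim_measure_decseq) (auto simp: less_top)
 have big: "measure \<mu> (A n) >= ?m / 2" for n
 proof -
  have "th * (?m - measure \<mu> (A n)) = th * measure \<mu> (N - A n)"
   using Nb Ab \<mu>K[OF N(1)] by (subst measure_Diff) (auto simp: A_def)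
  also have "... = (\<integral>x. indicator (N - A n) x * th \<partial>\<mu>)" using Nb Ab by (simp add: mult.commute)
  also have "... <= J (%x. \<Sum>k<n. v (k0 + k) x)"
   unfolding J_def
  proof (rule Bochner_Integration.integral_mono'[OF int])
   show "cont (%x. \<Sum>k<n. v (k0 + k) x)" by (intro continuous_intros cv)
   show "indicator (N - A n) x * th <= indicator N x * (\<Sum>k<n. v (k0 + k) x)" for x
    using v0 by (auto simp: A_def indicator_def sum_nonneg)
   show "0 <= indicator N x * (\<Sum>k<n. v (k0 + k) x)" for x using v0 by (simp add: sum_nonneg)
  qed
  also have "... = (\<Sum>k<n. J (v (k0 + k)))" by (rule J_sum[OF cv])
  also have "... <= (\<Sum>k<n. K0 * (1 / 2) ^ (k0 + k))" by (intro sum_mono Jv)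
  also have "... = K0 * (1 / 2) ^ k0 * (\<Sum>k<n. (1 / 2) ^ k)" by (simp add: power_add sum_distrib_left mult_ac)
  also have "... <= K0 * (1 / 2) ^ k0 * 2"
  proof (rule mult_left_mono)
   have "(\<Sum>k<n. (1 / 2 :: real) ^ k) <= (\<Sum>k. (1 / 2) ^ k)" by (intro sum_le_suminf summable_geometric) auto
   thus "(\<Sum>k<n. (1 / 2 :: real) ^ k) <= 2" by (simp add: suminf_geometric)
  qed (use K0 in simp)
  finally have "th * (?m - measure \<mu> (A n)) <= th * (?m / 2)" using k0 by simp
  thus ?thesis using th by simp
 qed
 define B where "B = (\<Inter>n. A n)"
 have Bc: "compact B" unfolding B_def using cA by (intro compact_Inter) auto
 have "measure \<mu> B >= ?m / 2" unfolding B_def using big by (intro tendsto_lowerbound[OF lim]) auto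
 hence mB: "measure \<mu> B > 0" using m by simp
 define K where "K b = B \<inter> {x. X b (F k0 b) x >= 2 * th}" for b
 have Kc: "compact (K b)" if "b \<in> hbasis" for b
  unfolding K_def using cD[OF F(1)[of k0], of "(b, b)"] that
  by (intro compact_Int_closed Bc closed_Collect_le continuous_intros) (auto simp: D_def)
 have "B \<subseteq> (\<Union>b\<in>hbasis. K b)"
 proof
  fix x assume x: "x \<in> B"
  hence "c <= (\<Sum>b\<in>hbasis. X b (F k0 b) x)" using F(1)[of k0] unfolding B_def A_def S_def small_field_def by auto
  also have "... < (\<Sum>b\<in>hbasis. 2 * th)" if "!!b. b \<in> hbasis ==> X b (F k0 b) x < 2 * th"
   using that hne hbasis(4) by (intro sum_strict_mono) auto
  also have "... = c" using hne by (simp add: th_def)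
  finally show "x \<in> (\<Union>b\<in>hbasis. K b)" using x by (force simp: K_def)
 qed
 hence "measure \<mu> B <= measure \<mu> (\<Union>b\<in>hbasis. K b)"
  using Kc Bc \<mu>b \<mu>K hbasis(4) by (intro measure_mono_fmeasurable fmeasurable.finite_UN fmeasurableI) (auto simp: compact_imp_closed)
 also have "... <= (\<Sum>b\<in>hbasis. measure \<mu> (K b))"
  using Kc \<mu>b hbasis(4) by (intro measure_UNION_le) (auto simp: compact_imp_closed)
 finally have "\<exists>b\<in>hbasis. measure \<mu> (K b) > 0" using mB by (meson not_le order_less_le_trans sum_nonpos)
 then obtain b where b: "b \<in> hbasis" "measure \<mu> (K b) > 0" by blast
 have var: "(\<Sum>k<n. \<bar>X d (F (k0 + Suc k) b) x - X d (F (k0 + k) b) x\<bar>) <= th" if x: "x \<in> K b" and d: "d \<in> hbasis" for n d x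
 proof -
  have "\<bar>X d (F (Suc k) b) x - X d (F k b) x\<bar> <= v k x" for k
   unfolding v_def using member_le_sum[of "(b, d)" ?P "%q. \<bar>D (F (Suc k)) q x - D (F k) q x\<bar>"] hbasis(4) b d by (simp add: D_def)
  hence "(\<Sum>k<n. \<bar>X d (F (k0 + Suc k) b) x - X d (F (k0 + k) b) x\<bar>) <= (\<Sum>k<n. v (k0 + k) x)"
   by (intro sum_mono) simp
  thus ?thesis using x by (auto simp: K_def B_def A_def intro: order_trans)
 qed
 show ?thesis
 proof (rule that[OF b(1) C(1) th Kc[OF b(1)], of "%k. F (k0 + k) b"])
  show "K b \<subseteq> N" by (auto simp: K_def B_def A_def)
  show "emeasure \<mu> (K b) > 0" using b(2) by (simp add: measure_def enn2real_positive_iff)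
  show "sm 1 (F (k0 + k) b)" "csupp (F (k0 + k) b)" for k using F(1)[of "k0 + k"] b by (auto simp: S_def small_field_def)
  show "\<bar>F (k0 + k) b x\<bar> <= 1 / real (Suc k)" for k x
  proof -
   have "F (k0 + k) \<in> S k" using S_mono[of k "n (k0 + k)"] n(2)[of "k0 + k"] F(1)[of "k0 + k"] by auto
   thus ?thesis using b by (auto simp: S_def small_field_def)
  qed
  show "\<bar>X d (F (k0 + k) b) x\<bar> <= C" if "d \<in> hbasis" for k d x using F(1)[of "k0 + k"] b that by (auto simp: S_def small_field_def)
  show "(\<Sum>k<n. \<bar>X d (F (k0 + Suc k) b) x - X d (F (k0 + k) b) x\<bar>) <= th" if "x \<in> K b" "d \<in> hbasis" for n d x
   using that by (rule var)
  show "X b (F (k0 + k) b) x >= th" if x: "x \<in> K b" for k x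
  proof -
   have "X b (F (k0 + k) b) x - X b (F (k0 + 0) b) x = (\<Sum>j<k. X b (F (k0 + Suc j) b) x - X b (F (k0 + j) b) x)"
    by (rule sum_lessThan_telescope[symmetric])
   also have "\<bar>...\<bar> <= th" using var[OF x b(1), of k] by (intro order_trans[OF sum_abs])
   finally show ?thesis using x by (auto simp: K_def)
  qed
 qed
qed

lemma X_extremum:
 assumes "sm (Suc k) f" "(\<forall>y. f y <= f x) \<or> (\<forall>y. f x <= f y)" shows "X b f x = 0"
proof -
 have "((%t. f (x \<odot> (t *R b))) has_real_derivative X b f x) (at 0)" by (rule X_deriv0[OF assms(1)])
 thus ?thesis
  using DERIV_local_max[of _ _ 0 1] DERIV_local_min[of _ _ 0 1] assms(2) by fastforce
qed

text \<open>A sum of bumps over finitely many balls is bounded below by some \<open>d > 0\<close> on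
  \<open>N\<close>; composing it with a \<open>C^1\<close> function that equals 1 from
  \<open>d\<close> on gives the cut-off.\<close>

lemma cutoff:
 assumes N: "compact N" "N \<subseteq> W" and W: "open W"
 obtains \<xi> where "sm 1 \<xi>" "csupp \<xi>" "!!x. 0 <= \<xi> x" "!!x. \<xi> x <= 1" "!!x. x \<in> N ==> \<xi> x = 1" "!!x. \<xi> x ~= 0 ==> x \<in> W"
proof -
 have "\<forall>z\<in>N. \<exists>r>0. ball z r \<subseteq> W" using N W open_contains_ball by blast
 from bchoice[OF this] obtain r where r: "!!z. z \<in> N ==> r z > 0" "!!z. z \<in> N ==> ball z (r z) \<subseteq> W" by auto
 have cov: "N \<subseteq> (\<Union>z\<in>N. ball z (r z))" using r(1) by auto
 obtain Z where Z: "Z \<subseteq> N" "finite Z" "N \<subseteq> (\<Union>z\<in>Z. ball z (r z))"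
  by (rule compactE_image[OF N(1), of N "%z. ball z (r z)"]) (use cov in \<open>auto intro: that\<close>)
 define q where "q z x = 1 - 1 / (r z)\<^sup>2 * (\<Sum>i\<in>Basis. ((x - z) \<bullet> i) * ((x - z) \<bullet> i))" for z x
 have q: "q z x > 0 \<longleftrightarrow> x \<in> ball z (r z)" if "z \<in> N" for z x
 proof -
  have "q z x = 1 - (norm (x - z))\<^sup>2 / (r z)\<^sup>2" by (simp add: q_def dot_square_norm flip: euclidean_inner)
  thus ?thesis using r(1)[OF that] abs_square_less_1[of "norm (x - z) / r z"]
   by (simp add: power_divide dist_norm norm_minus_commute)
 qed
 have smq: "sm 1 (q z)" for z
 proof -
  have "sm 1 (%x. (x - z) \<bullet> i)" for i
   unfolding inner_diff_left by (intro Ck_diff Ck_linear Ck_const linearI) (auto simp: inner_add_left)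
  thus ?thesis unfolding q_def by (intro Ck_diff Ck_cmult Ck_sum Ck_mult Ck_const)
 qed
 define s where "s x = (\<Sum>z\<in>Z. max 0 (q z x) ^ Suc (1 + 0))" for x
 have sms: "sm 1 s" unfolding s_def by (intro Ck_sum Ck_pos_power smq)
 have s0: "s x >= 0" for x by (simp add: s_def sum_nonneg)
 have spos: "s x > 0" if xN: "x \<in> N" for x
 proof -
  obtain z where z: "z \<in> Z" "x \<in> ball z (r z)" using Z(3) xN by blast
  hence "0 < max 0 (q z x) ^ Suc (1 + 0)" using q[of z x] Z(1) by auto
  also have "... <= s x" unfolding s_def using Z(2) z(1) by (intro member_le_sum) auto
  finally show ?thesis .
 qed
 have "\<exists>d>0. \<forall>x\<in>N. d <= s x"
 proof (cases "N = {}")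
  case False
  then obtain x where "x \<in> N" "\<forall>y\<in>N. s x <= s y"
   using continuous_attains_inf[OF N(1) False continuous_on_subset[OF sm_continuous[OF sms]]] by auto
  thus ?thesis using spos by blast
 qed (auto intro: exI[of _ 1])
 then obtain d where d: "d > 0" "!!x. x \<in> N ==> d <= s x" by blast
 define \<xi> where "\<xi> x = 1 - max 0 (1 - 1 / d * s x) ^ Suc (1 + 0)" for x
 have le1: "max 0 (1 - 1 / d * s x) <= 1" for x using s0 d(1) by simp
 have supp: "\<exists>z\<in>Z. x \<in> ball z (r z)" if "\<xi> x ~= 0" for x
 proof (rule ccontr)
  assume "\<not> ?thesis"
  hence "max 0 (q z x) = 0" if "z \<in> Z" for z using q[of z x] Z(1) that by (force simp: max_def)
  hence "s x = 0" by (simp add: s_def)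
  thus False using that by (simp add: \<xi>_def)
 qed
 show ?thesis
 proof (rule that[of \<xi>])
  show "sm 1 \<xi>" unfolding \<xi>_def by (intro Ck_diff Ck_const Ck_pos_power Ck_cmult sms)
  have "compact (\<Union>z\<in>Z. cball z (r z))" using Z(2) by (intro compact_UN) auto
  moreover have "\<xi> x = 0" if "x \<notin> (\<Union>z\<in>Z. cball z (r z))" for x using that supp[of x] by force
  ultimately show "csupp \<xi>" unfolding csupp_def by (intro exI conjI) auto
  show "0 <= \<xi> x" for x using power_mono[OF le1[of x], of "Suc (1 + 0)"] unfolding \<xi>_def by simp
  show "\<xi> x <= 1" for x by (simp add: \<xi>_def)
  show "\<xi> x = 1" if "x \<in> N" for x using d that by (simp add: \<xi>_def pos_le_divide_eq)
  show "x \<in> W" if "\<xi> x ~= 0" for x using supp[OF that] r(2) Z(1) by blast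
 qed
qed

text \<open>The mean value theorem combined with the uniform continuity of \<open>X b g\<close>,
  which has compact support.\<close>

lemma uniform_derivative:
 assumes g: "sm (Suc 0) g" "csupp g" and e: "e > 0" "t0 > 0"
 obtains t where "0 < t" "t <= t0" "!!x. \<bar>g (x \<odot> (t *R b)) - g x - t * X b g x\<bar> <= e * t"
proof -
 obtain n where n: "!!x u. u \<in> U (1 / a ^ n) ==> \<bar>X b g (x \<odot> u) - X b g x\<bar> < e"
  using sm_continuous[OF sm_X[OF g(1)]] csupp_X[OF g(2)] e(1) by (rule uniform_right) (rule that)
 have "1 / a ^ n > 0" by simp
 then obtain r where r: "r > 0" "ball 0 r \<subseteq> U (1 / a ^ n)" by (rule U_nbhd)
 define t where "t = min t0 (r / (2 * (norm b + 1)))"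
 have t: "0 < t" "t <= t0" using e r by (auto simp: t_def add_nonneg_pos)
 have "t * (norm b + 1) <= r / 2"
 proof -
  have "2 * (norm b + 1) > 0" by (simp add: add_nonneg_pos)
  moreover have "t <= r / (2 * (norm b + 1))" by (simp add: t_def)
  ultimately have "t * (2 * (norm b + 1)) <= r" by (simp only: pos_le_divide_eq)
  thus ?thesis by (simp add: algebra_simps)
 qed
 hence tb: "t * norm b < r" using t r by (simp add: distrib_left)
 show ?thesis
 proof (rule that[OF t])
  fix x
  have "\<exists>s. 0 < s \<and> s < t \<and> g (x \<odot> (t *R b)) - g (x \<odot> (0 *R b)) = (t - 0) * X b g (x \<odot> (s *R b))"
   by (rule MVT2[OF t(1)]) (rule X_deriv[OF g(1)])
  then obtain s where s: "0 < s" "s < t" "g (x \<odot> (t *R b)) - g x = t * X b g (x \<odot> (s *R b))" by auto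
  have "s * norm b <= t * norm b" using s by (intro mult_right_mono) auto
  hence "s *R b \<in> ball 0 r" using s tb by simp
  hence "\<bar>X b g (x \<odot> (s *R b)) - X b g x\<bar> <= e" using n r(2) by (blast intro: less_imp_le)
  hence "t * \<bar>X b g (x \<odot> (s *R b)) - X b g x\<bar> <= t * e" using t by (intro mult_left_mono) auto
  thus "\<bar>g (x \<odot> (t *R b)) - g x - t * X b g x\<bar> <= e * t"
   using t unfolding s(3) by (simp add: right_diff_distrib[symmetric] abs_mult mult.commute)
 qed
qed

lemma X_norm_le:
 assumes "sm (Suc k) f" "!!d. d \<in> hbasis ==> \<bar>X d f x\<bar> <= A" "u \<in> V 1"
 shows "\<bar>X u f x\<bar> <= real (card hbasis) * A * norm u"
proof -
 have "\<bar>X u f x\<bar> <= (\<Sum>b\<in>hbasis. norm u * A)"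
  unfolding X_hbasis[OF assms(1,3)]
 proof (intro order_trans[OF sum_abs] sum_mono)
  fix b assume b: "b \<in> hbasis"
  have "\<bar>u \<bullet> b\<bar> <= norm u" using Cauchy_Schwarz_ineq2[of u b] hbasis(3)[OF b] by simp
  thus "\<bar>(u \<bullet> b) * X b f x\<bar> <= norm u * A" using assms(2)[OF b] by (simp add: abs_mult mult_mono)
 qed
 thus ?thesis by (simp add: mult_ac)
qed

text \<open>
 The function is a sum of cut-off fields with alternating signs. Its difference quotients at the
 scales \<open>t k\<close> follow the derivatives of the partial sums, which keep jumping by \<open>c\<close>; these
 derivatives stay bounded on \<open>K\<close> because consecutive fields have nearly equal derivatives.
\<close>
theorem nondifferentiable:
 assumes \<mu>: "radon_measure \<mu>" and N: "compact N" "emeasure \<nu> N = 0" "emeasure \<mu> N > 0"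
 obtains f b A K where "b \<in> V 1" "!!x y. \<bar>f y - f x\<bar> <= A * cc_distance G x y" "compact K" "emeasure \<mu> K > 0"
  "!!x l. x \<in> K ==> \<not> ((%t. (f (x \<odot> (t *R b)) - f x) / t) \<longlongrightarrow> l) (at_right 0)"
proof -
 obtain p b C c K where b: "b \<in> hbasis" and C: "C > 0" "c > 0" and K: "compact K" "emeasure \<mu> K > 0"
  and p: "!!k. sm 1 (p k)" "!!k. csupp (p k)" "!!k x. \<bar>p k x\<bar> <= 1 / real (Suc k)"
   "!!k d x. d \<in> hbasis ==> \<bar>X d (p k) x\<bar> <= C" "!!k x. x \<in> K ==> X b (p k) x >= c"
   "!!n d x. x \<in> K ==> d \<in> hbasis ==> (\<Sum>k<n. \<bar>X d (p (Suc k)) x - X d (p k) x\<bar>) <= c"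
  by (rule convergent_fields[OF \<mu> N]) (rule that)
 have sp: "sm (Suc 0) (p k)" for k using p(1)[of k] by simp
 \<comment> \<open>Two difference quotients will each be within \<open>3 * e\<close> of a derivative
   and within \<open>e\<close> of a common limit, which would confine a jump of at least
   \<open>c\<close> to less than \<open>8 * e\<close>.\<close>
 define e where "e = c / 8"
 have e: "e > 0" using C by (simp add: e_def)
 \<comment> \<open>The summands are \<open>C + c + 1\<close> for the old sum near \<open>K\<close>,
   \<open>C\<close> for the derivative of the new field and 1 for the derivative of the
   cut-off.\<close>
 define A where "A = C + c + C + 2"
 \<comment> \<open>The state consists of the current sum \<open>g\<close>, the index
   \<open>M\<close> of the field added last and the scale \<open>t\<close>. On \<open>K\<close> the
   derivatives of \<open>g\<close> are close to 0 when the fields added so far pair off with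
   opposite signs, and otherwise close to those of the field \<open>M\<close>; the error is the
   variation up to \<open>M\<close>.\<close>
 define P where "P k s \<longleftrightarrow> (case s of (g, M, t) => sm (Suc 0) g \<and> csupp g \<and> (\<forall>d\<in>hbasis. \<forall>x. \<bar>X d g x\<bar> <= A) \<and>
   (\<forall>d\<in>hbasis. \<forall>x\<in>K. \<bar>X d g x - (if even k then 0 else X d (p M) x)\<bar> <= (\<Sum>i<M. \<bar>X d (p (Suc i)) x - X d (p i) x\<bar>)) \<and>
   0 < t \<and> t <= 1 / real (Suc k) \<and> (\<forall>x. \<bar>g (x \<odot> (t *R b)) - g x - t * X b g x\<bar> <= e * t))"
  for k :: nat and s :: "('a => real) \<times> nat \<times> real"
 \<comment> \<open>The geometric factor makes the sum of all later changes at most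
   \<open>e * t\<close>, so the difference quotient at the scale \<open>t\<close> hardly notices
   them.\<close>
 define Q where "Q k s s' \<longleftrightarrow> (case s of (g, M, t) => case s' of (g', M', t') => t' <= t \<and>
   (\<forall>x. \<bar>g' x - g x\<bar> <= e * t * (1 / 2) ^ Suc k) \<and> (\<forall>x\<in>K. \<bar>X b g' x - X b g x\<bar> >= c))"
  for k :: nat and s s' :: "('a => real) \<times> nat \<times> real"
 have "\<exists>s. \<forall>k. P k (s k) \<and> Q k (s k) (s (Suc k))"
 proof (rule dependent_nat_choice)
  have cs: "csupp (%x::'a. 0)" unfolding csupp_def by (intro exI[of _ "{}"]) simp
  have "P 0 ((%x. 0), 0, 1)" using C cs e unfolding P_def by (simp add: X_def A_def)
  thus "\<exists>s. P 0 s" by blast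
 next
  fix s k assume "P k s"
  then obtain g M t where s: "s = (g, M, t)" and g: "sm (Suc 0) g" "csupp g" "!!d x. d \<in> hbasis ==> \<bar>X d g x\<bar> <= A"
   "!!d x. d \<in> hbasis ==> x \<in> K ==> \<bar>X d g x - (if even k then 0 else X d (p M) x)\<bar> <= (\<Sum>i<M. \<bar>X d (p (Suc i)) x - X d (p i) x\<bar>)"
   and t: "0 < t" "t <= 1 / real (Suc k)"
   by (cases s) (auto simp: P_def)
  \<comment> \<open>An open neighbourhood of \<open>K\<close> on which the present derivatives are
    still below the bound that holds on \<open>K\<close>. The new term lives there, so the bound
    \<open>A\<close> does not deteriorate from step to step.\<close>
  define W where "W = (\<Inter>d\<in>hbasis. {x. \<bar>X d g x\<bar> < C + c + 1})"
  have "open W" unfolding W_def using hbasis(4)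
   by (intro open_INT ballI open_Collect_less continuous_intros sm_continuous[OF sm_X[OF g(1)]]) auto
  moreover have "K \<subseteq> W"
  proof
   fix x assume x: "x \<in> K"
   have "\<bar>X d g x\<bar> < C + c + 1" if d: "d \<in> hbasis" for d
    using g(4)[OF d x] p(6)[OF x d, of M] p(4)[OF d, of M x] C by (auto split: if_splits)
   thus "x \<in> W" by (simp add: W_def)
  qed
  ultimately obtain \<xi> where \<xi>: "sm 1 \<xi>" "csupp \<xi>" "!!x. 0 <= \<xi> x" "!!x. \<xi> x <= 1" "!!x. x \<in> K ==> \<xi> x = 1" "!!x. \<xi> x ~= 0 ==> x \<in> W"
   using cutoff[OF K(1)] by blast
  have s\<xi>: "sm (Suc 0) \<xi>" using \<xi>(1) by simp
  have "\<exists>B. \<forall>x. \<bar>X d \<xi> x\<bar> <= B" for d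
   using csupp_bounded[OF csupp_X[OF \<xi>(2)] sm_continuous[OF sm_X[OF s\<xi>]], of d] by blast
  then obtain B where B: "!!d x. \<bar>X d \<xi> x\<bar> <= B d" by metis
  \<comment> \<open>Values of the new field below \<open>1 / B0\<close> keep its product with the
    derivatives of the cut-off below 1, and are small enough for \<open>Q\<close>.\<close>
  define B0 where "B0 = 1 + (\<Sum>d\<in>hbasis. \<bar>B d\<bar>) + 1 / (e * t * (1 / 2) ^ Suc k)"
  have et: "e * t * (1 / 2) ^ Suc k > 0" using e t by simp
  have sB: "(\<Sum>d\<in>hbasis. \<bar>B d\<bar>) >= 0" by (simp add: sum_nonneg)
  have BB: "\<bar>X d \<xi> x\<bar> <= B0" if d: "d \<in> hbasis" for d x
  proof -
   have "\<bar>X d \<xi> x\<bar> <= \<bar>B d\<bar>" using B[of d x] by linarith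
   also have "... <= (\<Sum>d\<in>hbasis. \<bar>B d\<bar>)" using d hbasis(4) by (intro member_le_sum) auto
   also have "... <= B0" using et by (simp add: B0_def less_imp_le)
   finally show ?thesis .
  qed
  obtain m0 where m0: "real m0 > B0" using reals_Archimedean2 by blast
  \<comment> \<open>The indices must not decrease, so that the differences of derivatives are
    controlled by one telescoping sum.\<close>
  define m where "m = max M m0"
  have B0: "B0 > 0" "B0 >= 1 / (e * t * (1 / 2) ^ Suc k)" using sB et by (auto simp: B0_def add_pos_nonneg less_imp_le)
  have pB: "\<bar>p m x\<bar> <= 1 / B0" for x
  proof -
   have "1 / real (Suc m) <= 1 / B0" using m0 B0 by (intro divide_left_mono) (auto simp: m_def)
   thus ?thesis using p(3)[of m x] by linarith
  qed
  have pe: "\<bar>p m x\<bar> <= e * t * (1 / 2) ^ Suc k" for x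
  proof -
   have "1 / B0 <= e * t * (1 / 2) ^ Suc k" using B0 et by (simp add: field_simps)
   thus ?thesis using pB[of x] by linarith
  qed
  \<comment> \<open>The alternating sign: a field is added at even steps, and one with nearly the
    same derivatives on \<open>K\<close> is subtracted at odd steps.\<close>
  define \<sigma> :: real where "\<sigma> = (- 1) ^ k"
  have \<sigma>: "\<bar>\<sigma>\<bar> = 1" by (simp add: \<sigma>_def)
  define g' where "g' x = g x + \<sigma> * (\<xi> x * p m x)" for x
  have s\<xi>p: "sm (Suc 0) (%x. \<xi> x * p m x)" by (intro Ck_mult s\<xi> sp)
  have sg': "sm (Suc 0) g'" unfolding g'_def by (intro Ck_add Ck_cmult g s\<xi>p)
  have cg': "csupp g'"
  proof -
   have "bm g" "bm (%x. \<xi> x * p m x)"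
    using g sm_continuous[OF g(1)] sm_continuous[OF s\<xi>p] csupp_mult_right[OF p(2)] by (auto intro: bm_continuous)
   hence "bm g'" unfolding g'_def[abs_def] by (intro bm_add bm_cmult)
   thus ?thesis by (simp add: bm_def)
  qed
  have Xg': "X d g' x = X d g x + \<sigma> * (\<xi> x * X d (p m) x + X d \<xi> x * p m x)" for d x
   unfolding g'_def by (simp add: X_add[OF g(1) Ck_cmult[OF s\<xi>p]] X_cmult[OF s\<xi>p] X_mult[OF s\<xi> sp])
  \<comment> \<open>Where the cut-off is 0 or 1 it attains an extremum. On \<open>K\<close>, which
    may have empty interior, the derivative of the new term is thus exactly that of the
    field.\<close>
  have ext: "X d \<xi> x = 0" if "\<xi> x = 0 \<or> \<xi> x = 1" for d x
   using that \<xi>(3,4) by (intro X_extremum[OF s\<xi>]) auto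
  have XK: "X d g' x = X d g x + \<sigma> * X d (p m) x" if "x \<in> K" for d x
   using \<xi>(5)[OF that] ext[of x d] by (simp add: Xg')
  obtain t' where t': "0 < t'" "t' <= min t (1 / real (Suc (Suc k)))" "!!x. \<bar>g' (x \<odot> (t' *R b)) - g' x - t' * X b g' x\<bar> <= e * t'"
   using uniform_derivative[OF sg' cg' e, of "min t (1 / real (Suc (Suc k)))"] t(1) by (auto simp del: of_nat_Suc)
  have "\<bar>X d g' x\<bar> <= A" if d: "d \<in> hbasis" for d x
  proof (cases "\<xi> x = 0")
   case True
   thus ?thesis using ext[of x d] g(3)[OF d, of x] by (simp add: Xg')
  next
   case False
   hence "\<bar>X d g x\<bar> < C + c + 1" using \<xi>(6)[OF False] d by (auto simp: W_def)
   moreover have "\<bar>\<xi> x * X d (p m) x\<bar> <= 1 * C" unfolding abs_mult using \<xi>(3,4)[of x] p(4)[OF d] by (intro mult_mono) auto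
   moreover have "\<bar>X d \<xi> x * p m x\<bar> <= B0 * (1 / B0)" unfolding abs_mult using BB[OF d] pB B0 by (intro mult_mono) auto
   ultimately have "\<bar>X d g x\<bar> + (\<bar>\<xi> x * X d (p m) x\<bar> + \<bar>X d \<xi> x * p m x\<bar>) <= A" using B0 by (simp add: A_def)
   moreover have "\<bar>X d g' x\<bar> <= \<bar>X d g x\<bar> + (\<bar>\<xi> x * X d (p m) x\<bar> + \<bar>X d \<xi> x * p m x\<bar>)"
    unfolding Xg' by (intro order_trans[OF abs_triangle_ineq] add_mono order_refl) (simp add: abs_mult \<sigma> del: abs_mult_pos, simp add: abs_triangle_ineq flip: abs_mult)
   ultimately show ?thesis by linarith
  qed
  moreover have "\<bar>X d g' x - (if even (Suc k) then 0 else X d (p m) x)\<bar> <= (\<Sum>i<m. \<bar>X d (p (Suc i)) x - X d (p i) x\<bar>)"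
   if d: "d \<in> hbasis" and x: "x \<in> K" for d x
  proof -
   let ?a = "%i. X d (p i) x"
   have Mm: "{..<m} = {..<M} \<union> {M..<m}" by (auto simp: m_def)
   have split: "(\<Sum>i<m. \<bar>?a (Suc i) - ?a i\<bar>) = (\<Sum>i<M. \<bar>?a (Suc i) - ?a i\<bar>) + (\<Sum>i=M..<m. \<bar>?a (Suc i) - ?a i\<bar>)"
    unfolding Mm by (rule sum.union_disjoint) auto
   have "?a m - ?a M = (\<Sum>i=M..<m. ?a (Suc i) - ?a i)" by (rule sum_Suc_diff'[symmetric]) (simp add: m_def)
   hence "\<bar>?a m - ?a M\<bar> <= (\<Sum>i=M..<m. \<bar>?a (Suc i) - ?a i\<bar>)" by simp
   moreover have "0 <= (\<Sum>i=M..<m. \<bar>?a (Suc i) - ?a i\<bar>)" by (simp add: sum_nonneg)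
   ultimately show ?thesis
    unfolding split XK[OF x] using g(4)[OF d x] by (cases "even k") (auto simp: \<sigma>_def)
  qed
  ultimately have "P (Suc k) (g', m, t')"
   unfolding P_def using sg' cg' t' by (simp del: of_nat_Suc)
  moreover have "Q k s (g', m, t')"
  proof -
   have "\<bar>\<xi> x\<bar> * \<bar>p m x\<bar> <= 1 * (e * t * (1 / 2) ^ Suc k)" for x using \<xi>(3,4)[of x] pe[of x] by (intro mult_mono) auto
   hence "\<bar>g' x - g x\<bar> <= e * t * (1 / 2) ^ Suc k" for x by (simp add: g'_def abs_mult \<sigma>)
   moreover have "\<bar>X b g' x - X b g x\<bar> >= c" if "x \<in> K" for x
    using p(5)[OF that, of m] by (simp add: XK[OF that] abs_mult \<sigma>)
   ultimately show ?thesis using t'(2) by (simp add: Q_def s)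
  qed
  ultimately show "\<exists>s'. P (Suc k) s' \<and> Q k s s'" by blast
 qed
 then obtain s where s: "!!k. P k (s k)" "!!k. Q k (s k) (s (Suc k))" by blast
 define g where "g k = fst (s k)" for k
 define t where "t k = snd (snd (s k))" for k
 have g: "sm (Suc 0) (g k)" "!!d x. d \<in> hbasis ==> \<bar>X d (g k) x\<bar> <= A" "0 < t k" "t k <= 1 / real (Suc k)"
  "!!x. \<bar>g k (x \<odot> (t k *R b)) - g k x - t k * X b (g k) x\<bar> <= e * t k" for k
  using s(1)[of k] by (auto simp: P_def g_def t_def split: prod.splits)
 have st: "t (Suc k) <= t k" "!!x. \<bar>g (Suc k) x - g k x\<bar> <= e * t k * (1 / 2) ^ Suc k" "!!x. x \<in> K ==> \<bar>X b (g (Suc k)) x - X b (g k) x\<bar> >= c" for k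
  using s(2)[of k] by (auto simp: Q_def g_def t_def split: prod.splits)
 have tm: "t (k + j) <= t k" for k j by (induction j) (auto intro: order_trans[OF st(1)])
 have near: "\<bar>g (k + j) x - g k x\<bar> <= e * t k * (1 - (1 / 2) ^ j)" for k j x
 proof (induction j)
  case (Suc j)
  have "e * t (k + j) * (1 / 2) ^ Suc (k + j) <= e * t k * (1 / 2) ^ Suc j"
   using tm[of k j] e g(3)[of k] less_imp_le[OF g(3)[of "k + j"]] by (intro mult_mono power_decreasing) auto
  hence "\<bar>g (Suc (k + j)) x - g (k + j) x\<bar> <= e * t k * (1 / 2) ^ Suc j" using st(2)[of "k + j" x] by linarith
  moreover have "e * t k * (1 - (1 / 2) ^ Suc j) = e * t k * (1 - (1 / 2) ^ j) + e * t k * (1 / 2) ^ Suc j" by (simp add: algebra_simps)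
  ultimately have "\<bar>g (Suc (k + j)) x - g k x\<bar> <= e * t k * (1 - (1 / 2) ^ Suc j)" using Suc by linarith
  thus ?case by (simp only: add_Suc_right)
 qed simp
 have near': "\<bar>g (k + j) x - g k x\<bar> <= e * t k" for k j x
 proof -
  have "e * t k * (1 - (1 / 2) ^ j) <= e * t k * 1" by (rule mult_left_mono) (use e g(3)[of k] in auto)
  thus ?thesis using near[of k j x] by linarith
 qed
 have t0: "t \<longlonglongrightarrow> 0"
  by (rule tendsto_sandwich[OF _ _ tendsto_const LIMSEQ_inverse_real_of_nat])
   (use g(3,4) in \<open>auto simp: inverse_eq_divide intro!: always_eventually less_imp_le\<close>)
 have "convergent (%k. g k x)" for x
 proof (rule Cauchy_convergent, rule metric_CauchyI)
  fix r :: real assume r: "r > 0"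
  have "(%k. e * t k) \<longlonglongrightarrow> e * 0" by (intro tendsto_intros t0)
  hence "\<forall>\<^sub>F k in sequentially. e * t k < r / 2" using r by (intro order_tendstoD(2)) auto
  then obtain k where "e * t k < r / 2" by (auto simp: eventually_sequentially)
  hence k: "\<bar>g j x - g k x\<bar> < r / 2" if "j >= k" for j using near'[of k "j - k" x] that by simp
  show "\<exists>M. \<forall>m\<ge>M. \<forall>n\<ge>M. dist (g m x) (g n x) < r"
   using k by (intro exI[of _ k] allI impI) (smt (verit) dist_real_def field_sum_of_halves)
 qed
 then obtain f where f: "!!x. (%k. g k x) \<longlonglongrightarrow> f x" unfolding convergent_def by metis
 have fg: "\<bar>f x - g k x\<bar> <= e * t k" for k x
 proof (rule tendsto_upperbound)
  show "(%j. \<bar>g (k + j) x - g k x\<bar>) \<longlonglongrightarrow> \<bar>f x - g k x\<bar>"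
   using LIMSEQ_ignore_initial_segment[OF f[of x], of k] by (intro tendsto_intros) (simp add: add.commute)
 qed (use near' in auto)
 let ?A = "real (card hbasis) * A"
 show ?thesis
 proof (rule that[of b f ?A K])
  show bV: "b \<in> V 1" using b hbasis(1) by blast
  have A0: "?A >= 0" using C by (simp add: A_def)
  show "\<bar>f y - f x\<bar> <= ?A * cc_distance G x y" for x y
  proof (rule tendsto_upperbound)
   show "(%k. \<bar>g k y - g k x\<bar>) \<longlonglongrightarrow> \<bar>f y - f x\<bar>" by (intro tendsto_intros f)
   show "\<forall>\<^sub>F k in sequentially. \<bar>g k y - g k x\<bar> <= ?A * cc_distance G x y"
    using cc_lipschitz[OF g(1) A0 X_norm_le[OF g(1) g(2)]] by (intro always_eventually allI) auto
  qed simp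
  show "compact K" "emeasure \<mu> K > 0" using K by auto
  fix x l assume x: "x \<in> K"
  show "\<not> ((%t. (f (x \<odot> (t *R b)) - f x) / t) \<longlongrightarrow> l) (at_right 0)"
  proof
   assume lim: "((%t. (f (x \<odot> (t *R b)) - f x) / t) \<longlongrightarrow> l) (at_right 0)"
   have "filterlim t (at_right 0) sequentially"
    using t0 g(3) unfolding filterlim_at by (auto intro!: always_eventually) (metis less_irrefl)
   from filterlim_compose[OF lim this] have "(%k. (f (x \<odot> (t k *R b)) - f x) / t k) \<longlonglongrightarrow> l" .
   hence "\<forall>\<^sub>F k in sequentially. dist ((f (x \<odot> (t k *R b)) - f x) / t k) l < e" using e by (rule tendstoD)
   then obtain k where k: "!!j. j >= k ==> dist ((f (x \<odot> (t j *R b)) - f x) / t j) l < e" by (auto simp: eventually_sequentially)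
   \<comment> \<open>One \<open>e\<close> comes from the difference quotient of \<open>g j\<close>
     at its own scale, the other two from replacing \<open>g j\<close> by \<open>f\<close> at both
     ends.\<close>
   have "\<bar>(f (x \<odot> (t j *R b)) - f x) / t j - X b (g j) x\<bar> <= 3 * e" for j
   proof -
    have "\<bar>f (x \<odot> (t j *R b)) - f x - t j * X b (g j) x\<bar> <= 3 * e * t j"
     using g(5)[of j x] fg[of x j] fg[of "x \<odot> (t j *R b)" j] by linarith
    moreover have "(f (x \<odot> (t j *R b)) - f x) / t j - X b (g j) x = (f (x \<odot> (t j *R b)) - f x - t j * X b (g j) x) / t j"
     using g(3)[of j] by (simp add: field_simps)
    ultimately show ?thesis using g(3)[of j] by (simp add: pos_divide_le_eq)
   qed
   from this[of k] this[of "Suc k"] k[of k] k[of "Suc k"] have "\<bar>X b (g (Suc k)) x - X b (g k) x\<bar> < 8 * e"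
    using e unfolding dist_real_def by linarith
   thus False using st(3)[OF x, of k] by (simp add: e_def)
  qed
 qed
qed

end

section \<open>Absolute continuity\<close>

lemma (in stratified_group) cc_nonneg: "cc_distance G x y >= 0"
proof -
 obtain ga u where ga: "joined ga u x y" using joined_exists by blast
 have "{integral {0..1} (%t. norm (u t)) |ga u. horizontal_curve G ga u \<and> ga 0 = x \<and> ga 1 = y} ~= {}"
  using joined_curve[OF ga] ga unfolding joined_def by blast
 thus ?thesis unfolding cc_distance_def
  by (rule cInf_greatest) (auto intro!: Henstock_Kurzweil_Integration.integral_nonneg simp: horizontal_curve_def absolutely_integrable_on_def)
qed

text \<open>Left translation moves one point to 0, and on the line through an element of the first
  layer dilations are multiplications by scalars.\<close>

lemma homogeneous_distance_line:
 assumes H: "homogeneous_group H" and d: "homogeneous_distance H d" and v: "v \<in> layer H 1"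
 shows "d (s *R v) (t *R v) = \<bar>t - s\<bar> * d 0 v"
proof -
 interpret H: graded_group H by unfold_locales (rule H)
 interpret M: Metric_space UNIV d using d by (simp add: homogeneous_distance_def)
 have pos: "d (s *R v) (t *R v) = (t - s) * d 0 v" if "s < t" for s t
 proof -
  have 1: "d (dilation H r x) (dilation H r y) = r * d x y" if "r > 0" for r x y
   using d that unfolding homogeneous_distance_def by blast
  have 2: "d x y = d (gmult H z x) (gmult H z y)" for x y z
   using d unfolding homogeneous_distance_def by simp
  have 3: "gmult H ((- s) *R v) (s *R v) = dilation H (t - s) 0" unfolding H.mul_parallel
   by (simp add: linear_0[OF H.linear_dil])
  have 4: "gmult H ((- s) *R v) (t *R v) = dilation H (t - s) v" unfolding H.mul_parallel
   by (simp add: H.dil_V[OF v])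
  show ?thesis using 1[of "t - s" 0 v] 2[of "s *R v" "t *R v" "(- s) *R v"] that unfolding 3 4 by simp
 qed
 show ?thesis
  using pos[of s t] pos[of t s] M.commute by (cases s t rule: linorder_cases) auto
qed

text \<open>The point \<open>y\<close> need not lie on the line. The triangle inequality through
  \<open>y\<close> makes \<open>q\<close> Cauchy along a sequence, and the limit point on the line
  turns out to have distance 0 from \<open>y\<close>.\<close>

lemma tendsto_of_line_distance:
 fixes q :: "real => real"
 assumes d: "Metric_space UNIV d" and line: "!!s t. d (s *R v) (t *R v) = \<bar>t - s\<bar> * d 0 v" "d 0 v > 0"
  and q: "((%t. d (q t *R v) y) \<longlongrightarrow> 0) (at_right 0)"
 shows "\<exists>l. (q \<longlongrightarrow> l) (at_right 0)"
proof -
 interpret M: Metric_space UNIV d by (rule d)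
 have tri: "\<bar>t - s\<bar> * d 0 v <= d (s *R v) y + d (t *R v) y" for s t
  using M.triangle[of "s *R v" y "t *R v"] M.commute[of y] line(1)[of s t] by simp
 define u where "u n = 1 / real (Suc n)" for n
 have u: "filterlim u (at_right 0) sequentially"
  unfolding filterlim_at u_def using LIMSEQ_inverse_real_of_nat by (auto simp: inverse_eq_divide)
 have qu: "(%n. d (q (u n) *R v) y) \<longlonglongrightarrow> 0" by (rule filterlim_compose[OF q u])
 have "convergent (%n. q (u n))"
 proof (rule Cauchy_convergent, rule metric_CauchyI)
  fix e :: real assume e: "e > 0"
  have "\<forall>\<^sub>F n in sequentially. d (q (u n) *R v) y < e * d 0 v / 2" using e line by (intro order_tendstoD(2)[OF qu]) simp
  then obtain N where N: "!!n. n >= N ==> d (q (u n) *R v) y < e * d 0 v / 2" by (auto simp: eventually_sequentially)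
  show "\<exists>M. \<forall>m\<ge>M. \<forall>n\<ge>M. dist (q (u m)) (q (u n)) < e"
  proof (intro exI[of _ N] allI impI)
   fix m n assume "N <= m" "N <= n"
   hence "\<bar>q (u m) - q (u n)\<bar> * d 0 v < e * d 0 v" using tri[of "q (u m)" "q (u n)"] N[of m] N[of n] by simp
   thus "dist (q (u m)) (q (u n)) < e" using line by (simp add: dist_real_def)
  qed
 qed
 then obtain l where l: "(%n. q (u n)) \<longlonglongrightarrow> l" unfolding convergent_def by blast
 have "d (l *R v) y <= \<bar>q (u n) - l\<bar> * d 0 v + d (q (u n) *R v) y" for n
  using M.triangle[of "l *R v" "q (u n) *R v" y] line(1)[of l] by simp
 moreover have "(%n. \<bar>q (u n) - l\<bar> * d 0 v + d (q (u n) *R v) y) \<longlonglongrightarrow> \<bar>l - l\<bar> * d 0 v + 0" by (intro tendsto_intros l qu)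
 ultimately have "d (l *R v) y <= \<bar>l - l\<bar> * d 0 v + 0" by (intro tendsto_lowerbound) auto
 hence "\<bar>q t - l\<bar> * d 0 v <= d (q t *R v) y" for t using tri[of "q t" l] by (simp add: abs_minus_commute)
 hence bnd: "\<bar>q t - l\<bar> <= d (q t *R v) y / d 0 v" for t using line by (simp add: pos_le_divide_eq)
 have "((%t. d (q t *R v) y / d 0 v) \<longlongrightarrow> 0 / d 0 v) (at_right 0)"
  by (rule tendsto_divide[OF q tendsto_const]) (use line(2) in simp)
 hence lim0: "((%t. d (q t *R v) y / d 0 v) \<longlongrightarrow> 0) (at_right 0)" by simp
 have "((%t. q t - l) \<longlongrightarrow> 0) (at_right 0)"
  by (rule Lim_null_comparison[OF always_eventually lim0]) (simp only: real_norm_def bnd simp_thms)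
 hence "(q \<longlongrightarrow> l) (at_right 0)" by (rule LIM_zero_cancel)
 thus ?thesis ..
qed

text \<open>Along \<open>t *R b\<close> the increment of the map stays on the line of
  \<open>v\<close> and equals the dilation by \<open>t\<close> of the difference quotient times
  \<open>v\<close>, while \<open>L (t *R b)\<close> is the dilation by \<open>t\<close> of
  \<open>L b\<close>. Dividing by \<open>t\<close> and using \<open>cc_ray\<close> shows that the
  difference quotients times \<open>v\<close> converge to \<open>L b\<close>.\<close>

lemma pansu_directional_limit:
 assumes G: "carnot_group G" and H: "homogeneous_group H" and dH: "homogeneous_distance H dH"
  and v: "v \<in> layer H 1" "v ~= 0" and b: "b \<in> layer G 1"
  and P: "pansu_differentiable_at G H dH (%y. f y *R v) x"
 shows "\<exists>l. ((%t. (f (gmult G x (t *R b)) - f x) / t) \<longlongrightarrow> l) (at_right 0)"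
proof (cases "b = 0")
 case False
 interpret H: graded_group H by unfold_locales (rule H)
 interpret G: stratified_group G by unfold_locales (rule G)
 interpret M: Metric_space UNIV dH using dH by (simp add: homogeneous_distance_def)
 note line = homogeneous_distance_line[OF H dH v(1)]
 have c0: "dH 0 v > 0" using v(2) M.mdist_pos_less[of 0 v] by auto
 obtain L where L: "homogeneous_hom G H L"
  and o: "(%h. dH (gmult H (- (f x *R v)) (f (gmult G x h) *R v)) (L h)) \<in> o[at 0](%h. cc_distance G h 0)"
  using P unfolding pansu_differentiable_at_def by blast
 define q where "q t = (f (gmult G x (t *R b)) - f x) / t" for t
 have eq: "dH (gmult H (- (f x *R v)) (f (gmult G x (t *R b)) *R v)) (L (t *R b)) = t * dH (q t *R v) (L b)" if t: "t > 0" for t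
 proof -
  have "gmult H (- (f x *R v)) (f (gmult G x (t *R b)) *R v) = (f (gmult G x (t *R b)) - f x) *R v"
   using H.mul_parallel[of "- f x" v "f (gmult G x (t *R b))"] by simp
  also have "... = dilation H t (q t *R v)"
   using t H.dil_V[OF subspace_scale[OF H.subspace_V v(1)], of t "q t"] by (simp add: q_def)
  finally have 1: "gmult H (- (f x *R v)) (f (gmult G x (t *R b)) *R v) = dilation H t (q t *R v)" .
  have 2: "L (t *R b) = dilation H t (L b)"
   using L t G.dil_V[OF b, of t] unfolding homogeneous_hom_def by (metis power_one_right)
  show ?thesis unfolding 1 2 using dH t unfolding homogeneous_distance_def by blast
 qed
 have "((%t. dH (q t *R v) (L b)) \<longlongrightarrow> 0) (at_right 0)"
 proof (rule tendstoI)
  fix e :: real assume e: "e > 0"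
  have nb: "norm b > 0" using False by simp
  have "\<forall>\<^sub>F h in at 0. norm (dH (gmult H (- (f x *R v)) (f (gmult G x h) *R v)) (L h)) <= e / (2 * norm b) * norm (cc_distance G h 0)"
   by (rule landau_o.smallD[OF o]) (use e nb in simp)
  moreover have "filterlim (%t. t *R b) (at 0) (at_right 0)"
   unfolding filterlim_at using False
   by (auto intro!: tendsto_eq_intros eventually_at_right_less[THEN eventually_mono])
  ultimately have "\<forall>\<^sub>F t in at_right 0. norm (dH (gmult H (- (f x *R v)) (f (gmult G x (t *R b)) *R v)) (L (t *R b))) <=
    e / (2 * norm b) * norm (cc_distance G (t *R b) 0)"
   by (rule eventually_compose_filterlim)
  moreover have "\<forall>\<^sub>F t::real in at_right 0. t > 0" by (rule eventually_at_right_less)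
  ultimately show "\<forall>\<^sub>F t in at_right 0. dist (dH (q t *R v) (L b)) 0 < e"
  proof eventually_elim
   case (elim t)
   have "t * dH (q t *R v) (L b) <= e / (2 * norm b) * cc_distance G (t *R b) 0"
    using elim eq[of t] G.cc_nonneg by simp
   also have "... <= e / (2 * norm b) * (t * norm b)" using elim e by (intro mult_left_mono G.cc_ray[OF b]) auto
   also have "... = t * (e / 2)" using nb by simp
   finally have "dH (q t *R v) (L b) <= e / 2" using elim by simp
   thus ?case using e by simp
  qed
 qed
 from tendsto_of_line_distance[OF M.Metric_space_axioms line c0 this] show ?thesis by (simp add: q_def)
next
 case True
 interpret G: stratified_group G by unfold_locales (rule G)
 show ?thesis by (intro exI[of _ 0]) (simp add: True)
qed

text \<open>Some ball meets \<open>A\<close> in positive measure; the restriction of the measure to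
  it is finite, and finite Borel measures are inner regular.\<close>

lemma radon_inner_regular:
 assumes \<mu>: "radon_measure \<mu>" and A: "A \<in> sets borel" "emeasure \<mu> A > 0"
 obtains K where "compact K" "K \<subseteq> A" "emeasure \<mu> K > 0"
proof -
 have s: "sets \<mu> = sets borel" and fin: "!!K. compact K ==> emeasure \<mu> K < \<infinity>" using \<mu> by (auto simp: radon_measure_def)
 have "\<exists>n. emeasure \<mu> (A \<inter> cball 0 (real n)) > 0"
 proof (rule ccontr)
  assume "\<not> ?thesis"
  hence "A \<inter> cball 0 (real n) \<in> null_sets \<mu>" for n using A(1) s by (auto simp: null_sets_def)
  hence "(\<Union>n. A \<inter> cball 0 (real n)) \<in> null_sets \<mu>" by (intro null_sets_UN)
  moreover have "(\<Union>n. A \<inter> cball 0 (real n)) = A" using real_arch_simple by (auto simp: dist_norm)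
  ultimately show False using A(2) by auto
 qed
 then obtain n where n: "emeasure \<mu> (A \<inter> cball 0 (real n)) > 0" by blast
 let ?C = "cball 0 (real n)"
 define M where "M = density \<mu> (indicator ?C)"
 have M: "emeasure M B = emeasure \<mu> (?C \<inter> B)" if "B \<in> sets borel" for B
  unfolding M_def using that s by (intro emeasure_restricted) auto
 have "emeasure M (A \<inter> ?C) = (SUP K\<in>{K. K \<subseteq> A \<inter> ?C \<and> compact K}. emeasure M K)"
 proof (rule inner_regular)
  show sM: "sets M = sets borel" using s by (simp add: M_def)
  have "space M = UNIV" using sets_eq_imp_space_eq[OF sM] by simp
  thus "emeasure M (space M) ~= \<infinity>" using M[of UNIV] fin[of ?C] by simp
  show "A \<inter> ?C \<in> sets borel" using A(1) by simp
 qed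
 moreover have "emeasure M (A \<inter> ?C) > 0" using M[of "A \<inter> ?C"] A(1) n by (simp add: Int_commute Int_left_commute)
 ultimately obtain K where K: "K \<subseteq> A \<inter> ?C" "compact K" "emeasure M K > 0" by (auto simp: less_SUP_iff)
 hence "emeasure \<mu> K > 0" using M[of K] by (simp add: compact_imp_closed Int_absorb1)
 thus ?thesis using K by (intro that[of K]) auto
qed

theorem theorem1p1:
  fixes G :: "'a::euclidean_space graded_algebra"
    and H :: "'b::euclidean_space graded_algebra"
    and dH :: "'b \<Rightarrow> 'b \<Rightarrow> real"
    and \<mu> haar :: "'a measure"
  assumes "carnot_group G"
    and "homogeneous_group H"
    and "layer H 1 \<noteq> {0}"
    and "homogeneous_distance H dH"
    and "radon_measure \<mu>"
    and "haar_measure G haar"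
    and "\<And>f. lipschitz_wrt (cc_distance G) dH f \<Longrightarrow>
           AE x in \<mu>. pansu_differentiable_at G H dH f x"
  shows "absolutely_continuous haar \<mu>"
proof (rule ccontr)
 assume "\<not> absolutely_continuous haar \<mu>"
 then obtain A where A: "A \<in> null_sets haar" "A \<notin> null_sets \<mu>" by (auto simp: absolutely_continuous_def)
 interpret haar_group G haar by unfold_locales (rule assms)+
 have s: "sets \<mu> = sets borel" using assms(5) by (simp add: radon_measure_def)
 have "A \<in> sets borel" using A(1) by auto
 moreover have "emeasure \<mu> A > 0" using A(2) s \<open>A \<in> sets borel\<close> by (auto simp: null_sets_def zero_less_iff_neq_zero)
 ultimately obtain N where N: "compact N" "N \<subseteq> A" "emeasure \<mu> N > 0" by (rule radon_inner_regular[OF assms(5)]) (rule that)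
 have N0: "emeasure haar N = 0"
  using null_sets_subset[OF A(1) _ N(2)] N(1) by (auto simp: compact_imp_closed)
 obtain a where a: "a >= 2" "!!x y z. x \<in> U 1 ==> y \<in> U 1 ==> z \<in> U 1 ==> gmult G (gmult G x y) z \<in> U a"
  by (rule dilation_base_exists) (rule that)
 interpret dilation_base G haar a by unfold_locales (use a in auto)
 obtain f b C K where b: "b \<in> layer G 1" and f: "!!x y. \<bar>f y - f x\<bar> <= C * cc_distance G x y" and K: "compact K" "emeasure \<mu> K > 0"
  and no: "!!x l. x \<in> K ==> \<not> ((%t. (f (gmult G x (t *R b)) - f x) / t) \<longlongrightarrow> l) (at_right 0)"
  by (rule nondifferentiable[OF assms(5) N(1) N0 N(3)]) (rule that)
 interpret H: graded_group H by unfold_locales (rule assms)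
 \<comment> \<open>The nontriviality of the first layer of \<open>H\<close> enters here: it provides
   the line on which the real function is placed.\<close>
 obtain v where v: "v \<in> layer H 1" "v ~= 0" using assms(3) subspace_0[OF H.subspace_V[of 1]] by auto
 have "lipschitz_wrt (cc_distance G) dH (%x. f x *R v)"
  unfolding lipschitz_wrt_def
 proof (intro exI allI)
  fix x y
  interpret M: Metric_space UNIV dH using assms(4) by (simp add: homogeneous_distance_def)
  have "\<bar>f y - f x\<bar> * dH 0 v <= C * cc_distance G x y * dH 0 v" using f M.nonneg by (intro mult_right_mono)
  thus "dH (f x *R v) (f y *R v) <= (C * dH 0 v) * cc_distance G x y"
   by (simp add: homogeneous_distance_line[OF assms(2,4) v(1)] mult_ac)
 qed
 hence "AE x in \<mu>. pansu_differentiable_at G H dH (%x. f x *R v) x" by (rule assms(7))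
 then obtain Z where Z: "{x\<in>space \<mu>. \<not> pansu_differentiable_at G H dH (%x. f x *R v) x} \<subseteq> Z" "emeasure \<mu> Z = 0" "Z \<in> sets \<mu>"
  by (rule AE_E)
 have "K \<subseteq> Z"
 proof
  fix x assume x: "x \<in> K"
  have "\<not> pansu_differentiable_at G H dH (%x. f x *R v) x"
   using pansu_directional_limit[OF assms(1,2,4) v b] no[OF x] by blast
  moreover have "x \<in> space \<mu>" using sets_eq_imp_space_eq[OF s] by simp
  ultimately show "x \<in> Z" using Z(1) by blast
 qed
 hence "emeasure \<mu> K <= emeasure \<mu> Z" using Z(3) by (rule emeasure_mono)
 thus False using K(2) Z(2) by simp
qed

end
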